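(* Let $n\in\mathbb{N}$, $\nu\in(0,\frac12]$, $\beta\in(0,1]$, $c>0$ and $\lambda>0$. The solution to the Cauchy problem for the space-time fractional $n$-dimensional telegraph equation $$ \begin{cases} \left(\dfrac{{}^{C}\partial^{2\nu}}{\partial t^{2\nu}}+2\lambda\dfrac{{}^{C}\partial^{\nu}}{\partial t^{\nu}}\right)w_\nu^\beta(\boldsymbol{x},t)=-c^2(-\Delta)^\beta w_\nu^\beta(\boldsymbol{x},t), & \boldsymbol{x}\in\mathbb{R}^n,\ t>0,\\[2mm] w_\nu^\beta(\boldsymbol{x},0)=\delta(\boldsymbol{x}), \end{cases} $$ where the time derivatives are in the Dzerbayshan-Caputo sense, coincides with the probability law of the vector process $$\boldsymbol{W}_n(t)=\boldsymbol{S}_n^{2\beta}\left(c^2\mathcal{L}^\nu(t)\right),\qquad t>0,$$ and has Fourier transform $\widehat{w_\nu^\beta}(\boldsymbol{\xi},t)=\int_{\mathbb{R}^n}e^{i\boldsymbol{\xi}\cdot\boldsymbol{x}}w_\nu^\beta(\boldsymbol{x},t)\,d\boldsymbol{x}$ which reads $$ \widehat{w_\nu^\beta}(\boldsymbol{\xi},t)=\frac12\left[\left(1+\frac{\lambda}{\sqrt{\lambda^2-c^2\|\boldsymbol{\xi}\|^{2\beta}}}\right)E_{\nu,1}(r_1t^\nu)+\left(1-\frac{\lambda}{\sqrt{\lambda^2-c^2\|\boldsymbol{\xi}\|^{2\beta}}}\right)E_{\nu,1}(r_2t^\nu)\right], $$ where $r_1=-\lambda+\sqrt{\lambda^2-c^2\|\boldsymbol{\xi}\|^{2\beta}}$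 and $r_2=-\lambda-\sqrt{\lambda^2-c^2\|\boldsymbol{\xi}\|^{2\beta}}$.
   Context: $\boldsymbol{S}_n^{2\beta}(t)$, $t>0$, is the isotropic stable $n$-dimensional process with characteristic function $\mathbb{E}e^{i\boldsymbol{\xi}\cdot\boldsymbol{S}_n^{2\beta}(t)}=e^{-t\|\boldsymbol{\xi}\|^{2\beta}}$, $\boldsymbol{\xi}\in\mathbb{R}^n$. For $0<\alpha<1$, $H^\alpha(t)$, $t>0$, denotes the stable subordinator with $\mathbb{E}e^{-\mu H^\alpha(t)}=e^{-t\mu^\alpha}$, $\mu>0$; for $\alpha=1$, $H^1(t)=t$. Let $H_1^{2\nu}$, $H_2^\nu$ be independent, $\mathcal{H}^\nu(t)=H_1^{2\nu}(t)+(2\lambda)^{1/\nu}H_2^\nu(t)$, and let $\mathcal{L}^\nu(t)=\inf\{s>0:\mathcal{H}^\nu(s)\ge t\}$, $t>0$, be its inverse process. The process $\boldsymbol{S}_n^{2\beta}$ is independent of $\mathcal{L}^\nu$. The Dzerbayshan-Caputo derivative of order $\alpha$ is, for $m-1<\alpha<m$, $m\in\mathbb{N}$, $$\frac{{}^{C}\partial^\alpha}{\partial t^\alpha}f(t)=\frac{1}{\Gamma(m-\alpha)}\int_0^t\frac{\frac{d^m}{ds^m}f(s)}{(t-s)^{\alpha+1-m}}\,ds,$$ and it is the ordinary derivative when $\alpha=1$ (the case $2\nu=1$). The fractional Laplacian is defined through Fourier transforms by $$-(-\Delta)^\beta u(\boldsymbol{x})=-\frac{1}{(2\pi)^n}\int_{\mathbb{R}^n}e^{-i\boldsymbol{x}\cdot\boldsymbol{\xi}}\|\boldsymbol{\xi}\|^{2\beta}\,\widehat{u}(\boldsymbol{\xi})\,d\boldsymbol{\xi},\qquad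 \widehat u(\boldsymbol\xi)=\int_{\mathbb{R}^n}e^{i\boldsymbol\xi\cdot\boldsymbol x}u(\boldsymbol x)\,d\boldsymbol x,$$ with domain $\{u\in L^1_{\mathrm{loc}}(\mathbb{R}^n):\int_{\mathbb{R}^n}|\widehat u(\boldsymbol\xi)|^2(1+\|\boldsymbol\xi\|^{2\beta})\,d\boldsymbol\xi<\infty\}$. The Mittag-Leffler function is $E_{\nu,\psi}(x)=\sum_{k=0}^\infty\frac{x^k}{\Gamma(\nu k+\psi)}$, $\nu,\psi>0$ (an entire function of $x\in\mathbb{C}$). When $\lambda^2<c^2\|\boldsymbol\xi\|^{2\beta}$ the square roots are complex (the formula does not depend on the choice of root), and when $\lambda^2=c^2\|\boldsymbol\xi\|^{2\beta}$ the formula is understood as a limit. $\delta$ is the Dirac delta. *)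

theory Defs
  imports "HOL-Probability.Probability"
begin

section \<open>Fractional operators and the Mittag-Leffler function\<close>

definition iter_deriv :: "nat \<Rightarrow> (real \<Rightarrow> complex) \<Rightarrow> real \<Rightarrow> complex" where
  "iter_deriv m f = ((\<lambda>g s. vector_derivative g (at s)) ^^ m) f"

text \<open>For \<open>m - 1 < \<alpha> \<le> m\<close> the integer \<open>m\<close> is the ceiling of \<open>\<alpha>\<close>; for \<open>\<alpha> = m\<close> the derivative is the
  ordinary one. Only the values of \<open>f\<close> on the positive half-line matter.\<close>

definition caputo_deriv :: "real \<Rightarrow> (real \<Rightarrow> complex) \<Rightarrow> real \<Rightarrow> complex" where
  "caputo_deriv \<alpha> f t =
     (let m = nat \<lceil>\<alpha>\<rceil> in
      if \<alpha> = real m then iter_deriv m f t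
      else complex_of_real (1 / Gamma (real m - \<alpha>)) *
           (LINT s:{0<..<t}|lborel. iter_deriv m f s / complex_of_real ((t - s) powr (\<alpha> + 1 - real m))))"

text \<open>Both \<open>vector_derivative\<close> and the Lebesgue integral are total functions, so the existence of the
  derivatives and the absolute convergence of the integral in \<open>caputo_deriv\<close> are stated separately.\<close>

definition caputo_differentiable :: "real \<Rightarrow> (real \<Rightarrow> complex) \<Rightarrow> real \<Rightarrow> bool" where
  "caputo_differentiable \<alpha> f t \<longleftrightarrow>
     (let m = nat \<lceil>\<alpha>\<rceil> in
      (\<forall>j<m. \<forall>s\<in>{0<..t}. iter_deriv j f differentiable (at s)) \<and>
      (\<alpha> \<noteq> real m \<longrightarrow>
        set_integrable lborel {0<..<t}
          (\<lambda>s. iter_deriv m f s / complex_of_real ((t - s) powr (\<alpha> + 1 - real m)))))"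

definition fourier :: "('a::euclidean_space \<Rightarrow> complex) \<Rightarrow> 'a \<Rightarrow> complex" where
  "fourier u \<xi> = (LINT x|lborel. exp (\<i> * complex_of_real (\<xi> \<bullet> x)) * u x)"

text \<open>This is the operator \<open>- (- \<Delta>)^\<beta>\<close>, including the leading minus sign.\<close>

definition neg_frac_laplacian ::
  "real \<Rightarrow> ('a::euclidean_space \<Rightarrow> complex) \<Rightarrow> 'a \<Rightarrow> complex" where
  "neg_frac_laplacian \<beta> u x =
     - complex_of_real (1 / (2 * pi) ^ DIM('a)) *
       (LINT \<xi>|lborel. exp (- \<i> * complex_of_real (x \<bullet> \<xi>)) *
          complex_of_real (norm \<xi> powr (2 * \<beta>)) * fourier u \<xi>)"

definition mittag_leffler :: "real \<Rightarrow> real \<Rightarrow> complex \<Rightarrow> complex" where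
  "mittag_leffler \<nu> \<psi> x = (\<Sum>k. x ^ k / complex_of_real (Gamma (\<nu> * real k + \<psi>)))"

section \<open>The Cauchy problem\<close>

text \<open>The Cauchy problem starts from a Dirac delta and its solution is in general unbounded at the
  origin and outside the domain of the fractional Laplacian (its Fourier transform decays only like
  \<open>\<parallel>\<xi>\<parallel>\<close> to the power \<open>- 2 * \<beta>\<close>), so the equation is read in the sense of distributions in \<open>x\<close>: it is paired
  with test functions, the symmetric operator \<open>(- \<Delta>)^\<beta>\<close> being applied to the test function.

  The test functions are the continuous integrable functions for which the integral
  defining \<open>(- \<Delta>)^\<beta> \<phi>\<close> and the Fourier inversion integral converge absolutely. They include all
  Schwartz functions. Since \<open>fourier \<phi>\<close> is bounded, they lie in the domain
  \<open>\<integral> \<bar>fourier \<phi> \<xi>\<bar>^2 * (1 + \<parallel>\<xi>\<parallel>^(2 * \<beta>)) d\<xi> < \<infinity>\<close> of \<open>(- \<Delta>)^\<beta>\<close>.\<close>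

definition test_function :: "real \<Rightarrow> ('a::euclidean_space \<Rightarrow> complex) \<Rightarrow> bool" where
  "test_function \<beta> \<phi> \<longleftrightarrow>
     continuous_on UNIV \<phi> \<and> integrable lborel \<phi> \<and>
     integrable lborel (\<lambda>\<xi>. complex_of_real (1 + norm \<xi> powr (2 * \<beta>)) * fourier \<phi> \<xi>)"

definition pairing :: "('a::euclidean_space \<Rightarrow> real) \<Rightarrow> ('a \<Rightarrow> complex) \<Rightarrow> complex" where
  "pairing u \<phi> = (LINT x|lborel. complex_of_real (u x) * \<phi> x)"

text \<open>Solutions are families of (signed) integrable functions \<open>w x t\<close>, \<open>t > 0\<close>, with locally bounded
  \<open>L^1\<close>-norm in time. The last conjunct is the initial condition \<open>w(x, 0) = \<delta>(x)\<close>.\<close>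

definition telegraph_solution ::
  "real \<Rightarrow> real \<Rightarrow> real \<Rightarrow> real \<Rightarrow> ('a::euclidean_space \<Rightarrow> real \<Rightarrow> real) \<Rightarrow> bool" where
  "telegraph_solution \<nu> \<beta> c lam w \<longleftrightarrow>
     (\<forall>t>0. integrable lborel (\<lambda>x. w x t)) \<and>
     (\<forall>T>0. \<exists>B. \<forall>t\<in>{0<..T}. (LINT x|lborel. \<bar>w x t\<bar>) \<le> B) \<and>
     (\<forall>\<phi>. test_function \<beta> \<phi> \<longrightarrow>
        (let F = (\<lambda>t. pairing (\<lambda>x. w x t) \<phi>) in
         (\<forall>t>0. caputo_differentiable (2 * \<nu>) F t \<and> caputo_differentiable \<nu> F t \<and>
            caputo_deriv (2 * \<nu>) F t + complex_of_real (2 * lam) * caputo_deriv \<nu> F t =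
              complex_of_real (c\<^sup>2) * pairing (\<lambda>x. w x t) (neg_frac_laplacian \<beta> \<phi>)) \<and>
         (F \<longlongrightarrow> \<phi> 0) (at_right 0)))"

text \<open>The argument \<open>s\<close> stands for a complex square root of \<open>lam\<^sup>2 - c\<^sup>2 * \<parallel>\<xi>\<parallel>^(2 * \<beta>)\<close>.\<close>

definition telegraph_fourier :: "real \<Rightarrow> real \<Rightarrow> real \<Rightarrow> complex \<Rightarrow> complex" where
  "telegraph_fourier \<nu> lam t s =
     (let r1 = - complex_of_real lam + s; r2 = - complex_of_real lam - s in
      1 / 2 * ((1 + complex_of_real lam / s) * mittag_leffler \<nu> 1 (r1 * complex_of_real (t powr \<nu>)) +
               (1 - complex_of_real lam / s) * mittag_leffler \<nu> 1 (r2 * complex_of_real (t powr \<nu>))))"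

section \<open>The processes\<close>

definition levy_process :: "'w measure \<Rightarrow> (real \<Rightarrow> 'w \<Rightarrow> 'a::euclidean_space) \<Rightarrow> bool" where
  "levy_process M X \<longleftrightarrow>
     prob_space M \<and>
     (\<forall>t\<ge>0. X t \<in> borel_measurable M) \<and>
     (AE \<omega> in M. X 0 \<omega> = 0) \<and>
     (\<forall>n t. 0 \<le> t 0 \<and> (\<forall>i<n. t i \<le> t (Suc i)) \<longrightarrow>
        prob_space.indep_vars M (\<lambda>_. borel) (\<lambda>i \<omega>. X (t (Suc i)) \<omega> - X (t i) \<omega>) {..<n::nat}) \<and>
     (\<forall>s\<ge>0. \<forall>h\<ge>0. distr M borel (\<lambda>\<omega>. X (s + h) \<omega> - X s \<omega>) = distr M borel (X h)) \<and>
     (\<forall>\<omega>\<in>space M. \<forall>t\<ge>0. continuous (at_right t) (\<lambda>s. X s \<omega>)) \<and>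
     (\<forall>\<omega>\<in>space M. \<forall>t>0. \<exists>l. ((\<lambda>s. X s \<omega>) \<longlongrightarrow> l) (at_left t))"

definition isotropic_stable_process ::
  "'w measure \<Rightarrow> real \<Rightarrow> (real \<Rightarrow> 'w \<Rightarrow> 'a::euclidean_space) \<Rightarrow> bool" where
  "isotropic_stable_process M \<beta> S \<longleftrightarrow>
     levy_process M S \<and>
     (\<forall>t>0. \<forall>\<xi>. (LINT \<omega>|M. exp (\<i> * complex_of_real (\<xi> \<bullet> S t \<omega>))) =
        complex_of_real (exp (- t * norm \<xi> powr (2 * \<beta>))))"

definition stable_subordinator :: "'w measure \<Rightarrow> real \<Rightarrow> (real \<Rightarrow> 'w \<Rightarrow> real) \<Rightarrow> bool" where
  "stable_subordinator M \<alpha> H \<longleftrightarrow>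
     levy_process M H \<and>
     (\<forall>\<omega>\<in>space M. mono_on {0..} (\<lambda>t. H t \<omega>)) \<and>
     (if \<alpha> = 1 then \<forall>\<omega>\<in>space M. \<forall>t\<ge>0. H t \<omega> = t
      else \<forall>t>0. \<forall>\<mu>>0. (LINT \<omega>|M. exp (- \<mu> * H t \<omega>)) = exp (- t * \<mu> powr \<alpha>))"

text \<open>For a subordinator the set is nonempty almost surely. On the exceptional null event, where the
  infimum would be infinite (and the infimum of the empty set of reals is unspecified), the value is 0.\<close>

definition inverse_process :: "(real \<Rightarrow> 'w \<Rightarrow> real) \<Rightarrow> real \<Rightarrow> 'w \<Rightarrow> real" where
  "inverse_process H t \<omega> =
     (let A = {s. 0 < s \<and> t \<le> H s \<omega>} in if A = {} then 0 else Inf A)"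

definition process_sigma ::
  "'w measure \<Rightarrow> (real \<Rightarrow> 'w \<Rightarrow> 'a::topological_space) \<Rightarrow> 'w set set" where
  "process_sigma M X =
     sigma_sets (space M) {X t -` A \<inter> space M | t A. 0 < t \<and> A \<in> sets borel}"

definition indep_processes ::
  "'w measure \<Rightarrow> (real \<Rightarrow> 'w \<Rightarrow> 'a::topological_space) \<Rightarrow>
    (real \<Rightarrow> 'w \<Rightarrow> 'b::topological_space) \<Rightarrow> bool" where
  "indep_processes M X Y \<longleftrightarrow> prob_space.indep_set M (process_sigma M X) (process_sigma M Y)"

end

theory Submission
  imports Defs "HOL-Real_Asymp.Real_Asymp"
begin

text \<open>Write \<open>r = c\<^sup>2 * \<parallel>\<xi>\<parallel> powr (2 * \<beta>)\<close>. Conditioning on \<open>L t\<close> gives \<open>E exp (i \<xi> \<bullet> W t) = E exp (- r * L t)\<close>.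
  The Laplace transform in \<open>t\<close> of the latter is determined by the Laplace exponent
  \<open>\<mu> powr (2 * \<nu>) + 2 * lam * \<mu> powr \<nu>\<close> of \<open>H\<close>, and equals that of a series of Mittag-Leffler type solving the
  fractional relaxation equation with rate \<open>r\<close>; by continuity and monotonicity both agree for every \<open>t\<close>.

  Existence: \<open>W t\<close> has a density because the stable law at a positive time has one. Pairing it with
  a test function and inverting the Fourier transform writes \<open>E \<phi> (W t)\<close> as a superposition of these
  relaxation functions, and the equation follows by integrating over \<open>\<xi>\<close>. The domination needed is
  \<open>\<bar>G' t\<bar> \<le> r * t powr (2 * \<nu> - 1) / Gamma (2 * \<nu>)\<close> for \<open>G t = E exp (- r * L t)\<close>, which holds since \<open>G\<close> is decreasing.

  Uniqueness: testing an arbitrary solution with Gaussian-damped plane waves and applying the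
  fractional integral of order \<open>2 * \<nu>\<close>, one can remove the damping and obtains a Volterra equation
  for the Fourier transform of the solution, whose bounded solution is unique.\<close>

text \<open>Every function of time in the proof belongs to one family, \<open>telegraph_ml\<close>
  with index \<delta> and rate a: raising \<delta> is fractional integration, lowering it by 1 is
  differentiation, and a three-term recurrence links \<delta>, \<delta> + \<nu> and \<delta> +
  2\<nu>. The Caputo derivatives of the relaxation function are therefore again members of the
  family. The obstacle for existence is uniformity in the rate, which is unbounded as \<xi> varies:
  termwise estimates of the series grow with a. The sign of the member with index 2\<nu> comes from
  probability; the recurrence, whose other terms are fractional integrals of it, then bounds it by a
  kernel that does not depend on a. The single factor a left in the derivative is what the weight in
  \<open>test_function\<close> absorbs. The obstacle for uniqueness is that Caputo derivatives need
  not converge along a sequence of test functions. An equation between fractional integrals does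
  pass to the limit, by dominated convergence, so it is derived at fixed damping first.\<close>

section \<open>Fractional integrals\<close>

text \<open>The Riemann-Liouville kernel. Setting it to 0 for nonpositive arguments lets
  convolutions be written over the whole line: the integrand vanishes by itself outside the interval
  from 0 to \<open>t\<close>.\<close>

definition frac_kernel :: "real \<Rightarrow> real \<Rightarrow> real" where
  "frac_kernel \<delta> t = (if 0 < t then t powr (\<delta> - 1) / Gamma \<delta> else 0)"

lemma frac_kernel_nonneg: "0 < \<delta> \<Longrightarrow> 0 \<le> frac_kernel \<delta> t"
  by (simp add: frac_kernel_def Gamma_real_pos less_imp_le)

lemma frac_kernel_one: "0 < t \<Longrightarrow> frac_kernel 1 t = 1"
  by (simp add: frac_kernel_def)

lemma frac_kernel_measurable [measurable]: "frac_kernel \<delta> \<in> borel_measurable borel"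
  unfolding frac_kernel_def[abs_def] by measurable

text \<open>Substituting \<open>s = t * u\<close> leaves a power of \<open>t\<close> times the Beta
  integral, whose Gamma factors cancel those of the two kernels. With the nonnegative integral,
  integrability and the value come out together.\<close>

lemma nn_integral_frac_kernel_conv:
  assumes "0 < \<alpha>" "0 < \<delta>"
  shows "(\<integral>\<^sup>+s. ennreal (frac_kernel \<alpha> (t - s) * frac_kernel \<delta> s) \<partial>lborel) = ennreal (frac_kernel (\<alpha> + \<delta>) t)"
proof (cases "0 < t")
  case False
  then have "frac_kernel \<alpha> (t - s) * frac_kernel \<delta> s = 0" for s
    by (simp add: frac_kernel_def)
  then have "(\<integral>\<^sup>+s. ennreal (frac_kernel \<alpha> (t - s) * frac_kernel \<delta> s) \<partial>lborel) = 0"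
    by (simp only: ennreal_0 nn_integral_const mult_zero_left)
  then show ?thesis using False by (simp add: frac_kernel_def)
next
  case True
  note G = Gamma_real_pos[OF assms(1)] Gamma_real_pos[OF assms(2)]
  have beta: "((\<lambda>u. u powr (\<delta> - 1) * (1 - u) powr (\<alpha> - 1)) has_integral Beta \<delta> \<alpha>) {0<..<1}"
    using has_integral_Beta_real[OF assms(2,1)] by (simp add: has_integral_Icc_iff_Ioo)
  have B: "(\<integral>\<^sup>+u. ennreal (indicator {0<..<1} u * (u powr (\<delta> - 1) * (1 - u) powr (\<alpha> - 1))) \<partial>lborel) = ennreal (Beta \<delta> \<alpha>)"
    using nn_integral_has_integral_lebesgue[OF _ beta] by simp
  have "(\<integral>\<^sup>+s. ennreal (frac_kernel \<alpha> (t - s) * frac_kernel \<delta> s) \<partial>lborel)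
    = ennreal t * (\<integral>\<^sup>+u. ennreal (frac_kernel \<alpha> (t - (0 + t * u)) * frac_kernel \<delta> (0 + t * u)) \<partial>lborel)"
    using True by (subst nn_integral_real_affine[where c=t and t=0]) auto
  also have "\<dots> = ennreal t * (\<integral>\<^sup>+u. ennreal (t powr (\<alpha> + \<delta> - 2) / (Gamma \<alpha> * Gamma \<delta>)) *
      ennreal (indicator {0<..<1} u * (u powr (\<delta> - 1) * (1 - u) powr (\<alpha> - 1))) \<partial>lborel)"
  proof (intro arg_cong2[where f="(*)"] refl nn_integral_cong)
    fix u :: real
    have "frac_kernel \<alpha> (t - (0 + t * u)) * frac_kernel \<delta> (0 + t * u) =
      t powr (\<alpha> + \<delta> - 2) / (Gamma \<alpha> * Gamma \<delta>) * (indicator {0<..<1} u * (u powr (\<delta> - 1) * (1 - u) powr (\<alpha> - 1)))"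
    proof (cases "0 < u \<and> u < 1")
      case True': True
      have *: "t - t * u = t * (1 - u)" by (simp add: algebra_simps)
      have "t powr (\<alpha> + \<delta> - 2) = t powr (\<alpha> - 1) * t powr (\<delta> - 1)"
        using True by (simp flip: powr_add add: algebra_simps)
      then show ?thesis using True True'
        unfolding frac_kernel_def by (simp add: * powr_mult)
    next
      case False
      then have "\<not> (0 < t * u \<and> 0 < t - t * u)"
        using True by (auto simp: zero_less_mult_iff)
      then show ?thesis using False by (auto simp: frac_kernel_def indicator_def)
    qed
    then show "ennreal (frac_kernel \<alpha> (t - (0 + t * u)) * frac_kernel \<delta> (0 + t * u)) =
      ennreal (t powr (\<alpha> + \<delta> - 2) / (Gamma \<alpha> * Gamma \<delta>)) * ennreal (indicator {0<..<1} u * (u powr (\<delta> - 1) * (1 - u) powr (\<alpha> - 1)))"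
      using G by (subst ennreal_mult'[symmetric]) (auto simp: less_imp_le)
  qed
  also have "\<dots> = ennreal t * (ennreal (t powr (\<alpha> + \<delta> - 2) / (Gamma \<alpha> * Gamma \<delta>)) * ennreal (Beta \<delta> \<alpha>))"
    by (subst nn_integral_cmult) (auto simp only: B, measurable)
  also have "\<dots> = ennreal (t * (t powr (\<alpha> + \<delta> - 2) / (Gamma \<alpha> * Gamma \<delta>) * Beta \<delta> \<alpha>))"
    using G True assms by (simp add: ennreal_mult'[symmetric] Beta_def Gamma_real_pos less_imp_le)
  also have "t * (t powr (\<alpha> + \<delta> - 2) / (Gamma \<alpha> * Gamma \<delta>) * Beta \<delta> \<alpha>) = frac_kernel (\<alpha> + \<delta>) t"
  proof -
    have "t * t powr (\<alpha> + \<delta> - 2) = t powr (\<alpha> + \<delta> - 1)"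
      using True by (metis add.commute diff_add_cancel add_diff_eq powr_mult_base less_imp_le one_add_one diff_diff_add)
    then show ?thesis using G True by (simp add: frac_kernel_def Beta_def add.commute)
  qed
  finally show ?thesis .
qed

lemma frac_kernel_conv:
  assumes "0 < \<alpha>" "0 < \<delta>"
  shows "has_bochner_integral lborel (\<lambda>s. frac_kernel \<alpha> (t - s) * frac_kernel \<delta> s) (frac_kernel (\<alpha> + \<delta>) t)"
  using nn_integral_frac_kernel_conv[OF assms, of t] assms
  by (intro has_bochner_integral_nn_integral) (auto simp: frac_kernel_nonneg)

lemma frac_kernel_shift_conv:
  assumes "0 < \<alpha>" "0 < \<delta>"
  shows "has_bochner_integral lborel (\<lambda>s. frac_kernel \<alpha> (T - s) * frac_kernel \<delta> (s - r)) (frac_kernel (\<alpha> + \<delta>) (T - r))"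
proof -
  have "has_bochner_integral lborel (\<lambda>s. frac_kernel \<alpha> (T - (r + 1 * s)) * frac_kernel \<delta> ((r + 1 * s) - r)) (frac_kernel (\<alpha> + \<delta>) (T - r))"
    using frac_kernel_conv[OF assms, of "T - r"] by (simp add: algebra_simps)
  then show ?thesis
    using lborel_has_bochner_integral_real_affine_iff[of 1 "\<lambda>s. frac_kernel \<alpha> (T - s) * frac_kernel \<delta> (s - r)" "frac_kernel (\<alpha> + \<delta>) (T - r)" r]
    by simp
qed

lemma nn_integral_frac_kernel_laplace:
  assumes "0 < \<delta>" "0 < \<mu>"
  shows "(\<integral>\<^sup>+t. ennreal (exp (- \<mu> * t) * frac_kernel \<delta> t) \<partial>lborel) = ennreal (\<mu> powr (- \<delta>))"
proof -
  note G = Gamma_real_pos[OF assms(1)]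
  have "(\<integral>\<^sup>+t. ennreal (exp (- \<mu> * t) * frac_kernel \<delta> t) \<partial>lborel)
    = ennreal (1/\<mu>) * (\<integral>\<^sup>+t. ennreal (exp (- \<mu> * (0 + 1/\<mu> * t)) * frac_kernel \<delta> (0 + 1/\<mu> * t)) \<partial>lborel)"
    using assms by (subst nn_integral_real_affine[where c="1/\<mu>" and t=0]) auto
  also have "\<dots> = ennreal (1/\<mu>) * (\<integral>\<^sup>+t. ennreal (\<mu> powr (1 - \<delta>) / Gamma \<delta>) * ennreal (indicator {0..} t * t powr (\<delta> - 1) / exp t) \<partial>lborel)"
  proof (intro arg_cong2[where f="(*)"] refl nn_integral_cong)
    fix t :: real
    have "exp (- \<mu> * (0 + 1/\<mu> * t)) * frac_kernel \<delta> (0 + 1/\<mu> * t) =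
      \<mu> powr (1 - \<delta>) / Gamma \<delta> * (indicator {0..} t * t powr (\<delta> - 1) / exp t)"
    proof (cases "0 < t")
      case True
      have "(t / \<mu>) powr (\<delta> - 1) = \<mu> powr (1 - \<delta>) * t powr (\<delta> - 1)"
        using True assms by (simp add: powr_divide powr_diff field_simps)
      then show ?thesis using True assms by (simp add: frac_kernel_def exp_minus field_simps)
    next
      case False
      then have "\<not> 0 < t / \<mu>" using assms by (simp add: zero_less_divide_iff)
      then show ?thesis using False by (cases "t = 0") (simp_all add: frac_kernel_def)
    qed
    then show "ennreal (exp (- \<mu> * (0 + 1/\<mu> * t)) * frac_kernel \<delta> (0 + 1/\<mu> * t)) =
      ennreal (\<mu> powr (1 - \<delta>) / Gamma \<delta>) * ennreal (indicator {0..} t * t powr (\<delta> - 1) / exp t)"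
      using G by (subst ennreal_mult'[symmetric]) (auto simp: less_imp_le)
  qed
  also have "\<dots> = ennreal (1/\<mu>) * (ennreal (\<mu> powr (1 - \<delta>) / Gamma \<delta>) * ennreal (Gamma \<delta>))"
    using Gamma_conv_nn_integral_real[OF assms(1)] by (subst nn_integral_cmult) auto
  also have "\<dots> = ennreal (1/\<mu> * (\<mu> powr (1 - \<delta>) / Gamma \<delta> * Gamma \<delta>))"
    using G assms by (simp add: ennreal_mult'[symmetric] less_imp_le)
  also have "1/\<mu> * (\<mu> powr (1 - \<delta>) / Gamma \<delta> * Gamma \<delta>) = \<mu> powr (- \<delta>)"
    using less_imp_neq[OF G] assms by (simp add: powr_diff powr_minus field_simps)
  finally show ?thesis .
qed

lemma frac_kernel_laplace:
  assumes "0 < \<delta>" "0 < \<mu>"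
  shows "has_bochner_integral lborel (\<lambda>t. exp (- \<mu> * t) * frac_kernel \<delta> t) (\<mu> powr (- \<delta>))"
  using nn_integral_frac_kernel_laplace[OF assms] assms
  by (intro has_bochner_integral_nn_integral) (auto simp: frac_kernel_nonneg)

text \<open>Only the part \<open>t \<ge> M\<close> of the Gamma integral is kept, where
  \<open>t powr (x - 1)\<close> is at least \<open>M powr (x - 1)\<close>. As \<open>M\<close> is
  free, Gamma outgrows every geometric sequence, which is what the series of Mittag-Leffler type
  need.\<close>

lemma Gamma_real_lower_bound:
  fixes M x :: real
  assumes "0 < M" "1 \<le> x"
  shows "M powr (x - 1) * exp (- M) \<le> Gamma x"
proof (rule has_integral_le[where S="{0..}::real set"])
  show "((\<lambda>t. t powr (x - 1) / exp t) has_integral Gamma x) {0..}"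
    using assms by (intro Gamma_integral_real) auto
  have "((\<lambda>t. M powr (x - 1) * exp (- t)) has_integral M powr (x - 1) * exp (- M)) {M..}"
    using has_integral_mult_right[OF has_integral_exp_minus_to_infinity[of 1 M], of "M powr (x - 1)"] by simp
  then show "((\<lambda>t. if t \<in> {M..} then M powr (x - 1) * exp (- t) else 0) has_integral M powr (x - 1) * exp (- M)) {0..}"
    using assms by (subst has_integral_restrict) auto
  fix t :: real assume "t \<in> {0..}"
  show "(if t \<in> {M..} then M powr (x - 1) * exp (- t) else 0) \<le> t powr (x - 1) / exp t"
    using assms by (auto simp: exp_minus field_simps intro!: powr_mono2)
qed

lemma summable_power_over_Gamma:
  assumes "0 < \<nu>" "0 < \<delta>"
  shows "summable (\<lambda>k. R ^ k / Gamma (\<nu> * real k + \<delta>))"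
proof (rule summable_comparison_test_ev)
  define X where "X = \<bar>R\<bar> + 1"
  have X: "0 < X" "\<bar>R\<bar> \<le> X" by (simp_all add: X_def)
  \<comment> \<open>This makes \<open>M powr \<nu> = 2 * X\<close>, so the Gamma bound contributes
    \<open>(2 * X) ^ k\<close> against a numerator of at most \<open>X ^ k\<close>, and the ratio
    1/2 results.\<close>
  define M where "M = (2 * X) powr (1 / \<nu>)"
  have M: "0 < M" using X by (simp add: M_def)
  have Mnu: "M powr \<nu> = 2 * X" using assms X by (simp add: M_def powr_powr)
  define C where "C = exp M * M powr (1 - \<delta>)"
  show "summable (\<lambda>k. C * (1/2) ^ k)" by (intro summable_mult) simp
  have "\<forall>\<^sub>F k in sequentially. 1 \<le> \<nu> * real k + \<delta>"
    using assms by real_asymp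
  then show "\<forall>\<^sub>F k in sequentially. norm (R ^ k / Gamma (\<nu> * real k + \<delta>)) \<le> C * (1/2) ^ k"
  proof eventually_elim
    case (elim k)
    have "M powr (\<nu> * real k + \<delta> - 1) = (M powr \<nu>) ^ k * M powr (\<delta> - 1)"
      using M by (simp add: powr_add powr_diff powr_powr flip: powr_realpow)
    then have g: "(2 * X) ^ k * M powr (\<delta> - 1) * exp (- M) \<le> Gamma (\<nu> * real k + \<delta>)"
      using Gamma_real_lower_bound[OF M elim] by (simp add: Mnu)
    have pos: "0 < (2 * X) ^ k * M powr (\<delta> - 1) * exp (- M)"
      using M X by (intro mult_pos_pos zero_less_power) auto
    have "norm (R ^ k / Gamma (\<nu> * real k + \<delta>)) \<le> X ^ k / Gamma (\<nu> * real k + \<delta>)"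
      using g pos X by (auto simp: norm_divide power_abs intro!: divide_right_mono power_mono)
    also have "\<dots> \<le> X ^ k / ((2 * X) ^ k * M powr (\<delta> - 1) * exp (- M))"
      using g pos X by (intro divide_left_mono) auto
    also have "\<dots> = C * (1/2) ^ k"
      using M X by (simp add: C_def power_mult_distrib exp_minus powr_diff field_simps)
    finally show ?case .
  qed
qed

lemma frac_kernel_le:
  assumes "1 \<le> \<delta>" "t \<le> T"
  shows "frac_kernel \<delta> t \<le> T powr (\<delta> - 1) / Gamma \<delta>"
  using assms Gamma_real_pos[of \<delta>]
  by (auto simp: frac_kernel_def intro!: divide_right_mono powr_mono2)

lemma has_real_derivative_frac_kernel:
  assumes "0 < \<delta>" "0 < t"
  shows "(frac_kernel (\<delta> + 1) has_real_derivative frac_kernel \<delta> t) (at t)"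
proof -
  have "((\<lambda>t. t powr \<delta>) has_real_derivative \<delta> * t powr (\<delta> - 1)) (at t)"
    using assms by (auto intro!: derivative_eq_intros)
  then have "((\<lambda>t. t powr \<delta> / Gamma (\<delta> + 1)) has_real_derivative \<delta> * t powr (\<delta> - 1) / Gamma (\<delta> + 1)) (at t)"
    by (rule DERIV_cdivide)
  moreover have "Gamma (\<delta> + 1) = \<delta> * Gamma \<delta>"
    using assms by (intro Gamma_plus1) (auto elim!: nonpos_Ints_cases)
  then have "\<delta> * t powr (\<delta> - 1) / Gamma (\<delta> + 1) = frac_kernel \<delta> t"
    using assms by (simp add: frac_kernel_def)
  moreover have "\<forall>\<^sub>F s in nhds t. frac_kernel (\<delta> + 1) s = s powr \<delta> / Gamma (\<delta> + 1)"
    using eventually_nhds_in_open[of "{0<..}" t] assms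
    by (auto simp: frac_kernel_def elim!: eventually_mono)
  ultimately show ?thesis
    by (subst DERIV_cong_ev) auto
qed

section \<open>Riemann-Liouville integrals as operators and Volterra equations\<close>

definition frac_int :: "real \<Rightarrow> (real \<Rightarrow> 'b::{banach,second_countable_topology}) \<Rightarrow> real \<Rightarrow> 'b" where
  "frac_int \<alpha> f t = (LINT s:{0<..<t}|lborel. frac_kernel \<alpha> (t - s) *\<^sub>R f s)"

lemma frac_int_cong:
  "(\<And>s. 0 < s \<Longrightarrow> s < t \<Longrightarrow> f s = g s) \<Longrightarrow> frac_int \<alpha> f t = frac_int \<alpha> g t"
  unfolding frac_int_def by (rule set_lebesgue_integral_cong) auto

text \<open>Fubini for the product of the two kernels. For a merely integrable \<open>f\<close> the
  composition rule is in general valid for almost every \<open>T\<close>; the hypothesis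
  \<open>1 \<le> \<alpha> + \<delta>\<close> makes the composed kernel bounded, which yields the
  rule at the given \<open>T\<close>.\<close>

lemma
  fixes f :: "real \<Rightarrow> 'b::{banach,second_countable_topology}"
  assumes f: "set_integrable lborel {0<..<T} f" and "0 < \<alpha>" "0 < \<delta>" "1 \<le> \<alpha> + \<delta>"
  shows frac_int_iterated_integrable:
      "set_integrable lborel {0<..<T} (\<lambda>t. frac_kernel \<delta> (T - t) *\<^sub>R frac_int \<alpha> f t)"
    and frac_int_semigroup: "frac_int \<delta> (frac_int \<alpha> f) T = frac_int (\<alpha> + \<delta>) f T"
proof -
  define g where "g s = indicator {0<..<T} s *\<^sub>R f s" for s
  have g: "integrable lborel g" using f by (simp add: g_def[abs_def] set_integrable_def)
  then have gm[measurable]: "g \<in> borel_measurable borel" by auto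
  define K where "K s t = (frac_kernel \<delta> (T - t) * frac_kernel \<alpha> (t - s)) *\<^sub>R g s" for s t
  have Km: "(\<lambda>(s,t). K s t) \<in> borel_measurable (lborel \<Otimes>\<^sub>M lborel)"
    unfolding K_def by measurable
  have inner: "has_bochner_integral lborel (\<lambda>t. frac_kernel \<delta> (T - t) * frac_kernel \<alpha> (t - s)) (frac_kernel (\<alpha> + \<delta>) (T - s))" for s
    using frac_kernel_shift_conv[OF \<open>0 < \<delta>\<close> \<open>0 < \<alpha>\<close>, of T s] by (simp add: add.commute)
  have nn: "0 \<le> frac_kernel \<delta> u" "0 \<le> frac_kernel \<alpha> u" "0 \<le> frac_kernel (\<alpha> + \<delta>) u" for u
    using assms by (auto intro: frac_kernel_nonneg)
  have normK: "(\<integral>t. norm (K s t) \<partial>lborel) = frac_kernel (\<alpha> + \<delta>) (T - s) * norm (g s)" for s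
    using inner[of s] nn by (simp add: K_def abs_mult has_bochner_integral_iff)
  have outer: "integrable lborel (\<lambda>s. frac_kernel (\<alpha> + \<delta>) (T - s) *\<^sub>R g s)"
  proof (rule Bochner_Integration.integrable_bound)
    show "integrable lborel (\<lambda>s. (T powr (\<alpha> + \<delta> - 1) / Gamma (\<alpha> + \<delta>)) *\<^sub>R norm (g s))"
      using g by auto
    show "AE s in lborel. norm (frac_kernel (\<alpha> + \<delta>) (T - s) *\<^sub>R g s) \<le> norm ((T powr (\<alpha> + \<delta> - 1) / Gamma (\<alpha> + \<delta>)) *\<^sub>R norm (g s))"
    proof (rule AE_I2)
      fix s
      have "frac_kernel (\<alpha> + \<delta>) (T - s) \<le> T powr (\<alpha> + \<delta> - 1) / Gamma (\<alpha> + \<delta>)" if "0 < s"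
        using frac_kernel_le[of "\<alpha> + \<delta>" "T - s" T] that assms by auto
      then show "norm (frac_kernel (\<alpha> + \<delta>) (T - s) *\<^sub>R g s) \<le> norm ((T powr (\<alpha> + \<delta> - 1) / Gamma (\<alpha> + \<delta>)) *\<^sub>R norm (g s))"
        using nn(3)[of "T - s"] assms Gamma_real_pos[of "\<alpha> + \<delta>"]
          mult_right_mono[of "frac_kernel (\<alpha> + \<delta>) (T - s)" "T powr (\<alpha> + \<delta> - 1) / Gamma (\<alpha> + \<delta>)" "norm (g s)"]
        by (cases "0 < s") (auto simp: g_def)
    qed
  qed auto
  have intK: "integrable (lborel \<Otimes>\<^sub>M lborel) (\<lambda>(s,t). K s t)"
  proof (rule lborel_pair.Fubini_integrable[OF Km])
    show "integrable lborel (\<lambda>x. LINT y|lborel. norm (case (x, y) of (s, t) \<Rightarrow> K s t))"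
      using integrable_norm[OF outer] nn by (simp add: normK)
    show "AE x in lborel. integrable lborel (\<lambda>y. case (x, y) of (s, t) \<Rightarrow> K s t)"
      using inner by (auto simp: K_def has_bochner_integral_iff)
  qed
  have K1: "(\<integral>s. K s t \<partial>lborel) = indicator {0<..<T} t *\<^sub>R (frac_kernel \<delta> (T - t) *\<^sub>R frac_int \<alpha> f t)" for t
  proof (cases "0 < t \<and> t < T")
    case True
    then have "K s t = frac_kernel \<delta> (T - t) *\<^sub>R (indicator {0<..<t} s *\<^sub>R (frac_kernel \<alpha> (t - s) *\<^sub>R f s))" for s
      by (auto simp: K_def g_def frac_kernel_def indicator_def)
    then show ?thesis
      using True by (simp only: integral_scaleR_right frac_int_def set_lebesgue_integral_def) simp
  next
    case False
    then have "K s t = 0" for s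
      by (auto simp: K_def g_def frac_kernel_def indicator_def)
    then show ?thesis using False by auto
  qed
  have K2: "(\<integral>t. K s t \<partial>lborel) = frac_kernel (\<alpha> + \<delta>) (T - s) *\<^sub>R g s" for s
    unfolding K_def using inner[of s] by (subst integral_scaleR_left) (auto simp: has_bochner_integral_iff)
  show "set_integrable lborel {0<..<T} (\<lambda>t. frac_kernel \<delta> (T - t) *\<^sub>R frac_int \<alpha> f t)"
    using lborel_pair.integrable_snd[OF intK] by (simp add: K1 set_integrable_def)
  have "frac_int \<delta> (frac_int \<alpha> f) T = (\<integral>t. (\<integral>s. K s t \<partial>lborel) \<partial>lborel)"
    by (simp add: K1) (simp add: frac_int_def set_lebesgue_integral_def)
  also have "\<dots> = (\<integral>s. (\<integral>t. K s t \<partial>lborel) \<partial>lborel)"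
    by (rule lborel_pair.Fubini_integral[OF intK])
  also have "\<dots> = frac_int (\<alpha> + \<delta>) f T"
    by (simp add: K2) (simp add: frac_int_def set_lebesgue_integral_def g_def mult.commute)
  finally show "frac_int \<delta> (frac_int \<alpha> f) T = frac_int (\<alpha> + \<delta>) f T" .
qed

lemma frac_int_integrable_bounded:
  fixes f :: "real \<Rightarrow> 'b::{banach,second_countable_topology}"
  assumes "0 < \<alpha>" and m: "set_borel_measurable lborel {0<..<t} f"
    and B: "\<And>s. 0 < s \<Longrightarrow> s < t \<Longrightarrow> norm (f s) \<le> B"
  shows "set_integrable lborel {0<..<t} (\<lambda>s. frac_kernel \<alpha> (t - s) *\<^sub>R f s)"
  unfolding set_integrable_def
proof (rule Bochner_Integration.integrable_bound)
  \<comment> \<open>\<open>frac_kernel 1\<close> is the indicator of the positive half-line, so this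
    majorant is a kernel convolution already known to be integrable, and it is supported in the
    interval from 0 to \<open>t\<close>.\<close>
  show "integrable lborel (\<lambda>s. B * (frac_kernel \<alpha> (t - s) * frac_kernel 1 s))"
    using frac_kernel_conv[OF assms(1), of 1 t] by (intro integrable_mult_right) (auto simp: has_bochner_integral_iff)
  have "(\<lambda>s. frac_kernel \<alpha> (t - s) *\<^sub>R (indicator {0<..<t} s *\<^sub>R f s)) \<in> borel_measurable lborel"
    using m unfolding set_borel_measurable_def by measurable
  then show "(\<lambda>s. indicator {0<..<t} s *\<^sub>R frac_kernel \<alpha> (t - s) *\<^sub>R f s) \<in> borel_measurable lborel"
    by (simp add: mult.commute)
  show "AE s in lborel. norm (indicator {0<..<t} s *\<^sub>R frac_kernel \<alpha> (t - s) *\<^sub>R f s)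
      \<le> norm (B * (frac_kernel \<alpha> (t - s) * frac_kernel 1 s))"
  proof (rule AE_I2)
    fix s show "norm (indicator {0<..<t} s *\<^sub>R frac_kernel \<alpha> (t - s) *\<^sub>R f s)
      \<le> norm (B * (frac_kernel \<alpha> (t - s) * frac_kernel 1 s))"
      using B[of s] frac_kernel_nonneg[OF assms(1), of "t - s"]
      by (auto simp: indicator_def frac_kernel_one abs_mult mult.commute[of B] intro!: mult_left_mono)
  qed
qed

lemma frac_int_diff:
  fixes f g :: "real \<Rightarrow> 'b::{banach,second_countable_topology}"
  assumes "0 < \<alpha>" "set_borel_measurable lborel {0<..<t} f" "set_borel_measurable lborel {0<..<t} g"
    and "\<And>s. 0 < s \<Longrightarrow> s < t \<Longrightarrow> norm (f s) \<le> B" "\<And>s. 0 < s \<Longrightarrow> s < t \<Longrightarrow> norm (g s) \<le> C"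
  shows "frac_int \<alpha> (\<lambda>s. f s - g s) t = frac_int \<alpha> f t - frac_int \<alpha> g t"
  using set_integral_diff(2)[OF frac_int_integrable_bounded[OF assms(1,2,4)] frac_int_integrable_bounded[OF assms(1,3,5)]]
  by (simp add: frac_int_def scaleR_diff_right)

text \<open>A Gronwall argument. Inserting the bound into itself \<open>k\<close> times gives
  \<open>B * K ^ k * frac_kernel (\<nu> * real k + 1) t\<close>, because the orders of composed
  kernels add up. This is a general term of a convergent series, hence tends to 0.\<close>

lemma frac_int_norm_iterate_zero:
  fixes y :: "real \<Rightarrow> 'b::{banach,second_countable_topology}"
  assumes "0 < \<nu>" "0 \<le> K"
    and m: "set_borel_measurable lborel {0<..<T} y"
    and B: "\<And>s. 0 < s \<Longrightarrow> s \<le> T \<Longrightarrow> norm (y s) \<le> B"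
    and le: "\<And>t. 0 < t \<Longrightarrow> t \<le> T \<Longrightarrow> norm (y t) \<le> K * frac_int \<nu> (\<lambda>s. norm (y s)) t"
    and t: "0 < t" "t \<le> T"
  shows "y t = 0"
proof -
  have bound: "0 < t \<Longrightarrow> t \<le> T \<Longrightarrow> norm (y t) \<le> B * K ^ k * frac_kernel (\<nu> * real k + 1) t" for t k
  proof (induction k arbitrary: t)
    case 0
    then show ?case using B by (simp add: frac_kernel_one)
  next
    case (Suc k)
    have conv: "has_bochner_integral lborel (\<lambda>s. frac_kernel \<nu> (t - s) * frac_kernel (\<nu> * real k + 1) s)
        (frac_kernel (\<nu> + (\<nu> * real k + 1)) t)"
      using assms by (intro frac_kernel_conv) (auto intro!: add_nonneg_pos)
    have "(\<lambda>s. indicator {0<..<t} s *\<^sub>R (indicator {0<..<T} s *\<^sub>R y s)) \<in> borel_measurable lborel"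
      using m unfolding set_borel_measurable_def by measurable
    also have "(\<lambda>s. indicator {0<..<t} s *\<^sub>R (indicator {0<..<T} s *\<^sub>R y s)) = (\<lambda>s. indicator {0<..<t} s *\<^sub>R y s)"
      using Suc.prems by (auto simp: indicator_def fun_eq_iff)
    finally have m': "(\<lambda>s. indicator {0<..<t} s *\<^sub>R y s) \<in> borel_measurable lborel" .
    have "(\<lambda>s. norm (indicator {0<..<t} s *\<^sub>R y s)) \<in> borel_measurable lborel"
      using m' by measurable
    then have m'': "set_borel_measurable lborel {0<..<t} (\<lambda>s. norm (y s))"
      by (simp add: set_borel_measurable_def)
    have "frac_int \<nu> (\<lambda>s. norm (y s)) t \<le>
        (\<integral>s. B * K ^ k * (frac_kernel \<nu> (t - s) * frac_kernel (\<nu> * real k + 1) s) \<partial>lborel)"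
      unfolding frac_int_def set_lebesgue_integral_def
    proof (rule integral_mono)
      show "integrable lborel (\<lambda>s. indicator {0<..<t} s *\<^sub>R frac_kernel \<nu> (t - s) *\<^sub>R norm (y s))"
        using frac_int_integrable_bounded[OF assms(1) m'', of B] B Suc.prems
        by (simp add: set_integrable_def)
      show "integrable lborel (\<lambda>s. B * K ^ k * (frac_kernel \<nu> (t - s) * frac_kernel (\<nu> * real k + 1) s))"
        using conv by (intro integrable_mult_right) (auto simp: has_bochner_integral_iff)
      fix s :: real
      show "indicator {0<..<t} s *\<^sub>R frac_kernel \<nu> (t - s) *\<^sub>R norm (y s) \<le>
          B * K ^ k * (frac_kernel \<nu> (t - s) * frac_kernel (\<nu> * real k + 1) s)"
      proof (cases "0 < s \<and> s < t")
        case True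
        then show ?thesis
          using mult_left_mono[OF Suc.IH[of s] frac_kernel_nonneg[OF assms(1), of "t - s"]] Suc.prems
          by (simp add: mult_ac)
      next
        case False
        then show ?thesis by (auto simp: frac_kernel_def)
      qed
    qed
    also have "\<dots> = B * K ^ k * frac_kernel (\<nu> * real (Suc k) + 1) t"
      using conv by (simp add: has_bochner_integral_iff algebra_simps)
    finally have "K * frac_int \<nu> (\<lambda>s. norm (y s)) t \<le> K * (B * K ^ k * frac_kernel (\<nu> * real (Suc k) + 1) t)"
      using assms(2) by (rule mult_left_mono)
    with le[OF Suc.prems] show ?case by (simp add: mult_ac)
  qed
  have "(\<lambda>k. B * ((K * t powr \<nu>) ^ k / Gamma (\<nu> * real k + 1))) \<longlonglongrightarrow> B * 0"
    by (intro tendsto_mult_left summable_LIMSEQ_zero summable_power_over_Gamma) (use assms in auto)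
  moreover have "B * ((K * t powr \<nu>) ^ k / Gamma (\<nu> * real k + 1)) = B * K ^ k * frac_kernel (\<nu> * real k + 1) t" for k
    using t by (simp add: frac_kernel_def power_mult_distrib powr_powr flip: powr_realpow)
  ultimately have "norm (y t) \<le> 0"
    by (intro LIMSEQ_le_const[of _ 0]) (auto intro!: bound t)
  then show ?thesis by simp
qed

text \<open>On a bounded interval the kernel of order 2\<nu> is at most a multiple of the kernel of
  order \<nu>, so both fractional integrals collapse into one and the Gronwall argument applies to
  the norm of \<open>y\<close>.\<close>

lemma volterra_unique:
  fixes y :: "real \<Rightarrow> complex"
  assumes "0 < \<nu>"
    and m: "set_borel_measurable lborel {0<..<T} y"
    and B: "\<And>s. 0 < s \<Longrightarrow> s \<le> T \<Longrightarrow> norm (y s) \<le> B"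
    and eq: "\<And>t. 0 < t \<Longrightarrow> t \<le> T \<Longrightarrow> y t + p * frac_int \<nu> y t + q * frac_int (2 * \<nu>) y t = 0"
    and t: "0 < t" "t \<le> T"
  shows "y t = 0"
proof -
  \<comment> \<open>The quotient of the two kernels at \<open>u\<close> is
    \<open>u powr \<nu> * Gamma \<nu> / Gamma (2 * \<nu>)\<close>, which is largest at
    \<open>u = T\<close>.\<close>
  define D where "D = T powr \<nu> * Gamma \<nu> / Gamma (2 * \<nu>)"
  have G: "0 < Gamma \<nu>" "0 < Gamma (2 * \<nu>)" using assms by (auto intro!: Gamma_real_pos)
  have "0 \<le> D" using G by (simp add: D_def)
  have ker: "frac_kernel (2 * \<nu>) u \<le> D * frac_kernel \<nu> u" if "u \<le> T" for u
  proof (cases "0 < u")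
    case True
    have "u powr (2 * \<nu> - 1) = u powr \<nu> * u powr (\<nu> - 1)"
      using True by (simp flip: powr_add)
    also have "\<dots> \<le> T powr \<nu> * u powr (\<nu> - 1)"
      using True that assms by (intro mult_right_mono powr_mono2) auto
    finally show ?thesis
      using True G by (simp add: frac_kernel_def D_def field_simps)
  qed (simp add: frac_kernel_def)
  show ?thesis
  proof (rule frac_int_norm_iterate_zero[OF assms(1) _ m B _ t])
    show "0 \<le> norm p + norm q * D" using \<open>0 \<le> D\<close> by simp
    fix t assume t: "0 < t" "t \<le> T"
    have "(\<lambda>s. indicator {0<..<t} s *\<^sub>R (indicator {0<..<T} s *\<^sub>R y s)) \<in> borel_measurable lborel"
      using m unfolding set_borel_measurable_def by measurable
    also have "(\<lambda>s. indicator {0<..<t} s *\<^sub>R (indicator {0<..<T} s *\<^sub>R y s)) = (\<lambda>s. indicator {0<..<t} s *\<^sub>R y s)"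
      using t by (auto simp: indicator_def fun_eq_iff)
    finally have m': "(\<lambda>s. indicator {0<..<t} s *\<^sub>R y s) \<in> borel_measurable lborel" .
    have "(\<lambda>s. norm (indicator {0<..<t} s *\<^sub>R y s)) \<in> borel_measurable lborel"
      using m' by measurable
    then have m'': "set_borel_measurable lborel {0<..<t} (\<lambda>s. norm (y s))"
      by (simp add: set_borel_measurable_def)
    have int: "set_integrable lborel {0<..<t} (\<lambda>s. frac_kernel \<alpha> (t - s) *\<^sub>R norm (y s))" if "0 < \<alpha>" for \<alpha>
      using B t by (intro frac_int_integrable_bounded[OF that m'', where B=B]) auto
    have nrm: "norm (frac_int \<alpha> y t) \<le> frac_int \<alpha> (\<lambda>s. norm (y s)) t" if "0 < \<alpha>" for \<alpha>
    proof -
      have "norm (frac_int \<alpha> y t) \<le> (\<integral>s. norm (indicator {0<..<t} s *\<^sub>R frac_kernel \<alpha> (t - s) *\<^sub>R y s) \<partial>lborel)"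
        unfolding frac_int_def set_lebesgue_integral_def by (rule integral_norm_bound)
      also have "\<dots> = frac_int \<alpha> (\<lambda>s. norm (y s)) t"
        using frac_kernel_nonneg[OF that] by (simp add: frac_int_def set_lebesgue_integral_def mult.assoc)
      finally show ?thesis .
    qed
    have cmp: "frac_int (2 * \<nu>) (\<lambda>s. norm (y s)) t \<le> D * frac_int \<nu> (\<lambda>s. norm (y s)) t"
    proof -
      have "frac_int (2 * \<nu>) (\<lambda>s. norm (y s)) t \<le> (LINT s:{0<..<t}|lborel. D * (frac_kernel \<nu> (t - s) *\<^sub>R norm (y s)))"
        unfolding frac_int_def
      proof (rule set_integral_mono)
        fix s assume "s \<in> {0<..<t}"
        then show "frac_kernel (2 * \<nu>) (t - s) *\<^sub>R norm (y s) \<le> D * (frac_kernel \<nu> (t - s) *\<^sub>R norm (y s))"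
          using mult_right_mono[OF ker[of "t - s"], of "norm (y s)"] t by (simp add: mult_ac)
      qed (use int assms in auto)
      then show ?thesis by (simp add: frac_int_def)
    qed
    have "y t = - (p * frac_int \<nu> y t + q * frac_int (2 * \<nu>) y t)"
      using eq[OF t] by (simp only: eq_neg_iff_add_eq_0 add.assoc)
    then have "norm (y t) \<le> norm p * norm (frac_int \<nu> y t) + norm q * norm (frac_int (2 * \<nu>) y t)"
      by (metis norm_minus_cancel norm_triangle_ineq norm_mult)
    also have "\<dots> \<le> norm p * frac_int \<nu> (\<lambda>s. norm (y s)) t + norm q * (D * frac_int \<nu> (\<lambda>s. norm (y s)) t)"
      using assms by (intro add_mono mult_left_mono nrm order_trans[OF nrm cmp]) auto
    finally show "norm (y t) \<le> (norm p + norm q * D) * frac_int \<nu> (\<lambda>s. norm (y s)) t"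
      by (simp add: algebra_simps)
  qed
qed

section \<open>Series of Mittag-Leffler type\<close>

text \<open>Up to the factor \<open>t powr (\<delta> - 1)\<close> this is a power series in
  \<open>t powr \<nu>\<close>. With the terms written as kernels the coefficients \<open>b\<close>
  do not depend on \<delta>, so fractional integration and differentiation only move
  \<delta>.\<close>

definition ml_series :: "real \<Rightarrow> (nat \<Rightarrow> real) \<Rightarrow> real \<Rightarrow> real \<Rightarrow> real" where
  "ml_series \<nu> b \<delta> t = (\<Sum>k. b k * frac_kernel (\<nu> * real k + \<delta>) t)"

lemma frac_kernel_power:
  "0 < t \<Longrightarrow> frac_kernel (\<nu> * real k + \<delta>) t = t powr (\<delta> - 1) * ((t powr \<nu>) ^ k / Gamma (\<nu> * real k + \<delta>))"
  by (simp add: frac_kernel_def powr_powr powr_add powr_diff flip: powr_realpow)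

context
  fixes \<nu> R :: real and b :: "nat \<Rightarrow> real"
  assumes \<nu>: "0 < \<nu>" and b: "\<And>k. \<bar>b k\<bar> \<le> R ^ k"
begin

lemma ml_index_pos: "0 < \<delta> \<Longrightarrow> 0 < \<nu> * real k + \<delta>"
  using \<nu> by (simp add: add_nonneg_pos)

lemma ml_coeff_bound_nonneg: "0 \<le> R"
  using b[of 1] by simp

lemma ml_series_abs_summable:
  assumes "0 < \<delta>"
  shows "summable (\<lambda>k. \<bar>b k\<bar> * frac_kernel (\<nu> * real k + \<delta>) t)"
proof (cases "0 < t")
  case True
  show ?thesis
  proof (rule summable_comparison_test')
    show "summable (\<lambda>k. t powr (\<delta> - 1) * ((R * t powr \<nu>) ^ k / Gamma (\<nu> * real k + \<delta>)))"
      by (intro summable_mult summable_power_over_Gamma \<nu> assms)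
    fix k
    have "0 \<le> t powr (\<delta> - 1) * ((t powr \<nu>) ^ k / Gamma (\<nu> * real k + \<delta>))"
      using Gamma_real_pos[OF ml_index_pos[OF assms, of k]] by simp
    from mult_right_mono[OF b[of k] this]
    show "norm (\<bar>b k\<bar> * frac_kernel (\<nu> * real k + \<delta>) t) \<le> t powr (\<delta> - 1) * ((R * t powr \<nu>) ^ k / Gamma (\<nu> * real k + \<delta>))"
      using Gamma_real_pos[OF ml_index_pos[OF assms, of k]] True
      by (simp add: frac_kernel_power abs_mult power_mult_distrib mult_ac)
  qed
qed (simp add: frac_kernel_def)

lemma ml_series_summable:
  assumes "0 < \<delta>"
  shows "summable (\<lambda>k. b k * frac_kernel (\<nu> * real k + \<delta>) t)"
proof (rule summable_comparison_test'[OF ml_series_abs_summable[OF assms, of t], of 0])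
  show "norm (b k * frac_kernel (\<nu> * real k + \<delta>) t) \<le> \<bar>b k\<bar> * frac_kernel (\<nu> * real k + \<delta>) t" for k
    using frac_kernel_nonneg[OF ml_index_pos[OF assms, of k], of t]
    by (simp only: real_norm_def abs_mult abs_of_nonneg order_refl)
qed

lemma ml_series_conv:
  assumes "0 < \<alpha>" "0 < \<delta>"
  shows "has_bochner_integral lborel (\<lambda>s. frac_kernel \<alpha> (t - s) * ml_series \<nu> b \<delta> s) (ml_series \<nu> b (\<alpha> + \<delta>) t)"
proof -
  define f where "f k s = b k * (frac_kernel \<alpha> (t - s) * frac_kernel (\<nu> * real k + \<delta>) s)" for k s
  have conv: "has_bochner_integral lborel (f k) (b k * frac_kernel (\<nu> * real k + (\<alpha> + \<delta>)) t)" for k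
    unfolding f_def using frac_kernel_conv[OF assms(1) ml_index_pos[OF assms(2)], of t k]
    by (intro has_bochner_integral_mult_right) (simp add: add_ac)
  have nn: "0 \<le> frac_kernel \<alpha> (t - s) * frac_kernel (\<nu> * real k + \<delta>) s" for s k
    using assms ml_index_pos by (simp add: frac_kernel_nonneg)
  have nrm: "norm (f k s) = \<bar>b k\<bar> * (frac_kernel \<alpha> (t - s) * frac_kernel (\<nu> * real k + \<delta>) s)" for k s
    unfolding f_def real_norm_def abs_mult[of "b k"] using nn by (simp only: abs_of_nonneg)
  have fsum: "summable (\<lambda>k. norm (f k s))" for s
    using summable_mult[OF ml_series_abs_summable[OF assms(2), of s], of "frac_kernel \<alpha> (t - s)"]
    unfolding nrm by (simp add: mult_ac)
  have "(\<integral>s. norm (f k s) \<partial>lborel) = \<bar>b k\<bar> * frac_kernel (\<nu> * real k + (\<alpha> + \<delta>)) t" for k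
    unfolding nrm using frac_kernel_conv[OF assms(1) ml_index_pos[OF assms(2)], of t k]
    by (simp add: has_bochner_integral_iff add_ac)
  then have isum: "summable (\<lambda>k. \<integral>s. norm (f k s) \<partial>lborel)"
    using ml_series_abs_summable[of "\<alpha> + \<delta>" t] assms by simp
  have int: "integrable lborel (f k)" for k using conv by (simp add: has_bochner_integral_iff)
  have eq: "frac_kernel \<alpha> (t - s) * ml_series \<nu> b \<delta> s = (\<Sum>k. f k s)" for s
    unfolding ml_series_def f_def
    by (subst suminf_mult[symmetric]) (auto intro!: ml_series_summable assms simp: mult_ac)
  show ?thesis
    unfolding eq has_bochner_integral_iff
    using integrable_suminf[OF int AE_I2[OF fsum] isum] integral_suminf[OF int AE_I2[OF fsum] isum] conv
    by (simp add: has_bochner_integral_iff ml_series_def)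
qed

text \<open>Each kernel transforms into
  \<open>\<mu> powr (- \<delta>) * (\<mu> powr (- \<nu>)) ^ k\<close>. The threshold
  \<open>R < \<mu> powr \<nu>\<close> makes the geometric majorant of the transformed series
  converge; this is why transforms are compared for large \<mu> only.\<close>

lemma ml_series_laplace:
  assumes "0 < \<delta>" "0 < \<mu>" "R < \<mu> powr \<nu>"
  shows "has_bochner_integral lborel (\<lambda>t. exp (- \<mu> * t) * ml_series \<nu> b \<delta> t)
    (\<mu> powr (- \<delta>) * (\<Sum>k. b k * (\<mu> powr (- \<nu>)) ^ k))"
proof -
  define f where "f k s = b k * (exp (- \<mu> * s) * frac_kernel (\<nu> * real k + \<delta>) s)" for k s
  have pw: "\<mu> powr (- (\<nu> * real k + \<delta>)) = \<mu> powr (- \<delta>) * (\<mu> powr (- \<nu>)) ^ k" for k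
  proof -
    have "- (\<nu> * real k + \<delta>) = - \<delta> + - \<nu> * real k" by simp
    moreover have "(\<mu> powr (- \<nu>)) ^ k = \<mu> powr (- \<nu> * real k)"
      using assms by (subst powr_realpow[symmetric]) (auto simp: powr_powr)
    ultimately show ?thesis
      by (simp only: powr_add)
  qed
  have L: "has_bochner_integral lborel (\<lambda>s. exp (- \<mu> * s) * frac_kernel (\<nu> * real k + \<delta>) s) (\<mu> powr (- \<delta>) * (\<mu> powr (- \<nu>)) ^ k)" for k
    using frac_kernel_laplace[OF ml_index_pos[OF assms(1), of k] assms(2)] unfolding pw .
  have conv: "has_bochner_integral lborel (f k) (b k * (\<mu> powr (- \<delta>) * (\<mu> powr (- \<nu>)) ^ k))" for k
    unfolding f_def by (intro has_bochner_integral_mult_right L)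
  have nn: "0 \<le> exp (- \<mu> * s) * frac_kernel (\<nu> * real k + \<delta>) s" for s k
    using assms ml_index_pos by (simp add: frac_kernel_nonneg)
  have nrm: "norm (f k s) = \<bar>b k\<bar> * (exp (- \<mu> * s) * frac_kernel (\<nu> * real k + \<delta>) s)" for k s
    unfolding f_def real_norm_def abs_mult[of "b k"] using nn by (simp only: abs_of_nonneg)
  have fsum: "summable (\<lambda>k. norm (f k s))" for s
    using summable_mult[OF ml_series_abs_summable[OF assms(1), of s], of "exp (- \<mu> * s)"]
    unfolding nrm by (simp add: mult_ac)
  have bs: "summable (\<lambda>k. \<bar>b k\<bar> * (\<mu> powr (- \<nu>)) ^ k)"
  proof (rule summable_comparison_test')
    have "R / \<mu> powr \<nu> < 1"
      using assms by (subst pos_divide_less_eq) auto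
    then have "R * \<mu> powr (- \<nu>) < 1"
      by (simp add: powr_minus divide_inverse)
    then show "summable (\<lambda>k. (R * \<mu> powr (- \<nu>)) ^ k)"
      using ml_coeff_bound_nonneg by (intro summable_geometric) auto
    show "norm (\<bar>b k\<bar> * (\<mu> powr (- \<nu>)) ^ k) \<le> (R * \<mu> powr (- \<nu>)) ^ k" for k
      using mult_right_mono[OF b[of k], of "(\<mu> powr (- \<nu>)) ^ k"] by (simp add: power_mult_distrib)
  qed
  have bs': "summable (\<lambda>k. b k * (\<mu> powr (- \<nu>)) ^ k)"
    by (rule summable_comparison_test'[OF bs, of 0]) (simp add: abs_mult)
  have "(\<integral>s. norm (f k s) \<partial>lborel) = \<mu> powr (- \<delta>) * (\<bar>b k\<bar> * (\<mu> powr (- \<nu>)) ^ k)" for k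
    unfolding nrm using L[of k] by (simp only: integral_mult_right_zero has_bochner_integral_integral_eq mult.left_commute)
  then have isum: "summable (\<lambda>k. \<integral>s. norm (f k s) \<partial>lborel)"
    using summable_mult[OF bs, of "\<mu> powr (- \<delta>)"] by (simp only:)
  have int: "integrable lborel (f k)" for k using conv by (simp add: has_bochner_integral_iff)
  have eq: "exp (- \<mu> * s) * ml_series \<nu> b \<delta> s = (\<Sum>k. f k s)" for s
    unfolding ml_series_def f_def
    by (subst suminf_mult[symmetric]) (auto intro!: ml_series_summable assms simp: mult_ac)
  have "(\<Sum>k. integral\<^sup>L lborel (f k)) = \<mu> powr (- \<delta>) * (\<Sum>k. b k * (\<mu> powr (- \<nu>)) ^ k)"
    using conv suminf_mult[OF bs', of "\<mu> powr (- \<delta>)"]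
    by (simp add: has_bochner_integral_iff mult.left_commute)
  then show ?thesis
    unfolding eq has_bochner_integral_iff
    using integrable_suminf[OF int AE_I2[OF fsum] isum] integral_suminf[OF int AE_I2[OF fsum] isum]
    by simp
qed

lemma ml_series_has_derivative:
  assumes "0 < \<delta>" "0 < t"
  shows "(ml_series \<nu> b (\<delta> + 1) has_real_derivative ml_series \<nu> b \<delta> t) (at t)"
proof -
  define S where "S = {t/2..2*t}"
  \<comment> \<open>The power \<open>s powr (\<delta> - 1)\<close> increases or decreases on
    \<open>S\<close> depending on the sign of \<open>\<delta> - 1\<close>; the sum of its values at
    both ends bounds it in either case.\<close>
  define D where "D = (t/2) powr (\<delta> - 1) + (2 * t) powr (\<delta> - 1)"
  have unif: "uniformly_convergent_on S (\<lambda>n s. \<Sum>k<n. b k * frac_kernel (\<nu> * real k + \<delta>) s)"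
  proof (rule Weierstrass_m_test'[where M="\<lambda>k. D * ((R * (2 * t) powr \<nu>) ^ k / Gamma (\<nu> * real k + \<delta>))"])
    show "summable (\<lambda>k. D * ((R * (2 * t) powr \<nu>) ^ k / Gamma (\<nu> * real k + \<delta>)))"
      by (intro summable_mult summable_power_over_Gamma \<nu> assms)
    fix k s assume s: "s \<in> S"
    then have s': "0 < s" "t/2 \<le> s" "s \<le> 2 * t" using assms by (auto simp: S_def)
    note G = Gamma_real_pos[OF ml_index_pos[OF assms(1), of k]]
    have "s powr (\<delta> - 1) \<le> D"
    proof (cases "1 \<le> \<delta>")
      case True
      then have "s powr (\<delta> - 1) \<le> (2 * t) powr (\<delta> - 1)" using s' by (intro powr_mono2) auto
      then show ?thesis by (simp add: D_def add_increasing)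
    next
      case False
      then have "s powr (\<delta> - 1) \<le> (t/2) powr (\<delta> - 1)" using s' assms by (intro powr_mono2') auto
      then show ?thesis by (simp add: D_def add_increasing2)
    qed
    moreover have "(s powr \<nu>) ^ k \<le> ((2 * t) powr \<nu>) ^ k"
      using s' \<nu> by (intro power_mono powr_mono2) auto
    ultimately have "\<bar>b k\<bar> * (s powr (\<delta> - 1) * ((s powr \<nu>) ^ k / Gamma (\<nu> * real k + \<delta>)))
      \<le> R ^ k * (D * (((2 * t) powr \<nu>) ^ k / Gamma (\<nu> * real k + \<delta>)))"
      using G ml_coeff_bound_nonneg by (intro mult_mono b divide_right_mono) (auto simp: D_def)
    then show "norm (b k * frac_kernel (\<nu> * real k + \<delta>) s) \<le> D * ((R * (2 * t) powr \<nu>) ^ k / Gamma (\<nu> * real k + \<delta>))"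
      using G s' by (simp add: frac_kernel_power abs_mult power_mult_distrib mult_ac)
  qed
  have "((\<lambda>s. \<Sum>k. b k * frac_kernel (\<nu> * real k + (\<delta> + 1)) s) has_field_derivative
      (\<Sum>k. b k * frac_kernel (\<nu> * real k + \<delta>) t)) (at t)"
  proof (rule has_field_derivative_series'(2)[where S=S, OF _ _ unif])
    show "convex S" by (simp add: S_def)
    show "t \<in> S" "t \<in> interior S" using assms by (auto simp: S_def)
    show "summable (\<lambda>k. b k * frac_kernel (\<nu> * real k + (\<delta> + 1)) t)"
      using assms by (intro ml_series_summable) auto
    fix k s assume "s \<in> S"
    then have "0 < s" using assms by (auto simp: S_def)
    have "((\<lambda>s. b k * frac_kernel (\<nu> * real k + \<delta> + 1) s) has_field_derivative b k * frac_kernel (\<nu> * real k + \<delta>) s) (at s)"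
      by (intro DERIV_cmult has_real_derivative_frac_kernel ml_index_pos assms \<open>0 < s\<close>)
    then show "((\<lambda>s. b k * frac_kernel (\<nu> * real k + (\<delta> + 1)) s) has_field_derivative b k * frac_kernel (\<nu> * real k + \<delta>) s) (at s within S)"
      by (auto simp: add.assoc intro: has_field_derivative_at_within)
  qed
  then show ?thesis by (simp add: ml_series_def[abs_def])
qed

end

text \<open>The field is left general: a real \<open>a\<close> is the rate of a relaxation function,
  a complex one is needed when the series is compared with the Mittag-Leffler formula near a double
  root.\<close>

fun telegraph_coeff :: "real \<Rightarrow> 'a::real_normed_field \<Rightarrow> nat \<Rightarrow> 'a" where
  "telegraph_coeff l a 0 = 1"
| "telegraph_coeff l a (Suc 0) = - 2 * of_real l"
| "telegraph_coeff l a (Suc (Suc k)) = - 2 * of_real l * telegraph_coeff l a (Suc k) - a * telegraph_coeff l a k"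

lemma telegraph_coeff_of_real:
  "telegraph_coeff l (of_real a) k = of_real (telegraph_coeff l a k)"
  by (induction k rule: induct_nat_012) auto

lemma telegraph_coeff_bound:
  assumes "norm a \<le> A"
  shows "norm (telegraph_coeff l a k) \<le> (2 * \<bar>l\<bar> + A + 1) ^ k"
proof (induction k rule: induct_nat_012)
  case (ge2 k)
  \<comment> \<open>The added 1 gives \<open>1 \<le> R\<close>, so the older term can be raised from
    \<open>R ^ k\<close> to \<open>R ^ Suc k\<close>; then
    \<open>2 * \<bar>l\<bar> + A \<le> R\<close> closes the induction.\<close>
  define R where "R = 2 * \<bar>l\<bar> + A + 1"
  have A: "0 \<le> A" using assms norm_ge_zero order_trans by blast
  then have R: "1 \<le> R" by (simp add: R_def)
  have "norm (telegraph_coeff l a (Suc (Suc k))) \<le> 2 * \<bar>l\<bar> * norm (telegraph_coeff l a (Suc k)) + norm a * norm (telegraph_coeff l a k)"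
    using norm_triangle_ineq4[of "- 2 * of_real l * telegraph_coeff l a (Suc k)" "a * telegraph_coeff l a k"]
    by (simp add: norm_mult)
  also have "\<dots> \<le> 2 * \<bar>l\<bar> * R ^ Suc k + A * R ^ Suc k"
    using ge2 assms A R by (intro add_mono mult_mono order_trans[OF ge2(1)[folded R_def] power_increasing[of k "Suc k" R]])
      (auto simp: R_def)
  also have "\<dots> \<le> R * R ^ Suc k"
    using R by (simp add: distrib_right[symmetric]) (simp add: R_def)
  finally show ?case by (simp add: R_def)
qed (use order_trans[OF norm_ge_zero assms] in \<open>auto simp: norm_mult\<close>)

lemma continuous_on_telegraph_coeff: "continuous_on UNIV (\<lambda>a. telegraph_coeff l a k)"
  by (induction k rule: induct_nat_012) (auto intro!: continuous_intros)

lemma telegraph_coeff_measurable [measurable]: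
  "(\<lambda>a::real. telegraph_coeff l a k) \<in> borel_measurable borel"
  using continuous_on_telegraph_coeff by (rule borel_measurable_continuous_onI)

text \<open>The coefficients are those of \<open>1 / (1 + 2 l z + a z\<^sup>2)\<close>.\<close>

lemma telegraph_coeff_sum:
  fixes q :: "nat \<Rightarrow> 'a::{real_normed_field, banach}"
  assumes "summable (\<lambda>k. telegraph_coeff l a k * q k)"
    "summable (\<lambda>k. telegraph_coeff l a k * q (Suc k))"
    "summable (\<lambda>k. telegraph_coeff l a k * q (Suc (Suc k)))"
  shows "(\<Sum>k. telegraph_coeff l a k * q k) + 2 * of_real l * (\<Sum>k. telegraph_coeff l a k * q (Suc k))
    + a * (\<Sum>k. telegraph_coeff l a k * q (Suc (Suc k))) = q 0"
proof -
  let ?e = "telegraph_coeff l a"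
  have 2: "summable (\<lambda>k. ?e (Suc k) * q (Suc k))" "summable (\<lambda>k. ?e (Suc (Suc k)) * q (Suc (Suc k)))"
    "summable (\<lambda>k. ?e (Suc k) * q (Suc (Suc k)))"
    using assms by (simp_all add: summable_Suc_iff[of "\<lambda>k. ?e k * q k"] summable_Suc_iff[of "\<lambda>k. ?e (Suc k) * q (Suc k)"]
        summable_Suc_iff[of "\<lambda>k. ?e k * q (Suc k)"] del: telegraph_coeff.simps)
  have s0: "(\<Sum>k. ?e k * q k) = q 0 - 2 * of_real l * q 1 + (\<Sum>k. ?e (Suc (Suc k)) * q (Suc (Suc k)))"
    using suminf_split_head[OF assms(1)] suminf_split_head[OF 2(1)] by simp
  have s1: "(\<Sum>k. ?e k * q (Suc k)) = q 1 + (\<Sum>k. ?e (Suc k) * q (Suc (Suc k)))"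
    using suminf_split_head[OF assms(2)] by simp
  have "(\<Sum>k. ?e (Suc (Suc k)) * q (Suc (Suc k))) =
      (\<Sum>k. - (2 * of_real l) * (?e (Suc k) * q (Suc (Suc k))) - a * (?e k * q (Suc (Suc k))))"
    by (intro suminf_cong) (simp add: algebra_simps)
  also have "\<dots> = - (2 * of_real l) * (\<Sum>k. ?e (Suc k) * q (Suc (Suc k))) - a * (\<Sum>k. ?e k * q (Suc (Suc k)))"
    using 2(3) assms(3) by (simp only: suminf_diff[symmetric] suminf_mult summable_mult)
  finally have s2: "(\<Sum>k. ?e (Suc (Suc k)) * q (Suc (Suc k))) = \<dots>" .
  show ?thesis unfolding s0 s1 s2 by (simp add: algebra_simps)
qed

text \<open>For every \<open>\<delta> > 0\<close> this is the function whose Laplace transform is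
  \<open>\<mu> powr (2 * \<nu> - \<delta>) / (a + 2 * l * \<mu> powr \<nu> + \<mu> powr (2 * \<nu>))\<close>.\<close>

definition telegraph_ml :: "real \<Rightarrow> real \<Rightarrow> real \<Rightarrow> real \<Rightarrow> real \<Rightarrow> real" where
  "telegraph_ml \<nu> l a \<delta> = ml_series \<nu> (telegraph_coeff l a) \<delta>"

context
  fixes \<nu> l a :: real
  assumes \<nu>: "0 < \<nu>"
begin

lemma telegraph_coeff_real_bound: "\<bar>telegraph_coeff l a k\<bar> \<le> (2 * \<bar>l\<bar> + \<bar>a\<bar> + 1) ^ k"
  using telegraph_coeff_bound[of a "\<bar>a\<bar>" l k] by simp

lemmas telegraph_ml_conv = ml_series_conv[OF \<nu> telegraph_coeff_real_bound, folded telegraph_ml_def]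
lemmas telegraph_ml_has_derivative = ml_series_has_derivative[OF \<nu> telegraph_coeff_real_bound, folded telegraph_ml_def]

text \<open>Raising \<delta> by \<nu> is a fractional integral of order \<nu>, so this is the
  relaxation equation in integrated form with the kernel as source. It is
  \<open>telegraph_coeff_sum\<close> applied to
  \<open>q k = frac_kernel (\<nu> * real k + \<delta>) t\<close>.\<close>

lemma telegraph_ml_recurrence:
  assumes "0 < \<delta>"
  shows "telegraph_ml \<nu> l a \<delta> t + 2 * l * telegraph_ml \<nu> l a (\<delta> + \<nu>) t + a * telegraph_ml \<nu> l a (\<delta> + 2 * \<nu>) t
    = frac_kernel \<delta> t"
proof -
  note S = ml_series_summable[OF \<nu> telegraph_coeff_real_bound]
  have e: "\<nu> * real k + (\<delta> + \<nu>) = \<nu> * real (Suc k) + \<delta>" "\<nu> * real k + (\<delta> + 2 * \<nu>) = \<nu> * real (Suc (Suc k)) + \<delta>" for k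
    by (simp_all add: algebra_simps)
  show ?thesis
    using telegraph_coeff_sum[of l a "\<lambda>k. frac_kernel (\<nu> * real k + \<delta>) t"]
      S[of \<delta> t] S[of "\<delta> + \<nu>" t] S[of "\<delta> + 2 * \<nu>" t] assms \<nu>
    unfolding telegraph_ml_def ml_series_def e by simp
qed

text \<open>With \<open>z = \<mu> powr (- \<nu>)\<close> the transformed series is
  \<open>\<mu> powr (- \<delta>)\<close> times the generating function
  \<open>1 / (1 + 2 * l * z + a * z^2)\<close>; expanding the fraction by
  \<open>\<mu> powr (2 * \<nu>)\<close> gives the stated quotient.\<close>

lemma telegraph_ml_laplace:
  assumes "0 < \<delta>" "0 < \<mu>" "2 * \<bar>l\<bar> + \<bar>a\<bar> + 1 < \<mu> powr \<nu>"
  shows "has_bochner_integral lborel (\<lambda>t. exp (- \<mu> * t) * telegraph_ml \<nu> l a \<delta> t)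
    (\<mu> powr (2 * \<nu> - \<delta>) / (a + (\<mu> powr (2 * \<nu>) + 2 * l * \<mu> powr \<nu>)))"
proof -
  define z where "z = \<mu> powr (- \<nu>)"
  define X where "X = (\<Sum>k. telegraph_coeff l a k * z ^ k)"
  have z: "0 < z" "(2 * \<bar>l\<bar> + \<bar>a\<bar> + 1) * z < 1"
    using assms by (simp_all add: z_def powr_minus field_simps)
  have bs: "summable (\<lambda>k. telegraph_coeff l a k * z ^ k)"
  proof (rule summable_comparison_test')
    show "summable (\<lambda>k. ((2 * \<bar>l\<bar> + \<bar>a\<bar> + 1) * z) ^ k)"
      using z by (intro summable_geometric) auto
    show "norm (telegraph_coeff l a k * z ^ k) \<le> ((2 * \<bar>l\<bar> + \<bar>a\<bar> + 1) * z) ^ k" for k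
      using mult_right_mono[OF telegraph_coeff_real_bound[of k], of "z ^ k"] z(1) by (simp add: power_mult_distrib abs_mult)
  qed
  have "summable (\<lambda>k. z * (telegraph_coeff l a k * z ^ k))" "summable (\<lambda>k. z^2 * (telegraph_coeff l a k * z ^ k))"
    by (auto intro!: summable_mult bs)
  then have "X + 2 * l * (\<Sum>k. z * (telegraph_coeff l a k * z ^ k)) + a * (\<Sum>k. z^2 * (telegraph_coeff l a k * z ^ k)) = 1"
    using telegraph_coeff_sum[of l a "\<lambda>k. z ^ k"] bs by (simp add: X_def mult_ac power2_eq_square)
  moreover have "(\<Sum>k. z * (telegraph_coeff l a k * z ^ k)) = z * X" "(\<Sum>k. z^2 * (telegraph_coeff l a k * z ^ k)) = z^2 * X"
    unfolding X_def by (rule suminf_mult[OF bs])+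
  ultimately have X: "X * (1 + 2 * l * z + a * z^2) = 1"
    by (simp add: algebra_simps)
  have zz: "z^2 * \<mu> powr (2 * \<nu>) = 1" "z^2 * \<mu> powr \<nu> = z"
  proof -
    define m where "m = \<mu> powr \<nu>"
    have "\<mu> powr (2 * \<nu>) = m^2"
      unfolding m_def power2_eq_square mult_2 by (rule powr_add)
    moreover have "z = 1 / m" unfolding m_def z_def by (rule powr_minus_divide)
    moreover have "m \<noteq> 0" using assms(2) by (simp add: m_def)
    ultimately show "z^2 * \<mu> powr (2 * \<nu>) = 1" "z^2 * \<mu> powr \<nu> = z"
      by (simp_all add: power_divide power2_eq_square flip: m_def)
  qed
  have p: "\<mu> powr (2 * \<nu> - \<delta>) = \<mu> powr (- \<delta>) * \<mu> powr (2 * \<nu>)"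
    using assms by (simp flip: powr_add add: add.commute)
  define Q where "Q = a + (\<mu> powr (2 * \<nu>) + 2 * l * \<mu> powr \<nu>)"
  have Q: "1 + 2 * l * z + a * z^2 = z^2 * Q"
    using zz by (simp add: Q_def algebra_simps)
  then have "Q \<noteq> 0" using X by auto
  have "z^2 * (X * Q) = z^2 * \<mu> powr (2 * \<nu>)"
    using X zz(1) unfolding Q by (simp only: mult.left_commute)
  then have "X = \<mu> powr (2 * \<nu>) / Q" using z(1) \<open>Q \<noteq> 0\<close> by (simp add: eq_divide_eq)
  then have "\<mu> powr (- \<delta>) * X = \<mu> powr (2 * \<nu> - \<delta>) / Q" by (simp add: p)
  then show ?thesis
    using ml_series_laplace[OF \<nu> telegraph_coeff_real_bound assms]
    by (simp only: telegraph_ml_def X_def z_def Q_def)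
qed

end

section \<open>Uniqueness for Laplace and Fourier transforms\<close>

text \<open>In the variable \<open>x = exp (- t)\<close> the hypothesis says that all moments on the
  unit interval vanish. Polynomials in \<open>x\<close> therefore integrate to 0, and Weierstrass
  approximation extends this to continuous \<open>q\<close>.\<close>

lemma laplace_zero_imp_continuous_zero:
  fixes k :: "real \<Rightarrow> real" and q :: "real \<Rightarrow> real"
  assumes k: "integrable lborel k" and supp: "\<And>t. t \<le> 0 \<Longrightarrow> k t = 0"
    and zero: "\<And>n::nat. (\<integral>t. exp (- (real n * t)) * k t \<partial>lborel) = 0"
    and q: "continuous_on UNIV q"
  shows "(\<integral>t. q (exp (- t)) * k t \<partial>lborel) = 0"
proof -
  have km[measurable]: "k \<in> borel_measurable borel" using k by auto
  have qm[measurable]: "q \<in> borel_measurable borel" using q by (rule borel_measurable_continuous_onI)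
  have bnd: "integrable lborel (\<lambda>t. h (exp (- t)) * k t)"
    if h: "continuous_on UNIV h" for h :: "real \<Rightarrow> real"
  proof -
    have hm[measurable]: "h \<in> borel_measurable borel" using h by (rule borel_measurable_continuous_onI)
    have "bounded (h ` {0..1})"
      using h by (intro compact_imp_bounded compact_continuous_image) (auto intro: continuous_on_subset)
    then obtain B where B: "\<And>x. x \<in> {0..1} \<Longrightarrow> \<bar>h x\<bar> \<le> B"
      unfolding bounded_iff real_norm_def by blast
    show ?thesis
    proof (rule Bochner_Integration.integrable_bound)
      show "integrable lborel (\<lambda>t. B * k t)" using k by auto
      show "AE t in lborel. norm (h (exp (- t)) * k t) \<le> norm (B * k t)"
      proof (rule AE_I2)
        fix t :: real
        show "norm (h (exp (- t)) * k t) \<le> norm (B * k t)"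
        proof (cases "t \<le> 0")
          case False
          then have "\<bar>h (exp (- t))\<bar> \<le> \<bar>B\<bar>" by (intro order_trans[OF B]) auto
          then show ?thesis by (auto simp: abs_mult intro: mult_right_mono)
        qed (simp add: supp)
      qed
    qed auto
  qed
  define N where "N = (\<integral>t. norm (k t) \<partial>lborel)"
  have N: "0 \<le> N" by (simp add: N_def)
  have "\<bar>\<integral>t. q (exp (- t)) * k t \<partial>lborel\<bar> \<le> 0 + e" if "0 < e" for e
  proof -
    define d where "d = e / (N + 1)"
    have d: "0 < d" using that N by (simp add: d_def)
    obtain p where p: "real_polynomial_function p" "\<And>x. x \<in> {0..1} \<Longrightarrow> \<bar>q x - p x\<bar> < d"
      using Stone_Weierstrass_real_polynomial_function[of "{0..1}" q d] q d
      by (auto intro: continuous_on_subset)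
    obtain c m where pc: "p = (\<lambda>x. \<Sum>i\<le>m. c i * x ^ i)"
      using p(1) real_polynomial_function_iff_sum by auto
    have pcont: "continuous_on UNIV p"
      unfolding pc by (intro continuous_intros)
    have "(\<integral>t. p (exp (- t)) * k t \<partial>lborel) = (\<integral>t. (\<Sum>i\<le>m. c i * (exp (- (real i * t)) * k t)) \<partial>lborel)"
      by (simp add: pc sum_distrib_right mult.assoc flip: exp_of_nat_mult)
    also have "\<dots> = (\<Sum>i\<le>m. \<integral>t. c i * (exp (- (real i * t)) * k t) \<partial>lborel)"
    proof (rule Bochner_Integration.integral_sum)
      fix i
      have "integrable lborel (\<lambda>t. (exp (- t)) ^ i * k t)"
        by (rule bnd[of "\<lambda>x. x ^ i"]) (intro continuous_intros)
      then show "integrable lborel (\<lambda>t. c i * (exp (- (real i * t)) * k t))"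
        by (simp flip: exp_of_nat_mult)
    qed
    also have "\<dots> = 0" by (simp add: zero)
    finally have "(\<integral>t. q (exp (- t)) * k t \<partial>lborel) = (\<integral>t. q (exp (- t)) * k t - p (exp (- t)) * k t \<partial>lborel)"
      using bnd[OF q] bnd[OF pcont] by simp
    also have "\<bar>\<dots>\<bar> \<le> (\<integral>t. norm (q (exp (- t)) * k t - p (exp (- t)) * k t) \<partial>lborel)"
      using integral_norm_bound[of lborel "\<lambda>t. q (exp (- t)) * k t - p (exp (- t)) * k t"] by simp
    also have "\<dots> \<le> (\<integral>t. d * norm (k t) \<partial>lborel)"
    proof (rule integral_mono)
      show "integrable lborel (\<lambda>t. norm (q (exp (- t)) * k t - p (exp (- t)) * k t))"
        by (intro integrable_norm Bochner_Integration.integrable_diff bnd q pcont)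
      show "integrable lborel (\<lambda>t. d * norm (k t))" using k by auto
      fix t :: real
      show "norm (q (exp (- t)) * k t - p (exp (- t)) * k t) \<le> d * norm (k t)"
      proof (cases "t \<le> 0")
        case False
        then have "\<bar>q (exp (- t)) - p (exp (- t))\<bar> \<le> d" by (intro less_imp_le p(2)) auto
        then show ?thesis by (auto simp: abs_mult left_diff_distrib[symmetric] intro: mult_right_mono)
      qed (simp add: supp)
    qed
    also have "\<dots> = d * N" by (simp add: N_def)
    also have "\<dots> \<le> e" using N that by (simp add: d_def field_simps)
    finally show ?thesis by simp
  qed
  then have "\<bar>\<integral>t. q (exp (- t)) * k t \<partial>lborel\<bar> \<le> 0" by (rule field_le_epsilon)
  then show ?thesis by simp
qed

lemma laplace_zero_imp_integral_zero:
  fixes k :: "real \<Rightarrow> real"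
  assumes k: "integrable lborel k" and supp: "\<And>t. t \<le> 0 \<Longrightarrow> k t = 0"
    and zero: "\<And>n::nat. (\<integral>t. exp (- (real n * t)) * k t \<partial>lborel) = 0"
  shows "(LINT t:{S<..<T}|lborel. k t) = 0"
proof -
  have km[measurable]: "k \<in> borel_measurable borel" using k by auto
  \<comment> \<open>Trapezoids converging to the indicator of the interval from
    \<open>exp (- T)\<close> to \<open>exp (- S)\<close>, which is where \<open>exp (- t)\<close>
    lies for \<open>t\<close> between \<open>S\<close> and \<open>T\<close>.\<close>
  define q where "q n x = max 0 (min 1 (real n * min (x - exp (- T)) (exp (- S) - x)))" for n x
  have "(\<lambda>n. \<integral>t. q n (exp (- t)) * k t \<partial>lborel) \<longlonglongrightarrow> (\<integral>t. indicator {S<..<T} t * k t \<partial>lborel)"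
  proof (rule integral_dominated_convergence)
    show "integrable lborel (\<lambda>t. norm (k t))" using k by auto
    show "(\<lambda>t. q n (exp (- t)) * k t) \<in> borel_measurable lborel" for n
      unfolding q_def by measurable
    show "AE t in lborel. norm (q n (exp (- t)) * k t) \<le> norm (k t)" for n
      by (auto simp: q_def abs_mult intro!: mult_left_le_one_le)
    show "AE t in lborel. (\<lambda>n. q n (exp (- t)) * k t) \<longlonglongrightarrow> indicator {S<..<T} t * k t"
    proof (rule AE_I2)
      fix t :: real
      have "(\<lambda>n. q n (exp (- t))) \<longlonglongrightarrow> indicator {S<..<T} t"
      proof (cases "S < t \<and> t < T")
        case True
        define m where "m = min (exp (- t) - exp (- T)) (exp (- S) - exp (- t))"
        have m: "0 < m" using True by (simp add: m_def)
        have "filterlim (\<lambda>n. real n * m) at_top sequentially"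
          using filterlim_tendsto_pos_mult_at_top[OF tendsto_const[of m] m filterlim_real_sequentially]
          by (simp add: mult.commute)
        then have "\<forall>\<^sub>F n in sequentially. 1 \<le> real n * m" by (auto simp: filterlim_at_top)
        then have "\<forall>\<^sub>F n in sequentially. q n (exp (- t)) = 1"
          by eventually_elim (simp add: q_def flip: m_def)
        then show ?thesis using True by (auto intro: tendsto_eventually)
      next
        case False
        then have "min (exp (- t) - exp (- T)) (exp (- S) - exp (- t)) \<le> 0"
          by (auto simp: min_le_iff_disj)
        then have "real n * min (exp (- t) - exp (- T)) (exp (- S) - exp (- t)) \<le> 0" for n
          by (intro mult_nonneg_nonpos) auto
        then have "q n (exp (- t)) = 0" for n
          by (simp add: q_def max.absorb1 min.coboundedI2)
        then show ?thesis using False by simp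
      qed
      then show "(\<lambda>n. q n (exp (- t)) * k t) \<longlonglongrightarrow> indicator {S<..<T} t * k t"
        by (rule tendsto_mult_right)
    qed
  qed auto
  moreover have "(\<integral>t. q n (exp (- t)) * k t \<partial>lborel) = 0" for n
    by (intro laplace_zero_imp_continuous_zero[OF assms]) (auto simp: q_def intro!: continuous_intros)
  ultimately show ?thesis
    by (simp add: set_lebesgue_integral_def LIMSEQ_const_iff)
qed

text \<open>Equal transforms alone give equality almost everywhere. Here a gap at \<open>t\<close>
  persists on an interval: to the left of \<open>t\<close> if \<open>g\<close> exceeds
  \<open>G\<close>, to the right if it falls short, since \<open>g\<close> is decreasing and
  \<open>G\<close> continuous. The integral over such an interval cannot vanish.\<close>

lemma laplace_unique_antimono_continuous:
  fixes g G :: "real \<Rightarrow> real"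
  assumes mono: "\<And>s t. 0 < s \<Longrightarrow> s \<le> t \<Longrightarrow> g t \<le> g s"
    and cont: "\<And>t. 0 < t \<Longrightarrow> isCont G t"
    and int: "\<And>\<mu>. \<mu>0 \<le> \<mu> \<Longrightarrow> set_integrable lborel {0<..} (\<lambda>t. exp (- \<mu> * t) * g t)"
      "\<And>\<mu>. \<mu>0 \<le> \<mu> \<Longrightarrow> set_integrable lborel {0<..} (\<lambda>t. exp (- \<mu> * t) * G t)"
    and eq: "\<And>\<mu>. \<mu>0 \<le> \<mu> \<Longrightarrow>
      (LINT t:{0<..}|lborel. exp (- \<mu> * t) * g t) = (LINT t:{0<..}|lborel. exp (- \<mu> * t) * G t)"
    and "0 < t"
  shows "g t = G t"
proof -
  \<comment> \<open>The exponential weight moves the threshold to 0: the transform of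
    \<open>k\<close> at the integer \<open>n\<close> is the difference of the two transforms at
    \<open>\<mu>0 + n\<close>.\<close>
  define k where "k t = indicator {0<..} t * (exp (- \<mu>0 * t) * (g t - G t))" for t
  have kd: "exp (- (r * t)) * k t = indicator {0<..} t *\<^sub>R (exp (- (\<mu>0 + r) * t) * g t) - indicator {0<..} t *\<^sub>R (exp (- (\<mu>0 + r) * t) * G t)" for r t
  proof -
    have "exp (- (\<mu>0 + r) * t) = exp (- (r * t)) * exp (- \<mu>0 * t)"
      by (simp add: algebra_simps flip: exp_add)
    then show ?thesis by (simp add: k_def algebra_simps)
  qed
  have kn: "(\<integral>t. exp (- (real n * t)) * k t \<partial>lborel) = 0" for n
    using int[of "\<mu>0 + real n"] eq[of "\<mu>0 + real n"]
    unfolding kd by (subst Bochner_Integration.integral_diff) (auto simp: set_integrable_def set_lebesgue_integral_def)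
  have "integrable lborel (\<lambda>t. exp (- (0 * t)) * k t)"
    unfolding kd using int[of \<mu>0] by (intro Bochner_Integration.integrable_diff) (simp_all add: set_integrable_def)
  then have k: "integrable lborel k"
    by simp
  have zero: "(LINT t:{S<..<T}|lborel. k t) = 0" for S T
    by (rule laplace_zero_imp_integral_zero[OF k _ kn]) (simp add: k_def)
  \<comment> \<open>The factor \<open>s\<close> will be 1 or -1, so that one contradiction serves
    for gaps of either sign.\<close>
  have False if "S < T" and ge: "0 < c" "\<And>u. S < u \<Longrightarrow> u < T \<Longrightarrow> c \<le> s * k u" for S T c s
  proof -
    have "c * (T - S) = (LINT u:{S<..<T}|lborel. c)"
      using \<open>S < T\<close> by (simp add: set_lebesgue_integral_def)
    also have "\<dots> \<le> (LINT u:{S<..<T}|lborel. s * k u)"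
    proof (rule set_integral_mono)
      have "integrable lborel (indicat_real {S<..<T})"
        using \<open>S < T\<close> by (intro integrable_real_indicator) auto
      then show "set_integrable lborel {S<..<T} (\<lambda>u. c)"
        unfolding set_integrable_def by simp
      show "set_integrable lborel {S<..<T} (\<lambda>u. s * k u)"
        unfolding set_integrable_def using k by (intro integrable_mult_indicator) auto
    qed (use ge in auto)
    also have "\<dots> = 0" by (simp add: zero)
    finally show False using \<open>S < T\<close> \<open>0 < c\<close> by (simp add: mult_le_0_iff)
  qed note no_gap = this
  have close: "\<exists>d>0. \<forall>u. \<bar>u - t\<bar> < d \<longrightarrow> 0 < u \<and> \<bar>G u - G t\<bar> < e" if "0 < e" for e
  proof -
    have "\<forall>\<^sub>F u in at t. dist (G u) (G t) < e"
      using cont[OF \<open>0 < t\<close>] that unfolding isCont_def by (rule tendstoD)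
    then obtain d where d: "0 < d" "\<forall>u. u \<noteq> t \<and> dist u t < d \<longrightarrow> dist (G u) (G t) < e"
      unfolding eventually_at by auto
    have "0 < u \<and> \<bar>G u - G t\<bar> < e" if u: "\<bar>u - t\<bar> < min d t" for u
    proof
      show "0 < u" using u by (auto simp: abs_less_iff)
      show "\<bar>G u - G t\<bar> < e"
        using d(2)[rule_format, of u] u \<open>0 < e\<close> by (cases "u = t") (auto simp: dist_real_def)
    qed
    then show ?thesis using \<open>0 < t\<close> d(1) by (intro exI[of _ "min d t"]) auto
  qed
  \<comment> \<open>A lower bound of the weight in \<open>k\<close> between 0 and
    \<open>2 * t\<close>, where both intervals used below lie. The absolute value covers either sign
    of \<open>\<mu>0\<close>.\<close>
  define m where "m = exp (- \<bar>\<mu>0\<bar> * (2 * t))"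
  have expm: "m \<le> exp (- \<mu>0 * u)" if "0 < u" "u < 2 * t" for u
  proof -
    have "\<mu>0 * u \<le> \<bar>\<mu>0\<bar> * (2 * t)" using that by (intro mult_mono) auto
    then show ?thesis by (simp add: m_def)
  qed
  have "0 < m" by (simp add: m_def)
  consider "g t = G t" | "G t < g t" | "g t < G t" by linarith
  then show ?thesis
  proof cases
    case 2
    define e where "e = (g t - G t) / 2"
    have e: "0 < e" using 2 by (simp add: e_def)
    obtain d where d: "0 < d" "\<And>u. \<bar>u - t\<bar> < d \<Longrightarrow> 0 < u \<and> \<bar>G u - G t\<bar> < e" using close[OF e] by blast
    have False
    proof (rule no_gap[of "t - d" t "m * e" 1])
      fix u assume u: "t - d < u" "u < t"
      then have "0 < u" "G u - G t < e" using d(2)[of u] by (auto simp: abs_less_iff)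
      moreover have "g t \<le> g u" using mono \<open>0 < u\<close> u by auto
      ultimately have "e \<le> g u - G u" unfolding e_def by (simp add: field_simps)
      then have "m * e \<le> exp (- \<mu>0 * u) * (g u - G u)"
        using u \<open>0 < u\<close> \<open>0 < t\<close> e \<open>0 < m\<close> by (intro mult_mono expm) auto
      then show "m * e \<le> 1 * k u" using \<open>0 < u\<close> by (simp add: k_def)
    qed (use d e \<open>0 < m\<close> in auto)
    then show ?thesis ..
  next
    case 3
    define e where "e = (G t - g t) / 2"
    have e: "0 < e" using 3 by (simp add: e_def)
    obtain d where d: "0 < d" "\<And>u. \<bar>u - t\<bar> < d \<Longrightarrow> 0 < u \<and> \<bar>G u - G t\<bar> < e" using close[OF e] by blast
    have False
    proof (rule no_gap[of t "t + min d t" "m * e" "- 1"])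
      fix u assume u: "t < u" "u < t + min d t"
      then have "0 < u" "G t - G u < e" using d(2)[of u] \<open>0 < t\<close> by (auto simp: abs_less_iff)
      moreover have "g u \<le> g t" using mono \<open>0 < t\<close> u by auto
      ultimately have "e \<le> G u - g u" unfolding e_def by (simp add: field_simps)
      then have "m * e \<le> exp (- \<mu>0 * u) * (G u - g u)"
        using u \<open>0 < u\<close> \<open>0 < t\<close> e \<open>0 < m\<close> by (intro mult_mono expm) auto
      then show "m * e \<le> - 1 * k u" using \<open>0 < u\<close> by (simp add: k_def algebra_simps)
    qed (use d e \<open>0 < m\<close> \<open>0 < t\<close> in auto)
    then show ?thesis ..
  qed
qed

section \<open>Lebesgue measure on a Euclidean space: products over the basis and affine
  substitutions\<close>

lemma
  fixes f :: "'a::euclidean_space \<Rightarrow> real \<Rightarrow> 'b::{real_normed_field, banach, second_countable_topology}"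
  assumes f: "\<And>b. b \<in> Basis \<Longrightarrow> integrable lborel (f b)"
  shows integrable_lborel_prod_Basis: "integrable lborel (\<lambda>x. \<Prod>b\<in>Basis. f b (x \<bullet> b))"
    and integral_lborel_prod_Basis: "(\<integral>x. (\<Prod>b\<in>Basis. f b (x \<bullet> b)) \<partial>lborel) = (\<Prod>b\<in>Basis. \<integral>x. f b x \<partial>lborel)"
proof -
  interpret product_sigma_finite "\<lambda>b::'a. lborel :: real measure"
    by standard
  have L: "(lborel :: 'a measure) = distr (\<Pi>\<^sub>M b\<in>Basis. lborel) borel (\<lambda>f. \<Sum>b\<in>Basis. f b *\<^sub>R b)"
    by (subst lborel_def) (simp add: lborel_eq_real)
  have T: "(\<lambda>f. \<Sum>b\<in>Basis. f b *\<^sub>R (b::'a)) \<in> (\<Pi>\<^sub>M b\<in>Basis. lborel) \<rightarrow>\<^sub>M borel"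
    by measurable
  have [measurable]: "\<And>b. b \<in> Basis \<Longrightarrow> f b \<in> borel_measurable borel" using f by auto
  have m: "(\<lambda>x. \<Prod>b\<in>Basis. f b (x \<bullet> b)) \<in> borel_measurable borel" by measurable
  have e: "(\<Prod>b\<in>Basis. f b ((\<Sum>b\<in>Basis. x b *\<^sub>R b) \<bullet> b)) = (\<Prod>b\<in>Basis. f b (x b))" for x :: "'a \<Rightarrow> real"
    by (intro prod.cong) (simp_all add: inner_sum_left_Basis)
  show "integrable lborel (\<lambda>x. \<Prod>b\<in>Basis. f b (x \<bullet> b))"
    unfolding L integrable_distr_eq[OF T m] e by (rule product_integrable_prod) (use f in auto)
  show "(\<integral>x. (\<Prod>b\<in>Basis. f b (x \<bullet> b)) \<partial>lborel) = (\<Prod>b\<in>Basis. \<integral>x. f b x \<partial>lborel)"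
    by (subst L) (unfold integral_distr[OF T m] e, rule product_integral_prod, use f in auto)
qed

lemma lborel_integrable_affine_iff:
  fixes f :: "'a::euclidean_space \<Rightarrow> 'b::{banach, second_countable_topology}"
  assumes [measurable]: "f \<in> borel_measurable borel" and c: "c \<noteq> 0"
  shows "integrable lborel (\<lambda>x. f (t + c *\<^sub>R x)) \<longleftrightarrow> integrable lborel f"
proof -
  have "integrable lborel f \<longleftrightarrow> integrable (density (distr lborel borel (\<lambda>x. t + c *\<^sub>R x)) (\<lambda>_. ennreal (\<bar>c\<bar>^DIM('a)))) f"
    by (subst lborel_affine[OF c, of t]) simp
  also have "\<dots> \<longleftrightarrow> integrable (distr lborel borel (\<lambda>x. t + c *\<^sub>R x)) (\<lambda>x. (\<bar>c\<bar>^DIM('a)) *\<^sub>R f x)"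
    by (rule integrable_density) auto
  also have "\<dots> \<longleftrightarrow> integrable lborel (\<lambda>x. (\<bar>c\<bar>^DIM('a)) *\<^sub>R f (t + c *\<^sub>R x))"
    by (rule integrable_distr_eq) auto
  also have "\<dots> \<longleftrightarrow> integrable lborel (\<lambda>x. f (t + c *\<^sub>R x))"
    using c integrable_scaleR_right[of "inverse (\<bar>c\<bar>^DIM('a))" lborel "\<lambda>x. (\<bar>c\<bar>^DIM('a)) *\<^sub>R f (t + c *\<^sub>R x)"]
    by (auto simp del: power_inverse)
  finally show ?thesis ..
qed

lemma lborel_integral_affine:
  fixes f :: "'a::euclidean_space \<Rightarrow> 'b::{banach, second_countable_topology}"
  assumes [measurable]: "f \<in> borel_measurable borel" and c: "c \<noteq> 0"
  shows "(\<integral>x. f x \<partial>lborel) = (\<bar>c\<bar>^DIM('a)) *\<^sub>R (\<integral>x. f (t + c *\<^sub>R x) \<partial>lborel)"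
proof -
  have "(\<integral>x. f x \<partial>lborel) = (\<integral>x. f x \<partial>density (distr lborel borel (\<lambda>x. t + c *\<^sub>R x)) (\<lambda>_. ennreal (\<bar>c\<bar>^DIM('a))))"
    by (subst lborel_affine[OF c, of t]) simp
  also have "\<dots> = (\<integral>x. (\<bar>c\<bar>^DIM('a)) *\<^sub>R f x \<partial>distr lborel borel (\<lambda>x. t + c *\<^sub>R x))"
    by (rule integral_density) auto
  also have "\<dots> = (\<integral>x. (\<bar>c\<bar>^DIM('a)) *\<^sub>R f (t + c *\<^sub>R x) \<partial>lborel)"
    by (rule integral_distr) auto
  finally show ?thesis by simp
qed

lemma lborel_nn_integral_affine:
  fixes f :: "'a::euclidean_space \<Rightarrow> ennreal"
  assumes [measurable]: "f \<in> borel_measurable borel" and c: "c \<noteq> 0"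
  shows "(\<integral>\<^sup>+x. f x \<partial>lborel) = ennreal (\<bar>c\<bar>^DIM('a)) * (\<integral>\<^sup>+x. f (t + c *\<^sub>R x) \<partial>lborel)"
proof -
  have "(\<integral>\<^sup>+x. f x \<partial>lborel) = (\<integral>\<^sup>+x. f x \<partial>density (distr lborel borel (\<lambda>x. t + c *\<^sub>R x)) (\<lambda>_. ennreal (\<bar>c\<bar>^DIM('a))))"
    by (subst lborel_affine[OF c, of t]) simp
  also have "\<dots> = (\<integral>\<^sup>+x. ennreal (\<bar>c\<bar>^DIM('a)) * f x \<partial>distr lborel borel (\<lambda>x. t + c *\<^sub>R x))"
    by (rule nn_integral_density) auto
  also have "\<dots> = (\<integral>\<^sup>+x. ennreal (\<bar>c\<bar>^DIM('a)) * f (t + c *\<^sub>R x) \<partial>lborel)"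
    by (rule nn_integral_distr) auto
  finally show ?thesis by (simp add: nn_integral_cmult)
qed

section \<open>Gaussian densities, their Fourier transforms and Gaussian smoothing\<close>

definition gauss :: "'a::euclidean_space \<Rightarrow> real" where
  "gauss x = exp (- (norm x)\<^sup>2 / 2) / sqrt (2 * pi) ^ DIM('a)"

lemma gauss_prod: "gauss x = (\<Prod>b\<in>Basis. std_normal_density (x \<bullet> b))" for x :: "'a::euclidean_space"
proof -
  have "(norm x)\<^sup>2 = (\<Sum>b\<in>Basis. (x \<bullet> b)\<^sup>2)"
    by (subst power2_norm_eq_inner, subst euclidean_inner) (simp add: power2_eq_square)
  then have "exp (- (norm x)\<^sup>2 / 2) = (\<Prod>b\<in>Basis. exp (- (x \<bullet> b)\<^sup>2 / 2))"
    by (simp add: exp_sum[symmetric] sum_negf sum_divide_distrib)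
  then show ?thesis
    by (simp add: gauss_def std_normal_density_def prod_dividef)
qed

lemma gauss_pos: "0 < gauss x"
  by (simp add: gauss_def)

lemma gauss_nonneg: "0 \<le> gauss x"
  using gauss_pos less_imp_le by blast

lemma continuous_on_gauss: "continuous_on UNIV gauss"
  unfolding gauss_def[abs_def] by (intro continuous_intros) auto

lemma gauss_measurable [measurable]: "gauss \<in> borel_measurable borel"
  using continuous_on_gauss by (rule borel_measurable_continuous_onI)

lemma gauss_le: "gauss (x::'a::euclidean_space) \<le> 1 / sqrt (2 * pi) ^ DIM('a)"
  by (simp add: gauss_def divide_right_mono)

lemma integrable_gauss: "integrable lborel (gauss :: 'a::euclidean_space \<Rightarrow> real)"
  unfolding gauss_prod[abs_def] by (rule integrable_lborel_prod_Basis) auto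

lemma integral_gauss: "(\<integral>x. gauss (x::'a::euclidean_space) \<partial>lborel) = 1"
  unfolding gauss_prod[abs_def] by (subst integral_lborel_prod_Basis) auto

lemma fourier_gauss_1:
  "integrable lborel (\<lambda>x::real. exp (\<i> * complex_of_real (t * x)) * complex_of_real (std_normal_density x))"
  "(\<integral>x. exp (\<i> * complex_of_real (t * x)) * complex_of_real (std_normal_density x) \<partial>lborel) = complex_of_real (exp (- t\<^sup>2 / 2))"
proof -
  have "integrable lborel (\<lambda>x. complex_of_real (std_normal_density x))" by simp
  then show "integrable lborel (\<lambda>x::real. exp (\<i> * complex_of_real (t * x)) * complex_of_real (std_normal_density x))"
    by (rule Bochner_Integration.integrable_bound) (auto simp: norm_mult)
  have "char std_normal_distribution t = complex_of_real (exp (- t\<^sup>2 / 2))"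
    by (simp add: char_std_normal_distribution)
  then show "(\<integral>x. exp (\<i> * complex_of_real (t * x)) * complex_of_real (std_normal_density x) \<partial>lborel) = complex_of_real (exp (- t\<^sup>2 / 2))"
    unfolding char_def by (subst (asm) integral_density) (auto simp: scaleR_conv_of_real mult.commute)
qed

lemma fourier_gauss:
  "(\<integral>x. exp (\<i> * complex_of_real (\<xi> \<bullet> x)) * complex_of_real (gauss x) \<partial>lborel) = complex_of_real (exp (- (norm \<xi>)\<^sup>2 / 2))"
  for \<xi> :: "'a::euclidean_space"
proof -
  have e: "exp (\<i> * complex_of_real (\<xi> \<bullet> x)) * complex_of_real (gauss x) =
    (\<Prod>b\<in>Basis. exp (\<i> * complex_of_real ((\<xi> \<bullet> b) * (x \<bullet> b))) * complex_of_real (std_normal_density (x \<bullet> b)))" for x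
    by (simp add: gauss_prod prod.distrib exp_sum[symmetric] sum_distrib_left[symmetric] euclidean_inner[of \<xi> x])
  have n: "(norm \<xi>)\<^sup>2 = (\<Sum>b\<in>Basis. (\<xi> \<bullet> b)\<^sup>2)"
    by (subst power2_norm_eq_inner, subst euclidean_inner) (simp add: power2_eq_square)
  have "(\<integral>x. exp (\<i> * complex_of_real (\<xi> \<bullet> x)) * complex_of_real (gauss x) \<partial>lborel) =
    (\<Prod>b\<in>Basis. \<integral>x. exp (\<i> * complex_of_real ((\<xi> \<bullet> b) * x)) * complex_of_real (std_normal_density x) \<partial>lborel)"
    unfolding e by (rule integral_lborel_prod_Basis) (rule fourier_gauss_1)
  also have "\<dots> = (\<Prod>b\<in>Basis. complex_of_real (exp (- (\<xi> \<bullet> b)\<^sup>2 / 2)))"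
    by (simp only: fourier_gauss_1)
  also have "\<dots> = complex_of_real (exp (- (norm \<xi>)\<^sup>2 / 2))"
    unfolding of_real_prod[symmetric] n by (simp add: exp_sum[symmetric] sum_negf sum_divide_distrib)
  finally show ?thesis .
qed

lemma exp_eq_gauss: "exp (- (norm (x::'a::euclidean_space))\<^sup>2 / 2) = sqrt (2 * pi) ^ DIM('a) * gauss x"
  by (simp add: gauss_def)

lemma fourier_gauss_scaled:
  fixes \<xi> :: "'a::euclidean_space"
  assumes "0 < e"
  shows "(\<integral>x. exp (\<i> * complex_of_real (\<xi> \<bullet> x)) * complex_of_real (gauss (e *\<^sub>R x)) \<partial>lborel)
    = complex_of_real (sqrt (2 * pi) ^ DIM('a) * gauss ((1 / e) *\<^sub>R \<xi>) / e ^ DIM('a))"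
proof -
  have "(\<integral>x. exp (\<i> * complex_of_real (\<xi> \<bullet> x)) * complex_of_real (gauss (e *\<^sub>R x)) \<partial>lborel)
    = (\<bar>1/e\<bar>^DIM('a)) *\<^sub>R (\<integral>x. exp (\<i> * complex_of_real (\<xi> \<bullet> (0 + (1/e) *\<^sub>R x))) * complex_of_real (gauss (e *\<^sub>R (0 + (1/e) *\<^sub>R x))) \<partial>lborel)"
    using assms by (intro lborel_integral_affine) auto
  also have "\<dots> = (\<bar>1/e\<bar>^DIM('a)) *\<^sub>R (\<integral>x. exp (\<i> * complex_of_real (((1/e) *\<^sub>R \<xi>) \<bullet> x)) * complex_of_real (gauss x) \<partial>lborel)"
    using assms by simp
  also have "\<dots> = (\<bar>1/e\<bar>^DIM('a)) *\<^sub>R complex_of_real (sqrt (2 * pi) ^ DIM('a) * gauss ((1 / e) *\<^sub>R \<xi>))"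
    by (simp only: fourier_gauss exp_eq_gauss)
  finally show ?thesis using assms by (simp add: scaleR_conv_of_real power_divide)
qed

lemma integrable_gauss_scaled:
  fixes t :: "'a::euclidean_space"
  assumes "e \<noteq> 0"
  shows "integrable lborel (\<lambda>x::'a. gauss (t + e *\<^sub>R x))"
  using assms integrable_gauss by (subst lborel_integrable_affine_iff) auto

text \<open>Measure and weight are both free: the weight 1 gives the characteristic function of a
  finite measure, and \<open>lborel\<close> gives \<open>fourier\<close>. One smoothing identity
  then serves for uniqueness and for inversion.\<close>

definition weighted_fourier :: "'a::euclidean_space measure \<Rightarrow> ('a \<Rightarrow> complex) \<Rightarrow> 'a \<Rightarrow> complex" where
  "weighted_fourier M h \<xi> = (\<integral>x. exp (\<i> * complex_of_real (\<xi> \<bullet> x)) * h x \<partial>M)"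

lemma norm_exp_i_of_real [simp]: "norm (exp (\<i> * complex_of_real t)) = 1"
  by simp

text \<open>The Gaussian factor makes the inversion integral absolutely convergent for any
  integrable weight. Fubini then turns it into a convolution with the transform of that factor,
  which is a narrow Gaussian again.\<close>

lemma gauss_smoothing_fourier:
  fixes M :: "'a::euclidean_space measure"
  assumes "sigma_finite_measure M" and [measurable_cong]: "sets M = sets borel" and h: "integrable M h" and "0 < e"
  shows "(\<integral>\<xi>. exp (- \<i> * complex_of_real (y \<bullet> \<xi>)) * complex_of_real (gauss (e *\<^sub>R \<xi>)) * weighted_fourier M h \<xi> \<partial>lborel)
    = complex_of_real (sqrt (2 * pi) ^ DIM('a) / e ^ DIM('a)) * (\<integral>x. complex_of_real (gauss ((1 / e) *\<^sub>R (x - y))) * h x \<partial>M)"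
proof -
  interpret M: sigma_finite_measure M by fact
  interpret P: pair_sigma_finite lborel M by standard
  have [measurable]: "h \<in> borel_measurable M" using h by auto
  define K where "K \<xi> x = exp (\<i> * complex_of_real ((x - y) \<bullet> \<xi>)) * complex_of_real (gauss (e *\<^sub>R \<xi>)) * h x" for \<xi> x
  have g: "integrable lborel (\<lambda>\<xi>::'a. gauss (e *\<^sub>R \<xi>))"
    using integrable_gauss_scaled[of e 0] \<open>0 < e\<close> by simp
  have Km: "(\<lambda>(\<xi>, x). K \<xi> x) \<in> borel_measurable (lborel \<Otimes>\<^sub>M M)"
    unfolding K_def by measurable
  have nK: "norm (K \<xi> x) = gauss (e *\<^sub>R \<xi>) * norm (h x)" for \<xi> x
    by (simp add: K_def norm_mult gauss_nonneg)
  have int: "integrable (lborel \<Otimes>\<^sub>M M) (\<lambda>(\<xi>, x). K \<xi> x)"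
  proof (rule P.Fubini_integrable[OF Km])
    show "integrable lborel (\<lambda>\<xi>. \<integral>x. norm (case (\<xi>, x) of (\<xi>, x) \<Rightarrow> K \<xi> x) \<partial>M)"
      using g by (simp add: nK)
    have "integrable M (\<lambda>x. K \<xi> x)" for \<xi>
    proof (rule Bochner_Integration.integrable_bound)
      show "integrable M (\<lambda>x. gauss (e *\<^sub>R \<xi>) * norm (h x))" using h by auto
      show "(\<lambda>x. K \<xi> x) \<in> borel_measurable M" unfolding K_def by measurable
      show "AE x in M. norm (K \<xi> x) \<le> norm (gauss (e *\<^sub>R \<xi>) * norm (h x))"
        by (simp add: nK gauss_nonneg)
    qed
    then show "AE \<xi> in lborel. integrable M (\<lambda>x. case (\<xi>, x) of (\<xi>, x) \<Rightarrow> K \<xi> x)" by simp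
  qed
  have 1: "(\<integral>x. K \<xi> x \<partial>M) = exp (- \<i> * complex_of_real (y \<bullet> \<xi>)) * complex_of_real (gauss (e *\<^sub>R \<xi>)) * weighted_fourier M h \<xi>" for \<xi>
  proof -
    have "K \<xi> x = (exp (- \<i> * complex_of_real (y \<bullet> \<xi>)) * complex_of_real (gauss (e *\<^sub>R \<xi>))) * (exp (\<i> * complex_of_real (\<xi> \<bullet> x)) * h x)" for x
      by (simp add: K_def inner_diff_left inner_commute algebra_simps flip: exp_add)
    then show ?thesis unfolding weighted_fourier_def by simp
  qed
  have 2: "(\<integral>\<xi>. K \<xi> x \<partial>lborel) = complex_of_real (sqrt (2 * pi) ^ DIM('a) / e ^ DIM('a)) * (complex_of_real (gauss ((1 / e) *\<^sub>R (x - y))) * h x)" for x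
    unfolding K_def using fourier_gauss_scaled[OF \<open>0 < e\<close>, of "x - y"] by simp
  show ?thesis
    using P.Fubini_integral[OF int] unfolding 1 2 by simp
qed

section \<open>Uniqueness of the Fourier transform and absolute continuity\<close>

lemma open_continuous_approx:
  fixes U :: "'a::metric_space set"
  assumes "open U"
  obtains f :: "nat \<Rightarrow> 'a \<Rightarrow> real" where "\<And>k. continuous_on UNIV (f k)"
    "\<And>k x. 0 \<le> f k x" "\<And>k x. f k x \<le> indicator U x" "\<And>x. (\<lambda>k. f k x) \<longlonglongrightarrow> indicator U x"
proof
  \<comment> \<open>The distance to the empty set is 0 by convention, so the case of an empty
    complement is treated apart to keep \<open>r\<close> positive exactly on
    \<open>U\<close>.\<close>
  define r where "r x = (if U = UNIV then 1 else infdist x (- U))" for x :: 'a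
  have r: "0 \<le> r x" for x by (simp add: r_def infdist_nonneg)
  have rU: "0 < r x \<longleftrightarrow> x \<in> U" for x
    using assms in_closed_iff_infdist_zero[of "- U" x] r[of x]
    by (auto simp: r_def less_le closed_Compl)
  define f where "f k x = min 1 (real k * r x)" for k x
  show "continuous_on UNIV (f k)" for k
    unfolding f_def r_def by (cases "U = UNIV") (auto intro!: continuous_intros)
  show "0 \<le> f k x" for k x using r by (simp add: f_def)
  show "f k x \<le> indicator U x" for k x
    using rU[of x] r[of x] by (auto simp: f_def indicator_def)
  show "(\<lambda>k. f k x) \<longlonglongrightarrow> indicator U x" for x
  proof (cases "x \<in> U")
    case True
    then have "0 < r x" using rU by simp
    then have "filterlim (\<lambda>k. real k * r x) at_top sequentially"
      using filterlim_tendsto_pos_mult_at_top[OF tendsto_const[of "r x"] _ filterlim_real_sequentially]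
      by (simp add: mult.commute)
    then have "\<forall>\<^sub>F k in sequentially. 1 \<le> real k * r x" by (auto simp: filterlim_at_top)
    then have "\<forall>\<^sub>F k in sequentially. f k x = 1"
      by eventually_elim (simp add: f_def)
    then show ?thesis using True by (auto intro: tendsto_eventually)
  next
    case False
    then have "r x = 0" using rU[of x] r[of x] by simp
    then show ?thesis using False by (simp add: f_def)
  qed
qed

lemma inverse_Suc_tendsto_0: "(\<lambda>k. 1 / real (Suc k)) \<longlonglongrightarrow> 0"
  using LIMSEQ_inverse_real_of_nat by (simp add: inverse_eq_divide)

text \<open>For finite \<open>M\<close>, the density of the convolution of \<open>M\<close> with the
  centred normal law of standard deviation \<open>e\<close>.\<close>

definition gauss_smoothing :: "'a::euclidean_space measure \<Rightarrow> real \<Rightarrow> 'a \<Rightarrow> real" where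
  "gauss_smoothing M e y = (\<integral>x. gauss ((1 / e) *\<^sub>R (x - y)) \<partial>M) / e ^ DIM('a)"

lemma gauss_smoothing_nonneg: "0 < e \<Longrightarrow> 0 \<le> gauss_smoothing M e y"
  unfolding gauss_smoothing_def
  by (intro divide_nonneg_nonneg Bochner_Integration.integral_nonneg) (auto simp: gauss_nonneg)

text \<open>The factor \<open>s\<close> is used with the values 1 and -1, because the substitution
  that produces the average carries a minus sign when the smoothed variable is the second one in
  \<open>x - y\<close>.\<close>

lemma gauss_average_tendsto:
  fixes f :: "'a::euclidean_space \<Rightarrow> 'b::{banach, second_countable_topology, real_normed_algebra_1}"
  assumes f: "continuous_on UNIV f" and B: "\<And>x. norm (f x) \<le> B"
  shows "(\<lambda>k. \<integral>z. gauss z *\<^sub>R f (x + ((1 / real (Suc k)) * s) *\<^sub>R z) \<partial>lborel) \<longlonglongrightarrow> f x"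
proof -
  have [measurable]: "f \<in> borel_measurable borel" using f by (rule borel_measurable_continuous_onI)
  have "(\<lambda>k. \<integral>z. gauss z *\<^sub>R f (x + ((1 / real (Suc k)) * s) *\<^sub>R z) \<partial>lborel) \<longlonglongrightarrow> (\<integral>z. gauss z *\<^sub>R f x \<partial>(lborel :: 'a measure))"
  proof (rule integral_dominated_convergence)
    show "integrable lborel (\<lambda>z::'a. gauss z * B)" using integrable_gauss by auto
    show "AE z in lborel. norm (gauss z *\<^sub>R f (x + ((1 / real (Suc k)) * s) *\<^sub>R z)) \<le> gauss z * B" for k
      using B by (simp add: gauss_nonneg mult_left_mono)
    show "AE z in lborel. (\<lambda>k. gauss z *\<^sub>R f (x + ((1 / real (Suc k)) * s) *\<^sub>R z)) \<longlonglongrightarrow> gauss z *\<^sub>R f x"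
    proof (rule AE_I2)
      fix z
      have "(\<lambda>k. x + ((1 / real (Suc k)) * s) *\<^sub>R z) \<longlonglongrightarrow> x + (0 * s) *\<^sub>R z"
        by (intro tendsto_intros inverse_Suc_tendsto_0)
      then have "(\<lambda>k. f (x + ((1 / real (Suc k)) * s) *\<^sub>R z)) \<longlonglongrightarrow> f x"
        using f by (intro isCont_tendsto_compose[of x f]) (auto simp: continuous_on_eq_continuous_at)
      then show "(\<lambda>k. gauss z *\<^sub>R f (x + ((1 / real (Suc k)) * s) *\<^sub>R z)) \<longlonglongrightarrow> gauss z *\<^sub>R f x"
        by (intro tendsto_intros)
    qed
  qed auto
  also have "(\<integral>z. gauss z *\<^sub>R f x \<partial>(lborel :: 'a measure)) = f x"
    using integral_gauss[where 'a='a] integrable_gauss[where 'a='a] by (subst integral_scaleR_left) auto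
  finally show ?thesis .
qed

text \<open>Fubini moves the smoothing from the measure to the function: the left side is the
  integral over \<open>M\<close> of a Gaussian average of \<open>f\<close>, and these averages
  converge to \<open>f\<close> while staying between 0 and 1.\<close>

lemma gauss_smoothing_tendsto:
  fixes M :: "'a::euclidean_space measure" and f :: "'a \<Rightarrow> real"
  assumes "finite_measure M" and [measurable_cong]: "sets M = sets borel"
    and f: "continuous_on UNIV f" and f01: "\<And>x. 0 \<le> f x" "\<And>x. f x \<le> 1"
  shows "(\<lambda>k. \<integral>\<^sup>+y. ennreal (f y * gauss_smoothing M (1 / real (Suc k)) y) \<partial>lborel) \<longlonglongrightarrow> (\<integral>\<^sup>+x. ennreal (f x) \<partial>M)"
proof -
  interpret M: finite_measure M by fact
  interpret P: pair_sigma_finite M lborel by standard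
  have [measurable]: "f \<in> borel_measurable borel" using f by (rule borel_measurable_continuous_onI)
  define J where "J k x = (\<integral>z. gauss z *\<^sub>R f (x + ((1 / real (Suc k)) * - 1) *\<^sub>R z) \<partial>lborel)" for k x
  have intJ: "integrable lborel (\<lambda>z. gauss z *\<^sub>R f (x + ((1 / real (Suc k)) * - 1) *\<^sub>R z))" for k x
    by (rule Bochner_Integration.integrable_bound[OF integrable_gauss])
      (use f01 in \<open>auto simp: gauss_nonneg abs_mult intro!: mult_left_le\<close>)
  have J0: "0 \<le> J k x" for k x
    unfolding J_def using f01 by (intro Bochner_Integration.integral_nonneg) (auto simp: gauss_nonneg)
  have J1: "J k x \<le> 1" for k x
  proof -
    have "J k x \<le> (\<integral>z. gauss (z::'a) \<partial>lborel)"
      unfolding J_def using f01 by (intro integral_mono intJ integrable_gauss) (auto simp: gauss_nonneg intro: mult_left_le)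
    then show ?thesis by (simp add: integral_gauss)
  qed
  have Jlim: "(\<lambda>k. J k x) \<longlonglongrightarrow> f x" for x
    unfolding J_def using gauss_average_tendsto[of f 1 x "- 1"] f f01 by auto
  have Jm[measurable]: "J k \<in> borel_measurable borel" for k
    unfolding J_def by measurable
  have eq: "(\<integral>\<^sup>+y. ennreal (f y * gauss_smoothing M (1 / real (Suc k)) y) \<partial>lborel) = (\<integral>\<^sup>+x. ennreal (J k x) \<partial>M)" for k
  proof -
    define e where "e = 1 / real (Suc k)"
    have e: "0 < e" by (simp add: e_def)
    have gi: "integrable M (\<lambda>x. gauss ((1 / e) *\<^sub>R (x - y)))" for y :: 'a
      by (rule M.integrable_const_bound[of _ "1 / sqrt (2 * pi) ^ DIM('a)"]) (auto simp: gauss_nonneg gauss_le)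
    have "(\<integral>\<^sup>+y. ennreal (f y * gauss_smoothing M e y) \<partial>lborel)
      = (\<integral>\<^sup>+y. (\<integral>\<^sup>+x. ennreal (f y * gauss ((1 / e) *\<^sub>R (x - y)) / e ^ DIM('a)) \<partial>M) \<partial>lborel)"
    proof (intro nn_integral_cong)
      fix y
      have "(\<integral>\<^sup>+x. ennreal (f y * gauss ((1 / e) *\<^sub>R (x - y)) / e ^ DIM('a)) \<partial>M)
        = ennreal (\<integral>x. f y * gauss ((1 / e) *\<^sub>R (x - y)) / e ^ DIM('a) \<partial>M)"
        using gi[of y] f01 e by (intro nn_integral_eq_integral) (auto simp: gauss_nonneg)
      then show "ennreal (f y * gauss_smoothing M e y) = (\<integral>\<^sup>+x. ennreal (f y * gauss ((1 / e) *\<^sub>R (x - y)) / e ^ DIM('a)) \<partial>M)"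
        by (simp add: gauss_smoothing_def)
    qed
    also have "\<dots> = (\<integral>\<^sup>+x. (\<integral>\<^sup>+y. ennreal (f y * gauss ((1 / e) *\<^sub>R (x - y)) / e ^ DIM('a)) \<partial>lborel) \<partial>M)"
      by (rule P.Fubini') measurable
    also have "\<dots> = (\<integral>\<^sup>+x. ennreal (J k x) \<partial>M)"
    proof (intro nn_integral_cong)
      fix x
      have "(\<integral>\<^sup>+y. ennreal (f y * gauss ((1 / e) *\<^sub>R (x - y)) / e ^ DIM('a)) \<partial>lborel)
        = ennreal (\<bar>- e\<bar>^DIM('a)) * (\<integral>\<^sup>+z. ennreal (f (x + (- e) *\<^sub>R z) * gauss ((1 / e) *\<^sub>R (x - (x + (- e) *\<^sub>R z))) / e ^ DIM('a)) \<partial>lborel)"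
        using e by (intro lborel_nn_integral_affine) auto
      also have "\<dots> = (\<integral>\<^sup>+z. ennreal (\<bar>- e\<bar>^DIM('a)) * ennreal (f (x + (- e) *\<^sub>R z) * gauss ((1 / e) *\<^sub>R (x - (x + (- e) *\<^sub>R z))) / e ^ DIM('a)) \<partial>lborel)"
        by (rule nn_integral_cmult[symmetric]) measurable
      also have "\<dots> = (\<integral>\<^sup>+z. ennreal (gauss z *\<^sub>R f (x + ((1 / real (Suc k)) * - 1) *\<^sub>R z)) \<partial>lborel)"
        using e by (intro nn_integral_cong) (simp add: ennreal_mult'[symmetric] e_def mult.commute)
      also have "\<dots> = ennreal (J k x)"
        unfolding J_def using f01 by (intro nn_integral_eq_integral intJ) (auto simp: gauss_nonneg)
      finally show "(\<integral>\<^sup>+y. ennreal (f y * gauss ((1 / e) *\<^sub>R (x - y)) / e ^ DIM('a)) \<partial>lborel) = ennreal (J k x)" .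
    qed
    finally show ?thesis by (simp add: e_def)
  qed
  show ?thesis
    unfolding eq
  proof (rule nn_integral_dominated_convergence[where w="\<lambda>_. 1"])
    show "(\<integral>\<^sup>+x. 1 \<partial>M) < \<infinity>" by (simp add: M.emeasure_finite less_top[symmetric])
    show "AE x in M. (\<lambda>k. ennreal (J k x)) \<longlonglongrightarrow> ennreal (f x)"
      by (intro AE_I2 tendsto_ennrealI Jlim)
    show "AE x in M. ennreal (J k x) \<le> 1" for k
      using J1 by (simp add: ennreal_le_1)
  qed auto
qed

lemma gauss_smoothing_eq_fourier:
  fixes M :: "'a::euclidean_space measure"
  assumes "finite_measure M" "sets M = sets borel" "0 < e"
  shows "complex_of_real (sqrt (2 * pi) ^ DIM('a) * gauss_smoothing M e y)
    = (\<integral>\<xi>. exp (- \<i> * complex_of_real (y \<bullet> \<xi>)) * complex_of_real (gauss (e *\<^sub>R \<xi>)) * weighted_fourier M (\<lambda>_. 1) \<xi> \<partial>lborel)"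
proof -
  interpret finite_measure M by fact
  show ?thesis
    using gauss_smoothing_fourier[OF sigma_finite_measure_axioms assms(2), of "\<lambda>_. 1" e y] assms(3)
    by (simp add: gauss_smoothing_def)
qed

lemma finite_measure_eqI_open:
  fixes M N :: "'a::metric_space measure"
  assumes "finite_measure M" "sets M = sets borel" "sets N = sets borel"
    and eq: "\<And>U. open U \<Longrightarrow> emeasure M U = emeasure N U"
  shows "M = N"
proof (rule measure_eqI_generator_eq[where E="{S. open S}" and \<Omega>=UNIV and A="\<lambda>_. UNIV"])
  interpret finite_measure M by fact
  show "emeasure M UNIV \<noteq> \<infinity>" by simp
  show "sets M = sigma_sets UNIV {S. open S}" "sets N = sigma_sets UNIV {S. open S}"
    using assms by (simp_all add: borel_def)
qed (auto simp: Int_stable_def eq)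

text \<open>The transform determines the smoothed density at every width. Letting the width shrink
  gives equal integrals of continuous functions between 0 and 1, and these approximate the
  indicators of open sets.\<close>

theorem finite_measure_fourier_unique:
  fixes M N :: "'a::euclidean_space measure"
  assumes "finite_measure M" "finite_measure N" and sets: "sets M = sets borel" "sets N = sets borel"
    and eq: "\<And>\<xi>. weighted_fourier M (\<lambda>_. 1) \<xi> = weighted_fourier N (\<lambda>_. 1) \<xi>"
  shows "M = N"
proof (rule finite_measure_eqI_open[OF assms(1) sets])
  interpret M: finite_measure M by fact
  interpret N: finite_measure N by fact
  fix U :: "'a set" assume "open U"
  then obtain f :: "nat \<Rightarrow> 'a \<Rightarrow> real" where f: "\<And>k. continuous_on UNIV (f k)"
    "\<And>k x. 0 \<le> f k x" "\<And>k x. f k x \<le> indicator U x" "\<And>x. (\<lambda>k. f k x) \<longlonglongrightarrow> indicator U x"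
    using open_continuous_approx by blast
  have f1: "f k x \<le> 1" for k x
    using f(3)[of k x] by (cases "x \<in> U") auto
  have [measurable]: "f k \<in> borel_measurable borel" for k using f(1) by (rule borel_measurable_continuous_onI)
  have sm: "gauss_smoothing M e y = gauss_smoothing N e y" if "0 < e" for e y
  proof -
    have "complex_of_real (sqrt (2 * pi) ^ DIM('a) * gauss_smoothing M e y) = complex_of_real (sqrt (2 * pi) ^ DIM('a) * gauss_smoothing N e y)"
      using assms that by (simp only: gauss_smoothing_eq_fourier)
    then show ?thesis by (simp only: of_real_eq_iff) simp
  qed
  have int: "(\<integral>\<^sup>+x. ennreal (f k x) \<partial>M) = (\<integral>\<^sup>+x. ennreal (f k x) \<partial>N)" for k
    using gauss_smoothing_tendsto[OF assms(1) sets(1) f(1)[of k] f(2) f1]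
      gauss_smoothing_tendsto[OF assms(2) sets(2) f(1)[of k] f(2) f1]
    by (simp add: sm LIMSEQ_unique)
  have lim: "(\<lambda>k. \<integral>\<^sup>+x. ennreal (f k x) \<partial>L) \<longlonglongrightarrow> emeasure L U" if "finite_measure L" and [measurable_cong]: "sets L = sets borel" for L
  proof -
    interpret L: finite_measure L by fact
    have [measurable]: "U \<in> sets L" using that(2) \<open>open U\<close> by simp
    have "(\<lambda>k. \<integral>\<^sup>+x. ennreal (f k x) \<partial>L) \<longlonglongrightarrow> (\<integral>\<^sup>+x. ennreal (indicator U x) \<partial>L)"
    proof (rule nn_integral_dominated_convergence[where w="\<lambda>_. 1"])
      show "(\<integral>\<^sup>+x. 1 \<partial>L) < \<infinity>" by (simp add: L.emeasure_finite less_top[symmetric])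
      show "AE x in L. (\<lambda>k. ennreal (f k x)) \<longlonglongrightarrow> ennreal (indicator U x)"
        by (intro AE_I2 tendsto_ennrealI f)
      show "AE x in L. ennreal (f k x) \<le> 1" for k
        using f1 by (simp add: ennreal_le_1)
    qed (use \<open>open U\<close> in auto)
    also have "(\<integral>\<^sup>+x. ennreal (indicator U x) \<partial>L) = emeasure L U"
      using \<open>open U\<close> that by (simp add: ennreal_indicator)
    finally show ?thesis .
  qed
  show "emeasure M U = emeasure N U"
    using lim[OF assms(1) sets(1)] lim[OF assms(2) sets(2)] unfolding int by (rule LIMSEQ_unique)
qed

text \<open>The smoothed densities are bounded, uniformly in the width, by the integral
  \<open>C\<close> of the modulus of the transform. In the limit an open set has
  \<open>M\<close>-measure at most \<open>C\<close> times its Lebesgue measure, and outer regularity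
  carries this over to null sets.\<close>

lemma fourier_integrable_imp_absolutely_continuous:
  fixes M :: "'a::euclidean_space measure"
  assumes "finite_measure M" and sets: "sets M = sets borel"
    and int: "integrable lborel (weighted_fourier M (\<lambda>_. 1))"
    and N: "N \<in> sets borel" "emeasure lborel N = 0"
  shows "emeasure M N = 0"
proof -
  interpret M: finite_measure M by fact
  define C where "C = (\<integral>\<xi>. norm (weighted_fourier M (\<lambda>_. 1) \<xi>) \<partial>lborel)"
  define s where "s = sqrt (2 * pi) ^ DIM('a)"
  have s: "1 \<le> s" unfolding s_def using pi_gt3 by (intro one_le_power) auto
  have "0 \<le> C" by (simp add: C_def)
  have smC: "gauss_smoothing M e y \<le> C" if "0 < e" for e y
  proof -
    have "s * gauss_smoothing M e y \<le> norm (complex_of_real (s * gauss_smoothing M e y))" by (simp only: norm_of_real abs_ge_self)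
    also have "\<dots> \<le> (\<integral>\<xi>. norm (exp (- \<i> * complex_of_real (y \<bullet> \<xi>)) * complex_of_real (gauss (e *\<^sub>R \<xi>)) * weighted_fourier M (\<lambda>_. 1) \<xi>) \<partial>lborel)"
      unfolding s_def gauss_smoothing_eq_fourier[OF assms(1) sets that] by (rule integral_norm_bound)
    also have "\<dots> = (\<integral>\<xi>. gauss (e *\<^sub>R \<xi>) * norm (weighted_fourier M (\<lambda>_. 1) \<xi>) \<partial>lborel)"
      by (simp add: norm_mult gauss_nonneg)
    also have "\<dots> \<le> C"
      unfolding C_def
    proof (rule integral_mono)
      have le: "gauss (e *\<^sub>R \<xi>) \<le> 1" for \<xi> :: 'a
      proof -
        have "1 / s \<le> 1" using s by simp
        then show ?thesis using gauss_le[of "e *\<^sub>R \<xi>"] unfolding s_def by (rule order_trans[rotated])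
      qed
      show le': "gauss (e *\<^sub>R \<xi>) * norm (weighted_fourier M (\<lambda>_. 1) \<xi>) \<le> norm (weighted_fourier M (\<lambda>_. 1) \<xi>)" for \<xi>
        using le by (simp add: mult_left_le_one_le gauss_nonneg)
      show "integrable lborel (\<lambda>\<xi>. norm (weighted_fourier M (\<lambda>_. 1) \<xi>))" using int by auto
      show "integrable lborel (\<lambda>\<xi>. gauss (e *\<^sub>R \<xi>) * norm (weighted_fourier M (\<lambda>_. 1) \<xi>))"
        by (rule Bochner_Integration.integrable_bound[OF integrable_norm[OF int]])
          (use borel_measurable_integrable[OF int] le' in \<open>auto simp: gauss_nonneg\<close>)
    qed
    finally have "s * gauss_smoothing M e y \<le> C" .
    moreover have "gauss_smoothing M e y \<le> s * gauss_smoothing M e y"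
      using s that by (intro mult_right_mono[of 1 s, simplified])
        (auto simp: gauss_smoothing_nonneg)
    ultimately show ?thesis by simp
  qed
  have U: "emeasure M U \<le> ennreal C * emeasure lborel U" if U: "open U" for U :: "'a set"
  proof -
    obtain f :: "nat \<Rightarrow> 'a \<Rightarrow> real" where f: "\<And>k. continuous_on UNIV (f k)"
      "\<And>k x. 0 \<le> f k x" "\<And>k x. f k x \<le> indicator U x" "\<And>x. (\<lambda>k. f k x) \<longlonglongrightarrow> indicator U x"
      using open_continuous_approx[OF U] by blast
    have f1: "f k x \<le> 1" for k x
      using f(3)[of k x] by (cases "x \<in> U") auto
    have [measurable]: "f k \<in> borel_measurable borel" for k using f(1) by (rule borel_measurable_continuous_onI)
    have [measurable_cong]: "sets M = sets borel" by fact
    have [measurable]: "U \<in> sets M" using sets U by simp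
    have "(\<integral>\<^sup>+x. ennreal (f k x) \<partial>M) \<le> ennreal C * emeasure lborel U" for k
    proof (rule LIMSEQ_le_const2[OF gauss_smoothing_tendsto[OF assms(1) sets f(1)[of k] f(2) f1]], intro exI allI impI)
      fix j
      have "(\<integral>\<^sup>+y. ennreal (f k y * gauss_smoothing M (1 / real (Suc j)) y) \<partial>lborel) \<le> (\<integral>\<^sup>+y. ennreal C * indicator U y \<partial>lborel)"
      proof (rule nn_integral_mono)
        fix y
        have "f k y * gauss_smoothing M (1 / real (Suc j)) y \<le> indicator U y * C"
          using f(2,3)[of k y] smC[of "1 / real (Suc j)" y] \<open>0 \<le> C\<close> by (intro mult_mono') (auto simp: gauss_smoothing_nonneg)
        then show "ennreal (f k y * gauss_smoothing M (1 / real (Suc j)) y) \<le> ennreal C * indicator U y"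
          using f(2)[of k y] by (cases "y \<in> U") (auto intro: ennreal_leI simp: ennreal_eq_0_iff)
      qed
      also have "\<dots> = ennreal C * emeasure lborel U" using U by (simp add: nn_integral_cmult)
      finally show "(\<integral>\<^sup>+y. ennreal (f k y * gauss_smoothing M (1 / real (Suc j)) y) \<partial>lborel) \<le> ennreal C * emeasure lborel U" .
    qed
    moreover have "(\<lambda>k. \<integral>\<^sup>+x. ennreal (f k x) \<partial>M) \<longlonglongrightarrow> (\<integral>\<^sup>+x. ennreal (indicator U x) \<partial>M)"
    proof (rule nn_integral_dominated_convergence[where w="\<lambda>_. 1"])
      show "(\<integral>\<^sup>+x. 1 \<partial>M) < \<infinity>" by (simp add: M.emeasure_finite less_top[symmetric])
      show "AE x in M. (\<lambda>k. ennreal (f k x)) \<longlonglongrightarrow> ennreal (indicator U x)"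
        by (intro AE_I2 tendsto_ennrealI f)
      show "AE x in M. ennreal (f k x) \<le> 1" for k
        using f1 by (simp add: ennreal_le_1)
    qed (use U in auto)
    ultimately have "(\<integral>\<^sup>+x. ennreal (indicator U x) \<partial>M) \<le> ennreal C * emeasure lborel U"
      by (intro LIMSEQ_le_const2) auto
    then show ?thesis using U by (simp add: ennreal_indicator)
  qed
  have "emeasure M N \<le> 0 + ennreal d" if "0 < d" for d
  proof -
    \<comment> \<open>The bound \<open>d / (C + 1)\<close> makes \<open>C\<close> times the measure
      at most \<open>d\<close>, and the added 1 avoids dividing by 0.\<close>
    obtain U where O: "open U" "N \<subseteq> U" "emeasure lborel (U - N) < d / (C + 1)"
      using outer_regular_lborel[OF N(1), of "d / (C + 1)"] \<open>0 < d\<close> \<open>0 \<le> C\<close> by auto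
    have "emeasure lborel U = emeasure lborel (U - N)"
      using N O by (subst emeasure_Diff_null_set) (auto simp: null_sets_def)
    then have "emeasure lborel U \<le> ennreal (d / (C + 1))" using O by simp
    then have "ennreal C * emeasure lborel U \<le> ennreal C * ennreal (d / (C + 1))" by (rule mult_left_mono) simp
    also have "\<dots> = ennreal (C * (d / (C + 1)))" using \<open>0 \<le> C\<close> \<open>0 < d\<close> by (intro ennreal_mult[symmetric]) auto
    also have "\<dots> \<le> ennreal d" using \<open>0 \<le> C\<close> \<open>0 < d\<close> by (intro ennreal_leI) (simp add: field_simps)
    finally have Cd: "ennreal C * emeasure lborel U \<le> ennreal d" .
    have "emeasure M N \<le> emeasure M U" using O sets by (intro emeasure_mono) auto
    also have "\<dots> \<le> ennreal d" using U[OF O(1)] Cd by (rule order_trans)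
    finally show ?thesis by simp
  qed
  then have "emeasure M N \<le> 0" by (rule ennreal_le_epsilon)
  then show ?thesis by simp
qed

lemma fourier_eq_weighted: "fourier u = weighted_fourier lborel u"
  by (simp add: fun_eq_iff fourier_def weighted_fourier_def)

lemma gauss_le_exp: "gauss x \<le> exp (- (norm x)\<^sup>2 / 2)" for x :: "'a::euclidean_space"
proof -
  have "1 \<le> sqrt (2 * pi) ^ DIM('a)" using pi_gt3 by (intro one_le_power) auto
  then have "1 * gauss x \<le> sqrt (2 * pi) ^ DIM('a) * gauss x" by (intro mult_right_mono gauss_nonneg)
  then show ?thesis unfolding exp_eq_gauss by simp
qed

text \<open>The functions may change sign, so the uniqueness theorem is applied to the positive and
  the negative part of \<open>u - v\<close>, taken as densities of two finite measures.\<close>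

lemma fourier_unique_real:
  fixes u v :: "'a::euclidean_space \<Rightarrow> real"
  assumes u: "integrable lborel u" and v: "integrable lborel v"
    and eq: "\<And>\<xi>. fourier (\<lambda>x. complex_of_real (u x)) \<xi> = fourier (\<lambda>x. complex_of_real (v x)) \<xi>"
  shows "AE x in lborel. u x = v x"
proof -
  define p where "p x = max 0 (u x - v x)" for x
  define q where "q x = max 0 (v x - u x)" for x
  have [measurable]: "u \<in> borel_measurable borel" "v \<in> borel_measurable borel" using u v by auto
  have [measurable]: "p \<in> borel_measurable borel" "q \<in> borel_measurable borel"
    unfolding p_def q_def by measurable
  have p: "integrable lborel p" and q: "integrable lborel q"
    unfolding p_def q_def using u v by (auto intro!: integrable_max)
  have nn: "0 \<le> p x" "0 \<le> q x" for x by (simp_all add: p_def q_def)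
  have fin: "finite_measure (density lborel (\<lambda>x. ennreal (h x)))"
    if h: "integrable lborel h" "\<And>x. 0 \<le> h x" for h :: "'a \<Rightarrow> real"
    using that by (intro finite_measureI) (auto simp: emeasure_density nn_integral_eq_integral)
  have wf: "weighted_fourier (density lborel (\<lambda>x. ennreal (h x))) (\<lambda>_. 1) \<xi> = (\<integral>x. exp (\<i> * complex_of_real (\<xi> \<bullet> x)) * complex_of_real (h x) \<partial>lborel)"
    if [measurable]: "h \<in> borel_measurable borel" and h: "\<And>x. 0 \<le> h x" for h :: "'a \<Rightarrow> real" and \<xi>
    unfolding weighted_fourier_def using h by (subst integral_density) (auto simp: scaleR_conv_of_real mult.commute)
  have int: "integrable lborel (\<lambda>x. exp (\<i> * complex_of_real (\<xi> \<bullet> x)) * complex_of_real (h x))"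
    if h: "integrable lborel h" for h :: "'a \<Rightarrow> real" and \<xi>
  proof (rule Bochner_Integration.integrable_bound[OF integrable_norm[OF h]])
    have [measurable]: "h \<in> borel_measurable borel" using h by auto
    show "(\<lambda>x. exp (\<i> * complex_of_real (\<xi> \<bullet> x)) * complex_of_real (h x)) \<in> borel_measurable lborel" by measurable
  qed (simp add: norm_mult)
  have "density lborel (\<lambda>x. ennreal (p x)) = density lborel (\<lambda>x. ennreal (q x))"
  proof (rule finite_measure_fourier_unique)
    fix \<xi> :: 'a
    have "(\<integral>x. exp (\<i> * complex_of_real (\<xi> \<bullet> x)) * complex_of_real (p x) \<partial>lborel) - (\<integral>x. exp (\<i> * complex_of_real (\<xi> \<bullet> x)) * complex_of_real (q x) \<partial>lborel)
      = (\<integral>x. exp (\<i> * complex_of_real (\<xi> \<bullet> x)) * complex_of_real (p x) - exp (\<i> * complex_of_real (\<xi> \<bullet> x)) * complex_of_real (q x) \<partial>lborel)"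
      using int[OF p] int[OF q] by simp
    also have "\<dots> = (\<integral>x. exp (\<i> * complex_of_real (\<xi> \<bullet> x)) * complex_of_real (u x) - exp (\<i> * complex_of_real (\<xi> \<bullet> x)) * complex_of_real (v x) \<partial>lborel)"
    proof (rule Bochner_Integration.integral_cong[OF refl])
      fix x
      have "p x - q x = u x - v x" by (simp add: p_def q_def)
      then have "complex_of_real (p x) - complex_of_real (q x) = complex_of_real (u x) - complex_of_real (v x)"
        by (metis of_real_diff)
      then show "exp (\<i> * complex_of_real (\<xi> \<bullet> x)) * complex_of_real (p x) - exp (\<i> * complex_of_real (\<xi> \<bullet> x)) * complex_of_real (q x)
        = exp (\<i> * complex_of_real (\<xi> \<bullet> x)) * complex_of_real (u x) - exp (\<i> * complex_of_real (\<xi> \<bullet> x)) * complex_of_real (v x)"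
        by (simp only: right_diff_distrib[symmetric])
    qed
    also have "\<dots> = 0"
      using int[OF u, of \<xi>] int[OF v, of \<xi>] eq[of \<xi>] by (simp add: fourier_def)
    finally show "weighted_fourier (density lborel (\<lambda>x. ennreal (p x))) (\<lambda>_. 1) \<xi> = weighted_fourier (density lborel (\<lambda>x. ennreal (q x))) (\<lambda>_. 1) \<xi>"
      by (simp add: wf nn)
  qed (use fin[OF p] fin[OF q] nn in auto)
  then have "AE x in lborel. ennreal (p x) = ennreal (q x)"
    using p nn by (intro sigma_finite_measure.density_unique_iff[OF sigma_finite_lborel, THEN iffD1])
      (auto simp: )
  then show ?thesis
    by eventually_elim (auto simp: p_def q_def max_def split: if_splits)
qed

section \<open>Integrability of the characteristic functions of stable laws\<close>

lemma bounded_norm_powr_exp: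
  fixes c p :: real
  assumes "0 < c" "0 < p"
  shows "\<exists>C. \<forall>x. exp (- c * \<bar>x\<bar> powr p) \<le> C * inverse (1 + x\<^sup>2)"
proof -
  have "((\<lambda>x. (1 + x\<^sup>2) * exp (- c * x powr p)) \<longlongrightarrow> 0) at_top"
    using assms by real_asymp
  then have "\<forall>\<^sub>F x in at_top. (1 + x\<^sup>2) * exp (- c * x powr p) < 1"
    by (rule order_tendstoD) simp
  then obtain X where X: "\<And>x. X \<le> x \<Longrightarrow> (1 + x\<^sup>2) * exp (- c * x powr p) < 1"
    by (auto simp: eventually_at_top_linorder)
  have "exp (- c * \<bar>x\<bar> powr p) \<le> (2 + X\<^sup>2) * inverse (1 + x\<^sup>2)" for x
  proof (cases "X \<le> \<bar>x\<bar>")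
    case True
    have "(1 + x\<^sup>2) * exp (- c * \<bar>x\<bar> powr p) \<le> 2 + X\<^sup>2"
      using X[OF True] by (simp add: add_increasing2)
    moreover have "0 < 1 + x\<^sup>2" by (simp add: add_pos_nonneg)
    ultimately show ?thesis by (simp add: field_simps)
  next
    case False
    then have "x\<^sup>2 \<le> X\<^sup>2" by (simp add: abs_le_square_iff[symmetric])
    have "exp (- c * \<bar>x\<bar> powr p) \<le> 1" using assms by simp
    then have "(1 + x\<^sup>2) * exp (- c * \<bar>x\<bar> powr p) \<le> 1 + x\<^sup>2" by (intro mult_left_le) auto
    then have "(1 + x\<^sup>2) * exp (- c * \<bar>x\<bar> powr p) \<le> 2 + X\<^sup>2" using \<open>x\<^sup>2 \<le> X\<^sup>2\<close> by linarith
    moreover have "0 < 1 + x\<^sup>2" by (simp add: add_pos_nonneg)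
    ultimately show ?thesis by (simp add: field_simps)
  qed
  then show ?thesis by blast
qed

lemma integrable_exp_norm_powr:
  assumes "0 < c" "0 < p"
  shows "integrable lborel (\<lambda>x::'a::euclidean_space. exp (- c * norm x powr p))"
proof -
  \<comment> \<open>Splitting \<open>c\<close> evenly over the coordinates, each of which is at most
    \<open>norm x\<close> in absolute value, dominates the radial function by a product of
    one-dimensional ones.\<close>
  define d where "d = c / DIM('a)"
  have d: "0 < d" using assms by (simp add: d_def)
  obtain C where C: "\<And>x. exp (- d * \<bar>x\<bar> powr p) \<le> C * inverse (1 + x\<^sup>2)"
    using bounded_norm_powr_exp[OF d assms(2)] by blast
  have 1: "integrable lborel (\<lambda>x. exp (- d * \<bar>x\<bar> powr p))"
  proof (rule Bochner_Integration.integrable_bound)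
    have "set_integrable lborel (einterval (- \<infinity>) \<infinity>) (\<lambda>x. inverse (1 + x\<^sup>2))"
      by (rule integrable_inverse_1_plus_square)
    then show "integrable lborel (\<lambda>x. C * inverse (1 + x\<^sup>2))"
      by (simp add: set_integrable_def)
    show "AE x in lborel. norm (exp (- d * \<bar>x\<bar> powr p)) \<le> norm (C * inverse (1 + x\<^sup>2))"
    proof (rule AE_I2)
      fix x
      show "norm (exp (- d * \<bar>x\<bar> powr p)) \<le> norm (C * inverse (1 + x\<^sup>2))"
        unfolding real_norm_def abs_exp_cancel by (rule order_trans[OF C abs_ge_self])
    qed
  qed simp
  show ?thesis
  proof (rule Bochner_Integration.integrable_bound)
    show "integrable lborel (\<lambda>x::'a. \<Prod>b\<in>Basis. exp (- d * \<bar>x \<bullet> b\<bar> powr p))"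
      by (rule integrable_lborel_prod_Basis) (rule 1)
    show "AE x::'a in lborel. norm (exp (- c * norm x powr p)) \<le> norm (\<Prod>b\<in>Basis. exp (- d * \<bar>x \<bullet> b\<bar> powr p))"
    proof (rule AE_I2)
      fix x :: 'a
      have "(\<Sum>b\<in>Basis. d * \<bar>x \<bullet> b\<bar> powr p) \<le> (\<Sum>b\<in>(Basis::'a set). d * norm x powr p)"
        using d assms by (intro sum_mono mult_left_mono powr_mono2) (auto simp: Basis_le_norm)
      also have "\<dots> = c * norm x powr p" by (simp add: d_def)
      finally show "norm (exp (- c * norm x powr p)) \<le> norm (\<Prod>b\<in>Basis. exp (- d * \<bar>x \<bullet> b\<bar> powr p))"
        by (simp add: exp_sum[symmetric] sum_negf)
    qed
  qed measurable
qed

section \<open>Fourier inversion\<close>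

lemma power_exp_square_tendsto_0: "(\<lambda>k. real (Suc k) ^ n * exp (- (real (Suc k))\<^sup>2 / 2)) \<longlonglongrightarrow> 0"
proof (rule tendsto_sandwich[OF _ _ tendsto_const])
  have "(\<lambda>k. exp (1/2) * (real (Suc k) ^ n / exp (real (Suc k)))) \<longlonglongrightarrow> exp (1/2) * 0"
    by (intro tendsto_mult_left filterlim_compose[OF tendsto_power_div_exp_0]
        filterlim_compose[OF filterlim_real_sequentially] filterlim_Suc)
  then show "(\<lambda>k. exp (1/2) * (real (Suc k) ^ n / exp (real (Suc k)))) \<longlonglongrightarrow> 0" by simp
  show "\<forall>\<^sub>F k in sequentially. real (Suc k) ^ n * exp (- (real (Suc k))\<^sup>2 / 2) \<le> exp (1/2) * (real (Suc k) ^ n / exp (real (Suc k)))"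
  proof (rule always_eventually, rule allI)
    fix k
    \<comment> \<open>Expanding this square replaces the Gaussian by a plain exponential, for which
      the limit is known.\<close>
    have "0 \<le> (real (Suc k) - 1)\<^sup>2" by (rule zero_le_power2)
    then have "- (real (Suc k))\<^sup>2 / 2 \<le> 1/2 - real (Suc k)" unfolding power2_diff by simp
    then have "exp (- (real (Suc k))\<^sup>2 / 2) \<le> exp (1/2 - real (Suc k))" by simp
    then have "real (Suc k) ^ n * exp (- (real (Suc k))\<^sup>2 / 2) \<le> real (Suc k) ^ n * exp (1/2 - real (Suc k))"
      by (intro mult_left_mono) auto
    then show "real (Suc k) ^ n * exp (- (real (Suc k))\<^sup>2 / 2) \<le> exp (1/2) * (real (Suc k) ^ n / exp (real (Suc k)))"
      by (simp add: exp_diff mult.commute del: of_nat_Suc)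
  qed
qed auto

text \<open>\<open>\<phi>\<close> is continuous and integrable but possibly unbounded, so
  \<open>gauss_average_tendsto\<close> applies only after localisation. The part near
  \<open>y\<close> is bounded; on the part away from \<open>y\<close> the Gaussian is uniformly tiny
  and multiplies the finite \<open>L^1\<close> norm.\<close>

lemma gauss_convolution_tendsto:
  fixes \<phi> :: "'a::euclidean_space \<Rightarrow> complex"
  assumes cont: "continuous_on UNIV \<phi>" and int: "integrable lborel \<phi>"
  shows "(\<lambda>k. complex_of_real (real (Suc k) ^ DIM('a)) * (\<integral>x. complex_of_real (gauss (real (Suc k) *\<^sub>R (x - y))) * \<phi> x \<partial>lborel)) \<longlonglongrightarrow> \<phi> y"
proof -
  have [measurable]: "\<phi> \<in> borel_measurable borel" using cont by (rule borel_measurable_continuous_onI)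
  \<comment> \<open>Equal to 1 within distance 1 of \<open>y\<close> and to 0 beyond distance 2, so
    \<open>f\<close> is bounded and \<open>g\<close> vanishes near \<open>y\<close>.\<close>
  define cut where "cut x = max 0 (min 1 (2 - norm (x - y)))" for x :: 'a
  have cut: "0 \<le> cut x" "cut x \<le> 1" for x by (auto simp: cut_def)
  have cutc: "continuous_on UNIV cut" unfolding cut_def by (intro continuous_intros)
  then have [measurable]: "cut \<in> borel_measurable borel" by (rule borel_measurable_continuous_onI)
  define f where "f x = complex_of_real (cut x) * \<phi> x" for x
  define g where "g x = complex_of_real (1 - cut x) * \<phi> x" for x
  have [measurable]: "f \<in> borel_measurable borel" "g \<in> borel_measurable borel" unfolding f_def g_def by measurable
  have fc: "continuous_on UNIV f" unfolding f_def by (intro continuous_intros cutc cont)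
  have "bounded (\<phi> ` cball y 2)"
    using cont by (intro compact_imp_bounded compact_continuous_image) (auto intro: continuous_on_subset)
  then obtain B where B: "\<And>x. x \<in> cball y 2 \<Longrightarrow> norm (\<phi> x) \<le> B"
    unfolding bounded_iff by blast
  have fB: "norm (f x) \<le> \<bar>B\<bar>" for x
  proof (cases "x \<in> cball y 2")
    case True
    then have "norm (\<phi> x) \<le> \<bar>B\<bar>" using B by force
    then show ?thesis using cut[of x] by (auto simp: f_def norm_mult intro: order_trans[OF mult_left_le_one_le])
  next
    case False
    then have "cut x = 0" by (simp add: cut_def dist_norm norm_minus_commute)
    then show ?thesis by (simp add: f_def)
  qed
  have gb: "integrable lborel (\<lambda>x. complex_of_real (gauss (real (Suc k) *\<^sub>R (x - y))) * h x)"
    if [measurable]: "h \<in> borel_measurable borel" and h: "\<And>x. norm (h x) \<le> norm (\<phi> x)" for h :: "'a \<Rightarrow> complex" and k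
  proof (rule Bochner_Integration.integrable_bound)
    show "integrable lborel (\<lambda>x. (1 / sqrt (2 * pi) ^ DIM('a)) * norm (\<phi> x))" using int by auto
    show "AE x in lborel. norm (complex_of_real (gauss (real (Suc k) *\<^sub>R (x - y))) * h x) \<le> norm ((1 / sqrt (2 * pi) ^ DIM('a)) * norm (\<phi> x))"
    proof (rule AE_I2)
      fix x
      have "gauss (real (Suc k) *\<^sub>R (x - y)) * norm (h x) \<le> (1 / sqrt (2 * pi) ^ DIM('a)) * norm (\<phi> x)"
        by (intro mult_mono gauss_le h) auto
      then show "norm (complex_of_real (gauss (real (Suc k) *\<^sub>R (x - y))) * h x) \<le> norm ((1 / sqrt (2 * pi) ^ DIM('a)) * norm (\<phi> x))"
        by (simp add: norm_mult gauss_nonneg abs_mult del: of_nat_Suc)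
    qed
  qed measurable
  have fle: "norm (f x) \<le> norm (\<phi> x)" and gle: "norm (g x) \<le> norm (\<phi> x)" for x
  proof -
    have "norm (f x) = cut x * norm (\<phi> x)" "norm (g x) = (1 - cut x) * norm (\<phi> x)"
      unfolding f_def g_def norm_mult norm_of_real using cut[of x] by simp_all
    then show "norm (f x) \<le> norm (\<phi> x)" "norm (g x) \<le> norm (\<phi> x)"
      using cut[of x] by (simp_all add: mult_left_le_one_le)
  qed
  define N where "N = (\<integral>x. norm (\<phi> x) \<partial>lborel)"
  have near: "(\<lambda>k. complex_of_real (real (Suc k) ^ DIM('a)) * (\<integral>x. complex_of_real (gauss (real (Suc k) *\<^sub>R (x - y))) * f x \<partial>lborel)) \<longlonglongrightarrow> f y"
  proof -
    have "complex_of_real (real (Suc k) ^ DIM('a)) * (\<integral>x. complex_of_real (gauss (real (Suc k) *\<^sub>R (x - y))) * f x \<partial>lborel)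
      = (\<integral>z. gauss z *\<^sub>R f (y + ((1 / real (Suc k)) * 1) *\<^sub>R z) \<partial>lborel)" for k
    proof -
      define u where "u = real (Suc k)"
      have u: "0 < u" by (simp add: u_def)
      have "(\<integral>x. complex_of_real (gauss (u *\<^sub>R (x - y))) * f x \<partial>lborel)
        = (\<bar>1/u\<bar>^DIM('a)) *\<^sub>R (\<integral>z. complex_of_real (gauss (u *\<^sub>R ((y + (1/u) *\<^sub>R z) - y))) * f (y + (1/u) *\<^sub>R z) \<partial>lborel)"
        using u by (intro lborel_integral_affine) auto
      then show ?thesis using u unfolding u_def[symmetric]
        by (simp add: scaleR_conv_of_real power_divide)
    qed
    then show ?thesis using gauss_average_tendsto[OF fc fB, of y 1] by simp
  qed
  have far: "(\<lambda>k. complex_of_real (real (Suc k) ^ DIM('a)) * (\<integral>x. complex_of_real (gauss (real (Suc k) *\<^sub>R (x - y))) * g x \<partial>lborel)) \<longlonglongrightarrow> 0"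
  proof (rule Lim_null_comparison)
    show "(\<lambda>k. N * (real (Suc k) ^ DIM('a) * exp (- (real (Suc k))\<^sup>2 / 2))) \<longlonglongrightarrow> 0"
      using tendsto_mult_left[OF power_exp_square_tendsto_0[of "DIM('a)"], of N] by simp
    show "\<forall>\<^sub>F k in sequentially. norm (complex_of_real (real (Suc k) ^ DIM('a)) * (\<integral>x. complex_of_real (gauss (real (Suc k) *\<^sub>R (x - y))) * g x \<partial>lborel)) \<le> N * (real (Suc k) ^ DIM('a) * exp (- (real (Suc k))\<^sup>2 / 2))"
    proof (rule always_eventually, rule allI)
      fix k
      define u where "u = real (Suc k)"
      have u: "1 \<le> u" by (simp add: u_def)
      have "norm (\<integral>x. complex_of_real (gauss (u *\<^sub>R (x - y))) * g x \<partial>lborel) \<le> (\<integral>x. norm (complex_of_real (gauss (u *\<^sub>R (x - y))) * g x) \<partial>lborel)"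
        by (rule integral_norm_bound)
      also have "\<dots> \<le> (\<integral>x. exp (- u\<^sup>2 / 2) * norm (\<phi> x) \<partial>lborel)"
      proof (rule integral_mono)
        show "integrable lborel (\<lambda>x. norm (complex_of_real (gauss (u *\<^sub>R (x - y))) * g x))"
          unfolding u_def by (intro integrable_norm gb gle) measurable
        show "integrable lborel (\<lambda>x. exp (- u\<^sup>2 / 2) * norm (\<phi> x))" using int by auto
        fix x
        show "norm (complex_of_real (gauss (u *\<^sub>R (x - y))) * g x) \<le> exp (- u\<^sup>2 / 2) * norm (\<phi> x)"
        proof (cases "norm (x - y) < 1")
          case True
          then have "g x = 0" by (simp add: g_def cut_def)
          then show ?thesis by simp
        next
          case False
          then have "u * 1 \<le> u * norm (x - y)" using u by (intro mult_left_mono) auto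
          then have "u\<^sup>2 \<le> (norm (u *\<^sub>R (x - y)))\<^sup>2" using u by (intro power_mono) auto
          then have "exp (- (norm (u *\<^sub>R (x - y)))\<^sup>2 / 2) \<le> exp (- u\<^sup>2 / 2)" by simp
          with gauss_le_exp[of "u *\<^sub>R (x - y)"] have "gauss (u *\<^sub>R (x - y)) \<le> exp (- u\<^sup>2 / 2)"
            by (rule order_trans)
          then have "gauss (u *\<^sub>R (x - y)) * norm (g x) \<le> exp (- u\<^sup>2 / 2) * norm (\<phi> x)"
            by (intro mult_mono gle) auto
          then show ?thesis by (simp add: norm_mult gauss_nonneg)
        qed
      qed
      also have "\<dots> = exp (- u\<^sup>2 / 2) * N" by (simp add: N_def)
      finally have "u ^ DIM('a) * norm (\<integral>x. complex_of_real (gauss (u *\<^sub>R (x - y))) * g x \<partial>lborel) \<le> u ^ DIM('a) * (exp (- u\<^sup>2 / 2) * N)"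
        using u by (intro mult_left_mono) auto
      then show "norm (complex_of_real (real (Suc k) ^ DIM('a)) * (\<integral>x. complex_of_real (gauss (real (Suc k) *\<^sub>R (x - y))) * g x \<partial>lborel)) \<le> N * (real (Suc k) ^ DIM('a) * exp (- (real (Suc k))\<^sup>2 / 2))"
        unfolding u_def[symmetric] using u by (simp add: norm_mult norm_power mult_ac)
    qed
  qed
  have "(\<integral>x. complex_of_real (gauss (real (Suc k) *\<^sub>R (x - y))) * \<phi> x \<partial>lborel)
    = (\<integral>x. complex_of_real (gauss (real (Suc k) *\<^sub>R (x - y))) * f x \<partial>lborel) + (\<integral>x. complex_of_real (gauss (real (Suc k) *\<^sub>R (x - y))) * g x \<partial>lborel)" for k
    by (subst Bochner_Integration.integral_add[symmetric])
      (use gb[OF _ fle] gb[OF _ gle] in \<open>auto simp: f_def g_def algebra_simps\<close>)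
  then show ?thesis
    using tendsto_add[OF near far] by (simp add: f_def cut_def distrib_left del: of_nat_Suc)
qed

text \<open>Both sides of \<open>gauss_smoothing_fourier\<close> are followed as the damping
  disappears: the frequency side by dominated convergence, as the transform is integrable, the space
  side as an approximate identity.\<close>

theorem fourier_inversion:
  fixes \<phi> :: "'a::euclidean_space \<Rightarrow> complex"
  assumes cont: "continuous_on UNIV \<phi>" and int: "integrable lborel \<phi>" and fint: "integrable lborel (fourier \<phi>)"
  shows "(\<integral>\<xi>. exp (- \<i> * complex_of_real (y \<bullet> \<xi>)) * fourier \<phi> \<xi> \<partial>lborel) = complex_of_real ((2 * pi) ^ DIM('a)) * \<phi> y"
proof -
  \<comment> \<open>One factor \<open>s\<close> is the constant of the smoothing identity, the other
    comes from \<open>gauss 0 = 1 / s\<close>; together they form the constant of the inversion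
    formula.\<close>
  define s where "s = sqrt (2 * pi) ^ DIM('a)"
  have "s * s = (sqrt (2 * pi) * sqrt (2 * pi)) ^ DIM('a)"
    unfolding s_def by (simp only: power_mult_distrib)
  also have "sqrt (2 * pi) * sqrt (2 * pi) = 2 * pi" by simp
  finally have s: "0 < s" "s * s = (2 * pi) ^ DIM('a)"
    by (simp_all add: s_def)
  have [measurable]: "fourier \<phi> \<in> borel_measurable borel" using fint by auto
  have "(\<lambda>k. \<integral>\<xi>. exp (- \<i> * complex_of_real (y \<bullet> \<xi>)) * complex_of_real (gauss ((1 / real (Suc k)) *\<^sub>R \<xi>)) * fourier \<phi> \<xi> \<partial>lborel)
    \<longlonglongrightarrow> (\<integral>\<xi>. exp (- \<i> * complex_of_real (y \<bullet> \<xi>)) * complex_of_real (gauss (0::'a)) * fourier \<phi> \<xi> \<partial>lborel)"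
  proof (rule integral_dominated_convergence)
    show "integrable lborel (\<lambda>\<xi>. (1 / sqrt (2 * pi) ^ DIM('a)) * norm (fourier \<phi> \<xi>))" using fint by auto
    show "AE \<xi> in lborel. norm (exp (- \<i> * complex_of_real (y \<bullet> \<xi>)) * complex_of_real (gauss ((1 / real (Suc k)) *\<^sub>R \<xi>)) * fourier \<phi> \<xi>)
        \<le> (1 / sqrt (2 * pi) ^ DIM('a)) * norm (fourier \<phi> \<xi>)" for k
    proof (rule AE_I2)
      fix \<xi> :: 'a
      have "gauss ((1 / real (Suc k)) *\<^sub>R \<xi>) * norm (fourier \<phi> \<xi>) \<le> (1 / sqrt (2 * pi) ^ DIM('a)) * norm (fourier \<phi> \<xi>)"
        by (intro mult_right_mono gauss_le) auto
      then show "norm (exp (- \<i> * complex_of_real (y \<bullet> \<xi>)) * complex_of_real (gauss ((1 / real (Suc k)) *\<^sub>R \<xi>)) * fourier \<phi> \<xi>)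
        \<le> (1 / sqrt (2 * pi) ^ DIM('a)) * norm (fourier \<phi> \<xi>)"
        by (simp add: norm_mult gauss_nonneg del: of_nat_Suc)
    qed
    show "AE \<xi> in lborel. (\<lambda>k. exp (- \<i> * complex_of_real (y \<bullet> \<xi>)) * complex_of_real (gauss ((1 / real (Suc k)) *\<^sub>R \<xi>)) * fourier \<phi> \<xi>)
        \<longlonglongrightarrow> exp (- \<i> * complex_of_real (y \<bullet> \<xi>)) * complex_of_real (gauss (0::'a)) * fourier \<phi> \<xi>"
    proof (rule AE_I2)
      fix \<xi> :: 'a
      have "(\<lambda>k. (1 / real (Suc k)) *\<^sub>R \<xi>) \<longlonglongrightarrow> 0 *\<^sub>R \<xi>"
        by (intro tendsto_intros inverse_Suc_tendsto_0)
      then have "(\<lambda>k. gauss ((1 / real (Suc k)) *\<^sub>R \<xi>)) \<longlonglongrightarrow> gauss (0::'a)"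
        using continuous_on_gauss by (intro isCont_tendsto_compose[of 0 gauss]) (auto simp: continuous_on_eq_continuous_at)
      then show "(\<lambda>k. exp (- \<i> * complex_of_real (y \<bullet> \<xi>)) * complex_of_real (gauss ((1 / real (Suc k)) *\<^sub>R \<xi>)) * fourier \<phi> \<xi>)
        \<longlonglongrightarrow> exp (- \<i> * complex_of_real (y \<bullet> \<xi>)) * complex_of_real (gauss (0::'a)) * fourier \<phi> \<xi>"
        by (intro tendsto_intros)
    qed
  qed measurable
  also have "(\<lambda>k. \<integral>\<xi>. exp (- \<i> * complex_of_real (y \<bullet> \<xi>)) * complex_of_real (gauss ((1 / real (Suc k)) *\<^sub>R \<xi>)) * fourier \<phi> \<xi> \<partial>lborel)
    = (\<lambda>k. complex_of_real s * (complex_of_real (real (Suc k) ^ DIM('a)) * (\<integral>x. complex_of_real (gauss (real (Suc k) *\<^sub>R (x - y))) * \<phi> x \<partial>lborel)))"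
  proof
    fix k
    show "(\<integral>\<xi>. exp (- \<i> * complex_of_real (y \<bullet> \<xi>)) * complex_of_real (gauss ((1 / real (Suc k)) *\<^sub>R \<xi>)) * fourier \<phi> \<xi> \<partial>lborel)
      = complex_of_real s * (complex_of_real (real (Suc k) ^ DIM('a)) * (\<integral>x. complex_of_real (gauss (real (Suc k) *\<^sub>R (x - y))) * \<phi> x \<partial>lborel))"
      using gauss_smoothing_fourier[OF sigma_finite_lborel _ int, of "1 / real (Suc k)" y]
      by (simp add: fourier_eq_weighted s_def power_divide del: of_nat_Suc)
  qed
  finally have "(\<lambda>k. complex_of_real s * (complex_of_real (real (Suc k) ^ DIM('a)) * (\<integral>x. complex_of_real (gauss (real (Suc k) *\<^sub>R (x - y))) * \<phi> x \<partial>lborel)))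
    \<longlonglongrightarrow> (\<integral>\<xi>. exp (- \<i> * complex_of_real (y \<bullet> \<xi>)) * complex_of_real (gauss (0::'a)) * fourier \<phi> \<xi> \<partial>lborel)" .
  from LIMSEQ_unique[OF this tendsto_mult_left[OF gauss_convolution_tendsto[OF cont int]]]
  have "(\<integral>\<xi>. exp (- \<i> * complex_of_real (y \<bullet> \<xi>)) * complex_of_real (gauss (0::'a)) * fourier \<phi> \<xi> \<partial>lborel) = complex_of_real s * \<phi> y" .
  moreover have "(\<integral>\<xi>. exp (- \<i> * complex_of_real (y \<bullet> \<xi>)) * complex_of_real (gauss (0::'a)) * fourier \<phi> \<xi> \<partial>lborel)
    = complex_of_real (gauss (0::'a)) * (\<integral>\<xi>. exp (- \<i> * complex_of_real (y \<bullet> \<xi>)) * fourier \<phi> \<xi> \<partial>lborel)"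
    by (subst integral_mult_right_zero[symmetric]) (simp only: mult_ac)
  moreover have "gauss (0::'a) = 1 / s" by (simp add: gauss_def s_def)
  ultimately have "complex_of_real s * (complex_of_real (1 / s) * (\<integral>\<xi>. exp (- \<i> * complex_of_real (y \<bullet> \<xi>)) * fourier \<phi> \<xi> \<partial>lborel)) = complex_of_real s * (complex_of_real s * \<phi> y)"
    by simp
  moreover have "complex_of_real s * (complex_of_real (1 / s) * Z) = Z" for Z using s by simp
  ultimately show ?thesis using s(2) by (simp flip: mult.assoc of_real_mult)
qed

section \<open>Stable processes at random times\<close>

text \<open>Rounds \<open>t\<close> up strictly, so that right-continuity applies along \<open>k\<close>.\<close>

definition disc_index :: "nat \<Rightarrow> real \<Rightarrow> nat" where
  "disc_index k t = nat \<lfloor>real (Suc k) * t\<rfloor>"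

text \<open>With the numerator \<open>Suc i\<close> every grid time is positive, and it is at
  positive times that the characteristic function and the independence are given.\<close>

definition disc_time :: "nat \<Rightarrow> nat \<Rightarrow> real" where
  "disc_time k i = real (Suc i) / real (Suc k)"

lemma disc_time_pos: "0 < disc_time k i"
  by (simp add: disc_time_def)

lemma disc_time_gt:
  assumes "0 \<le> t"
  shows "t < disc_time k (disc_index k t)" "disc_time k (disc_index k t) \<le> t + 1 / real (Suc k)"
proof -
  define n where "n = real (Suc k)"
  have n: "0 < n" by (simp add: n_def)
  have "0 \<le> n * t" using n assms by simp
  then have f: "real (disc_index k t) = of_int \<lfloor>n * t\<rfloor>"
    by (simp add: disc_index_def n_def)
  have "n * t < real (disc_index k t) + 1" "real (disc_index k t) \<le> n * t"
    unfolding f by linarith+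
  then have "t < (real (disc_index k t) + 1) / n" "(real (disc_index k t) + 1) / n \<le> t + 1 / n"
    using n by (simp_all add: field_simps)
  then show "t < disc_time k (disc_index k t)" "disc_time k (disc_index k t) \<le> t + 1 / real (Suc k)"
    by (simp_all only: disc_time_def n_def of_nat_Suc add.commute)
qed

lemma disc_time_tendsto:
  assumes "0 \<le> t"
  shows "filterlim (\<lambda>k. disc_time k (disc_index k t)) (at_right t) sequentially"
  unfolding filterlim_at
proof (intro conjI always_eventually allI)
  show "(\<lambda>k. disc_time k (disc_index k t)) \<longlonglongrightarrow> t"
  proof (rule tendsto_sandwich)
    show "(\<lambda>k. t) \<longlonglongrightarrow> t" by simp
    show "(\<lambda>k. t + 1 / real (Suc k)) \<longlonglongrightarrow> t"
      using tendsto_add[OF tendsto_const[of t] inverse_Suc_tendsto_0] by simp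
  qed (use disc_time_gt[OF assms] less_imp_le in \<open>auto intro!: always_eventually simp del: of_nat_Suc\<close>)
qed (use disc_time_gt(1)[OF assms] disc_time_gt(1)[OF assms, THEN less_imp_not_eq2] in auto)

lemma right_continuous_disc:
  assumes "continuous (at_right t) f" "0 \<le> t"
  shows "(\<lambda>k. f (disc_time k (disc_index k t))) \<longlonglongrightarrow> f t"
  using filterlim_compose[OF _ disc_time_tendsto[OF assms(2)]] assms(1) by (simp add: continuous_within)

lemma disc_index_measurable [measurable]: "disc_index k \<in> borel \<rightarrow>\<^sub>M count_space UNIV"
  unfolding disc_index_def by measurable

text \<open>Right-continuity exhibits the process as a limit of processes that are constant on grid
  cells and therefore jointly measurable. The \<open>max 0 t\<close> extends it to the whole real
  line, the factor used in later product measures.\<close>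

lemma right_continuous_process_measurable:
  fixes X :: "real \<Rightarrow> 'w \<Rightarrow> 'a::euclidean_space"
  assumes m: "\<And>t. 0 \<le> t \<Longrightarrow> X t \<in> borel_measurable M"
    and rc: "\<And>\<omega> t. \<omega> \<in> space M \<Longrightarrow> 0 \<le> t \<Longrightarrow> continuous (at_right t) (\<lambda>s. X s \<omega>)"
  shows "(\<lambda>(t, \<omega>). X (max 0 t) \<omega>) \<in> borel_measurable ((borel :: real measure) \<Otimes>\<^sub>M M)"
proof (rule borel_measurable_LIMSEQ_metric)
  fix k
  have [measurable]: "X (disc_time k i) \<in> borel_measurable M" for i
    using m disc_time_pos less_imp_le by blast
  have "(\<lambda>p. X (disc_time k i) (snd p)) \<in> borel_measurable ((borel :: real measure) \<Otimes>\<^sub>M M)" for i by measurable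
  moreover have "(\<lambda>p. disc_index k (max 0 (fst p))) \<in> ((borel :: real measure) \<Otimes>\<^sub>M M) \<rightarrow>\<^sub>M count_space UNIV" by measurable
  ultimately show "(\<lambda>p. X (disc_time k (disc_index k (max 0 (fst p)))) (snd p)) \<in> borel_measurable ((borel :: real measure) \<Otimes>\<^sub>M M)"
    by (rule measurable_compose_countable)
next
  fix p assume "p \<in> space ((borel :: real measure) \<Otimes>\<^sub>M M)"
  then have "snd p \<in> space M" by (auto simp: space_pair_measure)
  from right_continuous_disc[OF rc[OF this, of "max 0 (fst p)"]]
  show "(\<lambda>k. X (disc_time k (disc_index k (max 0 (fst p)))) (snd p)) \<longlonglongrightarrow> (case p of (t, \<omega>) \<Rightarrow> X (max 0 t) \<omega>)"
    by (simp add: split_beta)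
qed

lemma sigma_sets_comp_subset_process_sigma:
  fixes f :: "'a::topological_space \<Rightarrow> 'b::topological_space"
  assumes "0 < u" and f: "f \<in> borel_measurable borel"
  shows "sigma_sets (space M) {(\<lambda>\<omega>. f (Z u \<omega>)) -` A \<inter> space M | A. A \<in> sets borel} \<subseteq> process_sigma M Z"
  unfolding process_sigma_def
proof (rule sigma_sets_mono', safe)
  fix A :: "'b set" assume "A \<in> sets borel"
  then have "f -` A \<in> sets borel" using measurable_sets[OF f] by simp
  then show "\<exists>t B. (\<lambda>\<omega>. f (Z u \<omega>)) -` A \<inter> space M = Z t -` B \<inter> space M \<and> 0 < t \<and> B \<in> sets borel"
    using \<open>0 < u\<close> by (intro exI[of _ u] exI[of _ "f -` A"]) auto
qed

lemma indep_processes_imp_indep_var: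
  fixes g :: "'a::topological_space \<Rightarrow> 'c::topological_space" and h :: "'b::topological_space \<Rightarrow> 'c"
  assumes "prob_space M" "indep_processes M X Y" "0 < s" "0 < t"
    and [measurable]: "X s \<in> borel_measurable M" "Y t \<in> borel_measurable M"
    and gh[measurable]: "g \<in> borel_measurable borel" "h \<in> borel_measurable borel"
  shows "prob_space.indep_var M borel (\<lambda>\<omega>. g (X s \<omega>)) borel (\<lambda>\<omega>. h (Y t \<omega>))"
proof -
  interpret prob_space M by fact
  have "indep_set (process_sigma M X) (process_sigma M Y)"
    using assms(2) by (simp add: indep_processes_def)
  then have "indep_set (sigma_sets (space M) {(\<lambda>\<omega>. g (X s \<omega>)) -` A \<inter> space M | A. A \<in> sets borel})
      (sigma_sets (space M) {(\<lambda>\<omega>. h (Y t \<omega>)) -` A \<inter> space M | A. A \<in> sets borel})"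
    unfolding indep_set_def
    by (rule indep_sets_mono_sets)
      (use assms(3,4) gh in \<open>simp split: bool.split add: sigma_sets_comp_subset_process_sigma\<close>)
  then show ?thesis by (simp add: indep_var_eq)
qed

text \<open>Splits the expectation according to the value of the random index. The modulus of the
  term \<open>i\<close> integrates to at most the probability that \<open>I\<close> equals
  \<open>i\<close>, so the series converges absolutely.\<close>

lemma integral_countable_index:
  fixes Z :: "nat \<Rightarrow> 'w \<Rightarrow> complex"
  assumes "prob_space M" and I[measurable]: "I \<in> M \<rightarrow>\<^sub>M count_space UNIV"
    and [measurable]: "\<And>i. Z i \<in> borel_measurable M" and B: "\<And>i \<omega>. norm (Z i \<omega>) \<le> 1"
  shows "(\<integral>\<omega>. Z (I \<omega>) \<omega> \<partial>M) = (\<Sum>i. \<integral>\<omega>. (if I \<omega> = i then Z i \<omega> else 0) \<partial>M)"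
proof -
  interpret prob_space M by fact
  define f where "f i \<omega> = (if I \<omega> = i then Z i \<omega> else 0)" for i \<omega>
  have [measurable]: "f i \<in> borel_measurable M" for i unfolding f_def by measurable
  have fn: "norm (f i \<omega>) \<le> indicator {i} (I \<omega>)" for i \<omega>
    using B by (simp add: f_def)
  have int: "integrable M (f i)" for i
    by (rule integrable_const_bound[of _ 1]) (use fn order_trans[OF fn indicator_le_1] in auto)
  have sums: "(\<lambda>i. f i \<omega>) sums Z (I \<omega>) \<omega>" for \<omega>
    using sums_single[of "I \<omega>" "\<lambda>i. Z i \<omega>"] by (simp add: f_def eq_commute)
  have sn: "summable (\<lambda>i. norm (f i \<omega>))" for \<omega>
    by (rule summable_finite[of "{I \<omega>}"]) (auto simp: f_def)
  have "summable (\<lambda>i. measure M (I -` {i} \<inter> space M))"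
    by (rule sums_summable[OF finite_measure_UNION]) (auto simp: disjoint_family_on_def)
  then have si: "summable (\<lambda>i. \<integral>\<omega>. norm (f i \<omega>) \<partial>M)"
  proof (rule summable_comparison_test')
    fix i
    have "(\<integral>\<omega>. norm (f i \<omega>) \<partial>M) \<le> (\<integral>\<omega>. indicator (I -` {i} \<inter> space M) \<omega> \<partial>M)"
    proof (rule integral_mono)
      show "integrable M (\<lambda>\<omega>. indicator (I -` {i} \<inter> space M) \<omega> :: real)"
        by (intro integrable_real_indicator) (auto simp: emeasure_finite less_top[symmetric])
    qed (use int fn in \<open>auto simp: indicator_def\<close>)
    then show "norm (\<integral>\<omega>. norm (f i \<omega>) \<partial>M) \<le> measure M (I -` {i} \<inter> space M)"
      by simp
  qed
  have "(\<integral>\<omega>. (\<Sum>i. f i \<omega>) \<partial>M) = (\<Sum>i. \<integral>\<omega>. f i \<omega> \<partial>M)"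
    by (rule integral_suminf[OF int AE_I2[OF sn] si])
  then show ?thesis using sums by (simp add: sums_iff f_def)
qed

text \<open>Conditioning on \<open>T\<close> is done on a grid. On the event that \<open>T\<close>
  lies in a given cell, \<open>S\<close> is evaluated at a fixed time, where independence factorises
  the expectation; right-continuity of the paths then removes the grid.\<close>

lemma stable_at_random_time:
  fixes S :: "real \<Rightarrow> 'w \<Rightarrow> 'a::euclidean_space" and T :: "'w \<Rightarrow> real"
  assumes "prob_space M" and S: "isotropic_stable_process M \<beta> S"
    and T[measurable]: "T \<in> borel_measurable M" and T0: "\<And>\<omega>. 0 \<le> T \<omega>"
    and indep: "\<And>s (g :: 'a \<Rightarrow> complex) h. 0 < s \<Longrightarrow> g \<in> borel_measurable borel \<Longrightarrow> h \<in> borel_measurable borel \<Longrightarrow>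
      prob_space.indep_var M borel (\<lambda>\<omega>. g (S s \<omega>)) borel (\<lambda>\<omega>. h (T \<omega>))"
  shows "(\<lambda>\<omega>. S (T \<omega>) \<omega>) \<in> borel_measurable M"
    and "(\<integral>\<omega>. exp (\<i> * complex_of_real (\<xi> \<bullet> S (T \<omega>) \<omega>)) \<partial>M) = complex_of_real (\<integral>\<omega>. exp (- T \<omega> * norm \<xi> powr (2 * \<beta>)) \<partial>M)"
proof -
  interpret prob_space M by fact
  have Sm: "S t \<in> borel_measurable M" if "0 \<le> t" for t
    using S that by (auto simp: isotropic_stable_process_def levy_process_def)
  have rc: "continuous (at_right t) (\<lambda>s. S s \<omega>)" if "\<omega> \<in> space M" "0 \<le> t" for \<omega> t
    using S that by (auto simp: isotropic_stable_process_def levy_process_def)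
  have char: "(\<integral>\<omega>. exp (\<i> * complex_of_real (\<xi> \<bullet> S t \<omega>)) \<partial>M) = complex_of_real (exp (- t * norm \<xi> powr (2 * \<beta>)))" if "0 < t" for t
    using S that by (auto simp: isotropic_stable_process_def)
  have "(\<lambda>(t, \<omega>). S (max 0 t) \<omega>) \<in> borel_measurable ((borel :: real measure) \<Otimes>\<^sub>M M)"
    by (rule right_continuous_process_measurable[OF Sm rc])
  moreover have "(\<lambda>\<omega>. (T \<omega>, \<omega>)) \<in> M \<rightarrow>\<^sub>M borel \<Otimes>\<^sub>M M" by measurable
  ultimately have "(\<lambda>\<omega>. case (T \<omega>, \<omega>) of (t, \<omega>) \<Rightarrow> S (max 0 t) \<omega>) \<in> borel_measurable M"
    by (rule measurable_compose[rotated])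
  then show m[measurable]: "(\<lambda>\<omega>. S (T \<omega>) \<omega>) \<in> borel_measurable M" using T0 by (simp add: max_absorb2)
  define I where "I k \<omega> = disc_index k (T \<omega>)" for k \<omega>
  have [measurable]: "I k \<in> M \<rightarrow>\<^sub>M count_space UNIV" for k unfolding I_def by measurable
  have [measurable]: "S (disc_time k i) \<in> borel_measurable M" for k i
    using Sm disc_time_pos less_imp_le by blast
  define e where "e t = complex_of_real (exp (- t * norm \<xi> powr (2 * \<beta>)))" for t
  have eq: "(\<integral>\<omega>. exp (\<i> * complex_of_real (\<xi> \<bullet> S (disc_time k (I k \<omega>)) \<omega>)) \<partial>M) = (\<integral>\<omega>. e (disc_time k (I k \<omega>)) \<partial>M)" for k
  proof -
    have trm: "(\<integral>\<omega>. (if I k \<omega> = i then exp (\<i> * complex_of_real (\<xi> \<bullet> S (disc_time k i) \<omega>)) else 0) \<partial>M)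
      = (\<integral>\<omega>. (if I k \<omega> = i then e (disc_time k i) else 0) \<partial>M)" for i
    proof -
      let ?g = "\<lambda>x. exp (\<i> * complex_of_real (\<xi> \<bullet> x))"
      \<comment> \<open>The indicator of the cell; multiplied by \<open>?g\<close> at the grid time
        it reproduces one term of the decomposition by index.\<close>
      let ?h = "\<lambda>t. if disc_index k t = i then 1 else 0 :: complex"
      have "indep_var borel (\<lambda>\<omega>. ?g (S (disc_time k i) \<omega>)) borel (\<lambda>\<omega>. ?h (T \<omega>))"
        by (rule indep[OF disc_time_pos]) measurable
      then have "(\<integral>\<omega>. ?g (S (disc_time k i) \<omega>) * ?h (T \<omega>) \<partial>M) = (\<integral>\<omega>. ?g (S (disc_time k i) \<omega>) \<partial>M) * (\<integral>\<omega>. ?h (T \<omega>) \<partial>M)"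
        by (intro indep_var_lebesgue_integral)
          (auto intro!: integrable_const_bound[of _ 1])
      also have "\<dots> = (\<integral>\<omega>. e (disc_time k i) * ?h (T \<omega>) \<partial>M)"
        by (simp add: char disc_time_pos e_def)
      finally show ?thesis by (simp add: I_def if_distrib cong: if_cong)
    qed
    have e1: "norm (e (disc_time k i)) \<le> 1" for i
      using disc_time_pos[of k i] by (simp add: e_def)
    show ?thesis
      using integral_countable_index[OF prob_space_axioms, of "I k" "\<lambda>i \<omega>. exp (\<i> * complex_of_real (\<xi> \<bullet> S (disc_time k i) \<omega>))"]
        integral_countable_index[OF prob_space_axioms, of "I k" "\<lambda>i \<omega>. e (disc_time k i)"] e1
      by (simp add: trm)
  qed
  have lim1: "(\<lambda>k. \<integral>\<omega>. exp (\<i> * complex_of_real (\<xi> \<bullet> S (disc_time k (I k \<omega>)) \<omega>)) \<partial>M) \<longlonglongrightarrow> (\<integral>\<omega>. exp (\<i> * complex_of_real (\<xi> \<bullet> S (T \<omega>) \<omega>)) \<partial>M)"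
  proof (rule integral_dominated_convergence[where w="\<lambda>_. 1"])
    show "(\<lambda>\<omega>. exp (\<i> * complex_of_real (\<xi> \<bullet> S (disc_time k (I k \<omega>)) \<omega>))) \<in> borel_measurable M" for k
      by (rule measurable_compose_countable[of "\<lambda>i \<omega>. exp (\<i> * complex_of_real (\<xi> \<bullet> S (disc_time k i) \<omega>))"]) measurable
    show "AE \<omega> in M. (\<lambda>k. exp (\<i> * complex_of_real (\<xi> \<bullet> S (disc_time k (I k \<omega>)) \<omega>))) \<longlonglongrightarrow> exp (\<i> * complex_of_real (\<xi> \<bullet> S (T \<omega>) \<omega>))"
      unfolding I_def using T0
      by (intro AE_I2 tendsto_intros right_continuous_disc[of _ "\<lambda>s. S s _"] rc) auto
  qed auto
  have lim2: "(\<lambda>k. \<integral>\<omega>. e (disc_time k (I k \<omega>)) \<partial>M) \<longlonglongrightarrow> (\<integral>\<omega>. e (T \<omega>) \<partial>M)"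
  proof (rule integral_dominated_convergence[where w="\<lambda>_. 1"])
    show "(\<lambda>\<omega>. e (disc_time k (I k \<omega>))) \<in> borel_measurable M" for k
      by (rule measurable_compose_countable[of "\<lambda>i \<omega>. e (disc_time k i)"]) measurable
    show "(\<lambda>\<omega>. e (T \<omega>)) \<in> borel_measurable M" unfolding e_def by measurable
    show "AE \<omega> in M. (\<lambda>k. e (disc_time k (I k \<omega>))) \<longlonglongrightarrow> e (T \<omega>)"
      unfolding I_def e_def using T0
      by (intro AE_I2 tendsto_intros right_continuous_disc[of _ "\<lambda>s. s"]) auto
    show "AE \<omega> in M. norm (e (disc_time k (I k \<omega>))) \<le> 1" for k
      by (auto simp: e_def intro!: AE_I2 mult_nonneg_nonneg less_imp_le[OF disc_time_pos])
  qed auto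
  have "(\<integral>\<omega>. exp (\<i> * complex_of_real (\<xi> \<bullet> S (T \<omega>) \<omega>)) \<partial>M) = (\<integral>\<omega>. e (T \<omega>) \<partial>M)"
    using lim1 lim2 unfolding eq by (rule LIMSEQ_unique)
  then show "(\<integral>\<omega>. exp (\<i> * complex_of_real (\<xi> \<bullet> S (T \<omega>) \<omega>)) \<partial>M) = complex_of_real (\<integral>\<omega>. exp (- T \<omega> * norm \<xi> powr (2 * \<beta>)) \<partial>M)"
    unfolding e_def by simp
qed

text \<open>On the product of two copies of \<open>M\<close>, one carrying \<open>T\<close> and the
  other \<open>S\<close>, the variable has the same transform and hence the same law. There Fubini
  applies, and almost every slice is a stable law at a fixed positive time, whose transform is
  integrable.\<close>

lemma stable_at_random_time_absolutely_continuous: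
  fixes S :: "real \<Rightarrow> 'w \<Rightarrow> 'a::euclidean_space" and T :: "'w \<Rightarrow> real"
  assumes "prob_space M" and S: "isotropic_stable_process M \<beta> S" and "0 < \<beta>"
    and T[measurable]: "T \<in> borel_measurable M" and T0: "\<And>\<omega>. 0 \<le> T \<omega>" and Tpos: "AE \<omega> in M. 0 < T \<omega>"
    and indep: "\<And>s (g :: 'a \<Rightarrow> complex) h. 0 < s \<Longrightarrow> g \<in> borel_measurable borel \<Longrightarrow> h \<in> borel_measurable borel \<Longrightarrow>
      prob_space.indep_var M borel (\<lambda>\<omega>. g (S s \<omega>)) borel (\<lambda>\<omega>. h (T \<omega>))"
    and N: "N \<in> sets borel" "emeasure lborel N = 0"
  shows "emeasure (distr M borel (\<lambda>\<omega>. S (T \<omega>) \<omega>)) N = 0"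
proof -
  interpret prob_space M by fact
  interpret P: pair_prob_space M M ..
  note st = stable_at_random_time[OF assms(1,2) T T0 indep]
  have [measurable]: "(\<lambda>\<omega>. S (T \<omega>) \<omega>) \<in> borel_measurable M" by (rule st)
  have Sm: "S t \<in> borel_measurable M" if "0 \<le> t" for t
    using S that by (auto simp: isotropic_stable_process_def levy_process_def)
  have rc: "continuous (at_right t) (\<lambda>s. S s \<omega>)" if "\<omega> \<in> space M" "0 \<le> t" for \<omega> t
    using S that by (auto simp: isotropic_stable_process_def levy_process_def)
  have char: "(\<integral>\<omega>. exp (\<i> * complex_of_real (\<xi> \<bullet> S t \<omega>)) \<partial>M) = complex_of_real (exp (- t * norm \<xi> powr (2 * \<beta>)))" if "0 < t" for t \<xi>
    using S that by (auto simp: isotropic_stable_process_def)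
  have "(\<lambda>(t, \<omega>). S (max 0 t) \<omega>) \<in> borel_measurable ((borel :: real measure) \<Otimes>\<^sub>M M)"
    by (rule right_continuous_process_measurable[OF Sm rc])
  moreover have "(\<lambda>(\<omega>', \<omega>). (T \<omega>', \<omega>)) \<in> M \<Otimes>\<^sub>M M \<rightarrow>\<^sub>M borel \<Otimes>\<^sub>M M" by measurable
  ultimately have "(\<lambda>p. case (case p of (\<omega>', \<omega>) \<Rightarrow> (T \<omega>', \<omega>)) of (t, \<omega>) \<Rightarrow> S (max 0 t) \<omega>) \<in> borel_measurable (M \<Otimes>\<^sub>M M)"
    by (rule measurable_compose[rotated])
  then have V[measurable]: "(\<lambda>(\<omega>', \<omega>). S (T \<omega>') \<omega>) \<in> borel_measurable (M \<Otimes>\<^sub>M M)"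
    using T0 by (simp add: max_absorb2 split_beta)
  have "distr M borel (\<lambda>\<omega>. S (T \<omega>) \<omega>) = distr (M \<Otimes>\<^sub>M M) borel (\<lambda>(\<omega>', \<omega>). S (T \<omega>') \<omega>)"
  proof (rule finite_measure_fourier_unique)
    show "finite_measure (distr M borel (\<lambda>\<omega>. S (T \<omega>) \<omega>))"
      by (intro finite_measure_distr) measurable
    show "finite_measure (distr (M \<Otimes>\<^sub>M M) borel (\<lambda>(\<omega>', \<omega>). S (T \<omega>') \<omega>))"
      by (intro P.P.finite_measure_distr) measurable
    fix \<xi> :: 'a
    have "weighted_fourier (distr (M \<Otimes>\<^sub>M M) borel (\<lambda>(\<omega>', \<omega>). S (T \<omega>') \<omega>)) (\<lambda>_. 1) \<xi>
      = (\<integral>p. exp (\<i> * complex_of_real (\<xi> \<bullet> (case p of (\<omega>', \<omega>) \<Rightarrow> S (T \<omega>') \<omega>))) \<partial>(M \<Otimes>\<^sub>M M))"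
      unfolding weighted_fourier_def by (subst integral_distr) auto
    also have "\<dots> = (\<integral>\<omega>'. \<integral>\<omega>. exp (\<i> * complex_of_real (\<xi> \<bullet> S (T \<omega>') \<omega>)) \<partial>M \<partial>M)"
      by (subst P.integral_fst'[symmetric]) (auto intro!: P.P.integrable_const_bound[of _ 1] simp: split_beta)
    also have "\<dots> = (\<integral>\<omega>'. complex_of_real (exp (- T \<omega>' * norm \<xi> powr (2 * \<beta>))) \<partial>M)"
    proof (rule integral_cong_AE)
      show "AE \<omega>' in M. (\<integral>\<omega>. exp (\<i> * complex_of_real (\<xi> \<bullet> S (T \<omega>') \<omega>)) \<partial>M) = complex_of_real (exp (- T \<omega>' * norm \<xi> powr (2 * \<beta>)))"
        using Tpos by eventually_elim (rule char)
      show "(\<lambda>\<omega>'. \<integral>\<omega>. exp (\<i> * complex_of_real (\<xi> \<bullet> S (T \<omega>') \<omega>)) \<partial>M) \<in> borel_measurable M"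
        by (rule borel_measurable_lebesgue_integral) measurable
    qed measurable
    also have "\<dots> = complex_of_real (\<integral>\<omega>. exp (- T \<omega> * norm \<xi> powr (2 * \<beta>)) \<partial>M)" by simp
    also have "\<dots> = weighted_fourier (distr M borel (\<lambda>\<omega>. S (T \<omega>) \<omega>)) (\<lambda>_. 1) \<xi>"
      unfolding weighted_fourier_def by (subst integral_distr) (auto simp: st(2))
    finally show "weighted_fourier (distr M borel (\<lambda>\<omega>. S (T \<omega>) \<omega>)) (\<lambda>_. 1) \<xi>
      = weighted_fourier (distr (M \<Otimes>\<^sub>M M) borel (\<lambda>(\<omega>', \<omega>). S (T \<omega>') \<omega>)) (\<lambda>_. 1) \<xi>" ..
  qed auto
  then have "emeasure (distr M borel (\<lambda>\<omega>. S (T \<omega>) \<omega>)) N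
    = emeasure (M \<Otimes>\<^sub>M M) ((\<lambda>(\<omega>', \<omega>). S (T \<omega>') \<omega>) -` N \<inter> space (M \<Otimes>\<^sub>M M))"
    using N by (simp add: emeasure_distr)
  also have "\<dots> = (\<integral>\<^sup>+\<omega>'. emeasure M (Pair \<omega>' -` ((\<lambda>(\<omega>', \<omega>). S (T \<omega>') \<omega>) -` N \<inter> space (M \<Otimes>\<^sub>M M))) \<partial>M)"
    using measurable_sets[OF V N(1)] by (rule emeasure_pair_measure_alt)
  also have "\<dots> = (\<integral>\<^sup>+\<omega>'. 0 \<partial>M)"
  proof (rule nn_integral_cong_AE)
    show "AE \<omega>' in M. emeasure M (Pair \<omega>' -` ((\<lambda>(\<omega>', \<omega>). S (T \<omega>') \<omega>) -` N \<inter> space (M \<Otimes>\<^sub>M M))) = 0"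
      using Tpos
    proof eventually_elim
      case (elim \<omega>')
      have [measurable]: "S (T \<omega>') \<in> borel_measurable M" using Sm T0 by blast
      interpret D: prob_space "distr M borel (S (T \<omega>'))" by (rule prob_space_distr) measurable
      have wf: "weighted_fourier (distr M borel (S (T \<omega>'))) (\<lambda>_. 1) = (\<lambda>\<xi>. complex_of_real (exp (- T \<omega>' * norm \<xi> powr (2 * \<beta>))))"
        unfolding weighted_fourier_def fun_eq_iff by (subst integral_distr) (auto simp: char[OF elim])
      have "integrable lborel (weighted_fourier (distr M borel (S (T \<omega>'))) (\<lambda>_. 1))"
        unfolding wf using integrable_exp_norm_powr[OF elim, of "2 * \<beta>"] \<open>0 < \<beta>\<close> by (intro integrable_of_real) auto
      from fourier_integrable_imp_absolutely_continuous[OF D.finite_measure_axioms _ this N]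
      have "emeasure M (S (T \<omega>') -` N \<inter> space M) = 0" using N by (simp add: emeasure_distr)
      moreover have "Pair \<omega>' -` ((\<lambda>(\<omega>', \<omega>). S (T \<omega>') \<omega>) -` N \<inter> space (M \<Otimes>\<^sub>M M)) \<subseteq> S (T \<omega>') -` N \<inter> space M"
        by (auto simp: space_pair_measure)
      moreover have "S (T \<omega>') -` N \<inter> space M \<in> sets M" using N by measurable
      ultimately show ?case by (metis emeasure_mono le_zero_eq)
    qed
  qed
  finally show ?thesis by simp
qed

section \<open>The inverse process and its Laplace transform\<close>

lemma subordinatorD:
  assumes "stable_subordinator M \<alpha> H"
  shows "prob_space M" "0 \<le> t \<Longrightarrow> H t \<in> borel_measurable M" "AE \<omega> in M. H 0 \<omega> = 0"
    "\<omega> \<in> space M \<Longrightarrow> 0 \<le> t \<Longrightarrow> continuous (at_right t) (\<lambda>s. H s \<omega>)"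
    "\<omega> \<in> space M \<Longrightarrow> 0 \<le> s \<Longrightarrow> s \<le> t \<Longrightarrow> H s \<omega> \<le> H t \<omega>"
  using assms by (auto simp: stable_subordinator_def levy_process_def mono_on_def)

lemma subordinator_laplace:
  assumes "stable_subordinator M \<alpha> H" "0 < t" "0 < \<mu>"
  shows "(\<integral>\<omega>. exp (- \<mu> * H t \<omega>) \<partial>M) = exp (- t * \<mu> powr \<alpha>)"
proof (cases "\<alpha> = 1")
  case True
  interpret prob_space M using subordinatorD(1)[OF assms(1)] .
  have "(\<integral>\<omega>. exp (- \<mu> * H t \<omega>) \<partial>M) = (\<integral>\<omega>. exp (- \<mu> * t) \<partial>M)"
    using assms True by (intro Bochner_Integration.integral_cong) (auto simp: stable_subordinator_def)
  then show ?thesis using True assms by (simp add: prob_space mult.commute)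
next
  case False
  then show ?thesis using assms by (simp add: stable_subordinator_def)
qed

lemma subordinator_nonneg:
  assumes "stable_subordinator M \<alpha> H" "0 \<le> t"
  shows "AE \<omega> in M. 0 \<le> H t \<omega>"
  using subordinatorD(3)[OF assms(1)] AE_space
proof eventually_elim
  case (elim \<omega>)
  then show ?case using subordinatorD(5)[OF assms(1), of \<omega> 0 t] assms(2) by simp
qed

lemma nn_integral_exp_tail:
  fixes h \<mu> :: real
  assumes "0 < \<mu>"
  shows "(\<integral>\<^sup>+t. ennreal (exp (- \<mu> * t)) * indicator {h<..} t \<partial>lborel) = ennreal (exp (- \<mu> * h) / \<mu>)"
proof -
  have lim: "((\<lambda>t. - exp (- \<mu> * t) / \<mu>) \<longlongrightarrow> 0) at_top"
    using assms by real_asymp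
  have "(\<integral>\<^sup>+t. ennreal (exp (- \<mu> * t)) * indicator {h<..} t \<partial>lborel) = (\<integral>\<^sup>+t. ennreal (exp (- \<mu> * t)) * indicator {h..} t \<partial>lborel)"
    by (rule nn_integral_cong_AE) (use AE_lborel_singleton[of h] in \<open>eventually_elim, auto simp: indicator_def\<close>)
  also have "\<dots> = ennreal (0 - (- exp (- \<mu> * h) / \<mu>))"
    by (rule nn_integral_FTC_atLeast[where F="\<lambda>t. - exp (- \<mu> * t) / \<mu>" and f="\<lambda>t. exp (- \<mu> * t)"])
      (use assms lim in \<open>auto intro!: derivative_eq_intros\<close>)
  finally show ?thesis by simp
qed

text \<open>Expresses \<open>1 - exp (- a * l)\<close> through the events \<open>x < l\<close>, the
  form in which an inverse process can be exchanged for the process itself.\<close>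

lemma nn_integral_exp_segment:
  fixes a l :: real
  assumes "0 < a" "0 \<le> l"
  shows "(\<integral>\<^sup>+x. ennreal (a * exp (- a * x)) * indicator {0..<l} x \<partial>lborel) = ennreal (1 - exp (- a * l))"
proof -
  have "(\<integral>\<^sup>+x. ennreal (a * exp (- a * x)) * indicator {0..<l} x \<partial>lborel) = (\<integral>\<^sup>+x. ennreal (a * exp (- a * x)) * indicator {0..l} x \<partial>lborel)"
    by (rule nn_integral_cong_AE) (use AE_lborel_singleton[of l] in \<open>eventually_elim, auto simp: indicator_def\<close>)
  also have "\<dots> = ennreal (- exp (- a * l) - (- exp (- a * 0)))"
    by (rule nn_integral_FTC_Icc[where F="\<lambda>x. - exp (- a * x)"])
      (use assms in \<open>auto intro!: derivative_eq_intros\<close>)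
  finally show ?thesis by simp
qed

locale telegraph_processes =
  fixes M :: "'w measure" and S :: "real \<Rightarrow> 'w \<Rightarrow> 'a::euclidean_space" and H1 H2 H :: "real \<Rightarrow> 'w \<Rightarrow> real"
    and \<nu> \<beta> c lam :: real
  assumes nu: "0 < \<nu>" "\<nu> \<le> 1 / 2" and beta: "0 < \<beta>" and c: "0 < c" and lam: "0 < lam"
    and S: "isotropic_stable_process M \<beta> S"
    and H1: "stable_subordinator M (2 * \<nu>) H1" and H2: "stable_subordinator M \<nu> H2"
    and indep_H1_H2: "indep_processes M H1 H2"
    and H: "H = (\<lambda>t \<omega>. H1 t \<omega> + (2 * lam) powr (1 / \<nu>) * H2 t \<omega>)"
    and indep_S_L: "indep_processes M S (inverse_process H)"
begin

abbreviation "L \<equiv> inverse_process H"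

sublocale prob_space M
  using subordinatorD(1)[OF H1] .

definition symbol :: "real \<Rightarrow> real" where
  "symbol \<mu> = \<mu> powr (2 * \<nu>) + 2 * lam * \<mu> powr \<nu>"

lemma symbol_pos: "0 < \<mu> \<Longrightarrow> 0 < symbol \<mu>"
  using lam by (simp add: symbol_def add_pos_pos)

lemma H_measurable: "0 \<le> t \<Longrightarrow> H t \<in> borel_measurable M"
  using subordinatorD(2)[OF H1] subordinatorD(2)[OF H2] unfolding H by simp

lemma H_mono: "\<omega> \<in> space M \<Longrightarrow> 0 \<le> s \<Longrightarrow> s \<le> t \<Longrightarrow> H s \<omega> \<le> H t \<omega>"
  unfolding H by (intro add_mono mult_left_mono subordinatorD(5)[OF H1] subordinatorD(5)[OF H2]) auto

lemma H_right_continuous: "\<omega> \<in> space M \<Longrightarrow> 0 \<le> t \<Longrightarrow> continuous (at_right t) (\<lambda>s. H s \<omega>)"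
  unfolding H by (intro continuous_intros subordinatorD(4)[OF H1] subordinatorD(4)[OF H2])

lemma H_0: "AE \<omega> in M. H 0 \<omega> = 0"
  using subordinatorD(3)[OF H1] subordinatorD(3)[OF H2] by eventually_elim (simp add: H)

lemma H_laplace:
  assumes "0 < s" "0 < \<mu>"
  shows "integrable M (\<lambda>\<omega>. exp (- \<mu> * H s \<omega>))" and "(\<integral>\<omega>. exp (- \<mu> * H s \<omega>) \<partial>M) = exp (- s * symbol \<mu>)"
proof -
  \<comment> \<open>Scaling a stable subordinator of index \<nu> by \<open>\<kappa>\<close>
    multiplies its exponent by \<open>\<kappa> powr \<nu>\<close>, which this choice makes equal to
    \<open>2 * lam\<close>.\<close>
  define \<kappa> where "\<kappa> = (2 * lam) powr (1 / \<nu>)"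
  have \<kappa>: "0 < \<kappa>" "\<kappa> powr \<nu> = 2 * lam" using lam nu by (simp_all add: \<kappa>_def powr_powr)
  have [measurable]: "H1 s \<in> borel_measurable M" "H2 s \<in> borel_measurable M"
    using assms subordinatorD(2)[OF H1] subordinatorD(2)[OF H2] by auto
  have i1: "integrable M (\<lambda>\<omega>. exp (- \<mu> * H1 s \<omega>))"
    using subordinator_nonneg[OF H1, of s] assms by (intro integrable_const_bound[of _ 1]) auto
  have i2: "integrable M (\<lambda>\<omega>. exp (- (\<mu> * \<kappa>) * H2 s \<omega>))"
    using subordinator_nonneg[OF H2, of s] assms \<kappa> by (intro integrable_const_bound[of _ 1]) auto
  have ind: "indep_var borel (\<lambda>\<omega>. exp (- \<mu> * H1 s \<omega>)) borel (\<lambda>\<omega>. exp (- (\<mu> * \<kappa>) * H2 s \<omega>))"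
    using indep_processes_imp_indep_var[OF prob_space_axioms indep_H1_H2 assms(1) assms(1), of "\<lambda>x. exp (- \<mu> * x)" "\<lambda>x. exp (- (\<mu> * \<kappa>) * x)"]
    by simp
  have e: "exp (- \<mu> * H s \<omega>) = exp (- \<mu> * H1 s \<omega>) * exp (- (\<mu> * \<kappa>) * H2 s \<omega>)" for \<omega>
    by (simp add: H \<kappa>_def algebra_simps flip: exp_add)
  show "integrable M (\<lambda>\<omega>. exp (- \<mu> * H s \<omega>))"
    unfolding e by (rule indep_var_integrable[OF ind i1 i2])
  have "(\<integral>\<omega>. exp (- \<mu> * H s \<omega>) \<partial>M) = exp (- s * \<mu> powr (2 * \<nu>)) * exp (- s * (\<mu> * \<kappa>) powr \<nu>)"
    unfolding e indep_var_lebesgue_integral[OF ind i1 i2]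
    using subordinator_laplace[OF H1 assms] subordinator_laplace[OF H2 assms(1), of "\<mu> * \<kappa>"] assms \<kappa> by simp
  also have "\<dots> = exp (- s * symbol \<mu>)"
    using assms \<kappa> by (simp add: symbol_def powr_mult algebra_simps flip: exp_add)
  finally show "(\<integral>\<omega>. exp (- \<mu> * H s \<omega>) \<partial>M) = exp (- s * symbol \<mu>)" .
qed

text \<open>The exponential Markov inequality with \<mu> = 1 bounds the probability that
  \<open>H (real (Suc n))\<close> stays below \<open>m\<close> by a quantity decaying geometrically
  in \<open>n\<close>.\<close>

lemma H_unbounded: "AE \<omega> in M. \<forall>t. \<exists>n. t \<le> H (real (Suc n)) \<omega>"
proof -
  have "AE \<omega> in M. \<exists>n. real m \<le> H (real (Suc n)) \<omega>" for m
  proof -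
    have [measurable]: "H (real (Suc n)) \<in> borel_measurable M" for n by (rule H_measurable) simp
    define E where "E = {\<omega> \<in> space M. \<forall>n. H (real (Suc n)) \<omega> < real m}"
    have [measurable]: "E \<in> sets M" unfolding E_def by measurable
    have bnd: "prob E \<le> exp (real m) * exp (- symbol 1) ^ Suc n" for n
    proof -
      have "prob E = (\<integral>\<omega>. indicator E \<omega> \<partial>M)" by simp
      also have "\<dots> \<le> (\<integral>\<omega>. exp (real m) * exp (- 1 * H (real (Suc n)) \<omega>) \<partial>M)"
      proof (rule integral_mono)
        show "integrable M (\<lambda>\<omega>. exp (real m) * exp (- 1 * H (real (Suc n)) \<omega>))"
          by (intro integrable_mult_right H_laplace) auto
        fix \<omega>
        show "indicator E \<omega> \<le> exp (real m) * exp (- 1 * H (real (Suc n)) \<omega>)"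
        proof (cases "\<omega> \<in> E")
          case True
          then have "H (real (Suc n)) \<omega> < real m" unfolding E_def by blast
          then show ?thesis using True by (simp flip: exp_add)
        qed simp
      qed (auto simp: emeasure_finite less_top[symmetric])
      also have "\<dots> = exp (real m) * exp (- real (Suc n) * symbol 1)"
        using H_laplace(2)[of "real (Suc n)" 1] by simp
      also have "exp (- real (Suc n) * symbol 1) = exp (- symbol 1) ^ Suc n"
        by (simp only: exp_of_nat_mult[symmetric] mult_minus_left mult_minus_right)
      finally show ?thesis .
    qed
    have "(\<lambda>n. exp (real m) * exp (- symbol 1) ^ Suc n) \<longlonglongrightarrow> exp (real m) * 0"
      using symbol_pos[of 1] by (intro tendsto_mult_left LIMSEQ_Suc LIMSEQ_realpow_zero) auto
    from LIMSEQ_le_const[OF this, of "prob E"] bnd have "prob E \<le> exp (real m) * 0" by blast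
    then have "prob E \<le> 0" by simp
    then have "prob E = 0" using measure_nonneg[of M E] by linarith
    then have "emeasure M E = 0" by (simp add: emeasure_eq_measure)
    then show ?thesis
      by (intro AE_I'[of E]) (use \<open>E \<in> sets M\<close> in \<open>auto simp: E_def null_sets_def not_le simp del: of_nat_Suc\<close>)
  qed
  then have "AE \<omega> in M. \<forall>m. \<exists>n. real m \<le> H (real (Suc n)) \<omega>"
    by (simp add: AE_all_countable)
  then show ?thesis
  proof eventually_elim
    case (elim \<omega>)
    show ?case
    proof
      fix t
      obtain m where "t \<le> real m" using real_arch_simple by blast
      with elim show "\<exists>n. t \<le> H (real (Suc n)) \<omega>" using order_trans by blast
    qed
  qed
qed

text \<open>The almost sure event on which the set in \<open>inverse_process\<close> is nonempty for
  every \<open>t\<close> and the path starts at 0, so that the infimum is a genuine first passage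
  time.\<close>

definition regular :: "'w \<Rightarrow> bool" where
  "regular \<omega> \<longleftrightarrow> \<omega> \<in> space M \<and> H 0 \<omega> = 0 \<and> (\<forall>t. \<exists>n. t \<le> H (real (Suc n)) \<omega>)"

lemma AE_regular: "AE \<omega> in M. regular \<omega>"
  using H_0 H_unbounded AE_space by eventually_elim (simp add: regular_def)

lemma L_nonneg: "0 \<le> L t \<omega>"
  by (auto simp: inverse_process_def Let_def intro!: cInf_greatest)

text \<open>The duality between a nondecreasing process and its first passage time. Strictness on
  both sides rests on right-continuity: a path below \<open>t\<close> at \<open>x\<close> stays
  below \<open>t\<close> for a while.\<close>

lemma L_gt_iff:
  assumes "regular \<omega>" "0 < t" "0 \<le> x"
  shows "x < L t \<omega> \<longleftrightarrow> H x \<omega> < t"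
proof -
  define A where "A = {s. 0 < s \<and> t \<le> H s \<omega>}"
  have \<omega>: "\<omega> \<in> space M" "H 0 \<omega> = 0" using assms by (auto simp: regular_def)
  obtain n where "t \<le> H (real (Suc n)) \<omega>" using assms by (auto simp: regular_def)
  then have "real (Suc n) \<in> A" by (simp add: A_def)
  then have A: "A \<noteq> {}" by blast
  have L: "L t \<omega> = Inf A" using A by (auto simp: inverse_process_def A_def Let_def)
  have bdd: "bdd_below A" unfolding A_def by (rule bdd_belowI[of _ 0]) auto
  show ?thesis
  proof
    assume *: "x < L t \<omega>"
    show "H x \<omega> < t"
    proof (rule ccontr)
      assume "\<not> H x \<omega> < t"
      \<comment> \<open>The infimum runs over positive times only; the value \<open>x = 0\<close> is
        excluded since the path starts at 0, which is less than \<open>t\<close>.\<close>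
      then have "x \<noteq> 0" "t \<le> H x \<omega>" using \<omega> assms by auto
      then have "x \<in> A" using assms by (simp add: A_def)
      then have "Inf A \<le> x" using bdd by (rule cInf_lower)
      then show False using * L by simp
    qed
  next
    assume "H x \<omega> < t"
    moreover have "((\<lambda>s. H s \<omega>) \<longlongrightarrow> H x \<omega>) (at_right x)"
      using H_right_continuous[OF \<omega>(1) assms(3)] by (simp add: continuous_within)
    ultimately have "\<forall>\<^sub>F s in at_right x. H s \<omega> < t" by (rule order_tendstoD(2)[rotated])
    then obtain y where y: "x < y" "\<And>s. x < s \<Longrightarrow> s < y \<Longrightarrow> H s \<omega> < t"
      by (auto simp: eventually_at_right_field)
    \<comment> \<open>By monotonicity no time before the midpoint belongs to \<open>A\<close>; going
      only up to the midpoint leaves the room needed for a strict inequality.\<close>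
    have "(x + y) / 2 \<le> s" if "s \<in> A" for s
    proof (rule ccontr)
      assume "\<not> (x + y) / 2 \<le> s"
      then have "s < (x + y) / 2" by simp
      then have "H s \<omega> \<le> H ((x + y) / 2) \<omega>" using that by (intro H_mono \<omega>) (auto simp: A_def)
      also have "\<dots> < t" using y by (intro y(2)) auto
      finally show False using that by (simp add: A_def)
    qed
    then have "(x + y) / 2 \<le> Inf A" using A by (intro cInf_greatest)
    then show "x < L t \<omega>" using y L by (simp add: field_simps)
  qed
qed

lemma L_mono:
  assumes "regular \<omega>" "0 < s" "s \<le> t"
  shows "L s \<omega> \<le> L t \<omega>"
proof (rule ccontr)
  assume "\<not> L s \<omega> \<le> L t \<omega>"
  then have "H (L t \<omega>) \<omega> < s" using L_gt_iff[OF assms(1,2) L_nonneg, of t \<omega>] by auto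
  then have "L t \<omega> < L t \<omega>" using L_gt_iff[OF assms(1) _ L_nonneg, of t t \<omega>] assms by auto
  then show False by simp
qed

lemma L_pos: "0 < t \<Longrightarrow> AE \<omega> in M. 0 < L t \<omega>"
  using AE_regular by eventually_elim (simp add: L_gt_iff regular_def)

text \<open>Measurability is read off the independence hypothesis: \<open>indep_set\<close> includes
  that both generated families consist of events.\<close>

lemma L_measurable: "0 < t \<Longrightarrow> L t \<in> borel_measurable M"
proof (rule measurableI)
  fix A :: "real set" assume "0 < t" "A \<in> sets borel"
  have "process_sigma M L \<subseteq> sets M"
    using indep_S_L indep_setD_ev2 unfolding indep_processes_def by blast
  moreover have "L t -` A \<inter> space M \<in> process_sigma M L"
    unfolding process_sigma_def using \<open>0 < t\<close> \<open>A \<in> sets borel\<close> by (intro sigma_sets.Basic) auto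
  ultimately show "L t -` A \<inter> space M \<in> sets M" by blast
qed simp

definition relax :: "real \<Rightarrow> real \<Rightarrow> real" where
  "relax a t = (\<integral>\<omega>. exp (- a * L t \<omega>) \<partial>M)"

lemma integrable_relax: "0 \<le> a \<Longrightarrow> 0 < t \<Longrightarrow> integrable M (\<lambda>\<omega>. exp (- a * L t \<omega>))"
  using L_measurable[of t] by (intro integrable_const_bound[of _ 1]) (auto simp: L_nonneg)

lemma relax_le_1: "0 \<le> a \<Longrightarrow> 0 < t \<Longrightarrow> relax a t \<le> 1"
  using integral_mono[OF integrable_relax, of a t "\<lambda>_. 1"] by (simp add: relax_def L_nonneg prob_space)

lemma relax_nonneg: "0 \<le> relax a t"
  by (simp add: relax_def)

lemma relax_antimono:
  assumes "0 \<le> a" "0 < s" "s \<le> t"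
  shows "relax a t \<le> relax a s"
  unfolding relax_def
proof (rule integral_mono_AE)
  show "AE \<omega> in M. exp (- a * L t \<omega>) \<le> exp (- a * L s \<omega>)"
    using AE_regular by eventually_elim (use assms in \<open>auto intro!: mult_left_mono L_mono\<close>)
qed (use assms integrable_relax[of a s] integrable_relax[of a t] in auto)

text \<open>Write \<open>1 - exp (- a * L)\<close> as the integral of
  \<open>a * exp (- a * x)\<close> over \<open>x < L\<close>, replace \<open>x < L t\<close> by
  \<open>H x < t\<close>, and integrate over \<open>t\<close> first. What remains is the Laplace
  transform of \<open>H x\<close>, integrated against an exponential in \<open>x\<close>.\<close>

lemma nn_integral_relax_laplace:
  assumes "0 < a" "0 < \<mu>"
  shows "(\<integral>\<^sup>+t. ennreal (exp (- \<mu> * t) * (1 - relax a t)) * indicator {0<..} t \<partial>lborel) = ennreal (1 / \<mu> * (a / (a + symbol \<mu>)))"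
    (is "?lhs = _")
proof -
  define HH where "HH = (\<lambda>(x, \<omega>). H (max 0 x) \<omega>)"
  have [measurable]: "HH \<in> borel_measurable (borel \<Otimes>\<^sub>M M)"
    unfolding HH_def by (rule right_continuous_process_measurable[OF H_measurable H_right_continuous])
  interpret P: pair_sigma_finite lborel M ..
  \<comment> \<open>A single nonnegative integrand for all three integrations, so that their order
    can be changed freely. The event \<open>H x < t\<close> enters as an indicator of a difference,
    which keeps it jointly measurable.\<close>
  define K where "K t x \<omega> = ennreal (exp (- \<mu> * t)) * indicator {0<..} t * (ennreal (a * exp (- a * x)) * indicator {0..} x) * indicator {0<..} (t - HH (x, \<omega>))" for t x \<omega>
  have Km[measurable]: "(\<lambda>p. K (f p) (g p) (h p)) \<in> borel_measurable N"
    if [measurable]: "f \<in> borel_measurable N" "g \<in> borel_measurable N" "h \<in> N \<rightarrow>\<^sub>M M" for f g h and N :: "'d measure"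
    unfolding K_def by measurable
  have 1: "ennreal (exp (- \<mu> * t) * (1 - relax a t)) * indicator {0<..} t = (\<integral>\<^sup>+\<omega>. \<integral>\<^sup>+x. K t x \<omega> \<partial>lborel \<partial>M)" for t
  proof (cases "0 < t")
    case True
    have [measurable]: "L t \<in> borel_measurable M" using True by (rule L_measurable)
    have "ennreal (1 - relax a t) = ennreal (\<integral>\<omega>. 1 - exp (- a * L t \<omega>) \<partial>M)"
      using integrable_relax[of a t] True assms by (simp add: relax_def prob_space)
    also have "\<dots> = (\<integral>\<^sup>+\<omega>. ennreal (1 - exp (- a * L t \<omega>)) \<partial>M)"
      using integrable_relax[of a t] True assms by (intro nn_integral_eq_integral[symmetric]) (auto simp: L_nonneg)
    also have "\<dots> = (\<integral>\<^sup>+\<omega>. \<integral>\<^sup>+x. ennreal (a * exp (- a * x)) * indicator {0..} x * indicator {0<..} (t - HH (x, \<omega>)) \<partial>lborel \<partial>M)"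
    proof (rule nn_integral_cong_AE)
      show "AE \<omega> in M. ennreal (1 - exp (- a * L t \<omega>)) = (\<integral>\<^sup>+x. ennreal (a * exp (- a * x)) * indicator {0..} x * indicator {0<..} (t - HH (x, \<omega>)) \<partial>lborel)"
        using AE_regular
      proof eventually_elim
        case (elim \<omega>)
        show ?case
          unfolding nn_integral_exp_segment[OF assms(1) L_nonneg, symmetric]
          using L_gt_iff[OF elim True]
          by (intro nn_integral_cong) (auto simp: indicator_def HH_def max_absorb2)
      qed
    qed
    finally have "ennreal (1 - relax a t) = (\<integral>\<^sup>+\<omega>. \<integral>\<^sup>+x. ennreal (a * exp (- a * x)) * indicator {0..} x * indicator {0<..} (t - HH (x, \<omega>)) \<partial>lborel \<partial>M)" .
    moreover have "ennreal (exp (- \<mu> * t) * (1 - relax a t)) * indicator {0<..} t = ennreal (exp (- \<mu> * t)) * ennreal (1 - relax a t)"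
      using True by (simp add: ennreal_mult')
    moreover have "ennreal (exp (- \<mu> * t)) * (\<integral>\<^sup>+\<omega>. \<integral>\<^sup>+x. ennreal (a * exp (- a * x)) * indicator {0..} x * indicator {0<..} (t - HH (x, \<omega>)) \<partial>lborel \<partial>M)
      = (\<integral>\<^sup>+\<omega>. \<integral>\<^sup>+x. K t x \<omega> \<partial>lborel \<partial>M)"
    proof -
      have "(\<integral>\<^sup>+\<omega>. \<integral>\<^sup>+x. K t x \<omega> \<partial>lborel \<partial>M) = (\<integral>\<^sup>+\<omega>. ennreal (exp (- \<mu> * t)) * (\<integral>\<^sup>+x. ennreal (a * exp (- a * x)) * indicator {0..} x * indicator {0<..} (t - HH (x, \<omega>)) \<partial>lborel) \<partial>M)"
      proof (rule nn_integral_cong)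
        fix \<omega> assume [measurable]: "\<omega> \<in> space M"
        have "K t x \<omega> = ennreal (exp (- \<mu> * t)) * (ennreal (a * exp (- a * x)) * indicator {0..} x * indicator {0<..} (t - HH (x, \<omega>)))" for x
          using True by (simp add: K_def mult.assoc)
        then show "(\<integral>\<^sup>+x. K t x \<omega> \<partial>lborel) = ennreal (exp (- \<mu> * t)) * (\<integral>\<^sup>+x. ennreal (a * exp (- a * x)) * indicator {0..} x * indicator {0<..} (t - HH (x, \<omega>)) \<partial>lborel)"
          by (simp only:) (rule nn_integral_cmult, measurable)
      qed
      also have "\<dots> = ennreal (exp (- \<mu> * t)) * (\<integral>\<^sup>+\<omega>. \<integral>\<^sup>+x. ennreal (a * exp (- a * x)) * indicator {0..} x * indicator {0<..} (t - HH (x, \<omega>)) \<partial>lborel \<partial>M)"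
        by (rule nn_integral_cmult) measurable
      finally show ?thesis ..
    qed
    ultimately show ?thesis by simp
  next
    case False
    then show ?thesis by (simp add: K_def)
  qed
  have 2: "(\<integral>\<^sup>+t. K t x \<omega> \<partial>lborel) = ennreal (a * exp (- a * x)) * indicator {0..} x * ennreal (exp (- \<mu> * HH (x, \<omega>)) / \<mu>)"
    if "0 \<le> HH (x, \<omega>)" for x \<omega>
  proof -
    have "(\<integral>\<^sup>+t. K t x \<omega> \<partial>lborel) = (\<integral>\<^sup>+t. (ennreal (a * exp (- a * x)) * indicator {0..} x) * (ennreal (exp (- \<mu> * t)) * indicator {HH (x, \<omega>)<..} t) \<partial>lborel)"
      using that by (intro nn_integral_cong) (auto simp: K_def indicator_def mult.commute)
    then show ?thesis
      using nn_integral_exp_tail[OF assms(2), of "HH (x, \<omega>)"] by (simp add: nn_integral_cmult)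
  qed
  \<comment> \<open>The Laplace transform of \<open>H x\<close> is known for \<open>x > 0\<close>;
    the point \<open>x = 0\<close> is discarded below as a null set.\<close>
  have 3: "(\<integral>\<^sup>+\<omega>. \<integral>\<^sup>+t. K t x \<omega> \<partial>lborel \<partial>M) = ennreal (a / \<mu>) * (ennreal (exp (- (a + symbol \<mu>) * x)) * indicator {0<..} x)" if "x \<noteq> 0" for x
  proof (cases "0 < x")
    case True
    have "(\<integral>\<^sup>+\<omega>. \<integral>\<^sup>+t. K t x \<omega> \<partial>lborel \<partial>M) = (\<integral>\<^sup>+\<omega>. ennreal (a * exp (- a * x) / \<mu>) * ennreal (exp (- \<mu> * H x \<omega>)) \<partial>M)"
    proof (rule nn_integral_cong_AE)
      show "AE \<omega> in M. (\<integral>\<^sup>+t. K t x \<omega> \<partial>lborel) = ennreal (a * exp (- a * x) / \<mu>) * ennreal (exp (- \<mu> * H x \<omega>))"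
        using AE_regular
      proof eventually_elim
        case (elim \<omega>)
        then have "0 \<le> HH (x, \<omega>)" using H_mono[of \<omega> 0 x] True by (simp add: HH_def regular_def max_absorb2)
        from 2[OF this] show ?case using True assms
          by (simp add: HH_def max_absorb2 ennreal_mult'[symmetric])
      qed
    qed
    also have "\<dots> = ennreal (a * exp (- a * x) / \<mu>) * ennreal (exp (- x * symbol \<mu>))"
      using True assms H_laplace[of x \<mu>] H_measurable[of x] by (subst nn_integral_cmult) (auto simp: nn_integral_eq_integral)
    also have "\<dots> = ennreal (a / \<mu>) * (ennreal (exp (- (a + symbol \<mu>) * x)) * indicator {0<..} x)"
      using True assms by (simp add: ennreal_mult'[symmetric] algebra_simps flip: exp_add)
    finally show ?thesis .
  next
    case False
    then show ?thesis using that by (simp add: K_def)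
  qed
  have "?lhs = (\<integral>\<^sup>+t. \<integral>\<^sup>+\<omega>. \<integral>\<^sup>+x. K t x \<omega> \<partial>lborel \<partial>M \<partial>lborel)"
    unfolding 1 ..
  also have "\<dots> = (\<integral>\<^sup>+t. \<integral>\<^sup>+x. \<integral>\<^sup>+\<omega>. K t x \<omega> \<partial>M \<partial>lborel \<partial>lborel)"
    by (intro nn_integral_cong P.Fubini') measurable
  also have "\<dots> = (\<integral>\<^sup>+x. \<integral>\<^sup>+t. \<integral>\<^sup>+\<omega>. K t x \<omega> \<partial>M \<partial>lborel \<partial>lborel)"
    by (rule lborel_pair.Fubini') measurable
  also have "\<dots> = (\<integral>\<^sup>+x. \<integral>\<^sup>+\<omega>. \<integral>\<^sup>+t. K t x \<omega> \<partial>lborel \<partial>M \<partial>lborel)"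
    by (intro nn_integral_cong P.Fubini'[symmetric]) measurable
  also have "\<dots> = (\<integral>\<^sup>+x. ennreal (a / \<mu>) * (ennreal (exp (- (a + symbol \<mu>) * x)) * indicator {0<..} x) \<partial>lborel)"
    by (rule nn_integral_cong_AE) (use AE_lborel_singleton[of 0] in \<open>eventually_elim, simp add: 3\<close>)
  also have "\<dots> = ennreal (a / \<mu>) * ennreal (exp (- (a + symbol \<mu>) * 0) / (a + symbol \<mu>))"
    by (subst nn_integral_cmult, measurable)
      (simp only: nn_integral_exp_tail[OF add_pos_pos[OF assms(1) symbol_pos[OF assms(2)]]])
  also have "\<dots> = ennreal (1 / \<mu> * (a / (a + symbol \<mu>)))"
    using assms symbol_pos[OF assms(2)] by (simp add: ennreal_mult'[symmetric])
  finally show ?thesis .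
qed

end

lemma telegraph_ml_nonpos: "t \<le> 0 \<Longrightarrow> telegraph_ml \<nu> l a \<delta> t = 0"
  by (simp add: telegraph_ml_def ml_series_def frac_kernel_def)

context telegraph_processes
begin

lemma has_bochner_integral_relax_laplace:
  assumes "0 < a" "0 < \<mu>"
  shows "has_bochner_integral lborel (\<lambda>t. indicator {0<..} t *\<^sub>R (exp (- \<mu> * t) * (relax a t - 1))) (- (1 / \<mu> * (a / (a + symbol \<mu>))))"
proof -
  \<comment> \<open>Extended by 0, this is nondecreasing on the whole line, and measurability in
    \<open>t\<close> follows from monotonicity.\<close>
  define m where "m t = (if 0 < t then 1 - relax a t else 0)" for t
  have "mono m"
    using relax_antimono[of a] relax_le_1[of a] assms by (auto simp: mono_def m_def)
  then have [measurable]: "m \<in> borel_measurable borel" by (rule borel_measurable_mono)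
  have m0: "0 \<le> m t" for t using relax_le_1[of a t] assms by (simp add: m_def)
  have e: "exp (- \<mu> * t) * m t = indicator {0<..} t *\<^sub>R (exp (- \<mu> * t) * (1 - relax a t))" for t
    by (simp add: m_def)
  have "(\<integral>\<^sup>+t. ennreal (exp (- \<mu> * t) * m t) \<partial>lborel) = (\<integral>\<^sup>+t. ennreal (exp (- \<mu> * t) * (1 - relax a t)) * indicator {0<..} t \<partial>lborel)"
    by (intro nn_integral_cong) (auto simp: m_def indicator_def)
  also have "\<dots> = ennreal (1 / \<mu> * (a / (a + symbol \<mu>)))" by (rule nn_integral_relax_laplace[OF assms])
  finally have "has_bochner_integral lborel (\<lambda>t. exp (- \<mu> * t) * m t) (1 / \<mu> * (a / (a + symbol \<mu>)))"
    using m0 assms symbol_pos[OF assms(2)] by (intro has_bochner_integral_nn_integral) auto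
  then have "has_bochner_integral lborel (\<lambda>t. - (exp (- \<mu> * t) * m t)) (- (1 / \<mu> * (a / (a + symbol \<mu>))))"
    by (rule has_bochner_integral_minus)
  then show ?thesis
    unfolding e by (simp add: right_diff_distrib)
qed

text \<open>The transform of \<open>1 - relax a t\<close> is \<open>a\<close> times
  \<open>\<mu> powr (- 1) / (a + symbol \<mu>)\<close>. The exponent
  \<open>2 * \<nu> - \<delta>\<close> in \<open>telegraph_ml_laplace\<close> equals -1 precisely for
  the index \<open>2 * \<nu> + 1\<close>.\<close>

theorem relax_eq_ml:
  assumes "0 \<le> a" "0 < t"
  shows "relax a t = 1 - a * telegraph_ml \<nu> lam a (2 * \<nu> + 1) t"
proof (cases "a = 0")
  case True
  then show ?thesis by (simp add: relax_def prob_space)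
next
  case False
  then have a: "0 < a" using assms by simp
  \<comment> \<open>Solves for the convergence threshold of \<open>telegraph_ml_laplace\<close>,
    with 2 in place of 1 so that the strict inequality already holds at \<open>\<mu>0\<close>
    itself.\<close>
  define \<mu>0 where "\<mu>0 = (2 * \<bar>lam\<bar> + \<bar>a\<bar> + 2) powr (1 / \<nu>)"
  have \<mu>0: "0 < \<mu>0" by (simp add: \<mu>0_def)
  have \<mu>0': "\<mu>0 powr \<nu> = 2 * \<bar>lam\<bar> + \<bar>a\<bar> + 2" using nu by (simp add: \<mu>0_def powr_powr)
  have pos: "0 < \<mu>" "2 * \<bar>lam\<bar> + \<bar>a\<bar> + 1 < \<mu> powr \<nu>" if "\<mu>0 \<le> \<mu>" for \<mu>
    using that \<mu>0 \<mu>0' powr_mono2[of \<nu> \<mu>0 \<mu>] nu by auto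
  have G: "has_bochner_integral lborel (\<lambda>t. indicator {0<..} t *\<^sub>R (exp (- \<mu> * t) * (- a * telegraph_ml \<nu> lam a (2 * \<nu> + 1) t))) (- (1 / \<mu> * (a / (a + symbol \<mu>))))"
    if "\<mu>0 \<le> \<mu>" for \<mu>
  proof -
    have e: "indicator {0<..} t *\<^sub>R (exp (- \<mu> * t) * (- a * telegraph_ml \<nu> lam a (2 * \<nu> + 1) t)) = - a * (exp (- \<mu> * t) * telegraph_ml \<nu> lam a (2 * \<nu> + 1) t)" for t
      by (cases "0 < t") (auto simp: telegraph_ml_nonpos)
    have "has_bochner_integral lborel (\<lambda>t. - a * (exp (- \<mu> * t) * telegraph_ml \<nu> lam a (2 * \<nu> + 1) t)) (- a * (\<mu> powr (2 * \<nu> - (2 * \<nu> + 1)) / (a + (\<mu> powr (2 * \<nu>) + 2 * lam * \<mu> powr \<nu>))))"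
      by (rule has_bochner_integral_mult_right) (use nu pos[OF that] in \<open>intro telegraph_ml_laplace; auto\<close>)
    moreover have "- a * (\<mu> powr (2 * \<nu> - (2 * \<nu> + 1)) / (a + (\<mu> powr (2 * \<nu>) + 2 * lam * \<mu> powr \<nu>))) = - (1 / \<mu> * (a / (a + symbol \<mu>)))"
      using pos(1)[OF that] by (simp add: symbol_def powr_minus_divide)
    ultimately show ?thesis unfolding e by (simp only:)
  qed
  note R = has_bochner_integral_relax_laplace[OF a]
  have "relax a t - 1 = - a * telegraph_ml \<nu> lam a (2 * \<nu> + 1) t"
  proof (rule laplace_unique_antimono_continuous[where ?\<mu>0.0=\<mu>0 and g="\<lambda>t. relax a t - 1" and G="\<lambda>t. - a * telegraph_ml \<nu> lam a (2 * \<nu> + 1) t"])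
    show "relax a t - 1 \<le> relax a s - 1" if "0 < s" "s \<le> t" for s t
      using relax_antimono[of a s t] that a by simp
    show "isCont (\<lambda>t. - a * telegraph_ml \<nu> lam a (2 * \<nu> + 1) t) t" if "0 < t" for t
      using DERIV_isCont[OF telegraph_ml_has_derivative[OF nu(1), of "2 * \<nu>" t lam a]] nu that
      by (intro continuous_intros) auto
    show "set_integrable lborel {0<..} (\<lambda>t. exp (- \<mu> * t) * (relax a t - 1))" if "\<mu>0 \<le> \<mu>" for \<mu>
      unfolding set_integrable_def using R[OF pos(1)[OF that]] by (simp only: has_bochner_integral_iff)
    show "set_integrable lborel {0<..} (\<lambda>t. exp (- \<mu> * t) * (- a * telegraph_ml \<nu> lam a (2 * \<nu> + 1) t))" if "\<mu>0 \<le> \<mu>" for \<mu>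
      unfolding set_integrable_def using G[OF that] by (simp only: has_bochner_integral_iff)
    show "(LINT t:{0<..}|lborel. exp (- \<mu> * t) * (relax a t - 1)) = (LINT t:{0<..}|lborel. exp (- \<mu> * t) * (- a * telegraph_ml \<nu> lam a (2 * \<nu> + 1) t))" if "\<mu>0 \<le> \<mu>" for \<mu>
      unfolding set_lebesgue_integral_def using G[OF that] R[OF pos(1)[OF that]] by (simp only: has_bochner_integral_iff)
  qed fact
  then show ?thesis by simp
qed

lemma relax_has_derivative:
  assumes "0 \<le> a" "0 < t"
  shows "(relax a has_real_derivative - (a * telegraph_ml \<nu> lam a (2 * \<nu>) t)) (at t)"
proof -
  have "((\<lambda>t. 1 - a * telegraph_ml \<nu> lam a (2 * \<nu> + 1) t) has_real_derivative 0 - a * telegraph_ml \<nu> lam a (2 * \<nu>) t) (at t)"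
    using nu assms by (intro DERIV_diff DERIV_const DERIV_cmult telegraph_ml_has_derivative) auto
  moreover have "\<forall>\<^sub>F s in nhds t. relax a s = 1 - a * telegraph_ml \<nu> lam a (2 * \<nu> + 1) s"
    using eventually_nhds_in_open[of "{0<..}" t] assms
    by (auto elim!: eventually_mono simp: relax_eq_ml)
  ultimately show ?thesis by (subst DERIV_cong_ev) auto
qed

text \<open>The sign comes from the monotonicity of the paths of \<open>L\<close>: for \<open>a > 0\<close> the function is
  the potential density of \<open>H\<close> killed at rate \<open>a\<close>.\<close>

lemma telegraph_ml_nonneg:
  assumes "0 < a"
  shows "0 \<le> telegraph_ml \<nu> lam a (2 * \<nu>) t"
proof (cases "0 < t")
  case True
  show ?thesis
  proof (rule ccontr)
    assume "\<not> ?thesis"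
    then have "0 < - (a * telegraph_ml \<nu> lam a (2 * \<nu>) t)" using assms by (simp add: mult_less_0_iff not_le)
    from DERIV_pos_inc_right[OF relax_has_derivative this] True assms
    obtain d where "0 < d" "\<And>h. 0 < h \<Longrightarrow> h < d \<Longrightarrow> relax a t < relax a (t + h)" by auto
    then have "relax a t < relax a (t + d / 2)" by simp
    moreover have "relax a (t + d / 2) \<le> relax a t"
      using True assms \<open>0 < d\<close> by (intro relax_antimono) auto
    ultimately show False by simp
  qed
qed (simp add: telegraph_ml_nonpos)

text \<open>In the recurrence at index \<open>2 * \<nu>\<close> the other two terms are fractional
  integrals of a nonnegative function with nonnegative coefficients, so dropping them leaves an
  upper bound. It does not depend on \<open>a\<close>, which makes it usable under an integral over
  \<xi>.\<close>

lemma telegraph_ml_le_kernel: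
  assumes "0 < a"
  shows "telegraph_ml \<nu> lam a (2 * \<nu>) t \<le> frac_kernel (2 * \<nu>) t"
proof -
  have nn: "0 \<le> telegraph_ml \<nu> lam a (\<alpha> + 2 * \<nu>) t" if "0 < \<alpha>" for \<alpha>
  proof -
    have "telegraph_ml \<nu> lam a (\<alpha> + 2 * \<nu>) t = (\<integral>s. frac_kernel \<alpha> (t - s) * telegraph_ml \<nu> lam a (2 * \<nu>) s \<partial>lborel)"
      using telegraph_ml_conv[OF nu(1) that, of "2 * \<nu>" t lam a] nu by (simp add: has_bochner_integral_iff)
    then show ?thesis
      using that assms by (simp add: Bochner_Integration.integral_nonneg frac_kernel_nonneg telegraph_ml_nonneg)
  qed
  have "telegraph_ml \<nu> lam a (2 * \<nu>) t + 2 * lam * telegraph_ml \<nu> lam a (\<nu> + 2 * \<nu>) t + a * telegraph_ml \<nu> lam a (2 * \<nu> + 2 * \<nu>) t = frac_kernel (2 * \<nu>) t"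
    using telegraph_ml_recurrence[OF nu(1), of "2 * \<nu>" lam a t] nu by (simp add: add.commute)
  moreover have "0 \<le> 2 * lam * telegraph_ml \<nu> lam a (\<nu> + 2 * \<nu>) t" "0 \<le> a * telegraph_ml \<nu> lam a (2 * \<nu> + 2 * \<nu>) t"
    using nn[of \<nu>] nn[of "2 * \<nu>"] nu lam assms by auto
  ultimately show ?thesis by linarith
qed

section \<open>The law of the time-changed process\<close>

definition W :: "real \<Rightarrow> 'w \<Rightarrow> 'a" where
  "W t \<omega> = S (c\<^sup>2 * L t \<omega>) \<omega>"

definition rate :: "'a \<Rightarrow> real" where
  "rate \<xi> = c\<^sup>2 * norm \<xi> powr (2 * \<beta>)"

lemma rate_nonneg: "0 \<le> rate \<xi>"
  by (simp add: rate_def)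

lemma rate_uminus: "rate (- \<xi>) = rate \<xi>"
  by (simp add: rate_def)

lemma rate_measurable [measurable]: "rate \<in> borel_measurable borel"
  unfolding rate_def[abs_def] by measurable

lemma W_time:
  assumes "0 < t"
  shows "(\<lambda>\<omega>. c\<^sup>2 * L t \<omega>) \<in> borel_measurable M" "\<And>\<omega>. 0 \<le> c\<^sup>2 * L t \<omega>" "AE \<omega> in M. 0 < c\<^sup>2 * L t \<omega>"
    "\<And>(s :: real) (g :: 'a \<Rightarrow> complex) h. 0 < s \<Longrightarrow> g \<in> borel_measurable borel \<Longrightarrow> h \<in> borel_measurable borel \<Longrightarrow>
      prob_space.indep_var M borel (\<lambda>\<omega>. g (S s \<omega>)) borel (\<lambda>\<omega>. h (c\<^sup>2 * L t \<omega>))"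
proof -
  show "(\<lambda>\<omega>. c\<^sup>2 * L t \<omega>) \<in> borel_measurable M" by (intro borel_measurable_times borel_measurable_const L_measurable assms)
  show "\<And>\<omega>. 0 \<le> c\<^sup>2 * L t \<omega>" by (simp add: L_nonneg)
  show "AE \<omega> in M. 0 < c\<^sup>2 * L t \<omega>" using L_pos[OF assms] by eventually_elim (use c in simp)
  fix s :: real and g :: "'a \<Rightarrow> complex" and h :: "real \<Rightarrow> complex" assume s: "0 < s" and g: "g \<in> borel_measurable borel" and [measurable]: "h \<in> borel_measurable borel"
  have Sm: "S s \<in> borel_measurable M"
    using S s by (auto simp: isotropic_stable_process_def levy_process_def)
  have "(\<lambda>u. h (c\<^sup>2 * u)) \<in> borel_measurable borel" by measurable
  from indep_processes_imp_indep_var[OF prob_space_axioms indep_S_L s assms Sm L_measurable[OF assms] g this]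
  show "indep_var borel (\<lambda>\<omega>. g (S s \<omega>)) borel (\<lambda>\<omega>. h (c\<^sup>2 * L t \<omega>))" .
qed

lemma W_measurable:
  assumes "0 < t"
  shows "W t \<in> borel_measurable M"
  unfolding W_def[abs_def] by (rule stable_at_random_time(1)[OF prob_space_axioms S W_time(1,2,4)[OF assms]])

lemma W_fourier:
  assumes "0 < t"
  shows "(\<integral>\<omega>. exp (\<i> * complex_of_real (\<xi> \<bullet> W t \<omega>)) \<partial>M) = complex_of_real (relax (rate \<xi>) t)"
proof -
  have "exp (- (c\<^sup>2 * L t \<omega>) * norm \<xi> powr (2 * \<beta>)) = exp (- rate \<xi> * L t \<omega>)" for \<omega>
    by (simp only: rate_def mult_minus_left mult_minus_right mult_ac)
  then have "complex_of_real (relax (rate \<xi>) t) = complex_of_real (\<integral>\<omega>. exp (- (c\<^sup>2 * L t \<omega>) * norm \<xi> powr (2 * \<beta>)) \<partial>M)"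
    by (simp only: relax_def)
  also have "\<dots> = (\<integral>\<omega>. exp (\<i> * complex_of_real (\<xi> \<bullet> W t \<omega>)) \<partial>M)"
    unfolding W_def by (rule stable_at_random_time(2)[OF prob_space_axioms S W_time(1,2,4)[OF assms], symmetric])
  finally show ?thesis ..
qed

lemma W_density:
  assumes "0 < t"
  obtains w :: "'a \<Rightarrow> real" where "\<And>x. 0 \<le> w x" "integrable lborel w" "(\<integral>x. w x \<partial>lborel) = 1"
    "distr M borel (W t) = density lborel (\<lambda>x. ennreal (w x))"
    "\<And>\<xi>. fourier (\<lambda>x. complex_of_real (w x)) \<xi> = complex_of_real (relax (rate \<xi>) t)"
proof -
  note [measurable] = W_measurable[OF assms]
  have D: "prob_space (distr M borel (W t))" by (rule prob_space_distr[OF W_measurable[OF assms]])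
  have "absolutely_continuous lborel (distr M borel (W t))"
    unfolding absolutely_continuous_def
  proof
    fix N :: "'a set" assume "N \<in> null_sets lborel"
    then have N: "N \<in> sets borel" "emeasure lborel N = 0" by auto
    have "emeasure (distr M borel (W t)) N = 0"
      unfolding W_def[abs_def]
      by (rule stable_at_random_time_absolutely_continuous[OF prob_space_axioms S beta W_time[OF assms] N])
    then show "N \<in> null_sets (distr M borel (W t))"
      using N(1) by (intro null_setsI) auto
  qed
  then obtain f where f[measurable]: "f \<in> borel_measurable lborel" and fd: "density lborel f = distr M borel (W t)"
    using sigma_finite_measure.Radon_Nikodym[OF sigma_finite_lborel, of "distr M borel (W t)"] by auto
  have fint: "(\<integral>\<^sup>+x. f x \<partial>lborel) = 1"
    using prob_space.emeasure_space_1[OF D] unfolding fd[symmetric] by (simp add: emeasure_density)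
  \<comment> \<open>The Radon-Nikodym density takes extended values; having integral 1, it is finite
    almost everywhere and agrees there with the real-valued \<open>w\<close>.\<close>
  define w where "w x = enn2real (f x)" for x
  have [measurable]: "w \<in> borel_measurable borel" unfolding w_def using f by measurable
  have "AE x in lborel. f x \<noteq> \<infinity>" by (rule nn_integral_PInf_AE) (simp_all add: fint)
  then have AE: "AE x in lborel. f x = ennreal (w x)"
    by eventually_elim (simp add: w_def ennreal_enn2real_if)
  have w0: "0 \<le> w x" for x by (simp add: w_def)
  have "(\<integral>\<^sup>+x. ennreal (w x) \<partial>lborel) = 1"
    using nn_integral_cong_AE[OF AE] fint by simp
  then have hb: "has_bochner_integral lborel w 1"
    by (intro has_bochner_integral_nn_integral) (auto simp: w0)
  have wd: "distr M borel (W t) = density lborel (\<lambda>x. ennreal (w x))"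
    unfolding fd[symmetric] by (rule density_cong) (use AE in auto)
  show thesis
  proof
    show "0 \<le> w x" for x by (rule w0)
    show "integrable lborel w" "(\<integral>x. w x \<partial>lborel) = 1" using hb by (auto simp: has_bochner_integral_iff)
    show "distr M borel (W t) = density lborel (\<lambda>x. ennreal (w x))" by (rule wd)
    fix \<xi>
    have "fourier (\<lambda>x. complex_of_real (w x)) \<xi> = (\<integral>x. exp (\<i> * complex_of_real (\<xi> \<bullet> x)) \<partial>density lborel (\<lambda>x. ennreal (w x)))"
      unfolding fourier_def by (subst integral_density) (auto simp: w0 scaleR_conv_of_real mult.commute)
    also have "\<dots> = (\<integral>\<omega>. exp (\<i> * complex_of_real (\<xi> \<bullet> W t \<omega>)) \<partial>M)"
      unfolding wd[symmetric] by (rule integral_distr) measurable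
    also have "\<dots> = complex_of_real (relax (rate \<xi>) t)" by (rule W_fourier[OF assms])
    finally show "fourier (\<lambda>x. complex_of_real (w x)) \<xi> = complex_of_real (relax (rate \<xi>) t)" .
  qed
qed

end

section \<open>Existence\<close>

text \<open>Parseval's relation with one factor given as an inverse transform. A test function and
  its fractional Laplacian are both of this form, so it converts either side of the equation into an
  integral over \<xi>.\<close>

lemma pairing_fourier_inverse:
  fixes w :: "'a::euclidean_space \<Rightarrow> real" and \<psi> :: "'a \<Rightarrow> complex"
  assumes w: "integrable lborel w" and \<psi>: "integrable lborel \<psi>"
  shows "pairing w (\<lambda>x. \<integral>\<xi>. exp (- \<i> * complex_of_real (x \<bullet> \<xi>)) * \<psi> \<xi> \<partial>lborel)
    = (\<integral>\<xi>. \<psi> \<xi> * fourier (\<lambda>x. complex_of_real (w x)) (- \<xi>) \<partial>lborel)"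
proof -
  have [measurable]: "w \<in> borel_measurable borel" "\<psi> \<in> borel_measurable borel" using w \<psi> by auto
  define K where "K x \<xi> = complex_of_real (w x) * (exp (- \<i> * complex_of_real (x \<bullet> \<xi>)) * \<psi> \<xi>)" for x \<xi>
  have Km: "(\<lambda>(x, \<xi>). K x \<xi>) \<in> borel_measurable (lborel \<Otimes>\<^sub>M lborel)"
    unfolding K_def by measurable
  have nK: "norm (K x \<xi>) = \<bar>w x\<bar> * norm (\<psi> \<xi>)" for x \<xi>
    by (simp add: K_def norm_mult)
  have int: "integrable (lborel \<Otimes>\<^sub>M lborel) (\<lambda>(x, \<xi>). K x \<xi>)"
  proof (rule lborel_pair.Fubini_integrable[OF Km])
    show "integrable lborel (\<lambda>x. \<integral>\<xi>. norm (case (x, \<xi>) of (x, \<xi>) \<Rightarrow> K x \<xi>) \<partial>lborel)"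
      using w by (simp add: nK)
    have "integrable lborel (K x)" for x
    proof (rule Bochner_Integration.integrable_bound)
      show "integrable lborel (\<lambda>\<xi>. \<bar>w x\<bar> * norm (\<psi> \<xi>))" using \<psi> by auto
      show "K x \<in> borel_measurable lborel" unfolding K_def by measurable
    qed (simp add: nK)
    then show "AE x in lborel. integrable lborel (\<lambda>\<xi>. case (x, \<xi>) of (x, \<xi>) \<Rightarrow> K x \<xi>)" by simp
  qed
  have 1: "(\<integral>\<xi>. K x \<xi> \<partial>lborel) = complex_of_real (w x) * (\<integral>\<xi>. exp (- \<i> * complex_of_real (x \<bullet> \<xi>)) * \<psi> \<xi> \<partial>lborel)" for x
    unfolding K_def by (rule integral_mult_right_zero)
  have 2: "(\<integral>x. K x \<xi> \<partial>lborel) = \<psi> \<xi> * fourier (\<lambda>x. complex_of_real (w x)) (- \<xi>)" for \<xi>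
  proof -
    have "K x \<xi> = \<psi> \<xi> * (exp (\<i> * complex_of_real ((- \<xi>) \<bullet> x)) * complex_of_real (w x))" for x
      by (simp add: K_def inner_commute mult_ac)
    then show ?thesis unfolding fourier_def by (simp only: integral_mult_right_zero)
  qed
  show ?thesis
    unfolding pairing_def using lborel_pair.Fubini_integral[OF int] by (simp only: 1 2)
qed

section \<open>Test functions, and Caputo derivatives as fractional integrals\<close>

lemma test_functionD:
  fixes \<phi> :: "'a::euclidean_space \<Rightarrow> complex"
  assumes "test_function \<beta> \<phi>"
  shows "continuous_on UNIV \<phi>" "integrable lborel \<phi>" "integrable lborel (fourier \<phi>)"
    "integrable lborel (\<lambda>\<xi>. complex_of_real (norm \<xi> powr (2 * \<beta>)) * fourier \<phi> \<xi>)"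
proof -
  define g where "g \<xi> = complex_of_real (1 + norm \<xi> powr (2 * \<beta>)) * fourier \<phi> \<xi>" for \<xi>
  have g: "integrable lborel g" and c: "continuous_on UNIV \<phi>" "integrable lborel \<phi>"
    using assms by (simp_all add: test_function_def g_def[abs_def])
  show "continuous_on UNIV \<phi>" "integrable lborel \<phi>" by fact+
  have [measurable]: "g \<in> borel_measurable borel" using g by auto
  have pos: "0 < 1 + norm \<xi> powr (2 * \<beta>)" for \<xi> :: 'a by (simp add: add_pos_nonneg)
  \<comment> \<open>\<open>test_function\<close> makes the weighted transform measurable; dividing
    by the positive weight recovers measurability of the transform itself.\<close>
  have f: "fourier \<phi> = (\<lambda>\<xi>. g \<xi> / complex_of_real (1 + norm \<xi> powr (2 * \<beta>)))"
    using pos by (simp add: g_def fun_eq_iff less_imp_neq[symmetric] del: of_real_add)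
  have [measurable]: "fourier \<phi> \<in> borel_measurable borel" unfolding f by measurable
  have n: "norm (g \<xi>) = (1 + norm \<xi> powr (2 * \<beta>)) * norm (fourier \<phi> \<xi>)" for \<xi>
    unfolding g_def norm_mult norm_of_real using pos[of \<xi>] by simp
  show "integrable lborel (fourier \<phi>)"
    by (rule Bochner_Integration.integrable_bound[OF g]) (auto simp: n distrib_right)
  show "integrable lborel (\<lambda>\<xi>. complex_of_real (norm \<xi> powr (2 * \<beta>)) * fourier \<phi> \<xi>)"
    by (rule Bochner_Integration.integrable_bound[OF g]) (auto simp: n norm_mult distrib_right)
qed

lemma nat_ceiling_eq_1: "0 < \<alpha> \<Longrightarrow> \<alpha> \<le> 1 \<Longrightarrow> nat \<lceil>\<alpha>\<rceil> = 1"
  by (simp add: ceiling_unique[of 1])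

lemma caputo_deriv_eq_frac_int:
  assumes "0 < \<alpha>" "\<alpha> < 1"
  shows "caputo_deriv \<alpha> f t = frac_int (1 - \<alpha>) (\<lambda>s. vector_derivative f (at s)) t"
proof -
  have "complex_of_real (1 / Gamma (1 - \<alpha>)) * (indicator {0<..<t} s *\<^sub>R (vector_derivative f (at s) / complex_of_real ((t - s) powr \<alpha>)))
    = indicator {0<..<t} s *\<^sub>R (frac_kernel (1 - \<alpha>) (t - s) *\<^sub>R vector_derivative f (at s))" for s
    by (auto simp: indicator_def frac_kernel_def scaleR_conv_of_real powr_minus_divide)
  then show ?thesis
    using assms unfolding frac_int_def set_lebesgue_integral_def
    by (simp add: caputo_deriv_def nat_ceiling_eq_1 iter_deriv_def set_lebesgue_integral_def integral_mult_right_zero[symmetric] del: integral_mult_right_zero)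
qed

lemma caputo_deriv_1: "caputo_deriv 1 f t = vector_derivative f (at t)"
  by (simp add: caputo_deriv_def iter_deriv_def)

lemma caputo_differentiable_iff:
  assumes "0 < \<alpha>" "\<alpha> < 1"
  shows "caputo_differentiable \<alpha> f t \<longleftrightarrow> (\<forall>s\<in>{0<..t}. f differentiable (at s)) \<and>
    set_integrable lborel {0<..<t} (\<lambda>s. frac_kernel (1 - \<alpha>) (t - s) *\<^sub>R vector_derivative f (at s))"
proof -
  have "0 < Gamma (1 - \<alpha>)" using assms by (intro Gamma_real_pos) auto
  then have G: "Gamma (1 - \<alpha>) \<noteq> 0" by (metis less_irrefl)
  have e: "indicator {0<..<t} s *\<^sub>R (vector_derivative f (at s) / complex_of_real ((t - s) powr \<alpha>))
    = complex_of_real (Gamma (1 - \<alpha>)) * (indicator {0<..<t} s *\<^sub>R (frac_kernel (1 - \<alpha>) (t - s) *\<^sub>R vector_derivative f (at s)))" for s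
    using G by (auto simp: indicator_def frac_kernel_def scaleR_conv_of_real powr_minus_divide)
  have "set_integrable lborel {0<..<t} (\<lambda>s. vector_derivative f (at s) / complex_of_real ((t - s) powr \<alpha>))
    \<longleftrightarrow> set_integrable lborel {0<..<t} (\<lambda>s. frac_kernel (1 - \<alpha>) (t - s) *\<^sub>R vector_derivative f (at s))"
    unfolding set_integrable_def e
  proof
    let ?g = "\<lambda>s. indicator {0<..<t} s *\<^sub>R (frac_kernel (1 - \<alpha>) (t - s) *\<^sub>R vector_derivative f (at s))"
    assume "integrable lborel (\<lambda>s. complex_of_real (Gamma (1 - \<alpha>)) * ?g s)"
    then have "integrable lborel (\<lambda>s. inverse (complex_of_real (Gamma (1 - \<alpha>))) * (complex_of_real (Gamma (1 - \<alpha>)) * ?g s))"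
      by (rule integrable_mult_right)
    moreover have "inverse (complex_of_real (Gamma (1 - \<alpha>))) * (complex_of_real (Gamma (1 - \<alpha>)) * z) = z" for z
      using G by simp
    ultimately show "integrable lborel ?g" by (simp only:)
  qed (rule integrable_mult_right)
  then show ?thesis
    using assms by (simp add: caputo_differentiable_def nat_ceiling_eq_1 iter_deriv_def)
qed

lemma caputo_differentiable_1: "caputo_differentiable 1 f t \<longleftrightarrow> (\<forall>s\<in>{0<..t}. f differentiable (at s))"
  by (simp add: caputo_differentiable_def iter_deriv_def)

context telegraph_processes
begin

lemma telegraph_ml_at_measurable [measurable]: "(\<lambda>\<xi>. telegraph_ml \<nu> lam (rate \<xi>) \<delta> t) \<in> borel_measurable borel"
  unfolding telegraph_ml_def ml_series_def by measurable

lemma relax_measurable: "0 < t \<Longrightarrow> (\<lambda>\<xi>. relax (rate \<xi>) t) \<in> borel_measurable borel"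
  by (simp add: relax_eq_ml rate_nonneg)

text \<open>The kernel bound was obtained for positive rates. The rate vanishes at \<xi> = 0, but so
  does the factor \<open>rate \<xi>\<close> that multiplies the function there; the second
  hypothesis expresses this.\<close>

lemma telegraph_ml_weighted_bound:
  assumes "0 \<le> a" "a = 0 \<Longrightarrow> z = 0"
  shows "norm (z * complex_of_real (telegraph_ml \<nu> lam a (2 * \<nu>) t)) \<le> norm z * frac_kernel (2 * \<nu>) t"
proof (cases "a = 0")
  case False
  then have "0 < a" using assms by simp
  from telegraph_ml_nonneg[OF this] telegraph_ml_le_kernel[OF this]
  show ?thesis by (simp add: norm_mult mult_left_mono)
qed (use assms in simp)

text \<open>Mean value theorem with the kernel bound for the derivative. Since
  \<open>2 * \<nu> \<le> 1\<close> the kernel is decreasing, so its value at the left end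
  \<open>r\<close> serves for all later times.\<close>

lemma relax_lipschitz:
  assumes "0 \<le> a" "0 < r" "r \<le> u" "u < v"
  shows "\<bar>relax a v - relax a u\<bar> \<le> (v - u) * (a * frac_kernel (2 * \<nu>) r)"
proof (cases "a = 0")
  case True
  then show ?thesis by (simp add: relax_def)
next
  case False
  then have a: "0 < a" using assms by simp
  obtain z where z: "u < z" "z < v" "relax a v - relax a u = (v - u) * - (a * telegraph_ml \<nu> lam a (2 * \<nu>) z)"
    using MVT2[of u v "relax a" "\<lambda>z. - (a * telegraph_ml \<nu> lam a (2 * \<nu>) z)"] relax_has_derivative assms by auto
  have "z powr (2 * \<nu> - 1) \<le> r powr (2 * \<nu> - 1)"
    using z assms nu by (intro powr_mono2') auto
  then have "frac_kernel (2 * \<nu>) z \<le> frac_kernel (2 * \<nu>) r"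
    using z assms nu Gamma_real_pos[of "2 * \<nu>"] by (simp add: frac_kernel_def divide_right_mono)
  then have "telegraph_ml \<nu> lam a (2 * \<nu>) z \<le> frac_kernel (2 * \<nu>) r"
    using telegraph_ml_le_kernel[OF a, of z] by simp
  then have "(v - u) * (a * telegraph_ml \<nu> lam a (2 * \<nu>) z) \<le> (v - u) * (a * frac_kernel (2 * \<nu>) r)"
    using assms by (intro mult_left_mono) auto
  then show ?thesis
    using z telegraph_ml_nonneg[OF a, of z] assms a by (simp add: abs_mult)
qed

text \<open>The kernel bound, integrated once in time. Its linear dependence on \<open>a\<close> is
  what yields the initial condition after integration over \<xi>.\<close>

lemma relax_near_0:
  assumes "0 \<le> a" "0 < t"
  shows "1 - relax a t \<le> a * frac_kernel (1 + 2 * \<nu>) t"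
proof (cases "a = 0")
  case True
  then show ?thesis by (simp add: relax_def prob_space)
next
  case False
  then have a: "0 < a" using assms by simp
  have U: "has_bochner_integral lborel (\<lambda>s. frac_kernel 1 (t - s) * telegraph_ml \<nu> lam a (2 * \<nu>) s) (telegraph_ml \<nu> lam a (1 + 2 * \<nu>) t)"
    using nu by (intro telegraph_ml_conv) auto
  have k: "has_bochner_integral lborel (\<lambda>s. frac_kernel 1 (t - s) * frac_kernel (2 * \<nu>) s) (frac_kernel (1 + 2 * \<nu>) t)"
    using nu by (intro frac_kernel_conv) auto
  have "frac_kernel 1 (t - s) * telegraph_ml \<nu> lam a (2 * \<nu>) s \<le> frac_kernel 1 (t - s) * frac_kernel (2 * \<nu>) s" for s
    by (intro mult_left_mono telegraph_ml_le_kernel a frac_kernel_nonneg) auto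
  then have "telegraph_ml \<nu> lam a (1 + 2 * \<nu>) t \<le> frac_kernel (1 + 2 * \<nu>) t"
    using integral_mono[of lborel "\<lambda>s. frac_kernel 1 (t - s) * telegraph_ml \<nu> lam a (2 * \<nu>) s" "\<lambda>s. frac_kernel 1 (t - s) * frac_kernel (2 * \<nu>) s"]
      U k by (simp add: has_bochner_integral_iff)
  then show ?thesis
    using relax_eq_ml[OF assms] a by (simp add: add.commute)
qed

section \<open>Superpositions of relaxation functions over \<xi> with amplitude
  \<open>\<Phi>\<close>\<close>

context
  fixes \<Phi> :: "'a \<Rightarrow> complex" and F :: "real \<Rightarrow> complex"
  assumes \<Phi>: "integrable lborel \<Phi>" and \<Theta>: "integrable lborel (\<lambda>\<xi>. complex_of_real (rate \<xi>) * \<Phi> \<xi>)"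
    and F: "\<And>t. 0 < t \<Longrightarrow> F t = (\<integral>\<xi>. \<Phi> \<xi> * complex_of_real (relax (rate \<xi>) t) \<partial>lborel)"
begin

lemma relax_mult_integrable:
  assumes "0 < t"
  shows "integrable lborel (\<lambda>\<xi>. \<Phi> \<xi> * complex_of_real (relax (rate \<xi>) t))"
proof (rule Bochner_Integration.integrable_bound[OF \<Phi>])
  have [measurable]: "\<Phi> \<in> borel_measurable borel" using \<Phi> by auto
  note [measurable] = relax_measurable[OF assms]
  show "(\<lambda>\<xi>. \<Phi> \<xi> * complex_of_real (relax (rate \<xi>) t)) \<in> borel_measurable lborel" by measurable
  show "AE \<xi> in lborel. norm (\<Phi> \<xi> * complex_of_real (relax (rate \<xi>) t)) \<le> norm (\<Phi> \<xi>)"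
    using relax_le_1[OF rate_nonneg assms] relax_nonneg by (simp add: norm_mult mult_left_le)
qed

text \<open>Differentiation under the integral sign. Staying within \<open>t / 2\<close> of
  \<open>t\<close> keeps the times away from 0, where the kernel bound may blow up, and the
  difference quotients are dominated by a constant times the modulus of
  \<open>rate \<xi> * \<Phi> \<xi>\<close>.\<close>

lemma superposition_has_derivative:
  assumes t: "0 < t"
  shows "(F has_vector_derivative - (\<integral>\<xi>. (complex_of_real (rate \<xi>) * \<Phi> \<xi>) * complex_of_real (telegraph_ml \<nu> lam (rate \<xi>) (2 * \<nu>) t) \<partial>lborel)) (at t)"
proof -
  have [measurable]: "\<Phi> \<in> borel_measurable borel" using \<Phi> by auto
  define G where "G \<xi> = (complex_of_real (rate \<xi>) * \<Phi> \<xi>) * complex_of_real (telegraph_ml \<nu> lam (rate \<xi>) (2 * \<nu>) t)" for \<xi>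
  have Gm[measurable]: "G \<in> borel_measurable borel" unfolding G_def using telegraph_ml_at_measurable by measurable
  have Gn: "norm (G \<xi>) \<le> norm (complex_of_real (rate \<xi>) * \<Phi> \<xi>) * frac_kernel (2 * \<nu>) t" for \<xi>
    unfolding G_def by (rule telegraph_ml_weighted_bound) (auto simp: rate_nonneg)
  have Gi: "integrable lborel G"
    by (rule Bochner_Integration.integrable_bound[OF integrable_mult_left[OF integrable_norm[OF \<Theta>], of "frac_kernel (2 * \<nu>) t"]])
      (use Gn nu in \<open>auto simp: frac_kernel_nonneg\<close>)
  define K where "K = frac_kernel (2 * \<nu>) (t / 2)"
  \<comment> \<open>The difference quotient minus its expected limit \<open>- G\<close>, so the
    claim becomes convergence of the integral of \<open>E h\<close> to 0.\<close>
  define E where "E h \<xi> = \<Phi> \<xi> * complex_of_real ((relax (rate \<xi>) (t + h) - relax (rate \<xi>) t) / h) + G \<xi>" for h \<xi>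
  have Em: "E h \<in> borel_measurable borel" if "\<bar>h\<bar> < t / 2" for h
  proof -
    have "0 < t + h" using that t by (auto simp: abs_less_iff)
    note [measurable] = relax_measurable[OF this] relax_measurable[OF t]
    show ?thesis unfolding E_def by measurable
  qed
  have En: "norm (E h \<xi>) \<le> norm (complex_of_real (rate \<xi>) * \<Phi> \<xi>) * (K + frac_kernel (2 * \<nu>) t)" if h: "\<bar>h\<bar> < t / 2" "h \<noteq> 0" for h \<xi>
  proof -
    have "\<bar>relax (rate \<xi>) (t + h) - relax (rate \<xi>) t\<bar> \<le> \<bar>h\<bar> * (rate \<xi> * K)"
    proof (cases "0 < h")
      case True
      then show ?thesis using relax_lipschitz[OF rate_nonneg, of "t/2" t "t + h" \<xi>] t by (simp add: K_def)
    next
      case False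
      then show ?thesis using relax_lipschitz[OF rate_nonneg, of "t/2" "t + h" t \<xi>] t h by (simp add: K_def abs_minus_commute)
    qed
    then have "\<bar>(relax (rate \<xi>) (t + h) - relax (rate \<xi>) t) / h\<bar> \<le> rate \<xi> * K"
      using h by (simp add: abs_divide pos_divide_le_eq mult.commute)
    then have "norm (\<Phi> \<xi>) * \<bar>(relax (rate \<xi>) (t + h) - relax (rate \<xi>) t) / h\<bar> \<le> norm (\<Phi> \<xi>) * (rate \<xi> * K)"
      by (intro mult_left_mono) auto
    then have "norm (\<Phi> \<xi> * complex_of_real ((relax (rate \<xi>) (t + h) - relax (rate \<xi>) t) / h)) \<le> norm (complex_of_real (rate \<xi>) * \<Phi> \<xi>) * K"
      unfolding norm_mult norm_of_real using rate_nonneg[of \<xi>] by (simp add: mult_ac)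
    then show ?thesis
      unfolding E_def using Gn[of \<xi>] by (intro order_trans[OF norm_triangle_ineq]) (simp add: distrib_left add_mono)
  qed
  have dq: "((\<lambda>h. \<integral>\<xi>. E h \<xi> \<partial>lborel) \<longlongrightarrow> 0) (at 0)"
  proof -
    \<comment> \<open>Dominated convergence works along sequences; restricting to this interval
      makes the bound \<open>En\<close> available for every member of the sequence.\<close>
    have "((\<lambda>h. \<integral>\<xi>. E h \<xi> \<partial>lborel) \<longlongrightarrow> 0) (at 0 within {- (t/2)<..<t/2})"
      unfolding tendsto_at_iff_sequentially comp_def
    proof (intro allI impI)
      fix X :: "nat \<Rightarrow> real" assume X: "\<forall>i. X i \<in> {- (t/2)<..<t/2} - {0}" "X \<longlonglongrightarrow> 0"
      have X': "\<bar>X i\<bar> < t/2" "X i \<noteq> 0" for i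
      proof -
        have "- (t/2) < X i" "X i < t/2" "X i \<noteq> 0" using X(1) by auto
        then show "\<bar>X i\<bar> < t/2" "X i \<noteq> 0" by linarith+
      qed
      have "(\<lambda>i. \<integral>\<xi>. E (X i) \<xi> \<partial>lborel) \<longlonglongrightarrow> (\<integral>\<xi>. 0 \<partial>(lborel :: 'a measure))"
      proof (rule integral_dominated_convergence)
        show "integrable lborel (\<lambda>\<xi>. norm (complex_of_real (rate \<xi>) * \<Phi> \<xi>) * (K + frac_kernel (2 * \<nu>) t))"
          by (intro integrable_mult_left integrable_norm \<Theta>)
        show "E (X i) \<in> borel_measurable lborel" for i using Em[OF X'(1)] by simp
        show "AE \<xi> in lborel. norm (E (X i) \<xi>) \<le> norm (complex_of_real (rate \<xi>) * \<Phi> \<xi>) * (K + frac_kernel (2 * \<nu>) t)" for i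
          by (intro AE_I2 En X')
        show "AE \<xi> in lborel. (\<lambda>i. E (X i) \<xi>) \<longlonglongrightarrow> 0"
        proof (rule AE_I2)
          fix \<xi>
          have "((\<lambda>h. (relax (rate \<xi>) (t + h) - relax (rate \<xi>) t) / h) \<longlongrightarrow> - (rate \<xi> * telegraph_ml \<nu> lam (rate \<xi>) (2 * \<nu>) t)) (at 0)"
            using relax_has_derivative[OF rate_nonneg t, of \<xi>] by (simp add: DERIV_def)
          moreover have "filterlim X (at 0) sequentially"
            using X X' by (simp add: filterlim_at)
          ultimately have "(\<lambda>i. (relax (rate \<xi>) (t + X i) - relax (rate \<xi>) t) / X i) \<longlonglongrightarrow> - (rate \<xi> * telegraph_ml \<nu> lam (rate \<xi>) (2 * \<nu>) t)"
            by (rule filterlim_compose)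
          then have "(\<lambda>i. E (X i) \<xi>) \<longlonglongrightarrow> \<Phi> \<xi> * complex_of_real (- (rate \<xi> * telegraph_ml \<nu> lam (rate \<xi>) (2 * \<nu>) t)) + G \<xi>"
            unfolding E_def by (intro tendsto_intros)
          then show "(\<lambda>i. E (X i) \<xi>) \<longlonglongrightarrow> 0" by (simp add: G_def mult_ac)
        qed
      qed auto
      then show "(\<lambda>i. \<integral>\<xi>. E (X i) \<xi> \<partial>lborel) \<longlonglongrightarrow> 0" by simp
    qed
    moreover have "at 0 within {- (t/2)<..<t/2} = at 0" using t by (intro at_within_open) auto
    ultimately show ?thesis by simp
  qed
  have eqE: "(F (t + h) - F t - h *\<^sub>R (- integral\<^sup>L lborel G)) /\<^sub>R h = (\<integral>\<xi>. E h \<xi> \<partial>lborel)" if h: "\<bar>h\<bar> < t / 2" "h \<noteq> 0" for h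
  proof -
    have th: "0 < t + h" using h t by (auto simp: abs_less_iff)
    have alg: "z * complex_of_real ((x - y) / h) = (z * complex_of_real x - z * complex_of_real y) /\<^sub>R h" for z x y
      unfolding scaleR_conv_of_real divide_inverse of_real_mult of_real_diff
      by (simp only: right_diff_distrib left_diff_distrib mult_ac)
    have "(\<integral>\<xi>. E h \<xi> \<partial>lborel) = (\<integral>\<xi>. ((\<Phi> \<xi> * complex_of_real (relax (rate \<xi>) (t + h)) - \<Phi> \<xi> * complex_of_real (relax (rate \<xi>) t)) /\<^sub>R h) + G \<xi> \<partial>lborel)"
      unfolding E_def alg ..
    also have "\<dots> = (\<integral>\<xi>. (\<Phi> \<xi> * complex_of_real (relax (rate \<xi>) (t + h)) - \<Phi> \<xi> * complex_of_real (relax (rate \<xi>) t)) /\<^sub>R h \<partial>lborel) + integral\<^sup>L lborel G"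
      by (intro Bochner_Integration.integral_add integrable_scaleR_right Bochner_Integration.integrable_diff relax_mult_integrable th t Gi)
    also have "\<dots> = (F (t + h) - F t) /\<^sub>R h + integral\<^sup>L lborel G"
      using relax_mult_integrable[OF th] relax_mult_integrable[OF t] by (simp add: F th t)
    finally show ?thesis using h by (simp add: scaleR_diff_right scaleR_add_right)
  qed
  have "((\<lambda>h. norm (F (t + h) - F t - h *\<^sub>R (- integral\<^sup>L lborel G)) / norm h) \<longlongrightarrow> 0) (at 0)"
  proof (rule Lim_transform_eventually[OF tendsto_norm_zero[OF dq]])
    have "\<forall>\<^sub>F h in at 0. h \<in> {- (t/2)<..<t/2} \<and> h \<noteq> 0"
      using t by (intro eventually_conj eventually_at_in_open' eventually_neq_at_within) auto
    then show "\<forall>\<^sub>F h in at 0. norm (\<integral>\<xi>. E h \<xi> \<partial>lborel) = norm (F (t + h) - F t - h *\<^sub>R (- integral\<^sup>L lborel G)) / norm h"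
    proof eventually_elim
      case (elim h)
      then have "\<bar>h\<bar> < t / 2" "h \<noteq> 0" by (auto simp: abs_less_iff)
      from eqE[OF this, symmetric] show ?case by (simp add: divide_inverse mult.commute)
    qed
  qed
  then have "(F has_vector_derivative - integral\<^sup>L lborel G) (at t)"
    using bounded_linear_scaleR_left[of "- integral\<^sup>L lborel G"]
    unfolding has_vector_derivative_def has_derivative_at by blast
  then show ?thesis by (simp add: G_def[abs_def])
qed

text \<open>By Fubini the fractional integral of order \<open>1 - \<alpha>\<close> acts on the
  relaxation functions inside the integral over \<xi>, where it raises the index of the derivative
  from \<open>2 * \<nu>\<close> to \<open>1 - \<alpha> + 2 * \<nu>\<close>.\<close>

lemma superposition_caputo_aux:
  assumes "0 < \<alpha>" "\<alpha> < 1" "0 < t"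
  shows "set_integrable lborel {0<..<t} (\<lambda>s. frac_kernel (1 - \<alpha>) (t - s) *\<^sub>R vector_derivative F (at s))"
    "integrable lborel (\<lambda>\<xi>. (complex_of_real (rate \<xi>) * \<Phi> \<xi>) * complex_of_real (telegraph_ml \<nu> lam (rate \<xi>) (1 - \<alpha> + 2 * \<nu>) t))"
    "frac_int (1 - \<alpha>) (\<lambda>s. vector_derivative F (at s)) t
      = - (\<integral>\<xi>. (complex_of_real (rate \<xi>) * \<Phi> \<xi>) * complex_of_real (telegraph_ml \<nu> lam (rate \<xi>) (1 - \<alpha> + 2 * \<nu>) t) \<partial>lborel)"
proof -
  have [measurable]: "\<Phi> \<in> borel_measurable borel" using \<Phi> by auto
  have \<alpha>: "0 < 1 - \<alpha>" using assms by simp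
  define \<theta> where "\<theta> \<xi> = complex_of_real (rate \<xi>) * \<Phi> \<xi>" for \<xi>
  have \<theta>: "integrable lborel \<theta>" using \<Theta> by (simp add: \<theta>_def[abs_def])
  have [measurable]: "\<theta> \<in> borel_measurable borel" unfolding \<theta>_def by measurable
  define K where "K \<xi> s = complex_of_real (frac_kernel (1 - \<alpha>) (t - s)) * (\<theta> \<xi> * complex_of_real (telegraph_ml \<nu> lam (rate \<xi>) (2 * \<nu>) s))" for \<xi> s
  have [measurable]: "(\<lambda>p. telegraph_ml \<nu> lam (rate (fst p)) (2 * \<nu>) (snd p)) \<in> borel_measurable (lborel \<Otimes>\<^sub>M lborel)"
    unfolding telegraph_ml_def ml_series_def by measurable
  have Km: "(\<lambda>(\<xi>, s). K \<xi> s) \<in> borel_measurable (lborel \<Otimes>\<^sub>M lborel)"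
    unfolding K_def split_beta by measurable
  have Kn: "norm (K \<xi> s) \<le> norm (\<theta> \<xi>) * (frac_kernel (1 - \<alpha>) (t - s) * frac_kernel (2 * \<nu>) s)" for \<xi> s
  proof -
    have "norm (\<theta> \<xi> * complex_of_real (telegraph_ml \<nu> lam (rate \<xi>) (2 * \<nu>) s)) \<le> norm (\<theta> \<xi>) * frac_kernel (2 * \<nu>) s"
      by (rule telegraph_ml_weighted_bound) (auto simp: rate_nonneg \<theta>_def)
    from mult_left_mono[OF this frac_kernel_nonneg[OF \<alpha>, of "t - s"]]
    show ?thesis
      using frac_kernel_nonneg[OF \<alpha>, of "t - s"] unfolding K_def norm_mult norm_of_real by (simp add: mult_ac)
  qed
  have kk: "has_bochner_integral lborel (\<lambda>s. frac_kernel (1 - \<alpha>) (t - s) * frac_kernel (2 * \<nu>) s) (frac_kernel (1 - \<alpha> + 2 * \<nu>) t)"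
    using \<alpha> nu by (intro frac_kernel_conv) auto
  have Ki: "integrable lborel (K \<xi>)" for \<xi>
  proof (rule Bochner_Integration.integrable_bound)
    show "integrable lborel (\<lambda>s. norm (\<theta> \<xi>) * (frac_kernel (1 - \<alpha>) (t - s) * frac_kernel (2 * \<nu>) s))"
      using kk by (intro integrable_mult_right) (simp add: has_bochner_integral_iff)
    show "K \<xi> \<in> borel_measurable lborel" using Km by simp
    show "AE s in lborel. norm (K \<xi> s) \<le> norm (norm (\<theta> \<xi>) * (frac_kernel (1 - \<alpha>) (t - s) * frac_kernel (2 * \<nu>) s))"
      by (rule AE_I2, rule order_trans[OF Kn]) simp
  qed
  have int: "integrable (lborel \<Otimes>\<^sub>M lborel) (\<lambda>(\<xi>, s). K \<xi> s)"
  proof (rule lborel_pair.Fubini_integrable[OF Km])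
    show "integrable lborel (\<lambda>\<xi>. \<integral>s. norm (case (\<xi>, s) of (\<xi>, s) \<Rightarrow> K \<xi> s) \<partial>lborel)"
    proof (rule Bochner_Integration.integrable_bound)
      show "integrable lborel (\<lambda>\<xi>. norm (\<theta> \<xi>) * frac_kernel (1 - \<alpha> + 2 * \<nu>) t)"
        by (intro integrable_mult_left integrable_norm \<theta>)
      have "(\<lambda>\<xi>. \<integral>s. norm (K \<xi> s) \<partial>lborel) \<in> borel_measurable lborel"
        using Km by measurable
      then show "(\<lambda>\<xi>. \<integral>s. norm (case (\<xi>, s) of (\<xi>, s) \<Rightarrow> K \<xi> s) \<partial>lborel) \<in> borel_measurable lborel" by simp
      show "AE \<xi> in lborel. norm (\<integral>s. norm (case (\<xi>, s) of (\<xi>, s) \<Rightarrow> K \<xi> s) \<partial>lborel) \<le> norm (norm (\<theta> \<xi>) * frac_kernel (1 - \<alpha> + 2 * \<nu>) t)"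
      proof (rule AE_I2)
        fix \<xi>
        have "(\<integral>s. norm (K \<xi> s) \<partial>lborel) \<le> (\<integral>s. norm (\<theta> \<xi>) * (frac_kernel (1 - \<alpha>) (t - s) * frac_kernel (2 * \<nu>) s) \<partial>lborel)"
          using kk by (intro integral_mono integrable_norm Ki Kn integrable_mult_right) (simp add: has_bochner_integral_iff)
        also have "\<dots> = norm (\<theta> \<xi>) * frac_kernel (1 - \<alpha> + 2 * \<nu>) t"
          using kk by (simp add: has_bochner_integral_iff)
        finally show "norm (\<integral>s. norm (case (\<xi>, s) of (\<xi>, s) \<Rightarrow> K \<xi> s) \<partial>lborel) \<le> norm (norm (\<theta> \<xi>) * frac_kernel (1 - \<alpha> + 2 * \<nu>) t)"
          by simp
      qed
    qed
    show "AE \<xi> in lborel. integrable lborel (\<lambda>s. case (\<xi>, s) of (\<xi>, s) \<Rightarrow> K \<xi> s)" using Ki by simp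
  qed
  have K1: "(\<integral>s. K \<xi> s \<partial>lborel) = \<theta> \<xi> * complex_of_real (telegraph_ml \<nu> lam (rate \<xi>) (1 - \<alpha> + 2 * \<nu>) t)" for \<xi>
  proof -
    have "K \<xi> s = \<theta> \<xi> * complex_of_real (frac_kernel (1 - \<alpha>) (t - s) * telegraph_ml \<nu> lam (rate \<xi>) (2 * \<nu>) s)" for s
      by (simp add: K_def mult_ac)
    then have "(\<integral>s. K \<xi> s \<partial>lborel) = \<theta> \<xi> * complex_of_real (\<integral>s. frac_kernel (1 - \<alpha>) (t - s) * telegraph_ml \<nu> lam (rate \<xi>) (2 * \<nu>) s \<partial>lborel)"
      by (simp only: integral_mult_right_zero integral_complex_of_real)
    then show ?thesis
      using telegraph_ml_conv[OF nu(1) \<alpha>, of "2 * \<nu>" t lam "rate \<xi>"] nu by (simp add: has_bochner_integral_iff)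
  qed
  have K2: "(\<integral>\<xi>. K \<xi> s \<partial>lborel) = - (indicator {0<..<t} s *\<^sub>R (frac_kernel (1 - \<alpha>) (t - s) *\<^sub>R vector_derivative F (at s)))" for s
  proof (cases "0 < s \<and> s < t")
    case True
    then have "vector_derivative F (at s) = - (\<integral>\<xi>. \<theta> \<xi> * complex_of_real (telegraph_ml \<nu> lam (rate \<xi>) (2 * \<nu>) s) \<partial>lborel)"
      unfolding \<theta>_def by (intro vector_derivative_at superposition_has_derivative) simp
    then show ?thesis
      using True unfolding K_def integral_mult_right_zero by (simp add: scaleR_conv_of_real)
  next
    case False
    then have "frac_kernel (1 - \<alpha>) (t - s) = 0 \<or> telegraph_ml \<nu> lam (rate \<xi>) (2 * \<nu>) s = 0" for \<xi>
      by (auto simp: frac_kernel_def telegraph_ml_nonpos)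
    then have "K \<xi> s = 0" for \<xi> by (auto simp: K_def)
    then show ?thesis using False by auto
  qed
  show "set_integrable lborel {0<..<t} (\<lambda>s. frac_kernel (1 - \<alpha>) (t - s) *\<^sub>R vector_derivative F (at s))"
    using lborel_pair.integrable_snd[OF int] unfolding K2 set_integrable_def by simp
  show "integrable lborel (\<lambda>\<xi>. (complex_of_real (rate \<xi>) * \<Phi> \<xi>) * complex_of_real (telegraph_ml \<nu> lam (rate \<xi>) (1 - \<alpha> + 2 * \<nu>) t))"
    using lborel_pair.integrable_fst[OF int] unfolding K1 \<theta>_def .
  have "- frac_int (1 - \<alpha>) (\<lambda>s. vector_derivative F (at s)) t
      = (\<integral>\<xi>. \<theta> \<xi> * complex_of_real (telegraph_ml \<nu> lam (rate \<xi>) (1 - \<alpha> + 2 * \<nu>) t) \<partial>lborel)"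
    using lborel_pair.Fubini_integral[OF int] unfolding K1 K2 frac_int_def set_lebesgue_integral_def by simp
  from this[symmetric] show "frac_int (1 - \<alpha>) (\<lambda>s. vector_derivative F (at s)) t
      = - (\<integral>\<xi>. (complex_of_real (rate \<xi>) * \<Phi> \<xi>) * complex_of_real (telegraph_ml \<nu> lam (rate \<xi>) (1 - \<alpha> + 2 * \<nu>) t) \<partial>lborel)"
    by (simp only: \<theta>_def minus_minus)
qed

lemma superposition_caputo:
  assumes "0 < \<alpha>" "\<alpha> \<le> 2 * \<nu>" "0 < t"
  shows "caputo_differentiable \<alpha> F t"
    "integrable lborel (\<lambda>\<xi>. (complex_of_real (rate \<xi>) * \<Phi> \<xi>) * complex_of_real (telegraph_ml \<nu> lam (rate \<xi>) (1 - \<alpha> + 2 * \<nu>) t))"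
    "caputo_deriv \<alpha> F t = - (\<integral>\<xi>. (complex_of_real (rate \<xi>) * \<Phi> \<xi>) * complex_of_real (telegraph_ml \<nu> lam (rate \<xi>) (1 - \<alpha> + 2 * \<nu>) t) \<partial>lborel)"
proof -
  have diff: "\<forall>s\<in>{0<..t}. F differentiable (at s)"
    by (auto intro!: differentiableI_vector[OF superposition_has_derivative])
  have "caputo_differentiable \<alpha> F t \<and>
    integrable lborel (\<lambda>\<xi>. (complex_of_real (rate \<xi>) * \<Phi> \<xi>) * complex_of_real (telegraph_ml \<nu> lam (rate \<xi>) (1 - \<alpha> + 2 * \<nu>) t)) \<and>
    caputo_deriv \<alpha> F t = - (\<integral>\<xi>. (complex_of_real (rate \<xi>) * \<Phi> \<xi>) * complex_of_real (telegraph_ml \<nu> lam (rate \<xi>) (1 - \<alpha> + 2 * \<nu>) t) \<partial>lborel)"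
  proof (cases "\<alpha> = 1")
    case True
    then have nu1: "1 - \<alpha> + 2 * \<nu> = 2 * \<nu>" by simp
    have [measurable]: "\<Phi> \<in> borel_measurable borel" using \<Phi> by auto
    have "integrable lborel (\<lambda>\<xi>. (complex_of_real (rate \<xi>) * \<Phi> \<xi>) * complex_of_real (telegraph_ml \<nu> lam (rate \<xi>) (2 * \<nu>) t))"
    proof (rule Bochner_Integration.integrable_bound)
      show "integrable lborel (\<lambda>\<xi>. norm (complex_of_real (rate \<xi>) * \<Phi> \<xi>) * frac_kernel (2 * \<nu>) t)"
        by (intro integrable_mult_left integrable_norm \<Theta>)
      show "(\<lambda>\<xi>. (complex_of_real (rate \<xi>) * \<Phi> \<xi>) * complex_of_real (telegraph_ml \<nu> lam (rate \<xi>) (2 * \<nu>) t)) \<in> borel_measurable lborel"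
        using telegraph_ml_at_measurable by measurable
      show "AE \<xi> in lborel. norm ((complex_of_real (rate \<xi>) * \<Phi> \<xi>) * complex_of_real (telegraph_ml \<nu> lam (rate \<xi>) (2 * \<nu>) t))
          \<le> norm (norm (complex_of_real (rate \<xi>) * \<Phi> \<xi>) * frac_kernel (2 * \<nu>) t)"
        by (rule AE_I2, rule order_trans[OF telegraph_ml_weighted_bound]) (auto simp: rate_nonneg)
    qed
    then show ?thesis
      unfolding nu1 True caputo_differentiable_1 caputo_deriv_1
      using diff vector_derivative_at[OF superposition_has_derivative[OF assms(3)]] by simp
  next
    case False
    then have \<alpha>: "0 < \<alpha>" "\<alpha> < 1" using assms nu by auto
    show ?thesis
      unfolding caputo_differentiable_iff[OF \<alpha>] caputo_deriv_eq_frac_int[OF \<alpha>]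
      using superposition_caputo_aux[OF \<alpha> assms(3)] diff by simp
  qed
  then show "caputo_differentiable \<alpha> F t"
    "integrable lborel (\<lambda>\<xi>. (complex_of_real (rate \<xi>) * \<Phi> \<xi>) * complex_of_real (telegraph_ml \<nu> lam (rate \<xi>) (1 - \<alpha> + 2 * \<nu>) t))"
    "caputo_deriv \<alpha> F t = - (\<integral>\<xi>. (complex_of_real (rate \<xi>) * \<Phi> \<xi>) * complex_of_real (telegraph_ml \<nu> lam (rate \<xi>) (1 - \<alpha> + 2 * \<nu>) t) \<partial>lborel)"
    by auto
qed

text \<open>The Caputo derivatives of orders \<open>2 * \<nu>\<close> and \<open>\<nu>\<close> carry
  the indices 1 and \<open>1 + \<nu>\<close>. By the recurrence at index 1, whose source is the
  constant 1, their combination is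
  \<open>1 - a * telegraph_ml \<nu> lam a (2 * \<nu> + 1) t\<close>, which is the relaxation
  function again.\<close>

lemma superposition_equation:
  assumes "0 < t"
  shows "caputo_deriv (2 * \<nu>) F t + complex_of_real (2 * lam) * caputo_deriv \<nu> F t
    = - (\<integral>\<xi>. (complex_of_real (rate \<xi>) * \<Phi> \<xi>) * complex_of_real (relax (rate \<xi>) t) \<partial>lborel)"
proof -
  define \<theta> where "\<theta> \<xi> = complex_of_real (rate \<xi>) * \<Phi> \<xi>" for \<xi>
  have n: "0 < 2 * \<nu>" "2 * \<nu> \<le> 2 * \<nu>" "0 < \<nu>" "\<nu> \<le> 2 * \<nu>" using nu by auto
  note c2 = superposition_caputo[OF n(1,2) assms, folded \<theta>_def]
  note c1 = superposition_caputo[OF n(3,4) assms, folded \<theta>_def]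
  have e: "\<theta> \<xi> * complex_of_real (telegraph_ml \<nu> lam (rate \<xi>) (1 - 2 * \<nu> + 2 * \<nu>) t) + complex_of_real (2 * lam) * (\<theta> \<xi> * complex_of_real (telegraph_ml \<nu> lam (rate \<xi>) (1 - \<nu> + 2 * \<nu>) t))
    = \<theta> \<xi> * complex_of_real (relax (rate \<xi>) t)" for \<xi>
  proof -
    have "telegraph_ml \<nu> lam (rate \<xi>) 1 t + 2 * lam * telegraph_ml \<nu> lam (rate \<xi>) (1 + \<nu>) t + rate \<xi> * telegraph_ml \<nu> lam (rate \<xi>) (1 + 2 * \<nu>) t = 1"
      using telegraph_ml_recurrence[OF nu(1), of 1 lam "rate \<xi>" t] assms by (simp add: frac_kernel_one)
    then have "relax (rate \<xi>) t = telegraph_ml \<nu> lam (rate \<xi>) (1 - 2 * \<nu> + 2 * \<nu>) t + 2 * lam * telegraph_ml \<nu> lam (rate \<xi>) (1 - \<nu> + 2 * \<nu>) t"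
      by (simp add: relax_eq_ml[OF rate_nonneg assms] add.commute)
    then show ?thesis by (simp only: of_real_add of_real_mult distrib_left mult.left_commute mult.assoc)
  qed
  have "caputo_deriv (2 * \<nu>) F t + complex_of_real (2 * lam) * caputo_deriv \<nu> F t
    = - ((\<integral>\<xi>. \<theta> \<xi> * complex_of_real (telegraph_ml \<nu> lam (rate \<xi>) (1 - 2 * \<nu> + 2 * \<nu>) t) \<partial>lborel)
       + (\<integral>\<xi>. complex_of_real (2 * lam) * (\<theta> \<xi> * complex_of_real (telegraph_ml \<nu> lam (rate \<xi>) (1 - \<nu> + 2 * \<nu>) t)) \<partial>lborel))"
    unfolding c2(3) c1(3) integral_mult_right_zero by simp
  also have "\<dots> = - (\<integral>\<xi>. \<theta> \<xi> * complex_of_real (relax (rate \<xi>) t) \<partial>lborel)"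
    using c2(2) integrable_mult_right[OF c1(2), of "complex_of_real (2 * lam)"]
    by (subst Bochner_Integration.integral_add[symmetric]) (simp_all only: e)
  finally show ?thesis by (simp only: \<theta>_def)
qed

lemma superposition_initial: "(F \<longlongrightarrow> (\<integral>\<xi>. \<Phi> \<xi> \<partial>lborel)) (at_right 0)"
proof -
  define N where "N = (\<integral>\<xi>. norm (complex_of_real (rate \<xi>) * \<Phi> \<xi>) \<partial>lborel)"
  have bound: "norm (F t - (\<integral>\<xi>. \<Phi> \<xi> \<partial>lborel)) \<le> N * (t powr (2 * \<nu>) / Gamma (1 + 2 * \<nu>))" if t: "0 < t" for t
  proof -
    have k: "frac_kernel (1 + 2 * \<nu>) t = t powr (2 * \<nu>) / Gamma (1 + 2 * \<nu>)" using t by (simp add: frac_kernel_def)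
    have "F t - (\<integral>\<xi>. \<Phi> \<xi> \<partial>lborel) = (\<integral>\<xi>. \<Phi> \<xi> * complex_of_real (relax (rate \<xi>) t) - \<Phi> \<xi> \<partial>lborel)"
      using relax_mult_integrable[OF t] \<Phi> by (simp add: F[OF t])
    also have "norm \<dots> \<le> (\<integral>\<xi>. norm (\<Phi> \<xi> * complex_of_real (relax (rate \<xi>) t) - \<Phi> \<xi>) \<partial>lborel)"
      by (rule integral_norm_bound)
    also have "\<dots> \<le> (\<integral>\<xi>. norm (complex_of_real (rate \<xi>) * \<Phi> \<xi>) * frac_kernel (1 + 2 * \<nu>) t \<partial>lborel)"
    proof (rule integral_mono)
      show "integrable lborel (\<lambda>\<xi>. norm (\<Phi> \<xi> * complex_of_real (relax (rate \<xi>) t) - \<Phi> \<xi>))"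
        by (intro integrable_norm Bochner_Integration.integrable_diff relax_mult_integrable t \<Phi>)
      show "integrable lborel (\<lambda>\<xi>. norm (complex_of_real (rate \<xi>) * \<Phi> \<xi>) * frac_kernel (1 + 2 * \<nu>) t)"
        by (intro integrable_mult_left integrable_norm \<Theta>)
      fix \<xi>
      have "\<Phi> \<xi> * complex_of_real (relax (rate \<xi>) t) - \<Phi> \<xi> = - (\<Phi> \<xi> * complex_of_real (1 - relax (rate \<xi>) t))"
        by (simp add: algebra_simps)
      then have "norm (\<Phi> \<xi> * complex_of_real (relax (rate \<xi>) t) - \<Phi> \<xi>) = norm (\<Phi> \<xi>) * (1 - relax (rate \<xi>) t)"
        using relax_le_1[OF rate_nonneg t, of \<xi>] by (simp only: norm_minus_cancel norm_mult norm_of_real)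
      also have "\<dots> \<le> norm (\<Phi> \<xi>) * (rate \<xi> * frac_kernel (1 + 2 * \<nu>) t)"
        by (intro mult_left_mono relax_near_0 rate_nonneg t) auto
      finally show "norm (\<Phi> \<xi> * complex_of_real (relax (rate \<xi>) t) - \<Phi> \<xi>) \<le> norm (complex_of_real (rate \<xi>) * \<Phi> \<xi>) * frac_kernel (1 + 2 * \<nu>) t"
        using rate_nonneg[of \<xi>] by (simp add: norm_mult mult_ac)
    qed
    also have "\<dots> = N * (t powr (2 * \<nu>) / Gamma (1 + 2 * \<nu>))" by (simp add: N_def k)
    finally show ?thesis .
  qed
  have lim: "((\<lambda>t. N * (t powr (2 * \<nu>) / Gamma (1 + 2 * \<nu>))) \<longlongrightarrow> 0) (at_right 0)"
  proof -
    have "((\<lambda>t. t powr (2 * \<nu>)) \<longlongrightarrow> 0) (at_right 0)" using nu by real_asymp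
    then show ?thesis by (intro tendsto_mult_right_zero tendsto_divide_zero)
  qed
  have "((\<lambda>t. F t - (\<integral>\<xi>. \<Phi> \<xi> \<partial>lborel)) \<longlongrightarrow> 0) (at_right 0)"
    by (rule Lim_null_comparison[OF _ lim]) (use bound in \<open>auto simp: eventually_at_filter\<close>)
  from tendsto_add[OF this tendsto_const[of "\<integral>\<xi>. \<Phi> \<xi> \<partial>lborel"]]
  show ?thesis by (simp only: diff_add_cancel add_0)
qed

end

end

section \<open>Uniqueness\<close>

lemma norm_square_mult_exp_le:
  "(norm z)\<^sup>2 * gauss z \<le> 4 * gauss ((1 / sqrt 2) *\<^sub>R z)" for z :: "'a::euclidean_space"
proof -
  \<comment> \<open>Half of the Gaussian exponent: one half absorbs the quadratic factor through
    \<open>y * exp (- y) \<le> 1\<close>, the other half survives as a wider Gaussian.\<close>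
  define y where "y = (norm z)\<^sup>2 / 4"
  have "y \<le> exp y" using exp_ge_add_one_self[of y] by linarith
  then have "y * exp (- y) \<le> 1" by (simp add: exp_minus field_simps)
  then have "4 * (y * exp (- y)) * exp (- y) \<le> 4 * 1 * exp (- y)" by (intro mult_right_mono mult_left_mono) auto
  moreover have "exp (- (norm z)\<^sup>2 / 2) = exp (- y) * exp (- y)"
    by (simp add: y_def flip: exp_add)
  moreover have "(norm ((1 / sqrt 2) *\<^sub>R z))\<^sup>2 = 2 * y"
    by (simp add: y_def power_mult_distrib power_divide)
  moreover have "(norm z)\<^sup>2 = 4 * y" by (simp add: y_def)
  ultimately have "(norm z)\<^sup>2 * exp (- (norm z)\<^sup>2 / 2) \<le> 4 * exp (- (norm ((1 / sqrt 2) *\<^sub>R z))\<^sup>2 / 2)"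
    by (simp add: mult.assoc)
  then show ?thesis
    unfolding gauss_def by (simp add: divide_right_mono)
qed

lemma integrable_norm_square_gauss: "integrable lborel (\<lambda>z::'a::euclidean_space. (norm z)\<^sup>2 * gauss z)"
proof (rule Bochner_Integration.integrable_bound)
  show "integrable lborel (\<lambda>z::'a. 4 * gauss (0 + (1 / sqrt 2) *\<^sub>R z))"
    by (intro integrable_mult_right integrable_gauss_scaled) auto
  show "AE z::'a in lborel. norm ((norm z)\<^sup>2 * gauss z) \<le> norm (4 * gauss (0 + (1 / sqrt 2) *\<^sub>R z))"
    using norm_square_mult_exp_le by (intro AE_I2) (simp add: gauss_nonneg)
qed measurable

text \<open>The bound is uniform in \<open>e\<close>, so one Gaussian moment majorant serves for all
  dampings. Quadratic growth suffices because \<open>p \<le> 2\<close>, which is where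
  \<open>\<beta> \<le> 1\<close> enters.\<close>

lemma norm_powr_le_square:
  fixes a z :: "'a::real_normed_vector"
  assumes "0 < p" "p \<le> 2" "0 \<le> e" "e \<le> 1"
  shows "norm (a + e *\<^sub>R z) powr p \<le> 1 + 2 * (norm a)\<^sup>2 + 2 * (norm z)\<^sup>2"
proof -
  define x where "x = norm (a + e *\<^sub>R z)"
  have x0: "0 \<le> x" by (simp add: x_def)
  have "x \<le> norm a + norm (e *\<^sub>R z)" unfolding x_def by (rule norm_triangle_ineq)
  also have "norm (e *\<^sub>R z) \<le> norm z" using assms by (simp add: mult_left_le_one_le)
  finally have "x\<^sup>2 \<le> (norm a + norm z)\<^sup>2" using x0 by (intro power_mono) auto
  also have "\<dots> \<le> 2 * (norm a)\<^sup>2 + 2 * (norm z)\<^sup>2"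
    using sum_squares_bound[of "norm a" "norm z"] by (simp add: power2_sum)
  finally have sq: "x\<^sup>2 \<le> 2 * (norm a)\<^sup>2 + 2 * (norm z)\<^sup>2" .
  have "x powr p \<le> 1 + x\<^sup>2"
  proof (cases "x \<le> 1")
    case True
    then have "x powr p \<le> 1 powr p" using x0 assms by (intro powr_mono2) auto
    then show ?thesis by (simp add: add_increasing2)
  next
    case False
    then have "x powr p \<le> x powr 2" using assms by (intro powr_mono) auto
    then show ?thesis using False by simp
  qed
  then show ?thesis using sq unfolding x_def by linarith
qed

lemma sqrt_power_square: "sqrt (2 * pi) ^ n * sqrt (2 * pi) ^ n = (2 * pi) ^ n"
proof -
  have "sqrt (2 * pi) ^ n * sqrt (2 * pi) ^ n = (sqrt (2 * pi) * sqrt (2 * pi)) ^ n"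
    by (simp only: power_mult_distrib)
  also have "sqrt (2 * pi) * sqrt (2 * pi) = 2 * pi" by simp
  finally show ?thesis .
qed

text \<open>Gaussian-damped plane waves are test functions whose Fourier transforms concentrate
  at \<open>- \<eta>\<close> as \<open>e\<close> tends to 0.\<close>

definition damped_wave :: "'a::euclidean_space \<Rightarrow> real \<Rightarrow> 'a \<Rightarrow> complex" where
  "damped_wave \<eta> e x = exp (\<i> * complex_of_real (\<eta> \<bullet> x)) * complex_of_real (sqrt (2 * pi) ^ DIM('a) * gauss (e *\<^sub>R x))"

context
  fixes \<eta> :: "'a::euclidean_space" and e \<beta> :: real
  assumes e: "0 < e" "e \<le> 1" and \<beta>: "0 < \<beta>" "\<beta> \<le> 1"
begin

lemma fourier_damped_wave:
  "fourier (damped_wave \<eta> e) \<xi> = complex_of_real ((2 * pi) ^ DIM('a) / e ^ DIM('a) * gauss ((1 / e) *\<^sub>R (\<xi> + \<eta>)))"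
proof -
  define s where "s = sqrt (2 * pi) ^ DIM('a)"
  have "fourier (damped_wave \<eta> e) \<xi> = (\<integral>x. complex_of_real s * (exp (\<i> * complex_of_real ((\<xi> + \<eta>) \<bullet> x)) * complex_of_real (gauss (e *\<^sub>R x))) \<partial>lborel)"
    unfolding fourier_def damped_wave_def s_def[symmetric]
    by (intro Bochner_Integration.integral_cong) (simp_all add: inner_add_left distrib_left exp_add mult_ac)
  also have "\<dots> = complex_of_real (s * (s * gauss ((1 / e) *\<^sub>R (\<xi> + \<eta>)) / e ^ DIM('a)))"
    unfolding integral_mult_right_zero fourier_gauss_scaled[OF e(1)] s_def by (simp only: of_real_mult)
  also have "s * (s * gauss ((1 / e) *\<^sub>R (\<xi> + \<eta>)) / e ^ DIM('a)) = (s * s) / e ^ DIM('a) * gauss ((1 / e) *\<^sub>R (\<xi> + \<eta>))"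
    by simp
  also have "s * s = (2 * pi) ^ DIM('a)" unfolding s_def by (rule sqrt_power_square)
  finally show ?thesis .
qed

lemma integrable_powr_gauss: "integrable lborel (\<lambda>z::'a. norm (- \<eta> + e *\<^sub>R z) powr (2 * \<beta>) * gauss z)"
proof (rule Bochner_Integration.integrable_bound)
  show "integrable lborel (\<lambda>z::'a. (1 + 2 * (norm \<eta>)\<^sup>2) * gauss z + 2 * ((norm z)\<^sup>2 * gauss z))"
    by (intro Bochner_Integration.integrable_add integrable_mult_right integrable_gauss integrable_norm_square_gauss)
  show "AE z::'a in lborel. norm (norm (- \<eta> + e *\<^sub>R z) powr (2 * \<beta>) * gauss z) \<le> norm ((1 + 2 * (norm \<eta>)\<^sup>2) * gauss z + 2 * ((norm z)\<^sup>2 * gauss z))"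
  proof (rule AE_I2)
    fix z :: 'a
    have "norm (- \<eta> + e *\<^sub>R z) powr (2 * \<beta>) \<le> 1 + 2 * (norm (- \<eta>))\<^sup>2 + 2 * (norm z)\<^sup>2"
      using e \<beta> by (intro norm_powr_le_square) auto
    from mult_right_mono[OF this gauss_nonneg[of z]]
    show "norm (norm (- \<eta> + e *\<^sub>R z) powr (2 * \<beta>) * gauss z) \<le> norm ((1 + 2 * (norm \<eta>)\<^sup>2) * gauss z + 2 * ((norm z)\<^sup>2 * gauss z))"
      by (simp add: gauss_nonneg abs_mult algebra_simps)
  qed
qed measurable

lemma test_function_damped_wave: "test_function \<beta> (damped_wave \<eta> e)"
  unfolding test_function_def
proof (intro conjI)
  show "continuous_on UNIV (damped_wave \<eta> e)"
    unfolding damped_wave_def gauss_def by (intro continuous_intros) auto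
  have g: "integrable lborel (\<lambda>x::'a. sqrt (2 * pi) ^ DIM('a) * gauss (0 + e *\<^sub>R x))"
    using e by (intro integrable_mult_right integrable_gauss_scaled) auto
  show "integrable lborel (damped_wave \<eta> e)"
  proof (rule Bochner_Integration.integrable_bound[OF g])
    show "damped_wave \<eta> e \<in> borel_measurable lborel" unfolding damped_wave_def by measurable
    show "AE x in lborel. norm (damped_wave \<eta> e x) \<le> norm (sqrt (2 * pi) ^ DIM('a) * gauss (0 + e *\<^sub>R x))"
      unfolding damped_wave_def norm_mult norm_exp_i_of_real norm_of_real by (simp add: abs_mult)
  qed
  define h where "h \<xi> = (1 + norm \<xi> powr (2 * \<beta>)) * gauss ((1 / e) *\<^sub>R (\<xi> + \<eta>))" for \<xi>
  have "integrable lborel (\<lambda>z. gauss z + norm (- \<eta> + e *\<^sub>R z) powr (2 * \<beta>) * gauss z)"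
    by (intro Bochner_Integration.integrable_add integrable_gauss integrable_powr_gauss)
  also have "(\<lambda>z. gauss z + norm (- \<eta> + e *\<^sub>R z) powr (2 * \<beta>) * gauss z) = (\<lambda>z. h (- \<eta> + e *\<^sub>R z))"
    using e by (simp add: h_def fun_eq_iff distrib_right)
  finally have "integrable lborel h"
    using e by (subst (asm) lborel_integrable_affine_iff) (auto simp: h_def[abs_def])
  then have "integrable lborel (\<lambda>\<xi>. complex_of_real ((2 * pi) ^ DIM('a) / e ^ DIM('a)) * complex_of_real (h \<xi>))"
    by (intro integrable_mult_right integrable_of_real)
  also have "(\<lambda>\<xi>. complex_of_real ((2 * pi) ^ DIM('a) / e ^ DIM('a)) * complex_of_real (h \<xi>))
    = (\<lambda>\<xi>. complex_of_real (1 + norm \<xi> powr (2 * \<beta>)) * fourier (damped_wave \<eta> e) \<xi>)"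
    unfolding fourier_damped_wave h_def fun_eq_iff of_real_mult by (simp only: mult_ac) simp
  finally show "integrable lborel (\<lambda>\<xi>. complex_of_real (1 + norm \<xi> powr (2 * \<beta>)) * fourier (damped_wave \<eta> e) \<xi>)" .
qed

text \<open>The substitution of \<open>- \<eta> + e *\<^sub>R z\<close> for the frequency cancels
  all normalising constants. The result is a Gaussian average of the multiplier near
  \<open>- \<eta>\<close>, from which bounds and the limit for small \<open>e\<close> can be read
  off.\<close>

lemma neg_frac_laplacian_damped_wave:
  "neg_frac_laplacian \<beta> (damped_wave \<eta> e) x
    = - (\<integral>z. exp (- \<i> * complex_of_real (x \<bullet> (- \<eta> + e *\<^sub>R z))) * complex_of_real (norm (- \<eta> + e *\<^sub>R z) powr (2 * \<beta>) * gauss z) \<partial>lborel)"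
proof -
  define n where "n = DIM('a)"
  define C where "C = complex_of_real ((2 * pi) ^ n / e ^ n)"
  define f where "f \<xi> = exp (- \<i> * complex_of_real (x \<bullet> \<xi>)) * complex_of_real (norm \<xi> powr (2 * \<beta>) * gauss ((1 / e) *\<^sub>R (\<xi> + \<eta>)))" for \<xi>
  have 1: "exp (- \<i> * complex_of_real (x \<bullet> \<xi>)) * complex_of_real (norm \<xi> powr (2 * \<beta>)) * fourier (damped_wave \<eta> e) \<xi> = C * f \<xi>" for \<xi>
    unfolding fourier_damped_wave f_def C_def n_def of_real_mult by (simp only: mult_ac)
  have 2: "(\<integral>\<xi>. f \<xi> \<partial>lborel) = (e ^ n) *\<^sub>R (\<integral>z. f (- \<eta> + e *\<^sub>R z) \<partial>lborel)"
    using lborel_integral_affine[of f e "- \<eta>"] e by (simp add: n_def f_def[abs_def])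
  have 3: "f (- \<eta> + e *\<^sub>R z) = exp (- \<i> * complex_of_real (x \<bullet> (- \<eta> + e *\<^sub>R z))) * complex_of_real (norm (- \<eta> + e *\<^sub>R z) powr (2 * \<beta>) * gauss z)" for z
    using e by (simp add: f_def)
  have "complex_of_real (1 / (2 * pi) ^ n) * (C * complex_of_real (e ^ n)) = 1"
    using e unfolding C_def of_real_mult[symmetric] by simp
  then have "- complex_of_real (1 / (2 * pi) ^ n) * (C * (complex_of_real (e ^ n) * Z)) = - Z" for Z
    by (simp only: mult_minus_left mult.assoc[symmetric] mult_1_left)
  then show ?thesis
    unfolding neg_frac_laplacian_def 1 integral_mult_right_zero 2 3 scaleR_conv_of_real n_def[symmetric] by (simp only:)
qed

lemma norm_damped_wave_le: "norm (damped_wave \<eta> e x) \<le> 1"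
proof -
  have "norm (damped_wave \<eta> e x) = sqrt (2 * pi) ^ DIM('a) * gauss (e *\<^sub>R x)"
    unfolding damped_wave_def norm_mult norm_exp_i_of_real norm_of_real by (simp add: gauss_nonneg)
  then show ?thesis unfolding exp_eq_gauss[symmetric] by simp
qed

text \<open>The right side depends neither on \<open>x\<close> nor on \<open>e\<close>. This allows
  dominated convergence against an arbitrary integrable solution when the damping is
  removed.\<close>

lemma norm_neg_frac_laplacian_damped_wave_le:
  "norm (neg_frac_laplacian \<beta> (damped_wave \<eta> e) x) \<le> (\<integral>z. (1 + 2 * (norm \<eta>)\<^sup>2) * gauss z + 2 * ((norm z)\<^sup>2 * gauss z) \<partial>(lborel :: 'a measure))"
proof -
  have "norm (neg_frac_laplacian \<beta> (damped_wave \<eta> e) x) \<le>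
    (\<integral>z. norm (exp (- \<i> * complex_of_real (x \<bullet> (- \<eta> + e *\<^sub>R z))) * complex_of_real (norm (- \<eta> + e *\<^sub>R z) powr (2 * \<beta>) * gauss z)) \<partial>lborel)"
    unfolding neg_frac_laplacian_damped_wave norm_minus_cancel by (rule integral_norm_bound)
  also have "\<dots> = (\<integral>z. norm (- \<eta> + e *\<^sub>R z) powr (2 * \<beta>) * gauss z \<partial>lborel)"
    by (simp add: norm_mult gauss_nonneg)
  also have "\<dots> \<le> (\<integral>z. (1 + 2 * (norm \<eta>)\<^sup>2) * gauss z + 2 * ((norm z)\<^sup>2 * gauss z) \<partial>(lborel :: 'a measure))"
  proof (rule integral_mono[OF integrable_powr_gauss])
    show "integrable lborel (\<lambda>z::'a. (1 + 2 * (norm \<eta>)\<^sup>2) * gauss z + 2 * ((norm z)\<^sup>2 * gauss z))"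
      by (intro Bochner_Integration.integrable_add integrable_mult_right integrable_gauss integrable_norm_square_gauss)
    fix z :: 'a
    have "norm (- \<eta> + e *\<^sub>R z) powr (2 * \<beta>) \<le> 1 + 2 * (norm (- \<eta>))\<^sup>2 + 2 * (norm z)\<^sup>2"
      using e \<beta> by (intro norm_powr_le_square) auto
    from mult_right_mono[OF this gauss_nonneg[of z]]
    show "norm (- \<eta> + e *\<^sub>R z) powr (2 * \<beta>) * gauss z \<le> (1 + 2 * (norm \<eta>)\<^sup>2) * gauss z + 2 * ((norm z)\<^sup>2 * gauss z)"
      by (simp add: algebra_simps)
  qed
  finally show ?thesis .
qed

lemma neg_frac_laplacian_damped_wave_measurable:
  "neg_frac_laplacian \<beta> (damped_wave \<eta> e) \<in> borel_measurable borel"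
proof -
  have "(\<lambda>x. - (\<integral>z. exp (- \<i> * complex_of_real (x \<bullet> (- \<eta> + e *\<^sub>R z))) * complex_of_real (norm (- \<eta> + e *\<^sub>R z) powr (2 * \<beta>) * gauss z) \<partial>lborel)) \<in> borel_measurable borel"
    by measurable
  then show ?thesis unfolding neg_frac_laplacian_damped_wave[abs_def, symmetric] by simp
qed

end

lemma damped_wave_tendsto:
  "(\<lambda>k. damped_wave \<eta> (1 / real (Suc k)) x) \<longlonglongrightarrow> exp (\<i> * complex_of_real (\<eta> \<bullet> x))" for \<eta> :: "'a::euclidean_space"
proof -
  have "(\<lambda>k. (1 / real (Suc k)) *\<^sub>R x) \<longlonglongrightarrow> 0 *\<^sub>R x"
    by (intro tendsto_intros inverse_Suc_tendsto_0)
  then have "(\<lambda>k. gauss ((1 / real (Suc k)) *\<^sub>R x)) \<longlonglongrightarrow> gauss (0::'a)"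
    using continuous_on_gauss by (intro isCont_tendsto_compose[of 0 gauss]) (auto simp: continuous_on_eq_continuous_at)
  then have "(\<lambda>k. damped_wave \<eta> (1 / real (Suc k)) x) \<longlonglongrightarrow> exp (\<i> * complex_of_real (\<eta> \<bullet> x)) * complex_of_real (sqrt (2 * pi) ^ DIM('a) * gauss (0::'a))"
    unfolding damped_wave_def by (intro tendsto_intros)
  then show ?thesis unfolding exp_eq_gauss[symmetric] by simp
qed

lemma neg_frac_laplacian_damped_wave_tendsto:
  fixes \<eta> :: "'a::euclidean_space"
  assumes \<beta>: "0 < \<beta>" "\<beta> \<le> 1"
  shows "(\<lambda>k. neg_frac_laplacian \<beta> (damped_wave \<eta> (1 / real (Suc k))) x) \<longlonglongrightarrow> - (complex_of_real (norm \<eta> powr (2 * \<beta>)) * exp (\<i> * complex_of_real (\<eta> \<bullet> x)))"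
proof -
  define f where "f e z = exp (- \<i> * complex_of_real (x \<bullet> (- \<eta> + e *\<^sub>R z))) * complex_of_real (norm (- \<eta> + e *\<^sub>R z) powr (2 * \<beta>) * gauss z)" for e z
  have e: "0 < 1 / real (Suc k)" "1 / real (Suc k) \<le> 1" for k by auto
  have eq: "neg_frac_laplacian \<beta> (damped_wave \<eta> (1 / real (Suc k))) x = - (\<integral>z. f (1 / real (Suc k)) z \<partial>lborel)" for k
    unfolding f_def by (rule neg_frac_laplacian_damped_wave[OF e \<beta>])
  have "(\<lambda>k. \<integral>z. f (1 / real (Suc k)) z \<partial>lborel) \<longlonglongrightarrow> (\<integral>z. (exp (\<i> * complex_of_real (\<eta> \<bullet> x)) * complex_of_real (norm \<eta> powr (2 * \<beta>))) * complex_of_real (gauss z) \<partial>(lborel :: 'a measure))"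
  proof (rule integral_dominated_convergence)
    show "integrable lborel (\<lambda>z::'a. (1 + 2 * (norm \<eta>)\<^sup>2) * gauss z + 2 * ((norm z)\<^sup>2 * gauss z))"
      by (intro Bochner_Integration.integrable_add integrable_mult_right integrable_gauss integrable_norm_square_gauss)
    show "f (1 / real (Suc k)) \<in> borel_measurable lborel" for k unfolding f_def by measurable
    show "AE z in lborel. norm (f (1 / real (Suc k)) z) \<le> (1 + 2 * (norm \<eta>)\<^sup>2) * gauss z + 2 * ((norm z)\<^sup>2 * gauss z)" for k
    proof (rule AE_I2)
      fix z :: 'a
      have "norm (- \<eta> + (1 / real (Suc k)) *\<^sub>R z) powr (2 * \<beta>) \<le> 1 + 2 * (norm (- \<eta>))\<^sup>2 + 2 * (norm z)\<^sup>2"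
        using \<beta> by (intro norm_powr_le_square) auto
      from mult_right_mono[OF this gauss_nonneg[of z]]
      have "norm (- \<eta> + (1 / real (Suc k)) *\<^sub>R z) powr (2 * \<beta>) * gauss z \<le> (1 + 2 * (norm \<eta>)\<^sup>2) * gauss z + 2 * ((norm z)\<^sup>2 * gauss z)"
        unfolding norm_minus_cancel by (simp add: distrib_right del: of_nat_Suc)
      then show "norm (f (1 / real (Suc k)) z) \<le> (1 + 2 * (norm \<eta>)\<^sup>2) * gauss z + 2 * ((norm z)\<^sup>2 * gauss z)"
        unfolding f_def by (simp add: norm_mult gauss_nonneg del: of_nat_Suc)
    qed
    show "AE z in lborel. (\<lambda>k. f (1 / real (Suc k)) z) \<longlonglongrightarrow> (exp (\<i> * complex_of_real (\<eta> \<bullet> x)) * complex_of_real (norm \<eta> powr (2 * \<beta>))) * complex_of_real (gauss z)"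
    proof (rule AE_I2)
      fix z :: 'a
      have l: "(\<lambda>k. - \<eta> + (1 / real (Suc k)) *\<^sub>R z) \<longlonglongrightarrow> - \<eta> + 0 *\<^sub>R z"
        by (intro tendsto_intros inverse_Suc_tendsto_0)
      have pw: "(\<lambda>k. norm (- \<eta> + (1 / real (Suc k)) *\<^sub>R z) powr (2 * \<beta>)) \<longlonglongrightarrow> norm (- \<eta> + 0 *\<^sub>R z) powr (2 * \<beta>)"
        using \<beta> by (intro tendsto_powr2 tendsto_norm l tendsto_const) auto
      have "(\<lambda>k. f (1 / real (Suc k)) z) \<longlonglongrightarrow> exp (- \<i> * complex_of_real (x \<bullet> (- \<eta> + 0 *\<^sub>R z))) * complex_of_real (norm (- \<eta> + 0 *\<^sub>R z) powr (2 * \<beta>) * gauss z)"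
        unfolding f_def by (intro tendsto_intros l pw)
      then show "(\<lambda>k. f (1 / real (Suc k)) z) \<longlonglongrightarrow> (exp (\<i> * complex_of_real (\<eta> \<bullet> x)) * complex_of_real (norm \<eta> powr (2 * \<beta>))) * complex_of_real (gauss z)"
        by (simp add: inner_commute mult.assoc del: of_nat_Suc)
    qed
  qed measurable
  also have "(\<integral>z. (exp (\<i> * complex_of_real (\<eta> \<bullet> x)) * complex_of_real (norm \<eta> powr (2 * \<beta>))) * complex_of_real (gauss z) \<partial>(lborel :: 'a measure)) = complex_of_real (norm \<eta> powr (2 * \<beta>)) * exp (\<i> * complex_of_real (\<eta> \<bullet> x))"
    unfolding integral_mult_right_zero integral_complex_of_real integral_gauss by simp
  finally show ?thesis unfolding eq by (rule tendsto_minus)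
qed

text \<open>Apply the fractional integral of order \<open>2 * \<nu>\<close>. A Caputo derivative is
  a fractional integral of \<open>F'\<close>, so by the semigroup rule the two terms become the
  integrals of \<open>F'\<close> of orders 1 and \<open>1 + \<nu>\<close>, that is
  \<open>F - f0\<close> and the integral of \<open>F - f0\<close> of order \<nu>.\<close>

lemma caputo_volterra:
  fixes F R :: "real \<Rightarrow> complex"
  assumes nu: "0 < \<nu>" "\<nu> \<le> 1 / 2"
    and c2: "\<And>t. 0 < t \<Longrightarrow> caputo_differentiable (2 * \<nu>) F t" and c1: "\<And>t. 0 < t \<Longrightarrow> caputo_differentiable \<nu> F t"
    and eq: "\<And>t. 0 < t \<Longrightarrow> caputo_deriv (2 * \<nu>) F t + p * caputo_deriv \<nu> F t = R t"
    and lim: "(F \<longlongrightarrow> f0) (at_right 0)" and T: "0 < T"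
  shows "F T - f0 + p * frac_int \<nu> (\<lambda>s. F s - f0) T = frac_int (2 * \<nu>) R T"
    and "set_integrable lborel {0<..<T} (\<lambda>t. frac_kernel (2 * \<nu>) (T - t) *\<^sub>R R t)"
proof -
  define f where "f s = vector_derivative F (at s)" for s
  have nu1: "0 < \<nu>" "\<nu> < 1" using nu by auto
  have diff: "F differentiable (at s)" if "0 < s" for s
    using c1[OF that] that unfolding caputo_differentiable_iff[OF nu1] by auto
  have fint: "set_integrable lborel {0<..<t} f" for t
  proof (cases "0 < t")
    case True
    \<comment> \<open>The Caputo condition at the later time \<open>2 * t\<close> gives
      integrability of \<open>f\<close> times a kernel that stays bounded away from 0 for
      \<open>s < t\<close>. Multiplying by the bounded reciprocal yields integrability of
      \<open>f\<close> up to \<open>t\<close>.\<close>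
    define m where "m s = indicator {0<..<t} s * inverse (frac_kernel (1 - \<nu>) (2 * t - s))" for s
    have "set_integrable lborel {0<..<2 * t} (\<lambda>s. frac_kernel (1 - \<nu>) (2 * t - s) *\<^sub>R f s)"
      using c1[of "2 * t"] True unfolding caputo_differentiable_iff[OF nu1] f_def by auto
    then have g: "integrable lborel (\<lambda>s. indicator {0<..<2 * t} s *\<^sub>R (frac_kernel (1 - \<nu>) (2 * t - s) *\<^sub>R f s))"
      by (simp only: set_integrable_def)
    have G: "0 < Gamma (1 - \<nu>)" using nu1 by (intro Gamma_real_pos) auto
    have mb: "\<bar>m s\<bar> \<le> (2 * t) powr \<nu> * Gamma (1 - \<nu>)" for s
    proof (cases "0 < s \<and> s < t")
      case st: True
      then have "inverse (frac_kernel (1 - \<nu>) (2 * t - s)) = (2 * t - s) powr \<nu> * Gamma (1 - \<nu>)"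
        by (simp add: frac_kernel_def powr_minus divide_inverse)
      also have "\<dots> \<le> (2 * t) powr \<nu> * Gamma (1 - \<nu>)"
        using st G nu1 by (intro mult_right_mono powr_mono2) auto
      finally have "inverse (frac_kernel (1 - \<nu>) (2 * t - s)) \<le> (2 * t) powr \<nu> * Gamma (1 - \<nu>)" .
      then show ?thesis using st frac_kernel_nonneg[of "1 - \<nu>" "2 * t - s"] nu1 by (simp add: m_def)
    next
      case False
      then show ?thesis using G by (auto simp: m_def)
    qed
    have [measurable]: "m \<in> borel_measurable borel" unfolding m_def by measurable
    have "integrable lborel (\<lambda>s. m s *\<^sub>R (indicator {0<..<2 * t} s *\<^sub>R (frac_kernel (1 - \<nu>) (2 * t - s) *\<^sub>R f s)))"
    proof (rule Bochner_Integration.integrable_bound)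
      let ?c = "(2 * t) powr \<nu> * Gamma (1 - \<nu>)"
      show "integrable lborel (\<lambda>s. ?c * norm (indicator {0<..<2 * t} s *\<^sub>R (frac_kernel (1 - \<nu>) (2 * t - s) *\<^sub>R f s)))"
        by (intro integrable_mult_right integrable_norm g)
      show "(\<lambda>s. m s *\<^sub>R (indicator {0<..<2 * t} s *\<^sub>R (frac_kernel (1 - \<nu>) (2 * t - s) *\<^sub>R f s))) \<in> borel_measurable lborel"
        by (intro borel_measurable_scaleR borel_measurable_integrable[OF g]) measurable
      show "AE s in lborel. norm (m s *\<^sub>R (indicator {0<..<2 * t} s *\<^sub>R (frac_kernel (1 - \<nu>) (2 * t - s) *\<^sub>R f s))) \<le> norm (?c * norm (indicator {0<..<2 * t} s *\<^sub>R (frac_kernel (1 - \<nu>) (2 * t - s) *\<^sub>R f s)))"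
      proof (rule AE_I2)
        fix s
        have "\<bar>m s\<bar> * norm z \<le> \<bar>?c * norm z\<bar>" for z :: complex
          using mult_right_mono[OF mb[of s] norm_ge_zero[of z]] by (rule order_trans[OF _ abs_ge_self])
        then show "norm (m s *\<^sub>R (indicator {0<..<2 * t} s *\<^sub>R (frac_kernel (1 - \<nu>) (2 * t - s) *\<^sub>R f s))) \<le> norm (?c * norm (indicator {0<..<2 * t} s *\<^sub>R (frac_kernel (1 - \<nu>) (2 * t - s) *\<^sub>R f s)))"
          by (subst norm_scaleR) (simp only: real_norm_def)
      qed
    qed
    moreover have "m s *\<^sub>R (indicator {0<..<2 * t} s *\<^sub>R (frac_kernel (1 - \<nu>) (2 * t - s) *\<^sub>R f s)) = indicator {0<..<t} s *\<^sub>R f s" for s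
    proof (cases "0 < s \<and> s < t")
      case True
      then have "frac_kernel (1 - \<nu>) (2 * t - s) \<noteq> 0" using G by (simp add: frac_kernel_def)
      then show ?thesis using True by (simp add: m_def)
    next
      case False
      then show ?thesis by (auto simp: m_def)
    qed
    ultimately show ?thesis by (simp only: set_integrable_def)
  next
    case False
    then show ?thesis by (simp add: set_integrable_def)
  qed
  have ftc: "F t - f0 = frac_int 1 f t" if t: "0 < t" for t
  proof -
    \<comment> \<open>Only the right limit of \<open>F\<close> at 0 is prescribed; replacing the
      value at 0 by it gives continuity on the closed interval.\<close>
    define F0 where "F0 s = (if s = 0 then f0 else F s)" for s
    have cont: "continuous_on {0..t} F0"
      unfolding continuous_on_def
    proof
      fix s assume s: "s \<in> {0..t}"
      show "(F0 \<longlongrightarrow> F0 s) (at s within {0..t})"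
      proof (cases "s = 0")
        case True
        have "\<forall>\<^sub>F s in at_right 0. F s = F0 s" by (auto simp: F0_def eventually_at_filter)
        then have "(F0 \<longlongrightarrow> f0) (at_right 0)" by (rule Lim_transform_eventually[OF lim])
        then show ?thesis using True t by (simp add: F0_def at_within_Icc_at_right)
      next
        case False
        then have "0 < s" using s by simp
        then have "isCont F s" using diff differentiable_imp_continuous_within by blast
        then have "(F \<longlongrightarrow> F s) (at s)" by (simp add: isCont_def)
        moreover have "\<forall>\<^sub>F u in at s. u \<in> {0<..}"
          using \<open>0 < s\<close> by (intro eventually_at_in_open') auto
        then have "\<forall>\<^sub>F u in at s. F u = F0 u"
          by eventually_elim (simp add: F0_def)
        ultimately have "(F0 \<longlongrightarrow> F s) (at s)" by (rule Lim_transform_eventually)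
        then have "(F0 \<longlongrightarrow> F s) (at s within {0..t})" by (rule tendsto_mono[OF at_le[OF subset_UNIV]])
        then show ?thesis using False by (simp add: F0_def)
      qed
    qed
    have der: "(F0 has_vector_derivative f s) (at s)" if "s \<in> {0<..<t}" for s
    proof (rule has_vector_derivative_transform_within_open[of F])
      show "(F has_vector_derivative f s) (at s)"
        using diff[of s] that by (simp add: f_def vector_derivative_works[symmetric])
      show "open {0<..<t}" "s \<in> {0<..<t}" using that by auto
    qed (auto simp: F0_def)
    \<comment> \<open>The derivative need not be continuous, so the fundamental theorem is used for
      the gauge integral, which agrees with the Lebesgue integral because \<open>f\<close> was shown
      to be integrable.\<close>
    have "(f has_integral F0 t - F0 0) {0..t}"
      using t cont der by (intro fundamental_theorem_of_calculus_interior) auto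
    then have "(f has_integral F t - f0) {0<..<t}"
      using t by (simp add: F0_def has_integral_Icc_iff_Ioo)
    moreover have "(f has_integral (LINT s:{0<..<t}|lborel. f s)) {0<..<t}"
      using set_borel_integral_eq_integral[OF fint[of t]] by (simp add: integrable_integral)
    ultimately have "F t - f0 = (LINT s:{0<..<t}|lborel. f s)" by (rule has_integral_unique)
    also have "\<dots> = frac_int 1 f t"
      unfolding frac_int_def by (rule set_lebesgue_integral_cong) (auto simp: frac_kernel_one)
    finally show ?thesis .
  qed
  note sg = frac_int_semigroup[OF fint[of T]] and ii = frac_int_iterated_integrable[OF fint[of T]]
  have I1: "frac_int \<nu> (\<lambda>s. F s - f0) T = frac_int (1 + \<nu>) f T"
    using sg[of 1 \<nu>] nu frac_int_cong[of T "\<lambda>s. F s - f0" "frac_int 1 f" \<nu>] by (simp add: ftc)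
  have D1: "caputo_deriv \<nu> F = frac_int (1 - \<nu>) f"
    by (simp add: fun_eq_iff caputo_deriv_eq_frac_int[OF nu1] f_def[abs_def])
  have J1: "frac_int (2 * \<nu>) (caputo_deriv \<nu> F) T = frac_int (1 + \<nu>) f T"
    unfolding D1 using sg[of "1 - \<nu>" "2 * \<nu>"] nu by (simp add: add.commute)
  have K1: "set_integrable lborel {0<..<T} (\<lambda>t. frac_kernel (2 * \<nu>) (T - t) *\<^sub>R caputo_deriv \<nu> F t)"
    unfolding D1 using nu by (intro ii) auto
  have "frac_int (2 * \<nu>) (caputo_deriv (2 * \<nu>) F) T = frac_int 1 f T \<and>
    set_integrable lborel {0<..<T} (\<lambda>t. frac_kernel (2 * \<nu>) (T - t) *\<^sub>R caputo_deriv (2 * \<nu>) F t)"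
  proof (cases "2 * \<nu> = 1")
    case True
    have D2: "caputo_deriv (2 * \<nu>) F = f" unfolding True by (simp add: fun_eq_iff caputo_deriv_1 f_def)
    have "set_integrable lborel {0<..<T} (\<lambda>t. frac_kernel 1 (T - t) *\<^sub>R f t) \<longleftrightarrow> set_integrable lborel {0<..<T} f"
      by (rule set_integrable_cong) (auto simp: frac_kernel_one)
    then show ?thesis unfolding D2 unfolding True using fint[of T] by simp
  next
    case False
    then have n: "0 < 2 * \<nu>" "2 * \<nu> < 1" using nu by auto
    have D2: "caputo_deriv (2 * \<nu>) F = frac_int (1 - 2 * \<nu>) f"
      by (simp add: fun_eq_iff caputo_deriv_eq_frac_int[OF n] f_def[abs_def])
    show ?thesis unfolding D2 using sg[of "1 - 2 * \<nu>" "2 * \<nu>"] ii[of "1 - 2 * \<nu>" "2 * \<nu>"] n by simp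
  qed
  then have J2: "frac_int (2 * \<nu>) (caputo_deriv (2 * \<nu>) F) T = F T - f0"
    and K2: "set_integrable lborel {0<..<T} (\<lambda>t. frac_kernel (2 * \<nu>) (T - t) *\<^sub>R caputo_deriv (2 * \<nu>) F t)"
    using ftc[OF T] by auto
  have K1': "set_integrable lborel {0<..<T} (\<lambda>t. p * (frac_kernel (2 * \<nu>) (T - t) *\<^sub>R caputo_deriv \<nu> F t))"
    using K1 by (rule set_integrable_mult_right)
  have "frac_int (2 * \<nu>) R T = frac_int (2 * \<nu>) (\<lambda>t. caputo_deriv (2 * \<nu>) F t + p * caputo_deriv \<nu> F t) T"
    using eq by (intro frac_int_cong) simp
  also have "\<dots> = (LINT t:{0<..<T}|lborel. frac_kernel (2 * \<nu>) (T - t) *\<^sub>R caputo_deriv (2 * \<nu>) F t + p * (frac_kernel (2 * \<nu>) (T - t) *\<^sub>R caputo_deriv \<nu> F t))"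
    unfolding frac_int_def by (simp add: scaleR_add_right)
  also have "\<dots> = frac_int (2 * \<nu>) (caputo_deriv (2 * \<nu>) F) T + p * frac_int (2 * \<nu>) (caputo_deriv \<nu> F) T"
    unfolding set_integral_add(2)[OF K2 K1'] frac_int_def by (simp only: set_integral_mult_right)
  finally show "F T - f0 + p * frac_int \<nu> (\<lambda>s. F s - f0) T = frac_int (2 * \<nu>) R T"
    using J1 J2 I1 by simp
  have "frac_kernel (2 * \<nu>) (T - t) *\<^sub>R R t = frac_kernel (2 * \<nu>) (T - t) *\<^sub>R caputo_deriv (2 * \<nu>) F t + p * (frac_kernel (2 * \<nu>) (T - t) *\<^sub>R caputo_deriv \<nu> F t)"
    if "t \<in> {0<..<T}" for t
    using eq[of t] that by (simp add: scaleR_add_right[symmetric] del: scaleR_add_right)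
  then have "set_integrable lborel {0<..<T} (\<lambda>t. frac_kernel (2 * \<nu>) (T - t) *\<^sub>R R t) \<longleftrightarrow>
    set_integrable lborel {0<..<T} (\<lambda>t. frac_kernel (2 * \<nu>) (T - t) *\<^sub>R caputo_deriv (2 * \<nu>) F t + p * (frac_kernel (2 * \<nu>) (T - t) *\<^sub>R caputo_deriv \<nu> F t))"
    by (intro set_integrable_cong) auto
  then show "set_integrable lborel {0<..<T} (\<lambda>t. frac_kernel (2 * \<nu>) (T - t) *\<^sub>R R t)"
    using set_integral_add(1)[OF K2 K1'] by blast
qed

text \<open>Measurability is required of the kernel-weighted functions rather than of
  \<open>f k\<close>, since for the right-hand sides of the equation it is available in this form,
  from the integrability part of \<open>caputo_volterra\<close>.\<close>

lemma frac_int_tendsto: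
  fixes f :: "nat \<Rightarrow> real \<Rightarrow> complex"
  assumes "0 < \<alpha>"
    and m: "\<And>k. (\<lambda>s. indicator {0<..<T} s *\<^sub>R (frac_kernel \<alpha> (T - s) *\<^sub>R f k s)) \<in> borel_measurable borel"
    and B: "\<And>k s. 0 < s \<Longrightarrow> s < T \<Longrightarrow> norm (f k s) \<le> B"
    and lim: "\<And>s. 0 < s \<Longrightarrow> s < T \<Longrightarrow> (\<lambda>k. f k s) \<longlonglongrightarrow> g s"
  shows "(\<lambda>k. frac_int \<alpha> (f k) T) \<longlonglongrightarrow> frac_int \<alpha> g T"
  unfolding frac_int_def set_lebesgue_integral_def
proof (rule integral_dominated_convergence)
  have ptw: "(\<lambda>k. indicator {0<..<T} s *\<^sub>R (frac_kernel \<alpha> (T - s) *\<^sub>R f k s)) \<longlonglongrightarrow> indicator {0<..<T} s *\<^sub>R (frac_kernel \<alpha> (T - s) *\<^sub>R g s)" for s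
    using lim[of s] by (cases "0 < s \<and> s < T") (auto intro!: tendsto_intros)
  then show "AE s in lborel. (\<lambda>k. indicator {0<..<T} s *\<^sub>R (frac_kernel \<alpha> (T - s) *\<^sub>R f k s)) \<longlonglongrightarrow> indicator {0<..<T} s *\<^sub>R (frac_kernel \<alpha> (T - s) *\<^sub>R g s)"
    by simp
  have "(\<lambda>s. indicator {0<..<T} s *\<^sub>R (frac_kernel \<alpha> (T - s) *\<^sub>R g s)) \<in> borel_measurable borel"
    by (rule borel_measurable_LIMSEQ_metric[OF m ptw])
  then show "(\<lambda>s. indicator {0<..<T} s *\<^sub>R (frac_kernel \<alpha> (T - s) *\<^sub>R g s)) \<in> borel_measurable lborel" by simp
  show "(\<lambda>s. indicator {0<..<T} s *\<^sub>R (frac_kernel \<alpha> (T - s) *\<^sub>R f k s)) \<in> borel_measurable lborel" for k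
    using m by simp
  have "integrable lborel (\<lambda>s. B * (frac_kernel \<alpha> (T - s) * frac_kernel 1 s))"
    using frac_kernel_conv[OF assms(1), of 1 T] by (intro integrable_mult_right) (simp add: has_bochner_integral_iff)
  then show "integrable lborel (\<lambda>s. B * (frac_kernel \<alpha> (T - s) * frac_kernel 1 s))" .
  show "AE s in lborel. norm (indicator {0<..<T} s *\<^sub>R (frac_kernel \<alpha> (T - s) *\<^sub>R f k s)) \<le> B * (frac_kernel \<alpha> (T - s) * frac_kernel 1 s)" for k
  proof (rule AE_I2)
    fix s
    show "norm (indicator {0<..<T} s *\<^sub>R (frac_kernel \<alpha> (T - s) *\<^sub>R f k s)) \<le> B * (frac_kernel \<alpha> (T - s) * frac_kernel 1 s)"
    proof (cases "0 < s \<and> s < T")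
      case True
      from mult_left_mono[OF B[of s k] frac_kernel_nonneg[OF assms(1), of "T - s"]] True
      show ?thesis using frac_kernel_nonneg[OF assms(1), of "T - s"] by (simp add: frac_kernel_one mult.commute)
    qed (auto simp: frac_kernel_def)
  qed
qed

lemma norm_pairing_le:
  fixes u :: "'a::euclidean_space \<Rightarrow> real"
  assumes "integrable lborel u" "\<And>x. norm (f x) \<le> D"
  shows "norm (pairing u f) \<le> (\<integral>x. \<bar>u x\<bar> \<partial>lborel) * D"
proof (cases "integrable lborel (\<lambda>x. complex_of_real (u x) * f x)")
  case True
  have "norm (pairing u f) \<le> (\<integral>x. norm (complex_of_real (u x) * f x) \<partial>lborel)"
    unfolding pairing_def by (rule integral_norm_bound)
  also have "\<dots> \<le> (\<integral>x. \<bar>u x\<bar> * D \<partial>lborel)"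
    using assms True by (intro integral_mono integrable_norm integrable_mult_left) (auto simp: norm_mult mult_left_mono)
  finally show ?thesis by simp
next
  case False
  \<comment> \<open>Without integrability the pairing is 0 by convention, and the claim reduces to
    the sign of \<open>D\<close>.\<close>
  have "0 \<le> D" using assms(2)[of undefined] norm_ge_zero order_trans by blast
  then show ?thesis using False by (simp add: pairing_def not_integrable_integral_eq)
qed

lemma pairing_tendsto:
  fixes u :: "'a::euclidean_space \<Rightarrow> real" and f :: "nat \<Rightarrow> 'a \<Rightarrow> complex"
  assumes u: "integrable lborel u" and m[measurable]: "\<And>k. f k \<in> borel_measurable borel"
    and D: "\<And>k x. norm (f k x) \<le> D" and lim: "\<And>x. (\<lambda>k. f k x) \<longlonglongrightarrow> g x"
  shows "(\<lambda>k. pairing u (f k)) \<longlonglongrightarrow> pairing u g"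
  unfolding pairing_def
proof (rule integral_dominated_convergence)
  have [measurable]: "u \<in> borel_measurable borel" using u by auto
  have [measurable]: "g \<in> borel_measurable borel" by (rule borel_measurable_LIMSEQ_metric[OF m lim])
  show "integrable lborel (\<lambda>x. \<bar>u x\<bar> * D)" using u by auto
  show "(\<lambda>x. complex_of_real (u x) * g x) \<in> borel_measurable lborel" by measurable
  show "(\<lambda>x. complex_of_real (u x) * f k x) \<in> borel_measurable lborel" for k by measurable
  show "AE x in lborel. (\<lambda>k. complex_of_real (u x) * f k x) \<longlonglongrightarrow> complex_of_real (u x) * g x"
    by (intro AE_I2 tendsto_intros lim)
  show "AE x in lborel. norm (complex_of_real (u x) * f k x) \<le> \<bar>u x\<bar> * D" for k
    using D by (intro AE_I2) (simp add: norm_mult mult_left_mono)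
qed

text \<open>The equation is tested with waves of damping \<open>1 / real (Suc k)\<close> and put
  into Volterra form for each \<open>k\<close>. That form contains only pairings, which are bounded
  in \<open>k\<close> by the local bound on the \<open>L^1\<close> norms and converge to
  \<open>y\<close> and to \<open>y\<close> times the multiplier. The constant 1 is the value of each
  test function at the origin.\<close>

lemma telegraph_solution_volterra:
  fixes w :: "'a::euclidean_space \<Rightarrow> real \<Rightarrow> real" and \<eta> :: 'a
  assumes nu: "0 < \<nu>" "\<nu> \<le> 1 / 2" and \<beta>: "0 < \<beta>" "\<beta> \<le> 1"
    and sol: "telegraph_solution \<nu> \<beta> c lam w" and T: "0 < T"
  defines "y \<equiv> (\<lambda>t. fourier (\<lambda>x. complex_of_real (w x t)) \<eta>)"
  shows "y T - 1 + complex_of_real (2 * lam) * frac_int \<nu> (\<lambda>s. y s - 1) T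
      + complex_of_real (c\<^sup>2 * norm \<eta> powr (2 * \<beta>)) * frac_int (2 * \<nu>) y T = 0" (is ?volterra)
    and "\<exists>B. \<forall>s. 0 < s \<and> s \<le> T \<longrightarrow> norm (y s) \<le> B" (is ?bounded)
    and "set_borel_measurable lborel {0<..<T} y" (is ?measurable)
proof -
  define \<phi> where "\<phi> k = damped_wave \<eta> (1 / real (Suc k))" for k
  define F where "F k t = pairing (\<lambda>x. w x t) (\<phi> k)" for k t
  define R where "R k t = complex_of_real (c\<^sup>2) * pairing (\<lambda>x. w x t) (neg_frac_laplacian \<beta> (\<phi> k))" for k t
  define D where "D = (\<integral>z. (1 + 2 * (norm \<eta>)\<^sup>2) * gauss z + 2 * ((norm z)\<^sup>2 * gauss z) \<partial>(lborel :: 'a measure))"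
  have e: "0 < 1 / real (Suc k)" "1 / real (Suc k) \<le> 1" for k by auto
  have D0: "0 \<le> D" unfolding D_def by (intro Bochner_Integration.integral_nonneg) (auto simp: gauss_nonneg)
  have wi: "integrable lborel (\<lambda>x. w x t)" if "0 < t" for t
    using sol that by (simp add: telegraph_solution_def)
  obtain B where B: "\<And>t. 0 < t \<Longrightarrow> t \<le> T \<Longrightarrow> (\<integral>x. \<bar>w x t\<bar> \<partial>lborel) \<le> B"
    using sol T unfolding telegraph_solution_def by fastforce
  have B0: "0 \<le> B" using B[OF T] by (meson Bochner_Integration.integral_nonneg abs_ge_zero order.trans order_refl)
  have sol\<phi>: "(\<forall>t>0. caputo_differentiable (2 * \<nu>) (F k) t \<and> caputo_differentiable \<nu> (F k) t \<and>
      caputo_deriv (2 * \<nu>) (F k) t + complex_of_real (2 * lam) * caputo_deriv \<nu> (F k) t = R k t) \<and>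
      (F k \<longlongrightarrow> \<phi> k 0) (at_right 0)" for k
    using sol test_function_damped_wave[OF e \<beta>, of \<eta> k]
    unfolding telegraph_solution_def Let_def F_def R_def \<phi>_def by blast
  have \<phi>0: "\<phi> k 0 = 1" for k
    unfolding \<phi>_def damped_wave_def exp_eq_gauss[symmetric] by simp
  have c2: "caputo_differentiable (2 * \<nu>) (F k) t" and c1: "caputo_differentiable \<nu> (F k) t"
    and eq: "caputo_deriv (2 * \<nu>) (F k) t + complex_of_real (2 * lam) * caputo_deriv \<nu> (F k) t = R k t"
    and F0: "(F k \<longlongrightarrow> 1) (at_right 0)" if "0 < t" for k t
    using sol\<phi>[of k] that by (auto simp: \<phi>0)
  note volt = caputo_volterra[OF nu c2 c1 eq F0[OF zero_less_one] T]
  have \<phi>m: "\<phi> k \<in> borel_measurable borel" for k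
    unfolding \<phi>_def damped_wave_def by measurable
  have \<phi>b: "norm (\<phi> k x) \<le> 1" for k x unfolding \<phi>_def by (rule norm_damped_wave_le[OF e \<beta>])
  have Fb: "norm (F k t) \<le> B" if "0 < t" "t \<le> T" for k t
  proof -
    have "norm (F k t) \<le> (\<integral>x. \<bar>w x t\<bar> \<partial>lborel) * 1"
      unfolding F_def by (intro norm_pairing_le wi that \<phi>b)
    then show ?thesis using B[OF that] by simp
  qed
  have Rb: "norm (R k t) \<le> c\<^sup>2 * (B * D)" if "0 < t" "t \<le> T" for k t
  proof -
    have "norm (pairing (\<lambda>x. w x t) (neg_frac_laplacian \<beta> (\<phi> k))) \<le> (\<integral>x. \<bar>w x t\<bar> \<partial>lborel) * D"
      unfolding \<phi>_def D_def by (intro norm_pairing_le wi that norm_neg_frac_laplacian_damped_wave_le[OF e \<beta>])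
    also have "\<dots> \<le> B * D" using B[OF that] D0 by (rule mult_right_mono)
    finally show ?thesis unfolding R_def norm_mult norm_of_real by (simp add: mult_left_mono)
  qed
  have Flim: "(\<lambda>k. F k t) \<longlonglongrightarrow> y t" if "0 < t" for t
  proof -
    have "(\<lambda>k. F k t) \<longlonglongrightarrow> pairing (\<lambda>x. w x t) (\<lambda>x. exp (\<i> * complex_of_real (\<eta> \<bullet> x)))"
      unfolding F_def by (rule pairing_tendsto[OF wi[OF that] \<phi>m \<phi>b]) (unfold \<phi>_def, rule damped_wave_tendsto)
    then show ?thesis by (simp add: y_def fourier_def pairing_def mult.commute)
  qed
  define a where "a = c\<^sup>2 * norm \<eta> powr (2 * \<beta>)"
  have Rlim: "(\<lambda>k. R k t) \<longlonglongrightarrow> - (complex_of_real a * y t)" if "0 < t" for t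
  proof -
    have "(\<lambda>k. pairing (\<lambda>x. w x t) (neg_frac_laplacian \<beta> (\<phi> k))) \<longlonglongrightarrow> pairing (\<lambda>x. w x t) (\<lambda>x. - (complex_of_real (norm \<eta> powr (2 * \<beta>)) * exp (\<i> * complex_of_real (\<eta> \<bullet> x))))"
      unfolding \<phi>_def
      by (rule pairing_tendsto[OF wi[OF that] neg_frac_laplacian_damped_wave_measurable[OF e \<beta>] norm_neg_frac_laplacian_damped_wave_le[OF e \<beta>] neg_frac_laplacian_damped_wave_tendsto[OF \<beta>]])
    then have "(\<lambda>k. R k t) \<longlonglongrightarrow> complex_of_real (c\<^sup>2) * pairing (\<lambda>x. w x t) (\<lambda>x. - (complex_of_real (norm \<eta> powr (2 * \<beta>)) * exp (\<i> * complex_of_real (\<eta> \<bullet> x))))"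
      unfolding R_def by (rule tendsto_mult_left)
    also have "pairing (\<lambda>x. w x t) (\<lambda>x. - (complex_of_real (norm \<eta> powr (2 * \<beta>)) * exp (\<i> * complex_of_real (\<eta> \<bullet> x)))) = - (complex_of_real (norm \<eta> powr (2 * \<beta>))) * y t"
      unfolding pairing_def y_def fourier_def integral_mult_right_zero[symmetric]
      by (intro Bochner_Integration.integral_cong) simp_all
    finally show ?thesis by (simp add: a_def mult.assoc)
  qed
  \<comment> \<open>A solution is not assumed measurable in time. The pairings are continuous
    because they are differentiable, and \<open>y\<close> inherits measurability as their pointwise
    limit.\<close>
  have Fm: "(\<lambda>s. indicator {0<..<T} s *\<^sub>R F k s) \<in> borel_measurable borel" for k
  proof (rule borel_measurable_continuous_on_indicator)
    have nu1: "0 < \<nu>" "\<nu> < 1" using nu by auto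
    have "isCont (F k) s" if "0 < s" for s
      using c1[OF that, of k] that unfolding caputo_differentiable_iff[OF nu1]
      by (auto intro!: differentiable_imp_continuous_within)
    then show "continuous_on {0<..<T} (F k)" by (intro continuous_at_imp_continuous_on) auto
  qed simp
  have "(\<lambda>s. indicator {0<..<T} s *\<^sub>R y s) \<in> borel_measurable borel"
  proof (rule borel_measurable_LIMSEQ_metric[OF Fm])
    show "(\<lambda>k. indicator {0<..<T} s *\<^sub>R F k s) \<longlonglongrightarrow> indicator {0<..<T} s *\<^sub>R y s" for s
      using Flim[of s] by (cases "0 < s \<and> s < T") auto
  qed
  then show ?measurable by (simp add: set_borel_measurable_def)
  have "norm (y s) \<le> B" if "0 < s" "s \<le> T" for s
    using tendsto_norm[OF Flim[OF that(1)]] by (rule LIMSEQ_le_const2) (use Fb that in auto)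
  then show ?bounded by blast
  have l1: "(\<lambda>k. frac_int \<nu> (\<lambda>s. F k s - 1) T) \<longlonglongrightarrow> frac_int \<nu> (\<lambda>s. y s - 1) T"
  proof (rule frac_int_tendsto[OF nu(1)])
    fix k
    have "(\<lambda>s. frac_kernel \<nu> (T - s) *\<^sub>R (indicator {0<..<T} s *\<^sub>R F k s - indicator {0<..<T} s *\<^sub>R (1::complex))) \<in> borel_measurable borel"
      using Fm[of k] by measurable
    also have "(\<lambda>s. frac_kernel \<nu> (T - s) *\<^sub>R (indicator {0<..<T} s *\<^sub>R F k s - indicator {0<..<T} s *\<^sub>R (1::complex))) = (\<lambda>s. indicator {0<..<T} s *\<^sub>R (frac_kernel \<nu> (T - s) *\<^sub>R (F k s - 1)))"
      by (auto simp: indicator_def fun_eq_iff)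
    finally show "(\<lambda>s. indicator {0<..<T} s *\<^sub>R (frac_kernel \<nu> (T - s) *\<^sub>R (F k s - 1))) \<in> borel_measurable borel" .
    fix s assume "0 < s" "s < T"
    then have "norm (F k s) \<le> B" by (intro Fb) auto
    then show "norm (F k s - 1) \<le> B + 1"
      by (intro order_trans[OF norm_triangle_ineq4]) simp
  next
    fix s assume "0 < s" "s < T"
    then show "(\<lambda>k. F k s - 1) \<longlonglongrightarrow> y s - 1" by (intro tendsto_intros Flim)
  qed
  have l2: "(\<lambda>k. frac_int (2 * \<nu>) (R k) T) \<longlonglongrightarrow> frac_int (2 * \<nu>) (\<lambda>s. - (complex_of_real a * y s)) T"
  proof (rule frac_int_tendsto[where B="c\<^sup>2 * (B * D)"])
    show "(\<lambda>s. indicator {0<..<T} s *\<^sub>R (frac_kernel (2 * \<nu>) (T - s) *\<^sub>R R k s)) \<in> borel_measurable borel" for k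
      using volt(2)[of k] unfolding set_integrable_def by (auto dest: borel_measurable_integrable)
  qed (use nu Rb Rlim in auto)
  have l3: "(\<lambda>k. F k T - 1 + complex_of_real (2 * lam) * frac_int \<nu> (\<lambda>s. F k s - 1) T) \<longlonglongrightarrow> y T - 1 + complex_of_real (2 * lam) * frac_int \<nu> (\<lambda>s. y s - 1) T"
    by (intro tendsto_intros Flim T l1)
  have v: "F k T - 1 + complex_of_real (2 * lam) * frac_int \<nu> (\<lambda>s. F k s - 1) T = frac_int (2 * \<nu>) (R k) T" for k
    using volt(1)[of k] by simp
  have "y T - 1 + complex_of_real (2 * lam) * frac_int \<nu> (\<lambda>s. y s - 1) T = frac_int (2 * \<nu>) (\<lambda>s. - (complex_of_real a * y s)) T"
    by (rule LIMSEQ_unique[OF _ l2]) (use l3 in \<open>simp only: v\<close>)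
  also have "\<dots> = (LINT s:{0<..<T}|lborel. - complex_of_real a * (frac_kernel (2 * \<nu>) (T - s) *\<^sub>R y s))"
    unfolding frac_int_def by (simp add: mult_scaleR_right)
  also have "\<dots> = - complex_of_real a * frac_int (2 * \<nu>) y T"
    unfolding frac_int_def by (rule set_integral_mult_right)
  finally show ?volterra by (simp add: a_def)
qed

section \<open>The closed form of the Fourier transform\<close>

text \<open>The relaxation function at time \<open>t\<close> as a function of its rate, continued to
  complex \<open>A\<close>. The double successor comes from the index \<open>2 * \<nu> + 1\<close>.
  Complex arguments are needed because the limit at a double root is taken over complex square
  roots.\<close>

definition telegraph_entire :: "real \<Rightarrow> real \<Rightarrow> real \<Rightarrow> complex \<Rightarrow> complex" where
  "telegraph_entire \<nu> l t A = 1 - A * (\<Sum>k. telegraph_coeff l A k * (complex_of_real ((t powr \<nu>) ^ Suc (Suc k) / Gamma (\<nu> * real (Suc (Suc k)) + 1))))"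

context
  fixes \<nu> l t :: real
  assumes \<nu>: "0 < \<nu>" and t: "0 < t"
begin

lemma telegraph_entire_of_real:
  "telegraph_entire \<nu> l t (complex_of_real a) = complex_of_real (1 - a * telegraph_ml \<nu> l a (2 * \<nu> + 1) t)"
proof -
  have e: "frac_kernel (\<nu> * real k + (2 * \<nu> + 1)) t = (t powr \<nu>) ^ Suc (Suc k) / Gamma (\<nu> * real (Suc (Suc k)) + 1)" for k
  proof -
    have "\<nu> * real k + (2 * \<nu> + 1) = \<nu> * real (Suc (Suc k)) + 1" by (simp add: algebra_simps)
    moreover have "frac_kernel (\<nu> * real (Suc (Suc k)) + 1) t = (t powr \<nu>) ^ Suc (Suc k) / Gamma (\<nu> * real (Suc (Suc k)) + 1)"
      using t by (subst frac_kernel_power) auto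
    ultimately show ?thesis by (simp only:)
  qed
  have "summable (\<lambda>k. telegraph_coeff l a k * frac_kernel (\<nu> * real k + (2 * \<nu> + 1)) t)"
    using \<nu> by (intro ml_series_summable[OF \<nu> telegraph_coeff_real_bound]) auto
  from suminf_of_real[OF this[unfolded e], where 'a=complex]
  show ?thesis
    unfolding telegraph_entire_def telegraph_ml_def ml_series_def e by (simp only: telegraph_coeff_of_real of_real_mult of_real_diff of_real_1)
qed

lemma telegraph_entire_continuous: "continuous_on UNIV (telegraph_entire \<nu> l t)"
proof -
  have "continuous_on (ball 0 R) (telegraph_entire \<nu> l t)" if "0 < R" for R
  proof -
    let ?q = "\<lambda>k. (t powr \<nu>) ^ Suc (Suc k) / Gamma (\<nu> * real (Suc (Suc k)) + 1)"
    define B where "B = 2 * \<bar>l\<bar> + R + 1"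
    have B: "1 \<le> B" using that by (simp add: B_def)
    have G: "0 < Gamma (\<nu> * real k + 1)" for k using \<nu> by (intro Gamma_real_pos) (simp add: add_nonneg_pos)
    have "uniform_limit (ball 0 R) (\<lambda>n A. \<Sum>k<n. telegraph_coeff l A k * complex_of_real (?q k))
        (\<lambda>A. \<Sum>k. telegraph_coeff l A k * complex_of_real (?q k)) sequentially"
    proof (rule Weierstrass_m_test)
      have "summable (\<lambda>k. (B * t powr \<nu>) ^ k / Gamma (\<nu> * real k + 1))"
        by (rule summable_power_over_Gamma[OF \<nu>]) simp
      then have "summable (\<lambda>k. (B * t powr \<nu>) ^ Suc (Suc k) / Gamma (\<nu> * real (Suc (Suc k)) + 1))"
        by (subst summable_Suc_iff[of "\<lambda>k. (B * t powr \<nu>) ^ Suc k / Gamma (\<nu> * real (Suc k) + 1)"])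
          (subst summable_Suc_iff[of "\<lambda>k. (B * t powr \<nu>) ^ k / Gamma (\<nu> * real k + 1)"])
      then show "summable (\<lambda>k. (B * t powr \<nu>) ^ Suc (Suc k) / Gamma (\<nu> * real (Suc (Suc k)) + 1))" .
      fix k and A :: complex assume "A \<in> ball 0 R"
      then have "norm A \<le> R" by simp
      from telegraph_coeff_bound[OF this, of l k]
      have "norm (telegraph_coeff l A k) \<le> B ^ k" by (simp add: B_def)
      \<comment> \<open>The exponent is raised to match that of \<open>t powr \<nu>\<close>, so that
        the majorant is a shifted Mittag-Leffler series.\<close>
      also have "\<dots> \<le> B ^ Suc (Suc k)" using B by (intro power_increasing) auto
      finally have c: "norm (telegraph_coeff l A k) \<le> B ^ Suc (Suc k)" .
      have q: "0 \<le> ?q k" using G[of "Suc (Suc k)"] by (intro divide_nonneg_pos) auto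
      have "norm (telegraph_coeff l A k * complex_of_real (?q k)) = norm (telegraph_coeff l A k) * ?q k"
        unfolding norm_mult norm_of_real using q by (simp only: abs_of_nonneg)
      also have "\<dots> \<le> B ^ Suc (Suc k) * ?q k" using c q by (rule mult_right_mono)
      also have "\<dots> = (B * t powr \<nu>) ^ Suc (Suc k) / Gamma (\<nu> * real (Suc (Suc k)) + 1)"
        by (simp only: power_mult_distrib times_divide_eq_right)
      finally show "norm (telegraph_coeff l A k * complex_of_real (?q k)) \<le> (B * t powr \<nu>) ^ Suc (Suc k) / Gamma (\<nu> * real (Suc (Suc k)) + 1)" .
    qed
    then have "continuous_on (ball 0 R) (\<lambda>A. \<Sum>k. telegraph_coeff l A k * complex_of_real (?q k))"
      by (rule uniform_limit_theorem[rotated])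
        (auto intro!: always_eventually continuous_intros continuous_on_subset[OF continuous_on_telegraph_coeff] simp del: of_real_divide of_real_power)
    then show ?thesis
      unfolding telegraph_entire_def by (intro continuous_intros)
  qed
  then have "isCont (telegraph_entire \<nu> l t) A" for A
  proof -
    have "A \<in> ball 0 (norm A + 1)" by simp
    with \<open>\<And>R. 0 < R \<Longrightarrow> continuous_on (ball 0 R) (telegraph_entire \<nu> l t)\<close>[of "norm A + 1"] show ?thesis
      using continuous_on_interior[of "ball 0 (norm A + 1)" "telegraph_entire \<nu> l t" A] by (simp add: add_nonneg_pos)
  qed
  then show ?thesis by (simp add: continuous_on_eq_continuous_at)
qed

lemma mittag_leffler_summable: "summable (\<lambda>k. z ^ k / complex_of_real (Gamma (\<nu> * real k + 1)))"
proof (rule summable_norm_cancel)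
  have "0 < Gamma (\<nu> * real k + 1)" for k using \<nu> by (intro Gamma_real_pos) (simp add: add_nonneg_pos)
  then have "norm (z ^ k / complex_of_real (Gamma (\<nu> * real k + 1))) = norm z ^ k / Gamma (\<nu> * real k + 1)" for k
    by (simp only: norm_divide norm_power norm_of_real abs_of_pos)
  then show "summable (\<lambda>k. norm (z ^ k / complex_of_real (Gamma (\<nu> * real k + 1))))"
    using summable_power_over_Gamma[OF \<nu>, of 1 "norm z"] by simp
qed

text \<open>The numbers \<open>- L + s\<close> and \<open>- L - s\<close> are the characteristic
  roots of the recurrence for \<open>telegraph_coeff\<close>. The weights in the closed form are
  those for which the combined powers start with 1 and 0, so from the second term on they are
  \<open>- A\<close> times the coefficients.\<close>

lemma telegraph_fourier_eq_entire:
  assumes s: "s \<noteq> 0"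
  shows "telegraph_fourier \<nu> l t s = telegraph_entire \<nu> l t ((complex_of_real l)\<^sup>2 - s\<^sup>2)"
proof -
  define A where "A = (complex_of_real l)\<^sup>2 - s\<^sup>2"
  define L where "L = complex_of_real l"
  define p where "p = 1 / 2 * (1 + L / s)"
  define q where "q = 1 / 2 * (1 - L / s)"
  define x where "x = complex_of_real (t powr \<nu>)"
  define g where "g k = complex_of_real (Gamma (\<nu> * real k + 1))" for k
  \<comment> \<open>The combined coefficient of the two Mittag-Leffler series; it solves the same
    recurrence as \<open>telegraph_coeff\<close>, with initial values 1 and 0.\<close>
  define e where "e k = p * (- L + s) ^ k + q * (- L - s) ^ k" for k
  have e0: "e 0 = 1" by (simp add: e_def p_def q_def add_divide_distrib diff_divide_distrib)
  have "p + q = 1" using s by (simp add: p_def q_def field_simps)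
  moreover have "(p - q) * s = L" using s by (simp add: p_def q_def field_simps)
  moreover have "e (Suc 0) = (p - q) * s - (p + q) * L" by (simp add: e_def algebra_simps)
  ultimately have e1: "e (Suc 0) = 0" by simp
  have erec: "e (Suc (Suc k)) = - 2 * L * e (Suc k) - A * e k" for k
  proof -
    have r1: "(- L + s) ^ Suc (Suc k) = - 2 * L * (- L + s) ^ Suc k - A * (- L + s) ^ k"
      by (simp add: A_def L_def power2_eq_square algebra_simps)
    have r2: "(- L - s) ^ Suc (Suc k) = - 2 * L * (- L - s) ^ Suc k - A * (- L - s) ^ k"
      by (simp add: A_def L_def power2_eq_square algebra_simps)
    show ?thesis unfolding e_def r1 r2 by (simp add: algebra_simps)
  qed
  have ecoef: "e (Suc (Suc k)) = - A * telegraph_coeff l A k" for k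
  proof (induction k rule: induct_nat_012)
    case 0
    show ?case by (simp only: erec e0 e1) simp
  next
    case 1
    show ?case by (simp only: erec e0 e1) (simp add: L_def)
  next
    case (ge2 k)
    show ?case unfolding erec[of "Suc (Suc k)"] ge2 by (simp add: L_def algebra_simps)
  qed
  have sm1: "summable (\<lambda>k. ((- L + s) * x) ^ k / g k)" and sm2: "summable (\<lambda>k. ((- L - s) * x) ^ k / g k)"
    unfolding g_def by (rule mittag_leffler_summable)+
  have trm: "p * (((- L + s) * x) ^ k / g k) + q * (((- L - s) * x) ^ k / g k) = e k * x ^ k / g k" for k
    unfolding e_def by (simp only: power_mult_distrib) (simp only: distrib_right add_divide_distrib times_divide_eq_right mult.assoc)
  have dist: "1 / 2 * (u * a + v * b) = 1 / 2 * u * a + 1 / 2 * v * b" for u v a b :: complex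
    by (simp add: algebra_simps)
  have "telegraph_fourier \<nu> l t s = p * (\<Sum>k. ((- L + s) * x) ^ k / g k) + q * (\<Sum>k. ((- L - s) * x) ^ k / g k)"
    unfolding telegraph_fourier_def mittag_leffler_def Let_def p_def q_def L_def x_def g_def by (rule dist)
  also have "\<dots> = (\<Sum>k. e k * x ^ k / g k)"
    unfolding suminf_mult[OF sm1, symmetric] suminf_mult[OF sm2, symmetric]
    by (subst suminf_add[OF summable_mult[OF sm1] summable_mult[OF sm2]]) (simp only: trm)
  finally have tf: "telegraph_fourier \<nu> l t s = (\<Sum>k. e k * x ^ k / g k)" .
  have sm: "summable (\<lambda>k. e k * x ^ k / g k)"
    using summable_add[OF summable_mult[OF sm1, of p] summable_mult[OF sm2, of q]] by (simp only: trm)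
  have sm': "summable (\<lambda>k. e (Suc k) * x ^ Suc k / g (Suc k))"
    using sm by (subst summable_Suc_iff[of "\<lambda>k. e k * x ^ k / g k"])
  have sm'': "summable (\<lambda>k. e (Suc (Suc k)) * x ^ Suc (Suc k) / g (Suc (Suc k)))"
    using sm' by (subst summable_Suc_iff[of "\<lambda>k. e (Suc k) * x ^ Suc k / g (Suc k)"])
  have t1: "e (Suc (Suc k)) * x ^ Suc (Suc k) / g (Suc (Suc k)) = - A * (telegraph_coeff l A k * complex_of_real ((t powr \<nu>) ^ Suc (Suc k) / Gamma (\<nu> * real (Suc (Suc k)) + 1)))" for k
    unfolding ecoef x_def g_def of_real_divide of_real_power by (simp only: times_divide_eq_right mult.assoc)
  have "g 0 = 1" by (simp add: g_def)
  then have "(\<Sum>k. e k * x ^ k / g k) = 1 + (\<Sum>k. e (Suc (Suc k)) * x ^ Suc (Suc k) / g (Suc (Suc k)))"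
    using suminf_split_head[OF sm] suminf_split_head[OF sm'] by (simp add: e0 e1)
  also have "(\<Sum>k. e (Suc (Suc k)) * x ^ Suc (Suc k) / g (Suc (Suc k))) = - A * (\<Sum>k. telegraph_coeff l A k * complex_of_real ((t powr \<nu>) ^ Suc (Suc k) / Gamma (\<nu> * real (Suc (Suc k)) + 1)))"
  proof (cases "A = 0")
    case True
    then show ?thesis unfolding t1 by simp
  next
    case False
    have "summable (\<lambda>k. telegraph_coeff l A k * complex_of_real ((t powr \<nu>) ^ Suc (Suc k) / Gamma (\<nu> * real (Suc (Suc k)) + 1)))"
      using sm'' False unfolding t1 by (subst (asm) summable_cmult_iff) auto
    then show ?thesis unfolding t1 by (rule suminf_mult)
  qed
  finally show ?thesis
    unfolding tf telegraph_entire_def A_def[symmetric] by (simp only: mult_minus_left diff_conv_add_uminus)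
qed

end

section \<open>Existence, uniqueness and the closed form combined\<close>

context telegraph_processes
begin

definition is_law_density :: "real \<Rightarrow> ('a \<Rightarrow> real) \<Rightarrow> bool" where
  "is_law_density t w \<longleftrightarrow> (\<forall>x. 0 \<le> w x) \<and> integrable lborel w \<and> (\<integral>x. w x \<partial>lborel) = 1 \<and>
    distr M borel (W t) = density lborel (\<lambda>x. ennreal (w x)) \<and>
    (\<forall>\<xi>. fourier (\<lambda>x. complex_of_real (w x)) \<xi> = complex_of_real (relax (rate \<xi>) t))"

lemma law_density_exists: "\<exists>w. \<forall>t>0. is_law_density t (\<lambda>x. w x t)"
proof -
  have "\<forall>t. \<exists>w. 0 < t \<longrightarrow> is_law_density t w"
  proof
    fix t
    show "\<exists>w. 0 < t \<longrightarrow> is_law_density t w"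
    proof (cases "0 < t")
      case True
      from W_density[OF this] show ?thesis unfolding is_law_density_def by metis
    qed simp
  qed
  then obtain v where "\<forall>t. 0 < t \<longrightarrow> is_law_density t (v t)" by metis
  then show ?thesis by (intro exI[of _ "\<lambda>x t. v t x"]) simp
qed

text \<open>\<open>\<phi>\<close> and its image under the operator are inverse transforms of
  \<open>\<Phi>\<close> and \<open>\<psi>\<close>, related by
  \<open>rate \<xi> * \<Phi> \<xi> = - c\<^sup>2 * \<psi> \<xi>\<close>. Parseval's relation turns
  both sides of the equation into the superpositions treated above.\<close>

lemma law_density_test_function:
  assumes w: "\<And>t. 0 < t \<Longrightarrow> is_law_density t (\<lambda>x. w x t)" and \<phi>: "test_function \<beta> \<phi>"
  defines "F \<equiv> (\<lambda>t. pairing (\<lambda>x. w x t) \<phi>)"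
  shows "0 < t \<Longrightarrow> caputo_differentiable (2 * \<nu>) F t" "0 < t \<Longrightarrow> caputo_differentiable \<nu> F t"
    "0 < t \<Longrightarrow> caputo_deriv (2 * \<nu>) F t + complex_of_real (2 * lam) * caputo_deriv \<nu> F t
      = complex_of_real (c\<^sup>2) * pairing (\<lambda>x. w x t) (neg_frac_laplacian \<beta> \<phi>)"
    "(F \<longlongrightarrow> \<phi> 0) (at_right 0)"
proof -
  have wi: "integrable lborel (\<lambda>x. w x t)"
    and wf: "fourier (\<lambda>x. complex_of_real (w x t)) \<xi> = complex_of_real (relax (rate \<xi>) t)" if "0 < t" for t \<xi>
    using w[OF that] by (auto simp: is_law_density_def)
  note D = test_functionD[OF \<phi>]
  define C where "C = complex_of_real (1 / (2 * pi) ^ DIM('a))"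
  define \<Phi> where "\<Phi> \<xi> = C * fourier \<phi> \<xi>" for \<xi>
  define \<psi> where "\<psi> \<xi> = - (C * (complex_of_real (norm \<xi> powr (2 * \<beta>)) * fourier \<phi> \<xi>))" for \<xi>
  have \<Phi>: "integrable lborel \<Phi>" unfolding \<Phi>_def by (intro integrable_mult_right D)
  have \<psi>: "integrable lborel \<psi>" unfolding \<psi>_def by (intro integrable_minus integrable_mult_right D)
  have rate\<Phi>: "complex_of_real (rate \<xi>) * \<Phi> \<xi> = - (complex_of_real (c\<^sup>2) * \<psi> \<xi>)" for \<xi>
    by (simp add: rate_def \<Phi>_def \<psi>_def)
  have \<Theta>: "integrable lborel (\<lambda>\<xi>. complex_of_real (rate \<xi>) * \<Phi> \<xi>)"
    unfolding rate\<Phi> by (intro integrable_minus integrable_mult_right \<psi>)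
  have inv: "\<phi> = (\<lambda>x. \<integral>\<xi>. exp (- \<i> * complex_of_real (x \<bullet> \<xi>)) * \<Phi> \<xi> \<partial>lborel)"
  proof
    fix x
    have "(\<integral>\<xi>. exp (- \<i> * complex_of_real (x \<bullet> \<xi>)) * \<Phi> \<xi> \<partial>lborel) = (\<integral>\<xi>. C * (exp (- \<i> * complex_of_real (x \<bullet> \<xi>)) * fourier \<phi> \<xi>) \<partial>lborel)"
      by (simp only: \<Phi>_def mult.left_commute)
    also have "\<dots> = C * (complex_of_real ((2 * pi) ^ DIM('a)) * \<phi> x)"
      unfolding integral_mult_right_zero fourier_inversion[OF D(1-3)] ..
    also have "\<dots> = \<phi> x" by (simp add: C_def)
    finally show "\<phi> x = (\<integral>\<xi>. exp (- \<i> * complex_of_real (x \<bullet> \<xi>)) * \<Phi> \<xi> \<partial>lborel)" ..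
  qed
  have nfl: "neg_frac_laplacian \<beta> \<phi> = (\<lambda>x. \<integral>\<xi>. exp (- \<i> * complex_of_real (x \<bullet> \<xi>)) * \<psi> \<xi> \<partial>lborel)"
  proof
    fix x
    have "exp (- \<i> * complex_of_real (x \<bullet> \<xi>)) * \<psi> \<xi> = - C * (exp (- \<i> * complex_of_real (x \<bullet> \<xi>)) * complex_of_real (norm \<xi> powr (2 * \<beta>)) * fourier \<phi> \<xi>)" for \<xi>
      by (simp add: \<psi>_def)
    then show "neg_frac_laplacian \<beta> \<phi> x = (\<integral>\<xi>. exp (- \<i> * complex_of_real (x \<bullet> \<xi>)) * \<psi> \<xi> \<partial>lborel)"
      unfolding neg_frac_laplacian_def C_def by (simp only: integral_mult_right_zero)
  qed
  have F: "F t = (\<integral>\<xi>. \<Phi> \<xi> * complex_of_real (relax (rate \<xi>) t) \<partial>lborel)" if "0 < t" for t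
    unfolding F_def by (subst inv) (simp only: pairing_fourier_inverse[OF wi[OF that] \<Phi>] wf[OF that] rate_uminus)
  have R: "complex_of_real (c\<^sup>2) * pairing (\<lambda>x. w x t) (neg_frac_laplacian \<beta> \<phi>)
    = - (\<integral>\<xi>. (complex_of_real (rate \<xi>) * \<Phi> \<xi>) * complex_of_real (relax (rate \<xi>) t) \<partial>lborel)" if "0 < t" for t
    unfolding nfl pairing_fourier_inverse[OF wi[OF that] \<psi>] wf[OF that] rate_uminus rate\<Phi>
    by (simp add: mult.assoc)
  show "caputo_differentiable (2 * \<nu>) F t" "caputo_differentiable \<nu> F t" if "0 < t"
    using nu that superposition_caputo(1)[OF \<Phi> \<Theta> F, of "2 * \<nu>"] superposition_caputo(1)[OF \<Phi> \<Theta> F, of \<nu>] by auto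
  show "caputo_deriv (2 * \<nu>) F t + complex_of_real (2 * lam) * caputo_deriv \<nu> F t
      = complex_of_real (c\<^sup>2) * pairing (\<lambda>x. w x t) (neg_frac_laplacian \<beta> \<phi>)" if "0 < t"
    unfolding R[OF that] by (rule superposition_equation[OF \<Phi> \<Theta> F that])
  have "\<phi> 0 = (\<integral>\<xi>. \<Phi> \<xi> \<partial>lborel)" by (subst inv) simp
  then show "(F \<longlongrightarrow> \<phi> 0) (at_right 0)" using superposition_initial[OF \<Phi> \<Theta> F] by simp
qed

lemma law_density_solution:
  assumes w: "\<And>t. 0 < t \<Longrightarrow> is_law_density t (\<lambda>x. w x t)"
  shows "telegraph_solution \<nu> \<beta> c lam w"
proof -
  have "\<exists>B. \<forall>t\<in>{0<..T}. (\<integral>x. \<bar>w x t\<bar> \<partial>lborel) \<le> B" for T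
  proof (intro exI ballI)
    fix t assume "t \<in> {0<..T}"
    then have "is_law_density t (\<lambda>x. w x t)" using w by simp
    then show "(\<integral>x. \<bar>w x t\<bar> \<partial>lborel) \<le> 1" by (simp add: is_law_density_def)
  qed
  moreover have "integrable lborel (\<lambda>x. w x t)" if "0 < t" for t
    using w[OF that] by (simp add: is_law_density_def)
  ultimately show ?thesis
    unfolding telegraph_solution_def Let_def using law_density_test_function[OF w] by blast
qed

text \<open>An arbitrary solution is compared with the one built from the densities of the process.
  Their transforms satisfy the same inhomogeneous Volterra equation, so the difference is a bounded
  solution of the homogeneous one and vanishes.\<close>

lemma solution_fourier:
  assumes "\<beta> \<le> 1" and sol: "telegraph_solution \<nu> \<beta> c lam w" and t: "0 < t"
  shows "fourier (\<lambda>x. complex_of_real (w x t)) \<xi> = complex_of_real (relax (rate \<xi>) t)"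
proof -
  obtain w0 where w0: "\<And>t. 0 < t \<Longrightarrow> is_law_density t (\<lambda>x. w0 x t)" using law_density_exists by blast
  have sol0: "telegraph_solution \<nu> \<beta> c lam w0" by (rule law_density_solution[OF w0])
  define y where "y t = fourier (\<lambda>x. complex_of_real (w x t)) \<xi>" for t
  define y0 where "y0 t = fourier (\<lambda>x. complex_of_real (w0 x t)) \<xi>" for t
  note V = telegraph_solution_volterra[OF nu beta \<open>\<beta> \<le> 1\<close> sol, of _ \<xi>, folded y_def rate_def]
  note V0 = telegraph_solution_volterra[OF nu beta \<open>\<beta> \<le> 1\<close> sol0, of _ \<xi>, folded y0_def rate_def]
  obtain B where B: "\<And>s. 0 < s \<Longrightarrow> s \<le> t \<Longrightarrow> norm (y s) \<le> B" using V(2)[OF t] by auto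
  obtain B0 where B0: "\<And>s. 0 < s \<Longrightarrow> s \<le> t \<Longrightarrow> norm (y0 s) \<le> B0" using V0(2)[OF t] by auto
  have gen: "(a - 1 + p * b + q * d) - (a' - 1 + p * b' + q * d') = a - a' + p * (b - b') + q * (d - d')"
    for a a' b b' d d' p q :: complex by (simp add: algebra_simps)
  have "y t - y0 t = 0"
  proof (rule volterra_unique[OF nu(1) _ _ _ t order_refl])
    have "(\<lambda>s. indicator {0<..<t} s *\<^sub>R y s - indicator {0<..<t} s *\<^sub>R y0 s) \<in> borel_measurable lborel"
      using V(3)[OF t] V0(3)[OF t] unfolding set_borel_measurable_def by (rule borel_measurable_diff)
    then show "set_borel_measurable lborel {0<..<t} (\<lambda>s. y s - y0 s)"
      by (simp add: set_borel_measurable_def scaleR_diff_right)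
    show "norm (y s - y0 s) \<le> B + B0" if "0 < s" "s \<le> t" for s
      using norm_triangle_ineq4[of "y s" "y0 s"] B[OF that] B0[OF that] by simp
    fix s assume s: "0 < s" "s \<le> t"
    have b: "norm (y u) \<le> B" "norm (y0 u) \<le> B0" "norm (1 :: complex) \<le> 1" if "0 < u" "u < s" for u
      using B[of u] B0[of u] that s by auto
    have one: "set_borel_measurable lborel {0<..<s} (\<lambda>u. 1 :: complex)"
      unfolding set_borel_measurable_def by measurable
    note m = V(3)[OF s(1)] V0(3)[OF s(1)]
    have "frac_int \<nu> (\<lambda>u. y u - 1) s - frac_int \<nu> (\<lambda>u. y0 u - 1) s = frac_int \<nu> (\<lambda>u. y u - y0 u) s"
      using frac_int_diff[OF nu(1) m(1) one b(1) b(3)] frac_int_diff[OF nu(1) m(2) one b(2) b(3)]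
        frac_int_diff[OF nu(1) m b(1) b(2)] by simp
    moreover have "frac_int (2 * \<nu>) y s - frac_int (2 * \<nu>) y0 s = frac_int (2 * \<nu>) (\<lambda>u. y u - y0 u) s"
      using frac_int_diff[OF _ m b(1) b(2), of "2 * \<nu>"] nu by simp
    moreover have "y s - y0 s + complex_of_real (2 * lam) * (frac_int \<nu> (\<lambda>u. y u - 1) s - frac_int \<nu> (\<lambda>u. y0 u - 1) s)
        + complex_of_real (rate \<xi>) * (frac_int (2 * \<nu>) y s - frac_int (2 * \<nu>) y0 s) = 0"
      by (subst gen[symmetric]) (simp only: V(1)[OF s(1)] V0(1)[OF s(1)] diff_self)
    ultimately show "y s - y0 s + complex_of_real (2 * lam) * frac_int \<nu> (\<lambda>u. y u - y0 u) s
        + complex_of_real (rate \<xi>) * frac_int (2 * \<nu>) (\<lambda>u. y u - y0 u) s = 0"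
      by (simp only:)
  qed
  then show ?thesis
    using w0[OF t] by (simp add: y_def y0_def is_law_density_def)
qed

text \<open>Solutions are allowed to be signed; positivity and the law both follow because a
  solution has the transform of a probability density, and an integrable real function is determined
  by its transform up to null sets.\<close>

lemma solution_law:
  assumes "\<beta> \<le> 1" and sol: "telegraph_solution \<nu> \<beta> c lam w" and t: "0 < t"
  shows "AE x in lborel. 0 \<le> w x t" "distributed M lborel (W t) (\<lambda>x. ennreal (w x t))"
proof -
  obtain v where v: "is_law_density t v" using law_density_exists t by blast
  have wi: "integrable lborel (\<lambda>x. w x t)" using sol t by (simp add: telegraph_solution_def)
  have [measurable]: "(\<lambda>x. w x t) \<in> borel_measurable borel" "v \<in> borel_measurable borel"
    using wi v by (auto simp: is_law_density_def)
  have AE: "AE x in lborel. w x t = v x"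
    using v by (intro fourier_unique_real[OF wi]) (auto simp: is_law_density_def solution_fourier[OF assms])
  then show "AE x in lborel. 0 \<le> w x t"
    by eventually_elim (use v in \<open>simp add: is_law_density_def\<close>)
  have "distr M lborel (W t) = distr M borel (W t)" by (rule distr_cong) simp_all
  also have "\<dots> = density lborel (\<lambda>x. ennreal (v x))" using v by (simp add: is_law_density_def)
  also have "\<dots> = density lborel (\<lambda>x. ennreal (w x t))"
    by (rule density_cong) (use AE in auto)
  finally show "distributed M lborel (W t) (\<lambda>x. ennreal (w x t))"
    unfolding distributed_def using W_measurable[OF t] by simp
qed

text \<open>For a double root the closed form contains a division by 0. Away from it the formula is
  \<open>telegraph_entire\<close> evaluated at \<open>lam\<^sup>2 - s\<^sup>2\<close>, which is
  continuous in \<open>s\<close>, so the limit at 0 exists and has the right value.\<close>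

lemma relax_eq_telegraph_fourier:
  assumes t: "0 < t" and s: "s\<^sup>2 = complex_of_real (lam\<^sup>2 - rate \<xi>)"
  shows "s \<noteq> 0 \<Longrightarrow> complex_of_real (relax (rate \<xi>) t) = telegraph_fourier \<nu> lam t s"
    "s = 0 \<Longrightarrow> (telegraph_fourier \<nu> lam t \<longlongrightarrow> complex_of_real (relax (rate \<xi>) t)) (at 0)"
proof -
  have r: "(complex_of_real lam)\<^sup>2 - s\<^sup>2 = complex_of_real (rate \<xi>)" by (simp add: s)
  have e: "complex_of_real (relax (rate \<xi>) t) = telegraph_entire \<nu> lam t (complex_of_real (rate \<xi>))"
    unfolding telegraph_entire_of_real[OF nu(1) t] relax_eq_ml[OF rate_nonneg t] ..
  show "complex_of_real (relax (rate \<xi>) t) = telegraph_fourier \<nu> lam t s" if "s \<noteq> 0"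
    unfolding telegraph_fourier_eq_entire[OF nu(1) t that] r e ..
  assume "s = 0"
  have "continuous_on UNIV (\<lambda>z. telegraph_entire \<nu> lam t ((complex_of_real lam)\<^sup>2 - z\<^sup>2))"
    by (rule continuous_on_compose2[OF telegraph_entire_continuous[OF nu(1) t]]) (auto intro!: continuous_intros)
  then have "((\<lambda>z. telegraph_entire \<nu> lam t ((complex_of_real lam)\<^sup>2 - z\<^sup>2)) \<longlongrightarrow> telegraph_entire \<nu> lam t ((complex_of_real lam)\<^sup>2 - 0\<^sup>2)) (at 0)"
    unfolding continuous_on_eq_continuous_at[OF open_UNIV] continuous_at by blast
  then have "((\<lambda>z. telegraph_entire \<nu> lam t ((complex_of_real lam)\<^sup>2 - z\<^sup>2)) \<longlongrightarrow> complex_of_real (relax (rate \<xi>) t)) (at 0)"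
    using r \<open>s = 0\<close> unfolding e by simp
  moreover have "\<forall>\<^sub>F z in at 0. telegraph_entire \<nu> lam t ((complex_of_real lam)\<^sup>2 - z\<^sup>2) = telegraph_fourier \<nu> lam t z"
    by (auto simp: eventually_at_filter telegraph_fourier_eq_entire[OF nu(1) t])
  ultimately show "(telegraph_fourier \<nu> lam t \<longlongrightarrow> complex_of_real (relax (rate \<xi>) t)) (at 0)"
    by (rule Lim_transform_eventually)
qed

end

theorem theorem4p1:
  fixes M :: "'w measure"
    and S :: "real \<Rightarrow> 'w \<Rightarrow> real ^ 'n"
    and H1 H2 :: "real \<Rightarrow> 'w \<Rightarrow> real"
    and \<nu> \<beta> c lam :: real
  defines "L \<equiv> inverse_process (\<lambda>t \<omega>. H1 t \<omega> + (2 * lam) powr (1 / \<nu>) * H2 t \<omega>)"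
  defines "W \<equiv> (\<lambda>t \<omega>. S (c\<^sup>2 * L t \<omega>) \<omega>)"
  assumes "0 < \<nu>" and "\<nu> \<le> 1 / 2" and "0 < \<beta>" and "\<beta> \<le> 1" and "0 < c" and "0 < lam"
    and "prob_space M"
    and "isotropic_stable_process M \<beta> S"
    and "stable_subordinator M (2 * \<nu>) H1"
    and "stable_subordinator M \<nu> H2"
    and "indep_processes M H1 H2"
    and "indep_processes M S L"
  shows "(\<exists>w :: real ^ 'n \<Rightarrow> real \<Rightarrow> real. telegraph_solution \<nu> \<beta> c lam w) \<and>
    (\<forall>w :: real ^ 'n \<Rightarrow> real \<Rightarrow> real. telegraph_solution \<nu> \<beta> c lam w \<longrightarrow>
      (\<forall>t>0.
        (AE x in lborel. 0 \<le> w x t) \<and>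
        distributed M lborel (W t) (\<lambda>x. ennreal (w x t)) \<and>
        (\<forall>\<xi> s. s\<^sup>2 = complex_of_real (lam\<^sup>2 - c\<^sup>2 * norm \<xi> powr (2 * \<beta>)) \<longrightarrow>
          (if s \<noteq> 0
           then fourier (\<lambda>x. complex_of_real (w x t)) \<xi> = telegraph_fourier \<nu> lam t s
           else (telegraph_fourier \<nu> lam t \<longlongrightarrow> fourier (\<lambda>x. complex_of_real (w x t)) \<xi>) (at 0)))))"
proof -
  let ?H = "\<lambda>t \<omega>. H1 t \<omega> + (2 * lam) powr (1 / \<nu>) * H2 t \<omega>"
  interpret P: telegraph_processes M S H1 H2 ?H \<nu> \<beta> c lam
    using assms by unfold_locales auto
  have W: "W = P.W" unfolding P.W_def[abs_def] W_def L_def ..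
  obtain w :: "real ^ 'n \<Rightarrow> real \<Rightarrow> real" where "\<And>t. 0 < t \<Longrightarrow> P.is_law_density t (\<lambda>x. w x t)"
    using P.law_density_exists by blast
  then have ex: "\<exists>w :: real ^ 'n \<Rightarrow> real \<Rightarrow> real. telegraph_solution \<nu> \<beta> c lam w"
    using P.law_density_solution by blast
  have "(AE x in lborel. 0 \<le> w x t) \<and> distributed M lborel (W t) (\<lambda>x. ennreal (w x t)) \<and>
      (\<forall>\<xi> s. s\<^sup>2 = complex_of_real (lam\<^sup>2 - c\<^sup>2 * norm \<xi> powr (2 * \<beta>)) \<longrightarrow>
        (if s \<noteq> 0
         then fourier (\<lambda>x. complex_of_real (w x t)) \<xi> = telegraph_fourier \<nu> lam t s
         else (telegraph_fourier \<nu> lam t \<longlongrightarrow> fourier (\<lambda>x. complex_of_real (w x t)) \<xi>) (at 0)))"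
    if sol: "telegraph_solution \<nu> \<beta> c lam w" and t: "0 < t" for w :: "real ^ 'n \<Rightarrow> real \<Rightarrow> real" and t
    using P.solution_law[OF \<open>\<beta> \<le> 1\<close> sol t] P.relax_eq_telegraph_fourier[OF t]
    unfolding W P.solution_fourier[OF \<open>\<beta> \<le> 1\<close> sol t] P.rate_def[symmetric] by auto
  with ex show ?thesis by blast
qed

end
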